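(* Let $X$ be a $20$-dimensional Riemannian spin manifold and let $V$ be a real Euclidean vector bundle over $X$ of rank $2m_0$ with Euclidean connection $\nabla^V$ and curvature $R^V$. Suppose $3p_1(V)=p_1(X)$. Then $$-264\left\{\widehat{A}(TX)\det{}^{\frac12}\cosh\left(\tfrac{\sqrt{-1}}{4\pi}R^V\right)\right\}^{(20)}=\left\{\widehat{A}(TX)\det{}^{\frac12}\cosh\left(\tfrac{\sqrt{-1}}{4\pi}R^V\right)\mathrm{ch}\big(\widetilde{TX}+2\wedge^2\widetilde{V_{\mathbb C}}-\widetilde{V_{\mathbb C}}\otimes\widetilde{V_{\mathbb C}}+\widetilde{V_{\mathbb C}}\big)\right\}^{(20)}.$$
   Context: $R^{TX}$ is the curvature of the Levi-Civita connection and $\widehat{A}(TX)=\det^{1/2}\left(\frac{\frac{\sqrt{-1}}{4\pi}R^{TX}}{\sinh(\frac{\sqrt{-1}}{4\pi}R^{TX})}\right)$. $p_1(X)$ and $p_1(V)$ are the first Pontryagin classes of $TX$ and $V$ (in de Rham cohomology). $\widetilde{TX}=TX\otimes\mathbb C-\dim X$ and $\widetilde{V_{\mathbb C}}=V\otimes\mathbb C-2m_0$ are virtual complex bundles of rank $0$ (trivial bundles subtracted). $\mathrm{ch}(E)=\mathrm{tr}\exp(\frac{\sqrt{-1}}{2\pi}R^E)$ is the Chern character for the induced connections, extended additively to virtual bundles. For a virtual bundle $W=E-F$, $\wedge^iW$ is the coefficient of $t^i$ in $\wedge_t(W)=\wedge_t(E)/\wedge_t(F)$, where $\wedge_t(E)=\sum_i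 t^i\wedge^iE$. $\det^{1/2}\cosh$ is normalized to have degree-$0$ part $1$. $\{\cdot\}^{(p)}$ denotes the degree-$p$ component; since the hypothesis is an equality of characteristic classes, the identity is between the cohomology classes in $H^{p}(X;\mathbb R)$ of these closed forms. *)

theory Defs
  imports
    "HOL-Analysis.Analysis"
    "HOL-Computational_Algebra.Formal_Power_Series"
    "HOL-Combinatorics.Permutations"
    "HOL-Library.Countable"
    "HOL-Library.Nat_Bijection"
begin

section \<open>The exterior algebra\<close>

text \<open>
  An element of the complexified exterior algebra of the dual of \<open>\<real>\<^sup>n\<close> is given by its coefficients
  with respect to the basis \<open>dx\<^sub>I = dx\<^sub>i\<^sub>1 \<and> \<dots> \<and> dx\<^sub>i\<^sub>k\<close>, where \<open>I = {i\<^sub>1 < \<dots> < i\<^sub>k}\<close>.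
  The ring multiplication is the wedge product.
\<close>

typedef ('n::"{finite,linorder}") ext = "UNIV :: ('n set \<Rightarrow> complex) set"
  morphisms ext_coeff Ext ..

text \<open>The sign of the permutation that sorts the elements of \<open>I\<close> followed by those of \<open>J\<close>.\<close>

definition shuffle_sign :: "'n::linorder set \<Rightarrow> 'n set \<Rightarrow> 'a::ring_1" where
  "shuffle_sign I J = (-1) ^ card {(i, j). i \<in> I \<and> j \<in> J \<and> j < i}"

instantiation ext :: ("{finite,linorder}") "{zero,one,plus,minus,uminus,times}"
begin

definition zero_ext :: "'a ext" where "zero_ext = Ext (\<lambda>I. 0)"
definition one_ext :: "'a ext" where "one_ext = Ext (\<lambda>I. if I = {} then 1 else 0)"
definition plus_ext :: "'a ext \<Rightarrow> 'a ext \<Rightarrow> 'a ext" where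
  "plus_ext a b = Ext (\<lambda>I. ext_coeff a I + ext_coeff b I)"
definition minus_ext :: "'a ext \<Rightarrow> 'a ext \<Rightarrow> 'a ext" where
  "minus_ext a b = Ext (\<lambda>I. ext_coeff a I - ext_coeff b I)"
definition uminus_ext :: "'a ext \<Rightarrow> 'a ext" where
  "uminus_ext a = Ext (\<lambda>I. - ext_coeff a I)"
definition times_ext :: "'a ext \<Rightarrow> 'a ext \<Rightarrow> 'a ext" where
  "times_ext a b = Ext (\<lambda>K. \<Sum>I\<in>Pow K. shuffle_sign I (K - I) * ext_coeff a I * ext_coeff b (K - I))"

instance ..

end

lemma ext_coeff_Ext [simp]: "ext_coeff (Ext f) = f"
  by (simp add: Ext_inverse)

lemma ext_eqI: "(\<And>I. ext_coeff a I = ext_coeff b I) \<Longrightarrow> a = b"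
  by (metis ext_coeff_inject ext)

lemma shuffle_sign_Un_left:
  fixes I J K :: "'n::{finite,linorder} set"
  assumes "I \<inter> J = {}"
  shows "shuffle_sign (I \<union> J) K = (shuffle_sign I K * shuffle_sign J K :: 'a::ring_1)"
proof -
  have "{(i, j). i \<in> I \<union> J \<and> j \<in> K \<and> j < i} =
        {(i, j). i \<in> I \<and> j \<in> K \<and> j < i} \<union> {(i, j). i \<in> J \<and> j \<in> K \<and> j < i}" by auto
  moreover have "card \<dots> = card {(i, j). i \<in> I \<and> j \<in> K \<and> j < i} + card {(i, j). i \<in> J \<and> j \<in> K \<and> j < i}"
    by (rule card_Un_disjoint) (use assms in auto)
  ultimately show ?thesis by (simp add: shuffle_sign_def power_add)
qed

lemma shuffle_sign_Un_right:
  fixes I J K :: "'n::{finite,linorder} set"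
  assumes "J \<inter> K = {}"
  shows "shuffle_sign I (J \<union> K) = (shuffle_sign I J * shuffle_sign I K :: 'a::ring_1)"
proof -
  have "{(i, j). i \<in> I \<and> j \<in> J \<union> K \<and> j < i} =
        {(i, j). i \<in> I \<and> j \<in> J \<and> j < i} \<union> {(i, j). i \<in> I \<and> j \<in> K \<and> j < i}" by auto
  moreover have "card \<dots> = card {(i, j). i \<in> I \<and> j \<in> J \<and> j < i} + card {(i, j). i \<in> I \<and> j \<in> K \<and> j < i}"
    by (rule card_Un_disjoint) (use assms in auto)
  ultimately show ?thesis by (simp add: shuffle_sign_def power_add)
qed

lemma shuffle_sign_empty [simp]: "shuffle_sign {} J = 1" "shuffle_sign I {} = 1"
  by (simp_all add: shuffle_sign_def)

lemma ext_mult_assoc: "(a * b) * c = a * (b * (c :: 'n::{finite,linorder} ext))"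
proof (rule ext_eqI)
  fix K :: "'n set"
  define F where "F = (\<lambda>J L. shuffle_sign J (K - J) * shuffle_sign L (K - J - L) *
    ext_coeff a J * ext_coeff b L * ext_coeff c (K - J - L))"
  have "ext_coeff ((a * b) * c) K = (\<Sum>I\<in>Pow K. \<Sum>J\<in>Pow I. shuffle_sign I (K - I) *
      (shuffle_sign J (I - J) * ext_coeff a J * ext_coeff b (I - J)) * ext_coeff c (K - I))"
    by (simp add: times_ext_def sum_distrib_left sum_distrib_right)
  also have "\<dots> = (\<Sum>I\<in>Pow K. \<Sum>J\<in>Pow I. F J (I - J))"
  proof (intro sum.cong refl)
    fix I J assume "I \<in> Pow K" "J \<in> Pow I"
    then have IK: "I \<subseteq> K" and JI: "J \<subseteq> I" by auto
    have e1: "K - J - (I - J) = K - I" using IK JI by auto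
    have "shuffle_sign I (K - I) = (shuffle_sign J (K - I) * shuffle_sign (I - J) (K - I) :: complex)"
      using shuffle_sign_Un_left[of J "I - J" "K - I"] JI by (simp add: Un_absorb1)
    moreover have "shuffle_sign J (K - J) = (shuffle_sign J (I - J) * shuffle_sign J (K - I) :: complex)"
    proof -
      have "K - J = (I - J) \<union> (K - I)" using IK JI by auto
      then show ?thesis using shuffle_sign_Un_right[of "I - J" "K - I" J] by auto
    qed
    ultimately show "shuffle_sign I (K - I) * (shuffle_sign J (I - J) * ext_coeff a J * ext_coeff b (I - J)) *
        ext_coeff c (K - I) = F J (I - J)"
      by (simp add: F_def e1)
  qed
  also have "\<dots> = (\<Sum>(I, J)\<in>Sigma (Pow K) Pow. F J (I - J))"
    by (rule sum.Sigma) auto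
  also have "\<dots> = (\<Sum>(J, L)\<in>Sigma (Pow K) (\<lambda>J. Pow (K - J)). F J L)"
    by (rule sum.reindex_bij_witness[of _ "\<lambda>(J, L). (J \<union> L, J)" "\<lambda>(I, J). (J, I - J)"]) auto
  also have "\<dots> = (\<Sum>J\<in>Pow K. \<Sum>L\<in>Pow (K - J). F J L)"
    by (rule sum.Sigma[symmetric]) auto
  also have "\<dots> = ext_coeff (a * (b * c)) K"
    by (simp add: times_ext_def F_def sum_distrib_left mult_ac)
  finally show "ext_coeff ((a * b) * c) K = ext_coeff (a * (b * c)) K" .
qed

instance ext :: ("{finite,linorder}") ring_1
proof
  fix a b c :: "'a ext"
  show "a * b * c = a * (b * c)" by (rule ext_mult_assoc)
  show "1 * a = a"
  proof (rule ext_eqI)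
    fix K
    have "ext_coeff (1 * a) K = (\<Sum>I\<in>Pow K. if I = {} then ext_coeff a K else 0)"
      unfolding times_ext_def one_ext_def ext_coeff_Ext by (intro sum.cong) auto
    then show "ext_coeff (1 * a) K = ext_coeff a K" by (simp add: sum.delta)
  qed
  show "a * 1 = a"
  proof (rule ext_eqI)
    fix K
    have "ext_coeff (a * 1) K = (\<Sum>I\<in>Pow K. if I = K then ext_coeff a K else 0)"
      unfolding times_ext_def one_ext_def ext_coeff_Ext by (intro sum.cong) auto
    then show "ext_coeff (a * 1) K = ext_coeff a K" by (simp add: sum.delta)
  qed
  have "ext_coeff (0::'a ext) {} \<noteq> ext_coeff 1 {}"
    by (simp add: zero_ext_def one_ext_def)
  then show "(0::'a ext) \<noteq> 1" by force
qed (auto intro!: ext_eqI simp: zero_ext_def plus_ext_def minus_ext_def uminus_ext_def times_ext_def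
      algebra_simps sum.distrib)

definition ext_const :: "complex \<Rightarrow> 'n::{finite,linorder} ext" where
  "ext_const z = Ext (\<lambda>I. if I = {} then z else 0)"

definition dx :: "'n::{finite,linorder} \<Rightarrow> 'n ext" where
  "dx i = Ext (\<lambda>I. if I = {i} then 1 else 0)"

definition degree_part :: "nat \<Rightarrow> 'n::{finite,linorder} ext \<Rightarrow> 'n ext" where
  "degree_part k a = Ext (\<lambda>I. if card I = k then ext_coeff a I else 0)"

section \<open>Smooth manifolds and differential forms\<close>

fun times_differentiable_on ::
  "nat \<Rightarrow> 'a::real_normed_vector set \<Rightarrow> ('a \<Rightarrow> 'b::real_normed_vector) \<Rightarrow> bool" where
  "times_differentiable_on 0 S f \<longleftrightarrow> continuous_on S f"
| "times_differentiable_on (Suc k) S f \<longleftrightarrow> (\<forall>x\<in>S. f differentiable (at x)) \<and>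
     (\<forall>v. times_differentiable_on k S (\<lambda>x. frechet_derivative f (at x) v))"

definition smooth_on :: "'a::real_normed_vector set \<Rightarrow> ('a \<Rightarrow> 'b::real_normed_vector) \<Rightarrow> bool" where
  "smooth_on S f \<longleftrightarrow> (\<forall>k. times_differentiable_on k S f)"

type_synonym 'n rvec = "real ^ 'n"
type_synonym 'n rmat = "real ^ 'n ^ 'n"

text \<open>A chart is a domain together with a coordinate map.\<close>

type_synonym ('x, 'n) chart = "'x set \<times> ('x \<Rightarrow> 'n rvec)"

definition chart_inv :: "('x, 'n::finite) chart \<Rightarrow> 'n rvec \<Rightarrow> 'x" where
  "chart_inv c = inv_into (fst c) (snd c)"

definition transition :: "('x, 'n::finite) chart \<Rightarrow> ('x, 'n) chart \<Rightarrow> 'n rvec \<Rightarrow> 'n rvec" where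
  "transition c d = snd d \<circ> chart_inv c"

definition jacobian :: "('x, 'n::finite) chart \<Rightarrow> ('x, 'n) chart \<Rightarrow> 'n rvec \<Rightarrow> 'n rmat" where
  "jacobian c d x = matrix (frechet_derivative (transition c d) (at x))"

definition smooth_atlas :: "('x::topological_space, 'n::finite) chart set \<Rightarrow> bool" where
  "smooth_atlas A \<longleftrightarrow>
     (\<Union>c\<in>A. fst c) = UNIV \<and>
     (\<forall>c\<in>A. open (fst c) \<and> open (snd c ` fst c) \<and>
        homeomorphism (fst c) (snd c ` fst c) (snd c) (chart_inv c)) \<and>
     (\<forall>c\<in>A. \<forall>d\<in>A. smooth_on (snd c ` (fst c \<inter> fst d)) (transition c d))"

definition smooth_fun ::
  "('x, 'n::finite) chart set \<Rightarrow> 'x set \<Rightarrow> ('x \<Rightarrow> 'b::real_normed_vector) \<Rightarrow> bool" where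
  "smooth_fun A W f \<longleftrightarrow> (\<forall>c\<in>A. smooth_on (snd c ` (fst c \<inter> W)) (f \<circ> chart_inv c))"

text \<open>A differential form is given by its coordinate expression in every chart.\<close>

type_synonym ('x, 'n) form = "('x, 'n) chart \<Rightarrow> 'n rvec \<Rightarrow> 'n ext"

definition pullback :: "'n rmat \<Rightarrow> 'n::{finite,linorder} ext \<Rightarrow> 'n ext" where
  "pullback J a = (\<Sum>I\<in>UNIV. ext_const (ext_coeff a I) *
     prod_list (map (\<lambda>i. \<Sum>j\<in>UNIV. ext_const (of_real (J $ i $ j)) * dx j) (sorted_list_of_set I)))"

text \<open>Real-valued smooth forms of degree \<open>k\<close> on an open set \<open>W\<close>.\<close>

definition diff_form ::
  "('x, 'n::{finite,linorder}) chart set \<Rightarrow> 'x set \<Rightarrow> nat \<Rightarrow> ('x, 'n) form \<Rightarrow> bool" where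
  "diff_form A W k \<omega> \<longleftrightarrow>
     (\<forall>c\<in>A. \<forall>I. smooth_on (snd c ` (fst c \<inter> W)) (\<lambda>x. ext_coeff (\<omega> c x) I)) \<and>
     (\<forall>c\<in>A. \<forall>x\<in>snd c ` (fst c \<inter> W). \<forall>I.
        ext_coeff (\<omega> c x) I \<in> \<real> \<and> (card I \<noteq> k \<longrightarrow> ext_coeff (\<omega> c x) I = 0)) \<and>
     (\<forall>c\<in>A. \<forall>d\<in>A. \<forall>x\<in>snd c ` (fst c \<inter> fst d \<inter> W).
        \<omega> c x = pullback (jacobian c d x) (\<omega> d (transition c d x)))"

definition ext_d :: "('n rvec \<Rightarrow> 'n::{finite,linorder} ext) \<Rightarrow> 'n rvec \<Rightarrow> 'n ext" where
  "ext_d \<omega> x = (\<Sum>j\<in>UNIV. dx j *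
     Ext (\<lambda>I. frechet_derivative (\<lambda>y. ext_coeff (\<omega> y) I) (at x) (axis j 1)))"

definition closed_form ::
  "('x, 'n::{finite,linorder}) chart set \<Rightarrow> nat \<Rightarrow> ('x, 'n) form \<Rightarrow> bool" where
  "closed_form A k \<omega> \<longleftrightarrow> diff_form A UNIV k \<omega> \<and> (\<forall>c\<in>A. \<forall>x\<in>snd c ` fst c. ext_d (\<omega> c) x = 0)"

text \<open>Equality of classes in real de Rham cohomology; used for positive degree \<open>k\<close> only.\<close>

definition cohomologous ::
  "('x, 'n::{finite,linorder}) chart set \<Rightarrow> nat \<Rightarrow> ('x, 'n) form \<Rightarrow> ('x, 'n) form \<Rightarrow> bool" where
  "cohomologous A k \<alpha> \<beta> \<longleftrightarrow> closed_form A k \<alpha> \<and> closed_form A k \<beta> \<and>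
     (\<exists>\<eta>. diff_form A UNIV (k - 1) \<eta> \<and>
        (\<forall>c\<in>A. \<forall>x\<in>snd c ` fst c. \<alpha> c x - \<beta> c x = ext_d (\<eta> c) x))"

section \<open>Riemannian metrics and the Levi-Civita connection\<close>

definition riemannian_metric ::
  "('x, 'n::finite) chart set \<Rightarrow> (('x, 'n) chart \<Rightarrow> 'n rvec \<Rightarrow> 'n rmat) \<Rightarrow> bool" where
  "riemannian_metric A G \<longleftrightarrow>
     (\<forall>c\<in>A. smooth_on (snd c ` fst c) (G c)) \<and>
     (\<forall>c\<in>A. \<forall>x\<in>snd c ` fst c. transpose (G c x) = G c x \<and> (\<forall>v. v \<noteq> 0 \<longrightarrow> v \<bullet> (G c x *v v) > 0)) \<and>
     (\<forall>c\<in>A. \<forall>d\<in>A. \<forall>x\<in>snd c ` (fst c \<inter> fst d).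
        G c x = transpose (jacobian c d x) ** G d (transition c d x) ** jacobian c d x)"

text \<open>\<open>christoffel g x k i j\<close> is the Christoffel symbol with upper index \<open>k\<close> and lower indices \<open>i\<close>, \<open>j\<close>.\<close>

definition christoffel ::
  "('n rvec \<Rightarrow> 'n rmat) \<Rightarrow> ('n::finite) rvec \<Rightarrow> 'n \<Rightarrow> 'n \<Rightarrow> 'n \<Rightarrow> real" where
  "christoffel g x k i j =
     (let D = (\<lambda>m a b. frechet_derivative (\<lambda>y. g y $ a $ b) (at x) (axis m 1))
      in (\<Sum>l\<in>UNIV. matrix_inv (g x) $ k $ l * (D i j l + D j i l - D l i j)) / 2)"

section \<open>Spin structures\<close>

text \<open>
  The Clifford algebra of \<open>\<real>\<^sup>n\<close> with \<open>e\<^sub>i\<^sup>2 = -1\<close>: an element is given by its coefficients with respect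
  to the basis of ordered products \<open>e\<^sub>I\<close>.
\<close>

definition cliff_mult ::
  "('n::{finite,linorder} set \<Rightarrow> real) \<Rightarrow> ('n set \<Rightarrow> real) \<Rightarrow> 'n set \<Rightarrow> real" where
  "cliff_mult a b = (\<lambda>K. \<Sum>I\<in>UNIV. let J = (I - K) \<union> (K - I) in
     shuffle_sign I J * (-1) ^ card (I \<inter> J) * a I * b J)"

definition cliff_one :: "'n set \<Rightarrow> real" where
  "cliff_one I = (if I = {} then 1 else 0)"

definition cliff_vec :: "'n rvec \<Rightarrow> 'n::finite set \<Rightarrow> real" where
  "cliff_vec v I = (\<Sum>i\<in>UNIV. if I = {i} then v $ i else 0)"

inductive_set Spin :: "('n::{finite,linorder} set \<Rightarrow> real) set" where
  one: "cliff_one \<in> Spin"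
| mult: "s \<in> Spin \<Longrightarrow> norm u = 1 \<Longrightarrow> norm v = 1 \<Longrightarrow>
    cliff_mult (cliff_mult (cliff_vec u) (cliff_vec v)) s \<in> Spin"

text \<open>\<open>M\<close> is the image of \<open>s\<close> under the double covering \<open>Spin(n) \<rightarrow> SO(n)\<close>,
  that is, \<open>s v s\<^sup>-\<^sup>1 = M v\<close> for all vectors \<open>v\<close>.\<close>

definition spin_covers :: "('n::{finite,linorder} set \<Rightarrow> real) \<Rightarrow> 'n rmat \<Rightarrow> bool" where
  "spin_covers s M \<longleftrightarrow> s \<in> Spin \<and> (\<forall>v. cliff_mult s (cliff_vec v) = cliff_mult (cliff_vec (M *v v)) s)"

text \<open>
  A local frame is a triple \<open>(c, W, E)\<close>: over the open subset \<open>W\<close> of the domain of the chart \<open>c\<close>, the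
  columns of \<open>E\<close> are the coordinates in \<open>c\<close> of the frame vectors. With
  \<open>a = (c, W, E)\<close> and \<open>b = (d, W', E')\<close>, \<open>frame_change a b p\<close> is the matrix \<open>g\<close> with \<open>b = a g\<close> at \<open>p\<close>.
\<close>

type_synonym ('x, 'n) local_frame = "('x, 'n) chart \<times> 'x set \<times> ('n rvec \<Rightarrow> 'n rmat)"

definition orthonormal_frame ::
  "('x::topological_space, 'n::finite) chart set \<Rightarrow> (('x, 'n) chart \<Rightarrow> 'n rvec \<Rightarrow> 'n rmat) \<Rightarrow>
   ('x, 'n) local_frame \<Rightarrow> bool" where
  "orthonormal_frame A G = (\<lambda>(c, W, E). c \<in> A \<and> open W \<and> W \<subseteq> fst c \<and> smooth_on (snd c ` W) E \<and>
     (\<forall>x\<in>snd c ` W. transpose (E x) ** G c x ** E x = mat 1))"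

definition frame_change ::
  "('x, 'n::finite) local_frame \<Rightarrow> ('x, 'n) local_frame \<Rightarrow> 'x \<Rightarrow> 'n rmat" where
  "frame_change = (\<lambda>(c, W, E) (d, W', E') p.
     matrix_inv (E (snd c p)) ** (jacobian d c (snd d p) ** E' (snd d p)))"

text \<open>
  A spin structure: an oriented orthonormal frame bundle (a cover by local orthonormal frames with
  transition functions in \<open>SO(n)\<close>) whose transition functions lift to a continuous cocycle with
  values in \<open>Spin(n)\<close>. Orientability is included, since the image of \<open>Spin(n)\<close> is \<open>SO(n)\<close>.
\<close>

definition spin ::
  "('x::topological_space, 'n::{finite,linorder}) chart set \<Rightarrow>
   (('x, 'n) chart \<Rightarrow> 'n rvec \<Rightarrow> 'n rmat) \<Rightarrow> bool" where
  "spin A G \<longleftrightarrow> (\<exists>(F :: ('x, 'n) local_frame set) \<gamma>.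
     (\<forall>a\<in>F. orthonormal_frame A G a) \<and> (\<Union>(c, W, E)\<in>F. W) = UNIV \<and>
     (\<forall>a\<in>F. \<forall>b\<in>F. let W = fst (snd a) \<inter> fst (snd b) in
        (\<forall>I. continuous_on W (\<lambda>p. \<gamma> a b p I)) \<and>
        (\<forall>p\<in>W. spin_covers (\<gamma> a b p) (frame_change a b p))) \<and>
     (\<forall>a\<in>F. \<forall>b\<in>F. \<forall>c\<in>F. \<forall>p\<in>fst (snd a) \<inter> fst (snd b) \<inter> fst (snd c).
        cliff_mult (\<gamma> a b p) (\<gamma> b c p) = \<gamma> a c p))"

section \<open>Euclidean vector bundles with connection\<close>

text \<open>
  A trivialization of a real vector bundle of rank \<open>r\<close> with total space \<open>'e\<close> is an open set together
  with fibre coordinates. Vectors of \<open>\<real>\<^sup>r\<close> are functions on \<open>nat\<close> that vanish outside \<open>{..<r}\<close>. The vector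
  space structure of the fibres and the smooth structure of \<open>'e\<close> are those transported by the
  trivializations, which is consistent because the changes of trivialization are linear and smooth.
\<close>

type_synonym ('x, 'e) trivialization = "'x set \<times> ('e \<Rightarrow> nat \<Rightarrow> real)"

definition basis_section ::
  "('e \<Rightarrow> 'x) \<Rightarrow> ('x, 'e) trivialization \<Rightarrow> nat \<Rightarrow> 'x \<Rightarrow> 'e" where
  "basis_section \<pi> t j p = inv_into (\<pi> -` {p}) (snd t) (\<lambda>i. if i = j then 1 else 0)"

text \<open>The matrix that turns coordinates with respect to \<open>s\<close> into coordinates with respect to \<open>t\<close>.\<close>

definition triv_change ::
  "('e \<Rightarrow> 'x) \<Rightarrow> ('x, 'e) trivialization \<Rightarrow> ('x, 'e) trivialization \<Rightarrow> nat \<Rightarrow> nat \<Rightarrow> 'x \<Rightarrow> real" where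
  "triv_change \<pi> t s i j p = snd t (basis_section \<pi> s j p) i"

definition vector_bundle ::
  "('x::topological_space, 'n::finite) chart set \<Rightarrow> nat \<Rightarrow> ('e \<Rightarrow> 'x) \<Rightarrow> ('x, 'e) trivialization set \<Rightarrow> bool"
  where
  "vector_bundle A r \<pi> T \<longleftrightarrow>
     (\<Union>t\<in>T. fst t) = UNIV \<and>
     (\<forall>t\<in>T. open (fst t) \<and> (\<forall>p\<in>fst t. bij_betw (snd t) (\<pi> -` {p}) {w. \<forall>i\<ge>r. w i = 0})) \<and>
     (\<forall>t\<in>T. \<forall>s\<in>T.
        (\<forall>i<r. \<forall>j<r. smooth_fun A (fst t \<inter> fst s) (triv_change \<pi> t s i j)) \<and>
        (\<forall>v. \<pi> v \<in> fst t \<inter> fst s \<longrightarrow>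
           (\<forall>i<r. snd t v i = (\<Sum>j<r. triv_change \<pi> t s i j (\<pi> v) * snd s v j))))"

text \<open>A Euclidean metric \<open>h\<close>; only its values on pairs of vectors in the same fibre matter.\<close>

definition gram ::
  "('e \<Rightarrow> 'x) \<Rightarrow> ('e \<Rightarrow> 'e \<Rightarrow> real) \<Rightarrow> ('x, 'e) trivialization \<Rightarrow> nat \<Rightarrow> nat \<Rightarrow> 'x \<Rightarrow> real" where
  "gram \<pi> h t i j p = h (basis_section \<pi> t i p) (basis_section \<pi> t j p)"

definition bundle_metric ::
  "('x, 'n::finite) chart set \<Rightarrow> nat \<Rightarrow> ('e \<Rightarrow> 'x) \<Rightarrow> ('x, 'e) trivialization set \<Rightarrow>
   ('e \<Rightarrow> 'e \<Rightarrow> real) \<Rightarrow> bool" where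
  "bundle_metric A r \<pi> T h \<longleftrightarrow> (\<forall>t\<in>T.
     (\<forall>i<r. \<forall>j<r. smooth_fun A (fst t) (gram \<pi> h t i j)) \<and>
     (\<forall>v w. \<pi> v = \<pi> w \<and> \<pi> v \<in> fst t \<longrightarrow>
        h v w = (\<Sum>i<r. \<Sum>j<r. gram \<pi> h t i j (\<pi> v) * snd t v i * snd t w j) \<and>
        h v w = h w v \<and> (snd t v \<noteq> (\<lambda>i. 0) \<longrightarrow> h v v > 0)))"

text \<open>
  A connection is given by its matrices of connection forms: \<open>\<nabla> e\<^sub>j = \<Sum>\<^sub>i (\<theta> t i j) e\<^sub>i\<close> for the basis
  sections \<open>e\<^sub>j\<close> of the trivialization \<open>t\<close>. The third condition is the transformation law
  \<open>g \<theta>\<^sub>s = dg + \<theta>\<^sub>t g\<close>, the last one is compatibility with the metric,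
  \<open>d h(e\<^sub>i, e\<^sub>j) = h(\<nabla> e\<^sub>i, e\<^sub>j) + h(e\<^sub>i, \<nabla> e\<^sub>j)\<close>.
\<close>

definition fun_form :: "('x \<Rightarrow> real) \<Rightarrow> ('x, 'n::{finite,linorder}) form" where
  "fun_form f c x = ext_const (of_real (f (chart_inv c x)))"

definition euclidean_connection ::
  "('x, 'n::{finite,linorder}) chart set \<Rightarrow> nat \<Rightarrow> ('e \<Rightarrow> 'x) \<Rightarrow> ('x, 'e) trivialization set \<Rightarrow>
   ('e \<Rightarrow> 'e \<Rightarrow> real) \<Rightarrow> (('x, 'e) trivialization \<Rightarrow> nat \<Rightarrow> nat \<Rightarrow> ('x, 'n) form) \<Rightarrow> bool" where
  "euclidean_connection A r \<pi> T h \<theta> \<longleftrightarrow>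
     (\<forall>t\<in>T. \<forall>i<r. \<forall>j<r. diff_form A (fst t) 1 (\<theta> t i j)) \<and>
     (\<forall>t\<in>T. \<forall>s\<in>T. \<forall>i<r. \<forall>j<r. \<forall>c\<in>A. \<forall>x\<in>snd c ` (fst c \<inter> fst t \<inter> fst s).
        (\<Sum>k<r. fun_form (triv_change \<pi> t s i k) c x * \<theta> s k j c x) =
        ext_d (fun_form (triv_change \<pi> t s i j) c) x +
        (\<Sum>k<r. \<theta> t i k c x * fun_form (triv_change \<pi> t s k j) c x)) \<and>
     (\<forall>t\<in>T. \<forall>i<r. \<forall>j<r. \<forall>c\<in>A. \<forall>x\<in>snd c ` (fst c \<inter> fst t).
        ext_d (fun_form (gram \<pi> h t i j) c) x =
        (\<Sum>k<r. \<theta> t k i c x * fun_form (gram \<pi> h t k j) c x + fun_form (gram \<pi> h t i k) c x * \<theta> t k j c x))"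

section \<open>Bundles with connection and induced bundles\<close>

text \<open>
  For the Chern-Weil forms, a bundle with connection assigns to each chart \<open>c\<close> and each point \<open>x\<close> in the
  image of \<open>c\<close> a frame near \<open>x\<close>, recorded by its finite index set (the rank is its cardinality) and by
  the matrix of connection forms in this frame as a function of the coordinates. Since the
  coefficients of the forms are complex, the same data describe a real bundle and its
  complexification with the induced connection.
\<close>

type_synonym ('x, 'n) cbundle =
  "('x, 'n) chart \<Rightarrow> 'n rvec \<Rightarrow> nat set \<times> ('n rvec \<Rightarrow> nat \<Rightarrow> nat \<Rightarrow> 'n ext)"

text \<open>The tangent bundle with the Levi-Civita connection, in the coordinate frame; \<open>to_nat\<close> numbers
  the coordinates.\<close>

definition tangent_bundle ::
  "(('x, 'n) chart \<Rightarrow> 'n rvec \<Rightarrow> 'n rmat) \<Rightarrow> ('x, 'n::{finite,linorder}) cbundle" where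
  "tangent_bundle G c x = (range (to_nat :: 'n \<Rightarrow> nat), \<lambda>y k j.
     \<Sum>i\<in>UNIV. ext_const (of_real (christoffel (G c) y (from_nat k) i (from_nat j))) * dx i)"

text \<open>The choice of the trivialization around the given point is immaterial for the forms below, which
  are invariant under changes of frame.\<close>

definition bundle_of ::
  "nat \<Rightarrow> ('x, 'e) trivialization set \<Rightarrow>
   (('x, 'e) trivialization \<Rightarrow> nat \<Rightarrow> nat \<Rightarrow> ('x, 'n) form) \<Rightarrow> ('x, 'n::{finite,linorder}) cbundle" where
  "bundle_of r T \<theta> c x =
     (let t = (SOME t. t \<in> T \<and> chart_inv c x \<in> fst t) in ({..<r}, \<lambda>y i j. \<theta> t i j c y))"

definition trivial_bundle :: "nat \<Rightarrow> ('x, 'n::{finite,linorder}) cbundle" where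
  "trivial_bundle r c x = ({..<r}, \<lambda>y i j. 0)"

definition tensor_bundle ::
  "('x, 'n) cbundle \<Rightarrow> ('x, 'n) cbundle \<Rightarrow> ('x, 'n::{finite,linorder}) cbundle" where
  "tensor_bundle E F c x = (prod_encode ` (fst (E c x) \<times> fst (F c x)), \<lambda>y a b.
     let (i, k) = prod_decode a; (j, l) = prod_decode b
     in (if k = l then snd (E c x) y i j else 0) + (if i = j then snd (F c x) y k l else 0))"

text \<open>
  The frame of the exterior power consists of the \<open>e\<^sub>S\<close> with \<open>S\<close> a \<open>k\<close>-subset of the index set. The induced
  connection acts as a derivation; replacing in \<open>e\<^sub>S\<close> the factor \<open>e\<^sub>j\<close> by \<open>e\<^sub>i\<close> with \<open>i \<notin> S - {j}\<close> gives
  \<open>\<plusminus> e\<^sub>R\<close> with \<open>R - {i} = S - {j}\<close>, and the sign is that of moving \<open>e\<^sub>i\<close> from the place of \<open>e\<^sub>j\<close> to its own.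
\<close>

definition wedge_bundle :: "nat \<Rightarrow> ('x, 'n) cbundle \<Rightarrow> ('x, 'n::{finite,linorder}) cbundle" where
  "wedge_bundle k E c x = (set_encode ` {S. S \<subseteq> fst (E c x) \<and> card S = k}, \<lambda>y a b.
     let R = set_decode a; S = set_decode b
     in \<Sum>j\<in>S. \<Sum>i\<in>R. if R - {i} = S - {j}
          then (-1) ^ (card {m \<in> S - {j}. m < j} + card {m \<in> S - {j}. m < i}) * snd (E c x) y i j
          else 0)"

text \<open>A virtual bundle is a formal integer combination of bundles.\<close>

type_synonym ('x, 'n) vbundle = "(int \<times> ('x, 'n) cbundle) list"

definition vminus :: "('x, 'n) cbundle \<Rightarrow> ('x, 'n) cbundle \<Rightarrow> ('x, 'n) vbundle" where
  "vminus E F = [(1, E), (-1, F)]"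

definition vscale :: "int \<Rightarrow> ('x, 'n) vbundle \<Rightarrow> ('x, 'n) vbundle" where
  "vscale m W = map (\<lambda>(k, E). (m * k, E)) W"

definition vtensor ::
  "('x, 'n) vbundle \<Rightarrow> ('x, 'n) vbundle \<Rightarrow> ('x, 'n::{finite,linorder}) vbundle" where
  "vtensor W W' = [(k * l, tensor_bundle E F). (k, E) \<leftarrow> W, (l, F) \<leftarrow> W']"

text \<open>
  The coefficient \<open>c\<^sub>k\<close> of \<open>t\<^sup>k\<close> in \<open>\<and>\<^sub>t(E) / \<and>\<^sub>t(F)\<close>, that is, \<open>\<Sum>\<^sub>l\<^sub>\<le>\<^sub>k \<and>\<^sup>k\<^sup>-\<^sup>l F \<otimes> c\<^sub>l = \<and>\<^sup>k E\<close> (where \<open>\<and>\<^sup>0 F\<close> is the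
  trivial line bundle), solved for \<open>c\<^sub>k\<close>.
\<close>

fun vwedge ::
  "nat \<Rightarrow> ('x, 'n) cbundle \<Rightarrow> ('x, 'n) cbundle \<Rightarrow> ('x, 'n::{finite,linorder}) vbundle" where
  "vwedge k E F = (1, wedge_bundle k E) #
     concat (map (\<lambda>l. vscale (-1) (vtensor [(1, wedge_bundle (k - l) F)] (vwedge l E F))) [0..<k])"

declare vwedge.simps [simp del]

section \<open>Characteristic forms\<close>

text \<open>Square matrices over a ring, indexed by a finite set \<open>I\<close> of natural numbers.\<close>

definition mtrace :: "nat set \<Rightarrow> (nat \<Rightarrow> nat \<Rightarrow> 'a::ring_1) \<Rightarrow> 'a" where
  "mtrace I M = (\<Sum>i\<in>I. M i i)"

fun mpower :: "nat set \<Rightarrow> (nat \<Rightarrow> nat \<Rightarrow> 'a::ring_1) \<Rightarrow> nat \<Rightarrow> nat \<Rightarrow> nat \<Rightarrow> 'a" where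
  "mpower I M 0 i j = (if i = j then 1 else 0)"
| "mpower I M (Suc k) i j = (\<Sum>l\<in>I. M i l * mpower I M k l j)"

text \<open>The library's determinant requires a commutative ring; the entries used below are sums of forms
  of even degree, so they commute and the order of the factors is immaterial.\<close>

definition mdet :: "nat set \<Rightarrow> (nat \<Rightarrow> nat \<Rightarrow> 'a::ring_1) \<Rightarrow> 'a" where
  "mdet I M = (\<Sum>p | p permutes I. of_int (sign p) *
     prod_list (map (\<lambda>i. M i (p i)) (sorted_list_of_set I)))"

text \<open>Power series are applied to (matrices of) forms without component of degree \<open>0\<close>; powers with
  exponent greater than \<open>n\<close> vanish, so the truncated sums are the full series.\<close>

definition fps_app :: "complex fps \<Rightarrow> 'n::{finite,linorder} ext \<Rightarrow> 'n ext" where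
  "fps_app f a = (\<Sum>k\<le>CARD('n). ext_const (fps_nth f k) * a ^ k)"

definition fps_mapp ::
  "nat set \<Rightarrow> complex fps \<Rightarrow> (nat \<Rightarrow> nat \<Rightarrow> 'n::{finite,linorder} ext) \<Rightarrow> nat \<Rightarrow> nat \<Rightarrow> 'n ext" where
  "fps_mapp I f M i j = (\<Sum>k\<le>CARD('n). ext_const (fps_nth f k) * mpower I M k i j)"

text \<open>The square root, with degree-\<open>0\<close> part \<open>1\<close>, of an even form with degree-\<open>0\<close> part \<open>1\<close>.\<close>

definition form_sqrt :: "'n::{finite,linorder} ext \<Rightarrow> 'n ext" where
  "form_sqrt a = fps_app (fps_binomial (1 / 2)) (a - 1)"

definition fps_cosh :: "complex fps" where
  "fps_cosh = fps_const (1 / 2) * (fps_exp 1 + fps_exp (-1))"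

definition fps_sinh :: "complex fps" where
  "fps_sinh = fps_const (1 / 2) * (fps_exp 1 - fps_exp (-1))"

definition index_set :: "('x, 'n::{finite,linorder}) cbundle \<Rightarrow> ('x, 'n) chart \<Rightarrow> 'n rvec \<Rightarrow> nat set" where
  "index_set E c x = fst (E c x)"

text \<open>The curvature matrix \<open>d\<theta> + \<theta> \<and> \<theta>\<close>.\<close>

definition curvature ::
  "('x, 'n::{finite,linorder}) cbundle \<Rightarrow> ('x, 'n) chart \<Rightarrow> 'n rvec \<Rightarrow> nat \<Rightarrow> nat \<Rightarrow> 'n ext" where
  "curvature E c x i j = (let (I, \<theta>) = E c x in
     ext_d (\<lambda>y. \<theta> y i j) x + (\<Sum>k\<in>I. \<theta> x i k * \<theta> x k j))"

definition scaled_curvature ::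
  "complex \<Rightarrow> ('x, 'n::{finite,linorder}) cbundle \<Rightarrow> ('x, 'n) chart \<Rightarrow> 'n rvec \<Rightarrow> nat \<Rightarrow> nat \<Rightarrow> 'n ext"
  where
  "scaled_curvature z E c x i j = ext_const z * curvature E c x i j"

definition p1_form :: "('x, 'n::{finite,linorder}) cbundle \<Rightarrow> ('x, 'n) form" where
  "p1_form E c x = ext_const (- 1 / (8 * of_real pi ^ 2)) *
     mtrace (index_set E c x) (mpower (index_set E c x) (curvature E c x) 2)"

definition A_hat_form :: "('x, 'n::{finite,linorder}) cbundle \<Rightarrow> ('x, 'n) form" where
  "A_hat_form E c x = form_sqrt (mdet (index_set E c x)
     (fps_mapp (index_set E c x) (fps_X / fps_sinh) (scaled_curvature (\<i> / (4 * of_real pi)) E c x)))"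

definition det_cosh_form :: "('x, 'n::{finite,linorder}) cbundle \<Rightarrow> ('x, 'n) form" where
  "det_cosh_form E c x = form_sqrt (mdet (index_set E c x)
     (fps_mapp (index_set E c x) fps_cosh (scaled_curvature (\<i> / (4 * of_real pi)) E c x)))"

definition ch_form :: "('x, 'n::{finite,linorder}) cbundle \<Rightarrow> ('x, 'n) form" where
  "ch_form E c x = mtrace (index_set E c x)
     (fps_mapp (index_set E c x) (fps_exp 1) (scaled_curvature (\<i> / (2 * of_real pi)) E c x))"

definition vch_form :: "('x, 'n::{finite,linorder}) vbundle \<Rightarrow> ('x, 'n) form" where
  "vch_form W c x = (\<Sum>(m, E)\<leftarrow>W. of_int m * ch_form E c x)"

end

theory Submission
  imports Defs
begin

text \<open>
  Let \<open>R\<close> and \<open>R'\<close> be the curvatures of \<open>TX\<close> and \<open>V\<close>. Both sides of the identity are polynomials in the five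
  closed forms \<open>S\<^sub>k = (i/2\<pi>)\<^sup>2\<^sup>k (tr R\<^sup>2\<^sup>k - (4\<^sup>k - 1) tr R'\<^sup>2\<^sup>k)\<close> of degree \<open>4k\<close>, and their difference is a multiple of
  \<open>S\<^sub>1\<close>, which is exact by assumption.

  Let \<open>v\<close> be the Chern character of \<open>V\<close> minus its rank, and let \<open>v\<^sub>2\<close> be the same with the
  curvature doubled. From \<open>2 ch(\<Lambda>\<^sup>2) = ch\<^sup>2 - ch\<^sub>2\<close> the virtual bundle formed from \<open>V\<close> has Chern character
  \<open>(v\<^sup>2 - v\<^sub>2) - v\<^sup>2 + v = v - v\<^sub>2\<close>, which is linear in traces of powers of the curvature (\<open>vch_form_W\<close>). The curvature of a
  metric connection is skew, so only even powers have a trace, and the total Chern character is \<open>\<Sum>\<^sub>k S\<^sub>k / (2k)!\<close>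
  (\<open>ch_eq_S\<close>).

  Let \<open>P\<close> be the product of the two square roots of determinants. The derivation \<open>euler\<close> multiplies
  forms by their degree, hence acts on power series in a curvature as \<open>2 X d/dX\<close>. By Jacobi's formula it maps
  \<open>det\<^sup>1\<^sup>/\<^sup>2 f(R)\<close> to a multiple of itself by half the trace of \<open>(2 X f' / f)(R)\<close> (\<open>euler_form_sqrt_mdet\<close>). Since
  \<open>sinh 2X = 2 sinh X cosh X\<close>, the coefficients for \<open>cosh X\<close> are \<open>- (4\<^sup>k - 1)\<close> times those for \<open>X / sinh X\<close>. So
  \<open>euler P\<close> is \<open>P\<close> times a linear combination of the same \<open>S\<^sub>k\<close>, and comparing degrees gives the parts \<open>P\<^sub>k\<close> of
  degree \<open>4k\<close> recursively (\<open>P_recursion\<close>).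

  Among the monomials of degree \<open>20\<close> only \<open>S\<^sub>5\<close> and \<open>S\<^sub>2 S\<^sub>3\<close> do not contain \<open>S\<^sub>1\<close>. In the
  difference of the two sides the coefficients of both are zero (\<open>weight_five_cancellation\<close>). Now \<open>S\<^sub>1\<close> is a multiple of
  \<open>3 p\<^sub>1(V) - p\<^sub>1(TX)\<close>, so it is \<open>d\<eta>\<close> for some \<open>\<eta>\<close>, and for the closed cofactor \<open>\<psi>\<close> the difference is
  \<open>\<psi> d\<eta> = d(\<psi>\<eta>)\<close>.

  It remains to see that the traces of powers of the curvatures are closed forms on the manifold.
  They are closed by the Bianchi identity (\<open>ext_d_mtrace_mpower_curv\<close>), and they do not depend on the frame because a
  change of frame conjugates the curvature (\<open>curv_gauge_change\<close>). For \<open>V\<close> the frames are the given trivializations.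
  For \<open>TX\<close> one needs that the Jacobian matrix of a change of charts is a change of frame between the two Levi-Civita
  connections; this follows from the uniqueness of a symmetric metric connection (\<open>christoffel_change\<close>).
\<close>

section \<open>The exterior algebra\<close>

lemma ext_coeff_simps [simp]:
  fixes a b :: "'n::{finite,linorder} ext"
  shows "ext_coeff (0 :: 'n ext) I = 0"
    and "ext_coeff (1 :: 'n ext) I = (if I = {} then 1 else 0)"
    and "ext_coeff (a + b) I = ext_coeff a I + ext_coeff b I"
    and "ext_coeff (a - b) I = ext_coeff a I - ext_coeff b I"
    and "ext_coeff (- a) I = - ext_coeff a I"
    and "ext_coeff (ext_const z :: 'n ext) I = (if I = {} then z else 0)"
    and "ext_coeff (dx i) I = (if I = {i} then 1 else 0)"
    and "ext_coeff (degree_part k a) I = (if card I = k then ext_coeff a I else 0)"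
  by (simp_all add: zero_ext_def one_ext_def plus_ext_def minus_ext_def uminus_ext_def
      ext_const_def dx_def degree_part_def)

lemma ext_coeff_mult:
  "ext_coeff (a * b) K = (\<Sum>I\<in>Pow K. shuffle_sign I (K - I) * ext_coeff a I * ext_coeff b (K - I))"
  by (simp add: times_ext_def)

lemma ext_coeff_sum [simp]: "ext_coeff (sum f A) I = (\<Sum>x\<in>A. ext_coeff (f x) I)"
  by (induction A rule: infinite_finite_induct) auto

lemma ext_coeff_const_mult [simp]: "ext_coeff (ext_const z * a) I = z * ext_coeff a I"
proof -
  have "ext_coeff (ext_const z * a) I = (\<Sum>J\<in>Pow I. if J = {} then z * ext_coeff a I else 0)"
    unfolding ext_coeff_mult by (intro sum.cong) auto
  then show ?thesis by (simp add: sum.delta)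
qed

lemma ext_const_simps:
  "ext_const 0 = 0" "ext_const 1 = 1" "ext_const (z + w) = ext_const z + ext_const w"
  "ext_const (z - w) = ext_const z - ext_const w" "ext_const (- z) = - ext_const z"
  by (auto intro!: ext_eqI)

lemma ext_const_mult: "ext_const (z * w) = ext_const z * ext_const w"
  by (auto intro!: ext_eqI)

lemma ext_const_power: "ext_const (z ^ k) = ext_const z ^ k"
  by (induction k) (simp_all add: ext_const_simps ext_const_mult)

lemma ext_const_of_nat: "ext_const (of_nat m) = of_nat m"
  by (induction m) (simp_all add: ext_const_simps)

lemma ext_const_of_int: "ext_const (of_int m) = of_int m"
  by (cases m rule: int_cases2) (simp_all add: ext_const_simps ext_const_of_nat)

lemma ext_const_numeral: "ext_const (numeral m) = numeral m"
  using ext_const_of_nat[of "numeral m"] by simp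

lemma ext_const_sum: "ext_const (sum f A) = (\<Sum>x\<in>A. ext_const (f x))"
  by (induction A rule: infinite_finite_induct) (auto simp: ext_const_simps)

subsection \<open>Graded commutativity\<close>

text \<open>Each pair in \<open>I \<times> J\<close> is an inversion for exactly one of the two orders, so
  that the two inversion counts add up to \<open>card I * card J\<close>.\<close>

lemma shuffle_sign_swap:
  fixes I J :: "'n::{finite,linorder} set"
  assumes "I \<inter> J = {}"
  shows "shuffle_sign I J = ((-1) ^ (card I * card J) * shuffle_sign J I :: 'a::ring_1)"
proof -
  let ?A = "{(i, j). i \<in> I \<and> j \<in> J \<and> j < i}" and ?B = "{(i, j). i \<in> I \<and> j \<in> J \<and> i < j}"
  have "?A \<union> ?B = I \<times> J" using assms by (auto simp: set_eq_iff neq_iff) (metis linorder_neqE)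
  moreover have "card (?A \<union> ?B) = card ?A + card ?B" by (rule card_Un_disjoint) auto
  ultimately have c: "card ?A + card ?B = card I * card J" by (metis card_cartesian_product)
  have "{(j, i). j \<in> J \<and> i \<in> I \<and> i < j} = prod.swap ` ?B" by force
  then have b: "card {(j, i). j \<in> J \<and> i \<in> I \<and> i < j} = card ?B"
    by (simp add: card_image)
  show ?thesis
    unfolding shuffle_sign_def b c[symmetric] power_add[symmetric]
    by (simp add: uminus_power_if)
qed

lemma card_split: "I \<subseteq> K \<Longrightarrow> card K = card I + card (K - I)"
  for I K :: "'n::finite set"
  by (simp add: card_Diff_subset card_mono)

definition homog :: "nat \<Rightarrow> 'n::{finite,linorder} ext \<Rightarrow> bool" where
  "homog k a \<longleftrightarrow> (\<forall>I. ext_coeff a I \<noteq> 0 \<longrightarrow> card I = k)"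

definition even_ext :: "'n::{finite,linorder} ext \<Rightarrow> bool" where
  "even_ext a \<longleftrightarrow> (\<forall>I. ext_coeff a I \<noteq> 0 \<longrightarrow> even (card I))"

definition real_ext :: "'n::{finite,linorder} ext \<Rightarrow> bool" where
  "real_ext a \<longleftrightarrow> (\<forall>I. ext_coeff a I \<in> \<real>)"

lemma homog_mult:
  assumes "homog k a" "homog l b" shows "homog (k + l) (a * b)"
  unfolding homog_def
proof (intro allI impI)
  fix K assume "ext_coeff (a * b) K \<noteq> 0"
  then obtain I where I: "I \<subseteq> K" "ext_coeff a I \<noteq> 0" "ext_coeff b (K - I) \<noteq> 0"
    unfolding ext_coeff_mult by (metis (no_types, lifting) PowD mult_zero_left mult_zero_right sum.neutral)
  then have "card I = k" "card (K - I) = l" using assms by (auto simp: homog_def)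
  then show "card K = k + l" using card_split[OF I(1)] by simp
qed

lemma homog_simps:
  "homog k 0" "homog k a \<Longrightarrow> homog k (- a)"
  "homog k a \<Longrightarrow> homog k b \<Longrightarrow> homog k (a + b)"
  "homog k a \<Longrightarrow> homog k b \<Longrightarrow> homog k (a - b)"
  "homog 0 (ext_const z)" "homog 1 (dx i)" "homog 0 1" "homog k (degree_part k a)"
  by (auto simp: homog_def split: if_splits) (metis add.right_neutral, metis diff_zero diff_self)

lemma homog_const_mult: "homog k a \<Longrightarrow> homog k (ext_const z * a)"
  by (auto simp: homog_def)

lemma homog_sum: "(\<And>x. x \<in> A \<Longrightarrow> homog k (f x)) \<Longrightarrow> homog k (sum f A)"
  by (induction A rule: infinite_finite_induct) (auto intro: homog_simps)

lemma homog_gt_card: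
  fixes a :: "'n::{finite,linorder} ext"
  assumes "homog k a" "k > CARD('n)" shows "a = 0"
proof (rule ext_eqI)
  fix I :: "'n set"
  have "card I \<le> CARD('n)" by (intro card_mono) auto
  then show "ext_coeff a I = ext_coeff 0 I" using assms by (auto simp: homog_def)
qed

lemma homog_eq_degree_part: "homog k a \<Longrightarrow> degree_part l a = (if l = k then a else 0)"
  by (auto intro!: ext_eqI simp: homog_def)

lemma homog_imp_even: "homog k a \<Longrightarrow> even k \<Longrightarrow> even_ext a"
  by (auto simp: homog_def even_ext_def)

lemma even_ext_simps:
  "even_ext 0" "even_ext 1" "even_ext (ext_const z)" "even_ext a \<Longrightarrow> even_ext (- a)"
  "even_ext a \<Longrightarrow> even_ext b \<Longrightarrow> even_ext (a + b)"
  "even_ext a \<Longrightarrow> even_ext b \<Longrightarrow> even_ext (a - b)"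
  "even_ext a \<Longrightarrow> even_ext (degree_part k a)"
  by (auto simp: even_ext_def) (metis add.right_neutral, metis diff_zero diff_self)

lemma even_ext_mult:
  assumes "even_ext a" "even_ext b" shows "even_ext (a * b)"
  unfolding even_ext_def
proof (intro allI impI)
  fix K assume "ext_coeff (a * b) K \<noteq> 0"
  then obtain I where I: "I \<subseteq> K" "ext_coeff a I \<noteq> 0" "ext_coeff b (K - I) \<noteq> 0"
    unfolding ext_coeff_mult by (metis (no_types, lifting) PowD mult_zero_left mult_zero_right sum.neutral)
  then have "even (card I)" "even (card (K - I))" using assms by (auto simp: even_ext_def)
  then show "even (card K)" using card_split[OF I(1)] by simp
qed

lemma even_ext_sum: "(\<And>x. x \<in> A \<Longrightarrow> even_ext (f x)) \<Longrightarrow> even_ext (sum f A)"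
  by (induction A rule: infinite_finite_induct) (auto intro: even_ext_simps)

lemma even_ext_power: "even_ext a \<Longrightarrow> even_ext (a ^ k)"
  by (induction k) (auto intro: even_ext_simps even_ext_mult)

text \<open>Even forms are central: the sign of the swap is trivial as soon as one of the two degrees is
  even.\<close>

lemma even_ext_commute:
  assumes "even_ext a" shows "a * b = b * a"
proof (rule ext_eqI)
  fix K
  have "ext_coeff (a * b) K = (\<Sum>I\<in>Pow K. shuffle_sign I (K - I) * ext_coeff b I * ext_coeff a (K - I))"
    unfolding ext_coeff_mult
  proof (rule sum.reindex_bij_witness[of _ "\<lambda>I. K - I" "\<lambda>I. K - I"])
    fix I assume I: "I \<in> Pow K"
    then have KI: "K - (K - I) = I" by auto
    have "ext_coeff a I \<noteq> 0 \<Longrightarrow> shuffle_sign I (K - I) = (shuffle_sign (K - I) I :: complex)"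
      using shuffle_sign_swap[of I "K - I", where 'a = complex] assms by (auto simp: even_ext_def)
    then show "shuffle_sign (K - I) (K - (K - I)) * ext_coeff b (K - I) * ext_coeff a (K - (K - I)) =
         shuffle_sign I (K - I) * ext_coeff a I * ext_coeff b (K - I)"
      unfolding KI by (cases "ext_coeff a I = 0") auto
  qed auto
  then show "ext_coeff (a * b) K = ext_coeff (b * a) K" by (simp add: ext_coeff_mult)
qed

lemma ext_const_commute: "a * ext_const z = ext_const z * a"
  using even_ext_commute[of "ext_const z" a] by (simp add: even_ext_simps)

lemma ext_const_left_commute: "a * (ext_const z * b) = ext_const z * (a * b)"
  by (metis ext_const_commute mult.assoc)

lemma ext_const_mult_mult: "(ext_const z * a) * (ext_const w * b) = ext_const (z * w) * (a * b)"
  by (metis ext_const_left_commute ext_const_mult mult.assoc)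

lemma ext_const_const_mult: "ext_const z * (ext_const w * b) = ext_const (z * w) * b"
  by (simp add: ext_const_mult mult.assoc)

lemma homog_one_anticommute:
  assumes "homog 1 a" "homog 1 b" shows "a * b = - (b * a)"
proof (rule ext_eqI)
  fix K
  have "ext_coeff (a * b) K = (\<Sum>I\<in>Pow K. - (shuffle_sign I (K - I) * ext_coeff b I * ext_coeff a (K - I)))"
    unfolding ext_coeff_mult
  proof (rule sum.reindex_bij_witness[of _ "\<lambda>I. K - I" "\<lambda>I. K - I"])
    fix I assume I: "I \<in> Pow K"
    then have KI: "K - (K - I) = I" by auto
    have "ext_coeff a I \<noteq> 0 \<Longrightarrow> ext_coeff b (K - I) \<noteq> 0 \<Longrightarrow>
        shuffle_sign I (K - I) = (- shuffle_sign (K - I) I :: complex)"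
      using shuffle_sign_swap[of I "K - I", where 'a = complex] assms by (auto simp: homog_def)
    then show "- (shuffle_sign (K - I) (K - (K - I)) * ext_coeff b (K - I) * ext_coeff a (K - (K - I))) =
         shuffle_sign I (K - I) * ext_coeff a I * ext_coeff b (K - I)"
      unfolding KI by (cases "ext_coeff a I = 0"; cases "ext_coeff b (K - I) = 0") auto
  qed auto
  then show "ext_coeff (a * b) K = ext_coeff (- (b * a)) K" by (simp add: ext_coeff_mult sum_negf)
qed

lemma real_ext_simps:
  "real_ext 0" "real_ext 1" "real_ext a \<Longrightarrow> real_ext (- a)" "real_ext (dx i)"
  "real_ext a \<Longrightarrow> real_ext b \<Longrightarrow> real_ext (a + b)"
  "real_ext a \<Longrightarrow> real_ext b \<Longrightarrow> real_ext (a - b)"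
  "real_ext (ext_const (of_real r))"
  by (auto simp: real_ext_def)

lemma real_ext_mult: "real_ext a \<Longrightarrow> real_ext b \<Longrightarrow> real_ext (a * b)"
  by (auto simp: real_ext_def ext_coeff_mult shuffle_sign_def intro!: sum_in_Reals Reals_mult Reals_power)

lemma real_ext_sum: "(\<And>x. x \<in> A \<Longrightarrow> real_ext (f x)) \<Longrightarrow> real_ext (sum f A)"
  by (induction A rule: infinite_finite_induct) (auto intro: real_ext_simps)

subsection \<open>Degrees of products\<close>

lemma degree_part_mult:
  "degree_part n (a * b) = (\<Sum>k\<le>n. degree_part k a * degree_part (n - k) b)"
proof (rule ext_eqI)
  fix K
  have *: "ext_coeff (degree_part k a * degree_part (n - k) b) K =
      (\<Sum>I\<in>Pow K. if card I = k \<and> card (K - I) = n - k then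
          shuffle_sign I (K - I) * ext_coeff a I * ext_coeff b (K - I) else 0)" for k
    unfolding ext_coeff_mult by (intro sum.cong) auto
  have "ext_coeff (\<Sum>k\<le>n. degree_part k a * degree_part (n - k) b) K =
     (\<Sum>I\<in>Pow K. \<Sum>k\<le>n. if card I = k \<and> card (K - I) = n - k then
          shuffle_sign I (K - I) * ext_coeff a I * ext_coeff b (K - I) else 0)"
    unfolding ext_coeff_sum * by (rule sum.swap)
  also have "\<dots> = (\<Sum>I\<in>Pow K. \<Sum>k\<le>n. if k = card I then (if card K = n then
          shuffle_sign I (K - I) * ext_coeff a I * ext_coeff b (K - I) else 0) else 0)"
  proof (intro sum.cong refl)
    fix I k assume I: "I \<in> Pow K" and k: "k \<in> {..n}"
    have "card K = card I + card (K - I)" using card_split[of I K] I by simp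
    then show "(if card I = k \<and> card (K - I) = n - k then
          shuffle_sign I (K - I) * ext_coeff a I * ext_coeff b (K - I) else 0) =
       (if k = card I then (if card K = n then
          shuffle_sign I (K - I) * ext_coeff a I * ext_coeff b (K - I) else 0) else 0)" using k by auto
  qed
  also have "\<dots> = (\<Sum>I\<in>Pow K. if card I \<le> n then (if card K = n then
          shuffle_sign I (K - I) * ext_coeff a I * ext_coeff b (K - I) else 0) else 0)"
    by (simp add: sum.delta)
  also have "\<dots> = ext_coeff (degree_part n (a * b)) K"
    by (auto simp: ext_coeff_mult intro!: sum.cong sum.neutral dest: card_mono[OF finite])
  finally show "ext_coeff (degree_part n (a * b)) K =
    ext_coeff (\<Sum>k\<le>n. degree_part k a * degree_part (n - k) b) K" ..
qed

lemma degree_part_simps: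
  "degree_part n 0 = 0" "degree_part n (a + b) = degree_part n a + degree_part n b"
  "degree_part n (a - b) = degree_part n a - degree_part n b"
  "degree_part n (ext_const z * a) = ext_const z * degree_part n a"
  by (auto intro!: ext_eqI)

lemma degree_part_sum: "degree_part n (sum f A) = (\<Sum>x\<in>A. degree_part n (f x))"
  by (induction A rule: infinite_finite_induct) (auto simp: degree_part_simps)

text \<open>The degree derivation. On power series in forms of degree two it acts as \<open>2 X d/dX\<close>, so that logarithmic
  derivatives of power series become differential equations for characteristic forms.\<close>

definition euler :: "'n::{finite,linorder} ext \<Rightarrow> 'n ext" where
  "euler a = Ext (\<lambda>I. of_nat (card I) * ext_coeff a I)"

lemma ext_coeff_euler [simp]: "ext_coeff (euler a) I = of_nat (card I) * ext_coeff a I"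
  by (simp add: euler_def)

lemma euler_add: "euler (a + b) = euler a + euler b"
  by (auto intro!: ext_eqI simp: algebra_simps)

lemma euler_const_mult: "euler (ext_const z * a) = ext_const z * euler a"
  by (auto intro!: ext_eqI simp: algebra_simps)

lemma euler_homog: "homog k a \<Longrightarrow> euler a = ext_const (of_nat k) * a"
  by (auto intro!: ext_eqI simp: homog_def)

lemma euler_mult: "euler (a * b) = euler a * b + a * euler b"
proof (rule ext_eqI)
  fix K
  have "ext_coeff (euler (a * b)) K = (\<Sum>I\<in>Pow K. of_nat (card I + card (K - I)) *
      (shuffle_sign I (K - I) * ext_coeff a I * ext_coeff b (K - I)))"
    unfolding ext_coeff_euler ext_coeff_mult sum_distrib_left
    by (intro sum.cong refl) (auto simp: card_split)
  also have "\<dots> = ext_coeff (euler a * b + a * euler b) K"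
    by (simp add: ext_coeff_mult sum.distrib[symmetric] algebra_simps)
  finally show "ext_coeff (euler (a * b)) K = ext_coeff (euler a * b + a * euler b) K" .
qed

lemma euler_sum: "euler (sum f A) = (\<Sum>x\<in>A. euler (f x))"
  by (induction A rule: infinite_finite_induct) (auto simp: euler_add intro!: ext_eqI)

lemma degree_part_euler: "degree_part n (euler a) = ext_const (of_nat n) * degree_part n a"
  by (auto intro!: ext_eqI)

lemma even_ext_euler: "even_ext a \<Longrightarrow> even_ext (euler a)"
  by (auto simp: even_ext_def)

lemma ext_coeff_mult_empty [simp]: "ext_coeff (a * b) {} = ext_coeff a {} * ext_coeff b {}"
  by (simp add: ext_coeff_mult)

text \<open>The degree filtration, used for the nilpotency of forms without constant term.\<close>

definition low :: "nat \<Rightarrow> 'n::{finite,linorder} ext \<Rightarrow> bool" where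
  "low k a \<longleftrightarrow> (\<forall>I. ext_coeff a I \<noteq> 0 \<longrightarrow> k \<le> card I)"

lemma low_mult:
  assumes "low k a" "low l b" shows "low (k + l) (a * b)"
  unfolding low_def
proof (intro allI impI)
  fix K assume "ext_coeff (a * b) K \<noteq> 0"
  then obtain I where I: "I \<subseteq> K" "ext_coeff a I \<noteq> 0" "ext_coeff b (K - I) \<noteq> 0"
    unfolding ext_coeff_mult by (metis (no_types, lifting) PowD mult_zero_left mult_zero_right sum.neutral)
  then have "k \<le> card I" "l \<le> card (K - I)" using assms by (auto simp: low_def)
  then show "k + l \<le> card K" using card_split[OF I(1)] by simp
qed

lemma power_eq_0_of_coeff_empty:
  fixes a :: "'n::{finite,linorder} ext"
  assumes "ext_coeff a {} = 0" "k > CARD('n)" shows "a ^ k = 0"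
proof -
  have 1: "low 1 a" using assms(1) by (auto simp: low_def Suc_le_eq card_gt_0_iff)
  have "low k (a ^ k)"
  proof (induction k)
    case (Suc k) then show ?case using low_mult[OF 1 Suc.IH] by simp
  qed (simp add: low_def)
  moreover have "card I \<le> CARD('n)" for I :: "'n set" by (intro card_mono) auto
  ultimately show ?thesis using assms(2)
    by (intro ext_eqI) (metis ext_coeff_simps(1) le_trans linorder_not_le low_def)
qed

section \<open>Power series and determinants of matrices of even forms\<close>

lemma mpower_add:
  assumes "finite I" "i \<in> I"
  shows "(\<Sum>l\<in>I. mpower I M k i l * mpower I M m l j) = mpower I M (k + m) i j"
  using assms(2)
proof (induction k arbitrary: i)
  case 0
  have "(\<Sum>l\<in>I. mpower I M 0 i l * mpower I M m l j) = (\<Sum>l\<in>I. if i = l then mpower I M m l j else 0)"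
    by (intro sum.cong) auto
  then show ?case using 0 assms(1) by simp
next
  case (Suc k)
  have "(\<Sum>l\<in>I. mpower I M (Suc k) i l * mpower I M m l j) =
      (\<Sum>l\<in>I. \<Sum>h\<in>I. M i h * (mpower I M k h l * mpower I M m l j))"
    by (simp add: sum_distrib_right mult.assoc)
  also have "\<dots> = (\<Sum>h\<in>I. M i h * (\<Sum>l\<in>I. mpower I M k h l * mpower I M m l j))"
    by (subst sum.swap) (simp add: sum_distrib_left)
  also have "\<dots> = mpower I M (Suc k + m) i j" using Suc.IH by simp
  finally show ?case .
qed

lemma mpower_cong:
  assumes "\<And>i j. i \<in> I \<Longrightarrow> j \<in> I \<Longrightarrow> M i j = M' i j" "i \<in> I" "j \<in> I"
  shows "mpower I M k i j = mpower I M' k i j"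
  using assms(2)
proof (induction k arbitrary: i)
  case (Suc k)
  then show ?case using assms(1) by (auto intro!: sum.cong)
qed simp

lemma fps_mapp_cong:
  assumes "\<And>i j. i \<in> I \<Longrightarrow> j \<in> I \<Longrightarrow> M i j = M' i j" "i \<in> I" "j \<in> I"
  shows "fps_mapp I f M i j = fps_mapp I f M' i j"
  unfolding fps_mapp_def using mpower_cong[OF assms(1)] assms(2,3) by simp

lemma homog_mpower:
  assumes "\<And>i j. i \<in> I \<Longrightarrow> j \<in> I \<Longrightarrow> homog 2 (M i j)" "i \<in> I" "j \<in> I"
  shows "homog (2 * k) (mpower I M k i j)"
  using assms(2)
proof (induction k arbitrary: i)
  case (Suc k)
  show ?case unfolding mpower.simps
  proof (rule homog_sum)
    fix l assume "l \<in> I"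
    then show "homog (2 * Suc k) (M i l * mpower I M k l j)"
      using homog_mult[of 2 "M i l" "2 * k" "mpower I M k l j"] assms Suc by simp
  qed
qed (auto simp: homog_simps)

lemma even_mpower:
  assumes "\<And>i j. i \<in> I \<Longrightarrow> j \<in> I \<Longrightarrow> even_ext (M i j)" "i \<in> I" "j \<in> I"
  shows "even_ext (mpower I M k i j)"
  using assms(2)
proof (induction k arbitrary: i)
  case (Suc k)
  then show ?case unfolding mpower.simps by (intro even_ext_sum even_ext_mult assms(1)) auto
qed (auto simp: even_ext_simps)

lemma even_fps_mapp:
  assumes "\<And>i j. i \<in> I \<Longrightarrow> j \<in> I \<Longrightarrow> even_ext (M i j)" "i \<in> I" "j \<in> I"
  shows "even_ext (fps_mapp I f M i j)"
  unfolding fps_mapp_def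
  by (intro even_ext_sum even_ext_mult even_mpower[OF assms(1)] even_ext_simps) (use assms in auto)

text \<open>Passes from a product of two truncated power series, a sum over a square, to the Cauchy product,
  a sum over a triangle; the terms outside the triangle vanish for degree reasons.\<close>

lemma square_sum_truncated:
  fixes F :: "nat \<Rightarrow> nat \<Rightarrow> 'a::comm_monoid_add"
  assumes "\<And>k l. k + l > N \<Longrightarrow> F k l = 0"
  shows "(\<Sum>k\<le>N. \<Sum>l\<le>N. F k l) = (\<Sum>m\<le>N. \<Sum>k\<le>m. F k (m - k))"
proof -
  have "(\<Sum>k\<le>N. \<Sum>l\<le>N. F k l) = (\<Sum>(k, l)\<in>{..N} \<times> {..N}. F k l)"
    by (simp add: sum.cartesian_product)
  also have "\<dots> = (\<Sum>(k, l)\<in>{(k, l). k + l \<le> N}. F k l)"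
    by (rule sum.mono_neutral_right) (auto, metis assms not_le)
  also have "\<dots> = (\<Sum>(m, k)\<in>Sigma {..N} (\<lambda>m. {..m}). F k (m - k))"
    by (rule sum.reindex_bij_witness[of _ "\<lambda>(m, k). (k, m - k)" "\<lambda>(k, l). (k + l, k)"]) auto
  also have "\<dots> = (\<Sum>m\<le>N. \<Sum>k\<le>m. F k (m - k))"
    by (rule sum.Sigma[symmetric]) auto
  finally show ?thesis .
qed

lemma cauchy_product_truncated:
  fixes X :: "nat \<Rightarrow> 'n::{finite,linorder} ext"
  assumes "\<And>m. m > N \<Longrightarrow> X m = 0"
  shows "(\<Sum>k\<le>N. \<Sum>l\<le>N. ext_const (fps_nth f k * fps_nth g l) * X (k + l)) =
    (\<Sum>m\<le>N. ext_const (fps_nth (f * g) m) * X m)"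
proof -
  have "(\<Sum>k\<le>N. \<Sum>l\<le>N. ext_const (fps_nth f k * fps_nth g l) * X (k + l)) =
      (\<Sum>m\<le>N. \<Sum>k\<le>m. ext_const (fps_nth f k * fps_nth g (m - k)) * X (k + (m - k)))"
    by (rule square_sum_truncated) (simp add: assms)
  also have "\<dots> = (\<Sum>m\<le>N. ext_const (fps_nth (f * g) m) * X m)"
    by (simp add: fps_mult_nth ext_const_sum sum_distrib_right atLeast0AtMost)
  finally show ?thesis .
qed

text \<open>Truncation after the dimension loses nothing for nilpotent matrices, so that a power series in
  \<open>M\<close> depends multiplicatively on the series.\<close>

lemma fps_mapp_mult:
  fixes M :: "nat \<Rightarrow> nat \<Rightarrow> 'n::{finite,linorder} ext"
  assumes "finite I" "i \<in> I" "\<And>m. m > CARD('n) \<Longrightarrow> mpower I M m i j = 0"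
  shows "(\<Sum>l\<in>I. fps_mapp I f M i l * fps_mapp I g M l j) = fps_mapp I (f * g) M i j"
proof -
  have "(\<Sum>l\<in>I. fps_mapp I f M i l * fps_mapp I g M l j) =
    (\<Sum>l\<in>I. \<Sum>k\<le>CARD('n). \<Sum>m\<le>CARD('n).
      ext_const (fps_nth f k * fps_nth g m) * (mpower I M k i l * mpower I M m l j))"
    by (simp add: fps_mapp_def sum_product ext_const_mult_mult)
  also have "\<dots> = (\<Sum>k\<le>CARD('n). \<Sum>m\<le>CARD('n). \<Sum>l\<in>I.
      ext_const (fps_nth f k * fps_nth g m) * (mpower I M k i l * mpower I M m l j))"
    by (subst sum.swap, rule sum.cong, simp, rule sum.swap)
  also have "\<dots> = (\<Sum>k\<le>CARD('n). \<Sum>m\<le>CARD('n).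
      ext_const (fps_nth f k * fps_nth g m) * mpower I M (k + m) i j)"
    by (simp add: sum_distrib_left[symmetric] mpower_add assms)
  also have "\<dots> = fps_mapp I (f * g) M i j"
    unfolding fps_mapp_def by (rule cauchy_product_truncated) (rule assms)
  finally show ?thesis .
qed

lemma fps_app_mult:
  fixes a :: "'n::{finite,linorder} ext"
  assumes "ext_coeff a {} = 0"
  shows "fps_app f a * fps_app g a = fps_app (f * g) a"
proof -
  have "fps_app f a * fps_app g a =
      (\<Sum>k\<le>CARD('n). \<Sum>m\<le>CARD('n). ext_const (fps_nth f k * fps_nth g m) * a ^ (k + m))"
    by (simp add: fps_app_def sum_product ext_const_mult_mult power_add)
  also have "\<dots> = fps_app (f * g) a"
    unfolding fps_app_def
    by (rule cauchy_product_truncated) (rule power_eq_0_of_coeff_empty[OF assms])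
  finally show ?thesis .
qed

text \<open>The entries of the \<open>k\<close>th power of \<open>M\<close> have degree \<open>2 *
  k\<close>.\<close>

lemma euler_fps_mapp:
  assumes "\<And>i j. i \<in> I \<Longrightarrow> j \<in> I \<Longrightarrow> homog 2 (M i j)" "i \<in> I" "j \<in> I"
  shows "euler (fps_mapp I f M i j) = fps_mapp I (2 * (fps_X * fps_deriv f)) M i j"
proof -
  have n: "fps_nth (2 * (fps_X * fps_deriv f)) k = 2 * of_nat k * fps_nth f k" for k
    by (cases k) (simp_all add: numeral_fps_const algebra_simps)
  show ?thesis
    unfolding fps_mapp_def euler_sum n
    by (intro sum.cong refl)
      (simp add: euler_const_mult euler_homog[OF homog_mpower[OF assms]] ext_const_const_mult mult_ac)
qed

subsection \<open>Determinants\<close>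

text \<open>The Leibniz formula in a commutative ring, with an unordered product. By contrast
  \<open>mdet\<close> multiplies the entries, which are forms, in a fixed order.\<close>

definition det_on :: "nat set \<Rightarrow> (nat \<Rightarrow> nat \<Rightarrow> 'a::comm_ring_1) \<Rightarrow> 'a" where
  "det_on I M = (\<Sum>p | p permutes I. of_int (sign p) * (\<Prod>i\<in>I. M i (p i)))"

text \<open>Composition with the transposition of the two rows preserves the product and flips the sign, so
  the determinant is its own negative.\<close>

lemma det_on_identical_rows:
  fixes M :: "nat \<Rightarrow> nat \<Rightarrow> 'a::comm_ring_1"
  assumes two: "\<And>a :: 'a. a + a = 0 \<Longrightarrow> a = 0"
    and I: "finite I" "i \<in> I" "k \<in> I" "i \<noteq> k" and rows: "\<And>j. M i j = M k j"
  shows "det_on I M = 0"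
proof -
  let ?t = "Transposition.transpose i k"
  have t: "?t permutes I" using I by (simp add: permutes_swap_id)
  have row: "M (?t l) j = M l j" for l j using rows by (auto simp: Transposition.transpose_def)
  have "det_on I M = (\<Sum>p | p permutes I. of_int (sign (p \<circ> ?t)) * (\<Prod>l\<in>I. M l ((p \<circ> ?t) l)))"
    unfolding det_on_def by (rule sum_permutations_compose_right[OF t])
  also have "\<dots> = (\<Sum>p | p permutes I. - (of_int (sign p) * (\<Prod>l\<in>I. M l (p l))))"
  proof (intro sum.cong refl)
    fix p assume "p \<in> {p. p permutes I}"
    then have p: "permutation p" using I(1) permutation_permutes by blast
    have "sign (p \<circ> ?t) = - sign p"
      using sign_compose[OF p permutation_swap_id] I(4) by (simp add: sign_swap_id)
    moreover have "(\<Prod>l\<in>I. M l ((p \<circ> ?t) l)) = (\<Prod>l\<in>I. M (?t l) (p (?t l)))"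
      by (simp add: row)
    moreover have "\<dots> = (\<Prod>l\<in>I. M l (p l))"
      using prod.permute[OF t, of "\<lambda>l. M l (p l)"] by (simp add: o_def)
    ultimately show "of_int (sign (p \<circ> ?t)) * (\<Prod>l\<in>I. M l ((p \<circ> ?t) l)) =
      - (of_int (sign p) * (\<Prod>l\<in>I. M l (p l)))" by simp
  qed
  also have "\<dots> = - det_on I M" by (simp add: det_on_def sum_negf)
  finally show ?thesis using two[of "det_on I M"] by simp
qed

lemma derivation_prod:
  fixes d :: "'a::comm_ring_1 \<Rightarrow> 'a"
  assumes mult: "\<And>a b. d (a * b) = d a * b + a * d b" and "finite A"
  shows "d (prod f A) = (\<Sum>i\<in>A. d (f i) * prod f (A - {i}))"
  using assms(2)
proof (induction A rule: finite_induct)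
  case empty
  have "d 1 = 0" using mult[of 1 1] by simp
  then show ?case by simp
next
  case (insert x A)
  have "(\<Sum>i\<in>A. d (f i) * prod f (insert x A - {i})) = (\<Sum>i\<in>A. f x * (d (f i) * prod f (A - {i})))"
  proof (intro sum.cong refl)
    fix i assume i: "i \<in> A"
    then have "insert x A - {i} = insert x (A - {i})" using insert by auto
    then show "d (f i) * prod f (insert x A - {i}) = f x * (d (f i) * prod f (A - {i}))"
      using insert by (simp add: mult_ac)
  qed
  then show ?case using insert by (simp add: mult sum_distrib_left)
qed

text \<open>Jacobi's formula. The derivation replaces the \<open>i\<close>th row by a combination of all rows with coefficients \<open>Y i k\<close>.
  A row \<open>k \<noteq> i\<close> contributes nothing, as it then occurs twice; what remains is the trace of \<open>Y\<close>.\<close>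

lemma jacobi_formula:
  fixes d :: "'a::comm_ring_1 \<Rightarrow> 'a" and N :: "nat \<Rightarrow> nat \<Rightarrow> 'a"
  assumes two: "\<And>a :: 'a. a + a = 0 \<Longrightarrow> a = 0" and I: "finite I"
    and add: "\<And>a b. d (a + b) = d a + d b"
    and mult: "\<And>a b. d (a * b) = d a * b + a * d b"
    and Y: "\<And>i j. i \<in> I \<Longrightarrow> j \<in> I \<Longrightarrow> d (N i j) = (\<Sum>k\<in>I. Y i k * N k j)"
  shows "d (det_on I N) = (\<Sum>i\<in>I. Y i i) * det_on I N"
proof -
  have d0: "d 0 = 0" using add[of 0 0] by simp
  have d_sum: "d (sum f A) = (\<Sum>x\<in>A. d (f x))" for f and A :: "(nat \<Rightarrow> nat) set"
    by (induction A rule: infinite_finite_induct) (auto simp: d0 add)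
  have d1: "d 1 = 0" using mult[of 1 1] by simp
  have "d (- a) = - d a" for a using add[of a "- a"] d0 by (simp add: eq_neg_iff_add_eq_0 add.commute)
  then have d_sign: "d (of_int (sign p) * a) = of_int (sign p) * d a" for p :: "nat \<Rightarrow> nat" and a
    by (simp add: sign_def)
  have row: "(\<Sum>p | p permutes I. of_int (sign p) * (N k (p i) * (\<Prod>l\<in>I - {i}. N l (p l)))) =
      (if k = i then det_on I N else 0)" if "i \<in> I" "k \<in> I" for i k
  proof -
    have "(\<Sum>p | p permutes I. of_int (sign p) * (N k (p i) * (\<Prod>l\<in>I - {i}. N l (p l)))) =
        det_on I (N(i := N k))"
      unfolding det_on_def
    proof (intro sum.cong refl)
      fix p :: "nat \<Rightarrow> nat"
      have "(\<Prod>l\<in>I. (N(i := N k)) l (p l)) = N k (p i) * (\<Prod>l\<in>I - {i}. (N(i := N k)) l (p l))"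
        using prod.remove[OF I that(1), of "\<lambda>l. (N(i := N k)) l (p l)"] by simp
      also have "(\<Prod>l\<in>I - {i}. (N(i := N k)) l (p l)) = (\<Prod>l\<in>I - {i}. N l (p l))"
        by (intro prod.cong) auto
      finally show "of_int (sign p) * (N k (p i) * (\<Prod>l\<in>I - {i}. N l (p l))) =
        of_int (sign p) * (\<Prod>l\<in>I. (N(i := N k)) l (p l))" by simp
    qed
    also have "\<dots> = (if k = i then det_on I N else 0)"
      using det_on_identical_rows[OF two I that, of "N(i := N k)"] by (auto simp: fun_upd_idem)
    finally show ?thesis .
  qed
  have "d (det_on I N) = (\<Sum>p | p permutes I. of_int (sign p) *
      (\<Sum>i\<in>I. (\<Sum>k\<in>I. Y i k * N k (p i)) * (\<Prod>l\<in>I - {i}. N l (p l))))"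
    unfolding det_on_def d_sum d_sign derivation_prod[where d = d, OF mult I]
  proof (intro sum.cong refl arg_cong2[where f = "(*)"])
    fix p i assume "p \<in> {p. p permutes I}" "i \<in> I"
    then have "p i \<in> I" by (simp add: permutes_in_image)
    then show "d (N i (p i)) = (\<Sum>k\<in>I. Y i k * N k (p i))" using Y \<open>i \<in> I\<close> by blast
  qed
  also have "\<dots> = (\<Sum>p | p permutes I. \<Sum>i\<in>I. \<Sum>k\<in>I.
      Y i k * (of_int (sign p) * (N k (p i) * (\<Prod>l\<in>I - {i}. N l (p l)))))"
    by (simp add: sum_distrib_left sum_distrib_right mult_ac)
  also have "\<dots> = (\<Sum>i\<in>I. \<Sum>k\<in>I. \<Sum>p | p permutes I.
      Y i k * (of_int (sign p) * (N k (p i) * (\<Prod>l\<in>I - {i}. N l (p l)))))"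
    by (subst sum.swap, rule sum.cong, simp, rule sum.swap)
  also have "\<dots> = (\<Sum>i\<in>I. \<Sum>k\<in>I. if k = i then Y i k * det_on I N else 0)"
    by (intro sum.cong refl) (simp add: sum_distrib_left[symmetric] row)
  also have "\<dots> = (\<Sum>i\<in>I. Y i i) * det_on I N"
    using I by (simp add: sum_distrib_right)
  finally show ?thesis .
qed

subsection \<open>The commutative ring of even forms\<close>

text \<open>Being central, the even forms are a commutative ring, where determinants are available.
  Curvature matrices have their entries there.\<close>

typedef ('n::"{finite,linorder}") even_form = "{a :: 'n ext. even_ext a}"
  morphisms ext_of Even_form
  by (rule exI[of _ 0]) (simp add: even_ext_simps)

lemma even_ext_ext_of [simp]: "even_ext (ext_of a)"
  using ext_of by simp

lemma ext_of_inverse [simp]: "even_ext a \<Longrightarrow> ext_of (Even_form a) = a"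
  by (simp add: Even_form_inverse)

instantiation even_form :: ("{finite,linorder}") comm_ring_1
begin
definition zero_even_form :: "'a even_form" where "zero_even_form = Even_form 0"
definition one_even_form :: "'a even_form" where "one_even_form = Even_form 1"
definition plus_even_form :: "'a even_form \<Rightarrow> 'a even_form \<Rightarrow> 'a even_form" where
  "plus_even_form a b = Even_form (ext_of a + ext_of b)"
definition minus_even_form :: "'a even_form \<Rightarrow> 'a even_form \<Rightarrow> 'a even_form" where
  "minus_even_form a b = Even_form (ext_of a - ext_of b)"
definition uminus_even_form :: "'a even_form \<Rightarrow> 'a even_form" where
  "uminus_even_form a = Even_form (- ext_of a)"
definition times_even_form :: "'a even_form \<Rightarrow> 'a even_form \<Rightarrow> 'a even_form" where
  "times_even_form a b = Even_form (ext_of a * ext_of b)"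

lemma ext_of_simps [simp]:
  "ext_of (0 :: 'a even_form) = 0" "ext_of (1 :: 'a even_form) = 1"
  "ext_of (a + b :: 'a even_form) = ext_of a + ext_of b"
  "ext_of (a - b :: 'a even_form) = ext_of a - ext_of b"
  "ext_of (- a :: 'a even_form) = - ext_of a"
  "ext_of (a * b :: 'a even_form) = ext_of a * ext_of b"
  by (simp_all add: zero_even_form_def one_even_form_def plus_even_form_def minus_even_form_def
      uminus_even_form_def times_even_form_def even_ext_simps even_ext_mult)

instance
proof
  show "(0 :: 'a even_form) \<noteq> 1" by (metis ext_of_simps(1,2) zero_neq_one)
  fix a b :: "'a even_form"
  show "a * b = b * a"
    by (simp add: ext_of_inject[symmetric] even_ext_commute[of "ext_of a"])
qed (simp_all add: ext_of_inject[symmetric] mult.assoc add.assoc add.commute distrib_right)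
end

lemma ext_of_sum: "ext_of (sum f A) = (\<Sum>x\<in>A. ext_of (f x))"
  by (induction A rule: infinite_finite_induct) auto

lemma ext_of_prod_list: "ext_of (prod_list xs) = prod_list (map ext_of xs)"
  by (induction xs) auto

lemma ext_of_of_int: "ext_of (of_int m) = of_int m"
proof -
  have "ext_of (of_nat k) = of_nat k" for k by (induction k) auto
  then show ?thesis by (cases m rule: int_cases2) auto
qed

lemma mdet_eq_det_on:
  assumes "finite I" "\<And>i j. i \<in> I \<Longrightarrow> j \<in> I \<Longrightarrow> even_ext (M i j)"
  shows "mdet I M = ext_of (det_on I (\<lambda>i j. Even_form (M i j)))"
proof -
  have "prod_list (map (\<lambda>i. M i (p i)) (sorted_list_of_set I)) = ext_of (\<Prod>i\<in>I. Even_form (M i (p i)))"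
    if "p permutes I" for p
  proof -
    have "(\<Prod>i\<in>I. Even_form (M i (p i))) = prod_list (map (\<lambda>i. Even_form (M i (p i))) (sorted_list_of_set I))"
      using prod.distinct_set_conv_list[of "sorted_list_of_set I" "\<lambda>i. Even_form (M i (p i))"] assms(1) by simp
    then have "ext_of (\<Prod>i\<in>I. Even_form (M i (p i))) =
        prod_list (map (\<lambda>i. ext_of (Even_form (M i (p i)))) (sorted_list_of_set I))"
      by (simp add: ext_of_prod_list comp_def)
    also have "\<dots> = prod_list (map (\<lambda>i. M i (p i)) (sorted_list_of_set I))"
      using assms that by (intro arg_cong[where f = prod_list] map_cong) (auto simp: permutes_in_image)
    finally show ?thesis ..
  qed
  then show ?thesis by (simp add: mdet_def det_on_def ext_of_sum ext_of_of_int)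
qed

lemma even_mdet:
  assumes "finite I" "\<And>i j. i \<in> I \<Longrightarrow> j \<in> I \<Longrightarrow> even_ext (M i j)"
  shows "even_ext (mdet I M)"
  using mdet_eq_det_on[OF assms] by simp

lemma euler_mdet:
  assumes I: "finite I" and ev: "\<And>i j. i \<in> I \<Longrightarrow> j \<in> I \<Longrightarrow> even_ext (N i j)"
    "\<And>i j. i \<in> I \<Longrightarrow> j \<in> I \<Longrightarrow> even_ext (Y i j)"
    and Y: "\<And>i j. i \<in> I \<Longrightarrow> j \<in> I \<Longrightarrow> euler (N i j) = (\<Sum>k\<in>I. Y i k * N k j)"
  shows "euler (mdet I N) = mtrace I Y * mdet I N"
proof -
  define d :: "'a even_form \<Rightarrow> 'a even_form" where "d a = Even_form (euler (ext_of a))" for a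
  have ext_d: "ext_of (d a) = euler (ext_of a)" for a by (simp add: d_def even_ext_euler)
  have "d (det_on I (\<lambda>i j. Even_form (N i j))) =
      (\<Sum>i\<in>I. Even_form (Y i i)) * det_on I (\<lambda>i j. Even_form (N i j))"
  proof (rule jacobi_formula[where d = d and Y = "\<lambda>i j. Even_form (Y i j)", OF _ I])
    fix a :: "'a even_form" assume "a + a = 0"
    then have "ext_of a + ext_of a = 0" by (metis ext_of_simps(1,3))
    then have "ext_coeff (ext_of a) J + ext_coeff (ext_of a) J = 0" for J by (metis ext_coeff_simps(1,3))
    then have "ext_of a = 0" by (intro ext_eqI) (simp add: mult_2[symmetric])
    then show "a = 0" by (metis ext_of_inject ext_of_simps(1))
  next
    fix i j assume ij: "i \<in> I" "j \<in> I"
    then show "d (Even_form (N i j)) = (\<Sum>k\<in>I. Even_form (Y i k) * Even_form (N k j))"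
      by (simp add: ext_of_inject[symmetric] ext_d ev Y ext_of_sum)
  qed (auto simp: ext_of_inject[symmetric] ext_d euler_add euler_mult)
  then have "ext_of (d (det_on I (\<lambda>i j. Even_form (N i j)))) =
      ext_of ((\<Sum>i\<in>I. Even_form (Y i i)) * det_on I (\<lambda>i j. Even_form (N i j)))" by simp
  then show ?thesis
    by (simp add: ext_d ext_of_sum mdet_eq_det_on[OF I ev(1)] mtrace_def ev)
qed

text \<open>In degree zero the matrix is the identity, and only the identity permutation
  contributes.\<close>

lemma ext_coeff_mdet_empty:
  assumes I: "finite I" "\<And>i j. i \<in> I \<Longrightarrow> j \<in> I \<Longrightarrow> ext_coeff (N i j) {} = (if i = j then 1 else 0)"
  shows "ext_coeff (mdet I N) {} = 1"
proof -
  have pl: "ext_coeff (prod_list (map f xs)) {} = prod_list (map (\<lambda>i. ext_coeff (f i) {}) xs)"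
    for f :: "nat \<Rightarrow> 'a ext" and xs by (induction xs) auto
  have si: "ext_coeff (of_int m :: 'a ext) {} = of_int m" for m
    by (simp flip: ext_const_of_int)
  have "ext_coeff (mdet I N) {} = (\<Sum>p | p permutes I. if p = id then 1 else 0)"
    unfolding mdet_def ext_coeff_sum ext_coeff_mult_empty pl si
  proof (intro sum.cong refl)
    fix p assume "p \<in> {p. p permutes I}"
    then have p: "p permutes I" by simp
    show "of_int (sign p) * prod_list (map (\<lambda>i. ext_coeff (N i (p i)) {}) (sorted_list_of_set I)) =
        (if p = id then 1 else (0 :: complex))"
    proof (cases "p = id")
      case True
      have "map (\<lambda>i. ext_coeff (N i (id i)) {}) (sorted_list_of_set I) = map (\<lambda>i. 1) (sorted_list_of_set I)"
        using assms by (intro map_cong) auto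
      then show ?thesis using True by (simp add: sign_id map_replicate_const)
    next
      case False
      then obtain i where "p i \<noteq> i" by (auto simp: fun_eq_iff)
      then have "i \<in> I" "p i \<in> I" "ext_coeff (N i (p i)) {} = 0"
        using p assms(2)[of i "p i"] by (metis permutes_not_in, metis permutes_in_image permutes_not_in,
            metis permutes_in_image permutes_not_in)
      then have "(0 :: complex) \<in> set (map (\<lambda>i. ext_coeff (N i (p i)) {}) (sorted_list_of_set I))"
        using I(1) by (auto intro!: image_eqI)
      then show ?thesis using False by (auto simp: prod_list_zero_iff)
    qed
  qed
  also have "\<dots> = 1" using I(1) by (simp add: finite_permutations permutes_id)
  finally show ?thesis .
qed

section \<open>Square roots of determinants\<close>

lemma fps_app_one_plus_X: "fps_app (1 + fps_X) (b :: 'n::{finite,linorder} ext) = 1 + b"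
proof -
  have "fps_app (1 + fps_X) b = (\<Sum>k\<in>{0, 1}. ext_const (fps_nth (1 + fps_X) k) * b ^ k)"
    unfolding fps_app_def
    by (rule sum.mono_neutral_right) (auto simp: ext_const_simps Suc_le_eq)
  then show ?thesis by (simp add: ext_const_simps)
qed

lemma ext_coeff_fps_app_empty:
  assumes "ext_coeff a {} = 0" shows "ext_coeff (fps_app f a) {} = fps_nth f 0"
proof -
  have "ext_coeff (a ^ k) {} = (if k = 0 then 1 else 0)" for k
    using assms by (induction k) auto
  then show ?thesis
    by (simp add: fps_app_def if_distrib[of "(*) _"] sum.delta cong: if_cong)
qed

lemma even_fps_app: "even_ext a \<Longrightarrow> even_ext (fps_app f a)"
  unfolding fps_app_def by (intro even_ext_sum even_ext_mult even_ext_power even_ext_simps)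

text \<open>The defining series is the binomial series of exponent \<open>1 / 2\<close>, whose square is
  \<open>1 + X\<close>.\<close>

lemma form_sqrt_square:
  assumes "ext_coeff a {} = 1" shows "form_sqrt a * form_sqrt a = a"
proof -
  have "fps_binomial (1 / 2 :: complex) * fps_binomial (1 / 2) = 1 + fps_X"
    by (simp flip: fps_binomial_add_mult add: fps_binomial_1)
  then have "form_sqrt a * form_sqrt a = fps_app (1 + fps_X) (a - 1)"
    unfolding form_sqrt_def using fps_app_mult[of "a - 1"] assms by simp
  then show ?thesis by (simp add: fps_app_one_plus_X)
qed

text \<open>The logarithmic derivative \<open>X f' / f\<close> is additive on eigenvalues, so the degree derivation turns
  \<open>det\<^sup>1\<^sup>/\<^sup>2 f(M)\<close> into a multiple of itself by a trace. The factor \<open>2\<close> in \<open>g\<close> is the degree of the entries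
  of \<open>M\<close>, the one in the last conclusion comes from the square root.\<close>

lemma euler_form_sqrt_mdet:
  fixes M :: "nat \<Rightarrow> nat \<Rightarrow> 'n::{finite,linorder} ext"
  assumes I: "finite I" and M: "\<And>i j. i \<in> I \<Longrightarrow> j \<in> I \<Longrightarrow> homog 2 (M i j)"
    and f: "fps_nth f 0 = 1" and g: "g * f = 2 * (fps_X * fps_deriv f)"
  defines "S \<equiv> form_sqrt (mdet I (fps_mapp I f M))"
  shows "even_ext S" "ext_coeff S {} = 1"
    "2 * euler S = mtrace I (fps_mapp I g M) * S"
proof -
  let ?D = "mdet I (fps_mapp I f M)" and ?h = "mtrace I (fps_mapp I g M)"
  have nil: "mpower I M m i j = 0" if "m > CARD('n)" "i \<in> I" "j \<in> I" for m i j
    using homog_gt_card[OF homog_mpower[of I M i j m, OF M that(2,3)]] that by auto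
  have Mev: "even_ext (M i j)" if "i \<in> I" "j \<in> I" for i j
    using homog_imp_even[OF M[OF that]] by simp
  have ev: "even_ext (fps_mapp I F M i j)" if "i \<in> I" "j \<in> I" for F i j
    by (rule even_fps_mapp[of I M i j F, OF Mev that])
  have eD: "euler ?D = ?h * ?D"
  proof (rule euler_mdet[OF I ev ev])
    fix i j assume ij: "i \<in> I" "j \<in> I"
    then show "euler (fps_mapp I f M i j) = (\<Sum>k\<in>I. fps_mapp I g M i k * fps_mapp I f M k j)"
      using euler_fps_mapp[of I M i j f, OF M ij] fps_mapp_mult[OF I ij(1), of M j g f] nil[OF _ ij] g by simp
  qed
  have D0: "ext_coeff ?D {} = 1"
  proof (rule ext_coeff_mdet_empty[OF I])
    fix i j assume ij: "i \<in> I" "j \<in> I"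
    have "ext_coeff (mpower I M k i j) {} = (if k = 0 \<and> i = j then 1 else 0)" for k
      using homog_mpower[of I M i j k, OF M ij] by (auto simp: homog_def)
    then have "ext_coeff (fps_mapp I f M i j) {} = (\<Sum>k\<le>CARD('n). if k = 0 then (if i = j then 1 else 0) else 0)"
      unfolding fps_mapp_def ext_coeff_sum ext_coeff_const_mult by (intro sum.cong) (auto simp: f)
    then show "ext_coeff (fps_mapp I f M i j) {} = (if i = j then 1 else 0)" by simp
  qed
  have Dev: "even_ext ?D" by (rule even_mdet[OF I ev])
  have hev: "even_ext ?h" unfolding mtrace_def by (intro even_ext_sum ev)
  have D10: "ext_coeff (?D - 1) {} = 0" and D1ev: "even_ext (?D - 1)"
    using D0 Dev by (auto intro: even_ext_simps)
  show Sev: "even_ext S" unfolding S_def form_sqrt_def by (rule even_fps_app[OF D1ev])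
  show "ext_coeff S {} = 1"
    unfolding S_def form_sqrt_def by (simp add: ext_coeff_fps_app_empty[OF D10])
  have SS: "S * S = ?D" unfolding S_def by (rule form_sqrt_square[OF D0])
  \<comment> \<open>The inverse of the determinant; with it one can divide the derivative of \<open>S * S = ?D\<close> by \<open>S\<close>.\<close>
  define D' where "D' = fps_app (inverse (1 + fps_X)) (?D - 1)"
  have "D' * fps_app (1 + fps_X) (?D - 1) = fps_app 1 (?D - 1)"
    unfolding D'_def fps_app_mult[OF D10] by (simp add: inverse_mult_eq_1)
  moreover have "fps_app 1 b = 1" for b :: "'n ext"
  proof -
    have "fps_app 1 b = (\<Sum>k\<in>{0}. ext_const (fps_nth 1 k) * b ^ k)"
      unfolding fps_app_def by (rule sum.mono_neutral_right) (auto simp: ext_const_simps)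
    then show ?thesis by (simp add: ext_const_simps)
  qed
  ultimately have DD: "D' * ?D = 1" by (simp add: fps_app_one_plus_X)
  have D'ev: "even_ext D'" unfolding D'_def by (rule even_fps_app[OF D1ev])
  have comm: "2 * e = h * s" if "s * s = d" "d' * d = 1" "e * s + s * e = h * d"
    for e h s d d' :: "'n even_form"
  proof -
    have "2 * e = (d' * d) * (2 * e)" using that by simp
    also have "\<dots> = d' * s * (e * s + s * e)" by (simp add: algebra_simps that(1)[symmetric])
    also have "\<dots> = (d' * d) * (h * s)" using that(3) by (simp add: algebra_simps)
    finally show ?thesis using that by simp
  qed
  have "2 * Even_form (euler S) = Even_form ?h * Even_form S"
  proof (rule comm[where d = "Even_form ?D" and d' = "Even_form D'"])
    show "Even_form S * Even_form S = Even_form ?D"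
      using SS by (simp add: ext_of_inject[symmetric] Sev Dev)
    show "Even_form D' * Even_form ?D = 1"
      using DD by (simp add: ext_of_inject[symmetric] D'ev Dev)
    show "Even_form (euler S) * Even_form S + Even_form S * Even_form (euler S) = Even_form ?h * Even_form ?D"
      using arg_cong[OF SS, of euler] unfolding ext_of_inject[symmetric] ext_of_simps
      by (simp add: Sev Dev hev eD even_ext_euler euler_mult)
  qed
  then have "ext_of (2 * Even_form (euler S)) = ext_of (Even_form ?h * Even_form S)" by simp
  moreover have "ext_of (2 * Even_form (euler S)) = 2 * euler S"
    unfolding mult_2 ext_of_simps(3) by (simp add: Sev even_ext_euler)
  ultimately show "2 * euler S = ?h * S" by (simp add: hev Sev)
qed

subsection \<open>The power series of the characteristic forms\<close>

lemma fps_nth_sinh: "fps_nth fps_sinh n = (if odd n then 1 / fact n else 0)"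
  by (simp add: fps_sinh_def fps_exp_def field_simps)

lemma fps_nth_cosh: "fps_nth fps_cosh n = (if even n then 1 / fact n else 0)"
  by (simp add: fps_cosh_def fps_exp_def field_simps)

lemma fps_deriv_sinh: "fps_deriv fps_sinh = fps_cosh"
  by (rule fps_ext) (simp add: fps_nth_sinh fps_nth_cosh del: of_nat_Suc)

lemma fps_deriv_cosh: "fps_deriv fps_cosh = fps_sinh"
  by (rule fps_ext) (simp add: fps_nth_sinh fps_nth_cosh del: of_nat_Suc)

abbreviation "A_hat_series \<equiv> fps_X / fps_sinh"
text \<open>The series \<open>2 X f' / f\<close> for \<open>f = X / sinh X\<close> and for \<open>f = cosh
  X\<close>.\<close>

abbreviation "A_hat_log \<equiv> 2 * (1 - A_hat_series * fps_cosh)"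
abbreviation "cosh_log \<equiv> 2 * (fps_X * fps_sinh * inverse fps_cosh)"

lemma A_hat_series_mult_sinh: "A_hat_series * fps_sinh = fps_X"
proof -
  have nz: "fps_sinh \<noteq> 0" using fps_nth_sinh[of 1] by auto
  have "subdegree fps_sinh = 1"
    by (rule subdegreeI) (auto simp: fps_nth_sinh)
  then have "fps_sinh dvd (fps_X :: complex fps)" using nz by (simp add: fps_dvd_iff)
  then show ?thesis by (rule dvd_div_mult_self)
qed

lemma A_hat_series_0: "fps_nth A_hat_series 0 = 1"
  using arg_cong[OF A_hat_series_mult_sinh, of "\<lambda>f. fps_nth f 1"]
  by (simp add: fps_mult_nth fps_nth_sinh)

lemma A_hat_log_mult: "A_hat_log * A_hat_series = 2 * (fps_X * fps_deriv A_hat_series)"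
proof -
  let ?f = A_hat_series
  have nz: "fps_sinh \<noteq> 0" using fps_nth_sinh[of 1] by auto
  have "fps_deriv (?f * fps_sinh) = 1" by (simp add: A_hat_series_mult_sinh)
  then have "?f * fps_cosh + fps_deriv ?f * fps_sinh = 1"
    by (simp only: fps_deriv_mult fps_deriv_sinh)
  then have "1 - ?f * fps_cosh = fps_deriv ?f * fps_sinh" by (metis add_diff_cancel_left')
  then have "(1 - ?f * fps_cosh) * ?f = fps_deriv ?f * (?f * fps_sinh)" by (simp only: mult_ac)
  then have "(1 - ?f * fps_cosh) * ?f = fps_X * fps_deriv ?f"
    unfolding A_hat_series_mult_sinh by (simp only: mult_ac)
  then show ?thesis by (simp only: mult.assoc)
qed

lemma cosh_log_mult: "cosh_log * fps_cosh = 2 * (fps_X * fps_deriv fps_cosh)"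
proof -
  have "inverse fps_cosh * fps_cosh = 1" by (rule inverse_mult_eq_1) (simp add: fps_nth_cosh)
  then have "2 * (fps_X * fps_sinh * (inverse fps_cosh * fps_cosh)) = 2 * (fps_X * fps_deriv fps_cosh)"
    by (simp add: fps_deriv_cosh)
  then show ?thesis by (simp add: mult.assoc)
qed

text \<open>The coefficients of \<open>c = X coth X\<close> follow one after the other from \<open>c sinh X
  = X cosh X\<close>.\<close>

lemma A_hat_log_nth:
  "fps_nth A_hat_log 0 = 0" "fps_nth A_hat_log 2 = - 2 / 3" "fps_nth A_hat_log 4 = 2 / 45"
  "fps_nth A_hat_log 6 = - 4 / 945" "fps_nth A_hat_log 8 = 2 / 4725" "fps_nth A_hat_log 10 = - 4 / 93555"
proof -
  define c where "c = A_hat_series * fps_cosh"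
  have "c * fps_sinh = fps_X * fps_cosh" using A_hat_series_mult_sinh by (simp add: c_def mult_ac)
  then have *: "(\<Sum>i=0..Suc n. fps_nth c i * fps_nth fps_sinh (Suc n - i)) = fps_nth fps_cosh n" for n
    by (metis fps_mult_nth fps_X_mult_nth diff_Suc_1 nat.simps(3))
  have r: "{0..Suc 0} = {0, 1}" "{0..Suc 2} = {0, 1, 2, 3}" "{0..Suc 4} = {0, 1, 2, 3, 4, 5}"
    "{0..Suc 6} = {0, 1, 2, 3, 4, 5, 6, 7}" "{0..Suc 8} = {0, 1, 2, 3, 4, 5, 6, 7, 8, 9}"
    "{0..Suc 10} = {0, 1, 2, 3, 4, 5, 6, 7, 8, 9, 10, 11}"
    by (rule set_eqI, simp, presburger)+
  have c0: "fps_nth c 0 = 1"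
    using *[of 0] unfolding r by (simp add: fps_nth_sinh fps_nth_cosh)
  have c2: "fps_nth c 2 = 1 / 3"
    using *[of 2] c0 unfolding r
    by (simp add: fps_nth_sinh fps_nth_cosh fact_numeral field_simps; algebra?)
  have c4: "fps_nth c 4 = - 1 / 45"
    using *[of 4] c0 c2 unfolding r
    by (simp add: fps_nth_sinh fps_nth_cosh fact_numeral field_simps; algebra?)
  have c6: "fps_nth c 6 = 2 / 945"
    using *[of 6] c0 c2 c4 unfolding r
    by (simp add: fps_nth_sinh fps_nth_cosh fact_numeral field_simps; algebra?)
  have c8: "fps_nth c 8 = - 1 / 4725"
    using *[of 8] c0 c2 c4 c6 unfolding r
    by (simp add: fps_nth_sinh fps_nth_cosh fact_numeral field_simps; algebra?)
  have c10: "fps_nth c 10 = 2 / 93555"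
    using *[of 10] c0 c2 c4 c6 c8 unfolding r
    by (simp add: fps_nth_sinh fps_nth_cosh fact_numeral field_simps; algebra?)
  have n: "fps_nth A_hat_log k = 2 * ((if k = 0 then 1 else 0) - fps_nth c k)" for k
    unfolding c_def by (simp add: numeral_fps_const)
  show "fps_nth A_hat_log 0 = 0" "fps_nth A_hat_log 2 = - 2 / 3" "fps_nth A_hat_log 4 = 2 / 45"
    "fps_nth A_hat_log 6 = - 4 / 945" "fps_nth A_hat_log 8 = 2 / 4725" "fps_nth A_hat_log 10 = - 4 / 93555"
    unfolding n by (simp_all add: c0 c2 c4 c6 c8 c10)
qed

text \<open>The ratios are \<open>- (4 ^ k - 1)\<close>: with \<open>a(X) = log (X / sinh X)\<close>, the
  identity \<open>sinh 2X = 2 sinh X cosh X\<close> gives \<open>log cosh X = a(X) - a(2X)\<close>. The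
  coefficients of \<open>c = X tanh X\<close> are computed from \<open>c cosh X = X sinh X\<close>.\<close>

lemma cosh_log_nth:
  "fps_nth cosh_log 0 = 0" "fps_nth cosh_log 2 = - 3 * fps_nth A_hat_log 2"
  "fps_nth cosh_log 4 = - 15 * fps_nth A_hat_log 4" "fps_nth cosh_log 6 = - 63 * fps_nth A_hat_log 6"
  "fps_nth cosh_log 8 = - 255 * fps_nth A_hat_log 8" "fps_nth cosh_log 10 = - 1023 * fps_nth A_hat_log 10"
proof -
  define c where "c = fps_X * fps_sinh * inverse fps_cosh"
  have "inverse fps_cosh * fps_cosh = 1" by (rule inverse_mult_eq_1) (simp add: fps_nth_cosh)
  then have "c * fps_cosh = fps_X * fps_sinh" by (simp add: c_def mult.assoc)
  then have *: "(\<Sum>i=0..n. fps_nth c i * fps_nth fps_cosh (n - i)) =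
      (if n = 0 then 0 else fps_nth fps_sinh (n - 1))" for n
    by (metis fps_mult_nth fps_X_mult_nth)
  have r: "{0..2} = {0, 1, 2 :: nat}" "{0..4} = {0, 1, 2, 3, 4 :: nat}"
    "{0..6} = {0, 1, 2, 3, 4, 5, 6 :: nat}" "{0..8} = {0, 1, 2, 3, 4, 5, 6, 7, 8 :: nat}"
    "{0..10} = {0, 1, 2, 3, 4, 5, 6, 7, 8, 9, 10 :: nat}"
    by (rule set_eqI, simp, presburger)+
  have c0: "fps_nth c 0 = 0"
    using *[of 0] by (simp add: fps_nth_sinh fps_nth_cosh)
  have c2: "fps_nth c 2 = 1"
    using *[of 2] c0 unfolding r
    by (simp add: fps_nth_sinh fps_nth_cosh fact_numeral field_simps; algebra?)
  have c4: "fps_nth c 4 = - 1 / 3"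
    using *[of 4] c0 c2 unfolding r
    by (simp add: fps_nth_sinh fps_nth_cosh fact_numeral field_simps; algebra?)
  have c6: "fps_nth c 6 = 2 / 15"
    using *[of 6] c0 c2 c4 unfolding r
    by (simp add: fps_nth_sinh fps_nth_cosh fact_numeral field_simps; algebra?)
  have c8: "fps_nth c 8 = - 17 / 315"
    using *[of 8] c0 c2 c4 c6 unfolding r
    by (simp add: fps_nth_sinh fps_nth_cosh fact_numeral field_simps; algebra?)
  have c10: "fps_nth c 10 = 62 / 2835"
    using *[of 10] c0 c2 c4 c6 c8 unfolding r
    by (simp add: fps_nth_sinh fps_nth_cosh fact_numeral field_simps; algebra?)
  have n: "fps_nth cosh_log k = 2 * fps_nth c k" for k
    unfolding c_def by (simp add: numeral_fps_const)
  show "fps_nth cosh_log 0 = 0" "fps_nth cosh_log 2 = - 3 * fps_nth A_hat_log 2"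
    "fps_nth cosh_log 4 = - 15 * fps_nth A_hat_log 4" "fps_nth cosh_log 6 = - 63 * fps_nth A_hat_log 6"
    "fps_nth cosh_log 8 = - 255 * fps_nth A_hat_log 8" "fps_nth cosh_log 10 = - 1023 * fps_nth A_hat_log 10"
    unfolding n A_hat_log_nth by (simp_all add: c0 c2 c4 c6 c8 c10)
qed

section \<open>Smooth functions on open sets\<close>

lemma has_derivative_eq_on_open:
  assumes "open U" "x \<in> U" "\<And>y. y \<in> U \<Longrightarrow> f y = g y"
  shows "(f has_derivative D) (at x) \<longleftrightarrow> (g has_derivative D) (at x)"
  using assms has_derivative_transform_within_open[of f D x UNIV U g]
    has_derivative_transform_within_open[of g D x UNIV U f] by auto

lemma frechet_derivative_eq_on_open:
  assumes "open U" "x \<in> U" "\<And>y. y \<in> U \<Longrightarrow> f y = g y"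
  shows "frechet_derivative f (at x) = frechet_derivative g (at x)"
  using has_derivative_eq_on_open[OF assms] by (simp add: frechet_derivative_def)

lemma differentiable_eq_on_open:
  assumes "open U" "x \<in> U" "\<And>y. y \<in> U \<Longrightarrow> f y = g y"
  shows "f differentiable (at x) \<longleftrightarrow> g differentiable (at x)"
  using has_derivative_eq_on_open[OF assms] by (simp add: differentiable_def)

lemma frechet_derivative_eqI: "(f has_derivative D) (at x) \<Longrightarrow> frechet_derivative f (at x) = D"
  using frechet_derivative_at by metis

lemma has_derivative_frechet:
  "f differentiable (at x) \<Longrightarrow> (f has_derivative frechet_derivative f (at x)) (at x)"
  by (simp add: frechet_derivative_works)

lemma times_differentiable_on_cong:
  assumes "open U" "\<And>y. y \<in> U \<Longrightarrow> f y = g y"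
  shows "times_differentiable_on k U f \<longleftrightarrow> times_differentiable_on k U g"
  using assms(2)
proof (induction k arbitrary: f g)
  case 0
  then show ?case by (simp cong: continuous_on_cong)
next
  case (Suc k)
  have "frechet_derivative f (at y) v = frechet_derivative g (at y) v" if "y \<in> U" for y v
    using frechet_derivative_eq_on_open[OF assms(1) that, of f g] Suc.prems by simp
  then have "times_differentiable_on k U (\<lambda>x. frechet_derivative f (at x) v) \<longleftrightarrow>
      times_differentiable_on k U (\<lambda>x. frechet_derivative g (at x) v)" for v
    by (intro Suc.IH)
  moreover have "f differentiable (at x) \<longleftrightarrow> g differentiable (at x)" if "x \<in> U" for x
    using differentiable_eq_on_open[OF assms(1) that, of f g] Suc.prems by simp
  ultimately show ?case by simp
qed

lemma times_differentiable_on_SucD: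
  "times_differentiable_on (Suc k) U f \<Longrightarrow> times_differentiable_on k U f"
proof (induction k arbitrary: f)
  case 0
  then show ?case
    by (auto intro!: differentiable_imp_continuous_on simp: differentiable_on_def differentiable_at_withinI)
next
  case (Suc k)
  then show ?case by (metis times_differentiable_on.simps(2))
qed

lemma times_differentiable_on_subset:
  "times_differentiable_on k U f \<Longrightarrow> V \<subseteq> U \<Longrightarrow> times_differentiable_on k V f"
  by (induction k arbitrary: f) (auto intro: continuous_on_subset)

lemma times_differentiable_on_const: "times_differentiable_on k U (\<lambda>x. c)"
proof (induction k arbitrary: c)
  case (Suc k)
  then show ?case by (simp add: frechet_derivative_eqI[OF has_derivative_const])
qed simp

lemma times_differentiable_on_SucI:
  assumes "open U" "\<And>x. x \<in> U \<Longrightarrow> (f has_derivative D x) (at x)"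
    "\<And>v. times_differentiable_on k U (\<lambda>x. D x v)"
  shows "times_differentiable_on (Suc k) U f"
proof -
  have "times_differentiable_on k U (\<lambda>x. frechet_derivative f (at x) v)" for v
    using times_differentiable_on_cong[OF assms(1), of "\<lambda>x. frechet_derivative f (at x) v" "\<lambda>x. D x v" k]
      frechet_derivative_eqI[OF assms(2)] assms(3) by simp
  then show ?thesis using assms(2) by (auto simp: differentiable_def)
qed

lemma times_differentiable_on_has_derivative:
  "times_differentiable_on (Suc k) U f \<Longrightarrow> x \<in> U \<Longrightarrow>
    (f has_derivative frechet_derivative f (at x)) (at x)"
  by (simp add: has_derivative_frechet)

lemma times_differentiable_on_linear:
  assumes "bounded_linear L" "open U" "times_differentiable_on k U f"
  shows "times_differentiable_on k U (\<lambda>x. L (f x))"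
  using assms(3)
proof (induction k arbitrary: f)
  case 0
  then show ?case using bounded_linear.continuous_on[OF assms(1)] by simp
next
  case (Suc k)
  show ?case
  proof (rule times_differentiable_on_SucI[OF assms(2)])
    show "((\<lambda>x. L (f x)) has_derivative (\<lambda>v. L (frechet_derivative f (at x) v))) (at x)" if "x \<in> U" for x
      by (rule bounded_linear.has_derivative[OF assms(1) times_differentiable_on_has_derivative[OF Suc.prems that]])
  qed (use Suc in auto)
qed

lemma times_differentiable_on_add:
  assumes "open U" "times_differentiable_on k U f" "times_differentiable_on k U g"
  shows "times_differentiable_on k U (\<lambda>x. f x + g x)"
  using assms(2,3)
proof (induction k arbitrary: f g)
  case 0
  then show ?case by (simp add: continuous_on_add)
next
  case (Suc k)
  show ?case
  proof (rule times_differentiable_on_SucI[OF assms(1)])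
    show "((\<lambda>x. f x + g x) has_derivative
        (\<lambda>v. frechet_derivative f (at x) v + frechet_derivative g (at x) v)) (at x)" if "x \<in> U" for x
      by (intro has_derivative_add times_differentiable_on_has_derivative[OF Suc.prems(1) that]
          times_differentiable_on_has_derivative[OF Suc.prems(2) that])
  qed (use Suc in auto)
qed

lemma times_differentiable_on_bilinear:
  assumes "bounded_bilinear B" "open U" "times_differentiable_on k U f" "times_differentiable_on k U g"
  shows "times_differentiable_on k U (\<lambda>x. B (f x) (g x))"
  using assms(3,4)
proof (induction k arbitrary: f g)
  case 0
  then show ?case using bounded_bilinear.continuous_on[OF assms(1)] by simp
next
  case (Suc k)
  show ?case
  proof (rule times_differentiable_on_SucI[OF assms(2)])
    show "((\<lambda>x. B (f x) (g x)) has_derivative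
        (\<lambda>v. B (f x) (frechet_derivative g (at x) v) + B (frechet_derivative f (at x) v) (g x))) (at x)"
      if "x \<in> U" for x
      by (intro bounded_bilinear.FDERIV[OF assms(1)] times_differentiable_on_has_derivative[OF Suc.prems(1) that]
          times_differentiable_on_has_derivative[OF Suc.prems(2) that])
  next
    fix v
    show "times_differentiable_on k U
       (\<lambda>x. B (f x) (frechet_derivative g (at x) v) + B (frechet_derivative f (at x) v) (g x))"
      using Suc.prems times_differentiable_on_SucD[OF Suc.prems(1)] times_differentiable_on_SucD[OF Suc.prems(2)]
      by (intro times_differentiable_on_add assms(2) Suc.IH) auto
  qed
qed

lemma times_differentiable_on_sum:
  assumes "open U" "\<And>i. i \<in> A \<Longrightarrow> times_differentiable_on k U (f i)"
  shows "times_differentiable_on k U (\<lambda>x. \<Sum>i\<in>A. f i x)"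
  using assms(2)
  by (induction A rule: infinite_finite_induct)
    (auto intro: times_differentiable_on_const times_differentiable_on_add[OF assms(1)])

lemma times_differentiable_on_inverse:
  fixes f :: "'a::real_normed_vector \<Rightarrow> 'b::real_normed_field"
  assumes "open U" "times_differentiable_on k U f" "\<And>x. x \<in> U \<Longrightarrow> f x \<noteq> 0"
  shows "times_differentiable_on k U (\<lambda>x. inverse (f x))"
  using assms(2)
proof (induction k)
  case 0
  then show ?case using assms(3) by (auto intro: continuous_on_inverse)
next
  case (Suc k)
  show ?case
  proof (rule times_differentiable_on_SucI[OF assms(1)])
    show "((\<lambda>x. inverse (f x)) has_derivative
        (\<lambda>v. (- 1) * (inverse (f x) * (frechet_derivative f (at x) v * inverse (f x))))) (at x)"
      if "x \<in> U" for x
      using Deriv.has_derivative_inverse[OF assms(3)[OF that] times_differentiable_on_has_derivative[OF Suc.prems that]]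
      by (simp add: mult.assoc)
    have "times_differentiable_on k U f" by (rule times_differentiable_on_SucD[OF Suc.prems])
    then show "times_differentiable_on k U
        (\<lambda>x. (- 1) * (inverse (f x) * (frechet_derivative f (at x) v * inverse (f x))))" for v
      using Suc
      by (intro times_differentiable_on_bilinear[OF bounded_bilinear_mult assms(1)] times_differentiable_on_const) auto
  qed
qed

text \<open>The derivative of \<open>g \<circ> f\<close> in direction \<open>v\<close> is expanded in a basis, so that only derivatives of
  \<open>g\<close> in fixed directions occur.\<close>

lemma times_differentiable_on_compose:
  fixes f :: "'a::real_normed_vector \<Rightarrow> 'b::euclidean_space" and g :: "'b \<Rightarrow> 'c::real_normed_vector"
  assumes "open U" "open V" "f ` U \<subseteq> V" "times_differentiable_on k U f" "times_differentiable_on k V g"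
  shows "times_differentiable_on k U (\<lambda>x. g (f x))"
  using assms(4,5)
proof (induction k arbitrary: g)
  case 0
  then show ?case using assms(3) by (auto intro: continuous_on_compose2)
next
  case (Suc k)
  have f: "times_differentiable_on k U f" by (rule times_differentiable_on_SucD[OF Suc.prems(1)])
  show ?case
  proof (rule times_differentiable_on_SucI[OF assms(1)])
    fix x assume x: "x \<in> U"
    then have fx: "f x \<in> V" using assms(3) by auto
    let ?f = "frechet_derivative f (at x)" and ?g = "frechet_derivative g (at (f x))"
    have g: "(g has_derivative ?g) (at (f x))"
      by (rule times_differentiable_on_has_derivative[OF Suc.prems(2) fx])
    have lin: "linear ?g" using g by (simp add: has_derivative_linear)
    have rep: "?g w = (\<Sum>b\<in>Basis. (w \<bullet> b) *\<^sub>R ?g b)" for w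
    proof -
      have "?g w = ?g (\<Sum>b\<in>Basis. (w \<bullet> b) *\<^sub>R b)" by (simp add: euclidean_representation)
      also have "\<dots> = (\<Sum>b\<in>Basis. (w \<bullet> b) *\<^sub>R ?g b)"
        by (simp add: linear_sum[OF lin] linear_scale[OF lin])
      finally show ?thesis .
    qed
    have "(\<lambda>v. ?g (?f v)) = (\<lambda>v. \<Sum>b\<in>Basis. (?f v \<bullet> b) *\<^sub>R ?g b)" by (rule ext, rule rep)
    moreover have "((\<lambda>x. g (f x)) has_derivative (\<lambda>v. ?g (?f v))) (at x)"
      by (rule has_derivative_compose[OF times_differentiable_on_has_derivative[OF Suc.prems(1) x] g])
    ultimately show "((\<lambda>x. g (f x)) has_derivative (\<lambda>v. \<Sum>b\<in>Basis. (?f v \<bullet> b) *\<^sub>R ?g b)) (at x)"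
      by (simp only:)
  next
    fix v
    show "times_differentiable_on k U (\<lambda>x. \<Sum>b\<in>Basis. (frechet_derivative f (at x) v \<bullet> b) *\<^sub>R
        frechet_derivative g (at (f x)) b)"
    proof (intro times_differentiable_on_sum[OF assms(1)]
        times_differentiable_on_bilinear[OF bounded_bilinear_scaleR assms(1)])
      fix b :: 'b
      show "times_differentiable_on k U (\<lambda>x. frechet_derivative f (at x) v \<bullet> b)"
        using Suc.prems(1) by (intro times_differentiable_on_linear[OF bounded_linear_inner_left assms(1)]) auto
      show "times_differentiable_on k U (\<lambda>x. frechet_derivative g (at (f x)) b)"
        using Suc.prems(2) by (intro Suc.IH f) auto
    qed
  qed
qed

lemma smooth_on_cong:
  "open U \<Longrightarrow> (\<And>y. y \<in> U \<Longrightarrow> f y = g y) \<Longrightarrow> smooth_on U f \<longleftrightarrow> smooth_on U g"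
  unfolding smooth_on_def using times_differentiable_on_cong[of U f g] by blast

lemma smooth_on_subset: "smooth_on U f \<Longrightarrow> V \<subseteq> U \<Longrightarrow> smooth_on V f"
  unfolding smooth_on_def using times_differentiable_on_subset by blast

lemma smooth_on_const: "smooth_on U (\<lambda>x. c)"
  by (simp add: smooth_on_def times_differentiable_on_const)

lemma smooth_on_linear: "bounded_linear L \<Longrightarrow> open U \<Longrightarrow> smooth_on U f \<Longrightarrow> smooth_on U (\<lambda>x. L (f x))"
  by (simp add: smooth_on_def times_differentiable_on_linear)

lemma smooth_on_add: "open U \<Longrightarrow> smooth_on U f \<Longrightarrow> smooth_on U g \<Longrightarrow> smooth_on U (\<lambda>x. f x + g x)"
  by (simp add: smooth_on_def times_differentiable_on_add)

lemma smooth_on_mult: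
  fixes f g :: "'a::real_normed_vector \<Rightarrow> 'b::real_normed_algebra"
  shows "open U \<Longrightarrow> smooth_on U f \<Longrightarrow> smooth_on U g \<Longrightarrow> smooth_on U (\<lambda>x. f x * g x)"
  by (simp add: smooth_on_def times_differentiable_on_bilinear[OF bounded_bilinear_mult])

lemma smooth_on_minus:
  fixes f g :: "'a::real_normed_vector \<Rightarrow> 'b::real_normed_vector"
  shows "open U \<Longrightarrow> smooth_on U f \<Longrightarrow> smooth_on U g \<Longrightarrow> smooth_on U (\<lambda>x. f x - g x)"
  using smooth_on_add[of U f "\<lambda>x. - g x"] smooth_on_linear[of uminus U g]
  by (simp add: bounded_linear_minus[OF bounded_linear_ident])

lemma smooth_on_sum:
  "open U \<Longrightarrow> (\<And>i. i \<in> A \<Longrightarrow> smooth_on U (f i)) \<Longrightarrow> smooth_on U (\<lambda>x. \<Sum>i\<in>A. f i x)"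
  by (simp add: smooth_on_def times_differentiable_on_sum)

lemma smooth_on_prod:
  fixes f :: "'i \<Rightarrow> 'a::real_normed_vector \<Rightarrow> 'b::real_normed_field"
  assumes "open U" "\<And>i. i \<in> A \<Longrightarrow> smooth_on U (f i)"
  shows "smooth_on U (\<lambda>x. \<Prod>i\<in>A. f i x)"
  using assms(2)
  by (induction A rule: infinite_finite_induct) (auto intro: smooth_on_const smooth_on_mult[OF assms(1)])

lemma smooth_on_inverse:
  fixes f :: "'a::real_normed_vector \<Rightarrow> 'b::real_normed_field"
  shows "open U \<Longrightarrow> smooth_on U f \<Longrightarrow> (\<And>x. x \<in> U \<Longrightarrow> f x \<noteq> 0) \<Longrightarrow> smooth_on U (\<lambda>x. inverse (f x))"
  by (simp add: smooth_on_def times_differentiable_on_inverse)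

lemma smooth_on_compose:
  fixes f :: "'a::real_normed_vector \<Rightarrow> 'b::euclidean_space"
  shows "open U \<Longrightarrow> open V \<Longrightarrow> f ` U \<subseteq> V \<Longrightarrow> smooth_on U f \<Longrightarrow> smooth_on V g \<Longrightarrow>
    smooth_on U (\<lambda>x. g (f x))"
  unfolding smooth_on_def using times_differentiable_on_compose by blast

lemma smooth_on_differentiable: "smooth_on U f \<Longrightarrow> x \<in> U \<Longrightarrow> f differentiable (at x)"
  unfolding smooth_on_def by (metis times_differentiable_on.simps(2))

lemma smooth_on_frechet_derivative:
  "smooth_on U f \<Longrightarrow> smooth_on U (\<lambda>x. frechet_derivative f (at x) v)"
  unfolding smooth_on_def by (metis times_differentiable_on.simps(2))

lemma smooth_on_continuous_on: "smooth_on U f \<Longrightarrow> continuous_on U f"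
  unfolding smooth_on_def by (metis times_differentiable_on.simps(1))

subsection \<open>Symmetry of second derivatives\<close>

text \<open>The mean value theorem, first in direction \<open>v\<close> and then in direction
  \<open>w\<close>. The left-hand side is symmetric in \<open>v\<close> and \<open>w\<close>.\<close>

lemma double_difference_mean_value:
  fixes f :: "'a::real_normed_vector \<Rightarrow> real"
  assumes h: "h > 0"
    and U: "\<And>s t. 0 \<le> s \<Longrightarrow> s \<le> h \<Longrightarrow> 0 \<le> t \<Longrightarrow> t \<le> h \<Longrightarrow> x + s *\<^sub>R v + t *\<^sub>R w \<in> U"
    and f: "smooth_on U f"
  shows "\<exists>s t. 0 < s \<and> s < h \<and> 0 < t \<and> t < h \<and>
    f (x + h *\<^sub>R v + h *\<^sub>R w) - f (x + h *\<^sub>R v) - f (x + h *\<^sub>R w) + f x =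
    h * h * frechet_derivative (\<lambda>y. frechet_derivative f (at y) v) (at (x + s *\<^sub>R v + t *\<^sub>R w)) w"
proof -
  let ?D = "\<lambda>y. frechet_derivative f (at y) v"
  have line: "((\<lambda>s. F (a + s *\<^sub>R u)) has_real_derivative frechet_derivative F (at (a + s *\<^sub>R u)) u) (at s)"
    if "F differentiable (at (a + s *\<^sub>R u))" for F :: "'a \<Rightarrow> real" and a u s
  proof -
    have "((\<lambda>s. a + s *\<^sub>R u) has_derivative (\<lambda>s. s *\<^sub>R u)) (at s)"
      by (auto intro!: derivative_eq_intros)
    from has_derivative_compose[OF this has_derivative_frechet[OF that]]
    have "((\<lambda>s. F (a + s *\<^sub>R u)) has_derivative (\<lambda>r. frechet_derivative F (at (a + s *\<^sub>R u)) (r *\<^sub>R u))) (at s)" .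
    moreover have "linear (frechet_derivative F (at (a + s *\<^sub>R u)))"
      using that by (rule linear_frechet_derivative)
    ultimately show ?thesis
      by (simp add: has_field_derivative_def linear_scale mult.commute[of _ "frechet_derivative F (at (a + s *\<^sub>R u)) u"])
  qed
  have fd: "f differentiable (at y)" "?D differentiable (at y)" if "y \<in> U" for y
    using smooth_on_differentiable[OF f that] smooth_on_differentiable[OF smooth_on_frechet_derivative[OF f] that]
    by auto
  let ?g = "\<lambda>s. f ((x + h *\<^sub>R w) + s *\<^sub>R v) - f (x + s *\<^sub>R v)"
  have "\<exists>s>0. s < h \<and> ?g h - ?g 0 = (h - 0) * (?D ((x + h *\<^sub>R w) + s *\<^sub>R v) - ?D (x + s *\<^sub>R v))"
  proof (rule MVT2[OF h])
    fix s assume s: "0 \<le> s" "s \<le> h"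
    have "(x + h *\<^sub>R w) + s *\<^sub>R v \<in> U" "x + s *\<^sub>R v \<in> U"
      using U[of s h] U[of s 0] s h by (auto simp: algebra_simps)
    then show "(?g has_real_derivative (?D ((x + h *\<^sub>R w) + s *\<^sub>R v) - ?D (x + s *\<^sub>R v))) (at s)"
      by (intro DERIV_diff line fd)
  qed
  then obtain s where s: "0 < s" "s < h"
    "?g h - ?g 0 = h * (?D ((x + h *\<^sub>R w) + s *\<^sub>R v) - ?D (x + s *\<^sub>R v))" by auto
  let ?k = "\<lambda>t. ?D ((x + s *\<^sub>R v) + t *\<^sub>R w)"
  have "\<exists>t>0. t < h \<and> ?k h - ?k 0 = (h - 0) * frechet_derivative ?D (at ((x + s *\<^sub>R v) + t *\<^sub>R w)) w"
  proof (rule MVT2[OF h])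
    fix t assume t: "0 \<le> t" "t \<le> h"
    then show "(?k has_real_derivative frechet_derivative ?D (at ((x + s *\<^sub>R v) + t *\<^sub>R w)) w) (at t)"
      using U[of s t] s by (intro line fd) auto
  qed
  then obtain t where t: "0 < t" "t < h"
    "?k h - ?k 0 = h * frechet_derivative ?D (at (x + s *\<^sub>R v + t *\<^sub>R w)) w" by auto
  have "?g h - ?g 0 = h * (?k h - ?k 0)" using s(3) by (simp add: algebra_simps)
  then have "f (x + h *\<^sub>R v + h *\<^sub>R w) - f (x + h *\<^sub>R v) - f (x + h *\<^sub>R w) + f x =
    h * h * frechet_derivative ?D (at (x + s *\<^sub>R v + t *\<^sub>R w)) w"
    using t(3) by (simp add: algebra_simps)
  then show ?thesis using s(1,2) t(1,2) by blast
qed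

text \<open>On an arbitrarily small parallelogram at \<open>x\<close> both mixed derivatives take the value
  of the same second difference; by continuity they agree at \<open>x\<close>.\<close>

lemma second_derivative_symmetric_real:
  fixes f :: "'a::real_normed_vector \<Rightarrow> real"
  assumes U: "open U" "x \<in> U" and f: "smooth_on U f"
  shows "frechet_derivative (\<lambda>y. frechet_derivative f (at y) v) (at x) w =
    frechet_derivative (\<lambda>y. frechet_derivative f (at y) w) (at x) v"
proof -
  define a where "a = (\<lambda>z. frechet_derivative (\<lambda>y. frechet_derivative f (at y) v) (at z) w)"
  define b where "b = (\<lambda>z. frechet_derivative (\<lambda>y. frechet_derivative f (at y) w) (at z) v)"
  have cont: "continuous_on U a" "continuous_on U b"
    unfolding a_def b_def by (intro smooth_on_continuous_on smooth_on_frechet_derivative f)+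
  have near: "\<exists>y z. dist y x < e \<and> dist z x < e \<and> a y = b z" if e: "e > 0" "ball x e \<subseteq> U" for e
  proof -
    \<comment> \<open>With this \<open>h\<close> the parallelogram spanned by \<open>h v\<close> and \<open>h w\<close> at \<open>x\<close> lies in the ball of radius \<open>e\<close>.\<close>
    define h where "h = e / (norm v + norm w + 1)"
    have pos: "norm v + norm w + 1 > 0" by (smt (verit) norm_ge_zero)
    have h: "h > 0" using e pos by (simp add: h_def)
    have near: "dist (x + s *\<^sub>R v + t *\<^sub>R w) x < e" if "0 \<le> s" "s \<le> h" "0 \<le> t" "t \<le> h" for s t
    proof -
      have "dist (x + s *\<^sub>R v + t *\<^sub>R w) x = norm (s *\<^sub>R v + t *\<^sub>R w)"
        by (simp add: dist_norm algebra_simps)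
      also have "\<dots> \<le> s * norm v + t * norm w" using that by (intro norm_triangle_le) simp
      also have "\<dots> \<le> h * norm v + h * norm w" using that by (intro add_mono mult_right_mono) auto
      also have "\<dots> < h * (norm v + norm w + 1)" using h by (simp add: algebra_simps)
      also have "\<dots> = e" using pos by (simp add: h_def)
      finally show ?thesis .
    qed
    have inU: "x + s *\<^sub>R v + t *\<^sub>R w \<in> U" if "0 \<le> s" "s \<le> h" "0 \<le> t" "t \<le> h" for s t
      using near[OF that] e(2) by (auto simp: subset_eq dist_commute)
    then have inU': "x + s *\<^sub>R w + t *\<^sub>R v \<in> U" if "0 \<le> s" "s \<le> h" "0 \<le> t" "t \<le> h" for s t
      using inU[OF that(3,4,1,2)] by (simp add: algebra_simps)
    obtain s t where st: "0 < s" "s < h" "0 < t" "t < h"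
      "f (x + h *\<^sub>R v + h *\<^sub>R w) - f (x + h *\<^sub>R v) - f (x + h *\<^sub>R w) + f x =
        h * h * a (x + s *\<^sub>R v + t *\<^sub>R w)"
      using double_difference_mean_value[OF h inU f] unfolding a_def by blast
    obtain s' t' where st': "0 < s'" "s' < h" "0 < t'" "t' < h"
      "f (x + h *\<^sub>R w + h *\<^sub>R v) - f (x + h *\<^sub>R w) - f (x + h *\<^sub>R v) + f x =
        h * h * b (x + s' *\<^sub>R w + t' *\<^sub>R v)"
      using double_difference_mean_value[OF h inU' f] unfolding b_def by blast
    have "h * h * a (x + s *\<^sub>R v + t *\<^sub>R w) = h * h * b (x + t' *\<^sub>R v + s' *\<^sub>R w)"
      using st(5) st'(5) by (simp add: algebra_simps)
    then have "a (x + s *\<^sub>R v + t *\<^sub>R w) = b (x + t' *\<^sub>R v + s' *\<^sub>R w)" using h by simp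
    then show ?thesis using near[of s t] near[of t' s'] st st' by force
  qed
  have "a x = b x"
  proof (rule ccontr)
    assume "a x \<noteq> b x"
    define \<epsilon> where "\<epsilon> = dist (a x) (b x) / 2"
    have \<epsilon>: "\<epsilon> > 0" using \<open>a x \<noteq> b x\<close> by (simp add: \<epsilon>_def)
    obtain d1 where d1: "d1 > 0" "\<And>y. y \<in> U \<Longrightarrow> dist y x < d1 \<Longrightarrow> dist (a y) (a x) < \<epsilon>"
      using cont(1) U(2) \<epsilon> unfolding continuous_on_iff by blast
    obtain d2 where d2: "d2 > 0" "\<And>y. y \<in> U \<Longrightarrow> dist y x < d2 \<Longrightarrow> dist (b y) (b x) < \<epsilon>"
      using cont(2) U(2) \<epsilon> unfolding continuous_on_iff by blast
    obtain d3 where d3: "d3 > 0" "ball x d3 \<subseteq> U" using U openE by blast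
    define e where "e = min d1 (min d2 d3)"
    have e: "e > 0" "ball x e \<subseteq> U" using d1 d2 d3 by (auto simp: e_def)
    obtain y z where yz: "dist y x < e" "dist z x < e" "a y = b z" using near[OF e] by blast
    then have "y \<in> U" "z \<in> U" using e(2) by (auto simp: subset_eq dist_commute)
    then have "dist (a y) (a x) < \<epsilon>" "dist (b z) (b x) < \<epsilon>"
      using d1(2)[of y] d2(2)[of z] yz(1,2) by (simp_all add: e_def)
    then have "dist (a x) (b x) < 2 * \<epsilon>"
      using yz(3) dist_triangle2[of "a x" "b x" "a y"] by (simp add: dist_commute)
    then show False by (simp add: \<epsilon>_def)
  qed
  then show ?thesis by (simp add: a_def b_def)
qed

lemma frechet_derivative_linear:
  assumes "bounded_linear L" "f differentiable (at x)"
  shows "frechet_derivative (\<lambda>y. L (f y)) (at x) v = L (frechet_derivative f (at x) v)"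
  using frechet_derivative_eqI[OF bounded_linear.has_derivative[OF assms(1) has_derivative_frechet[OF assms(2)]]]
  by simp

lemma second_derivative_symmetric:
  fixes f :: "'a::real_normed_vector \<Rightarrow> complex"
  assumes U: "open U" "x \<in> U" and f: "smooth_on U f"
  shows "frechet_derivative (\<lambda>y. frechet_derivative f (at y) v) (at x) w =
    frechet_derivative (\<lambda>y. frechet_derivative f (at y) w) (at x) v"
proof -
  have *: "L (frechet_derivative (\<lambda>y. frechet_derivative f (at y) v) (at x) w) =
    frechet_derivative (\<lambda>y. frechet_derivative (\<lambda>z. L (f z)) (at y) v) (at x) w"
    if L: "bounded_linear L" for L :: "complex \<Rightarrow> real" and v w
  proof -
    have "frechet_derivative (\<lambda>y. frechet_derivative (\<lambda>z. L (f z)) (at y) v) (at x) =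
        frechet_derivative (\<lambda>y. L (frechet_derivative f (at y) v)) (at x)"
      by (rule frechet_derivative_eq_on_open[OF U])
        (simp add: frechet_derivative_linear[OF L smooth_on_differentiable[OF f]])
    then show ?thesis
      by (simp add: frechet_derivative_linear[OF L]
          smooth_on_differentiable[OF smooth_on_frechet_derivative[OF f] U(2)])
  qed
  have "L (frechet_derivative (\<lambda>y. frechet_derivative f (at y) v) (at x) w) =
    L (frechet_derivative (\<lambda>y. frechet_derivative f (at y) w) (at x) v)"
    if "bounded_linear L" for L :: "complex \<Rightarrow> real"
    unfolding *[OF that] by (rule second_derivative_symmetric_real[OF U smooth_on_linear[OF that U(1) f]])
  then show ?thesis using bounded_linear_Re bounded_linear_Im by (simp add: complex_eq_iff)
qed

section \<open>Calculus of differential forms\<close>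

lemma ext_eq_neg_imp_zero:
  assumes "a = - a" shows "a = (0 :: 'n::{finite,linorder} ext)"
proof (rule ext_eqI)
  fix I show "ext_coeff a I = ext_coeff 0 I"
    using arg_cong[OF assms, of "\<lambda>b. ext_coeff b I"] by simp
qed

definition smooth_ext_on :: "'n rvec set \<Rightarrow> ('n rvec \<Rightarrow> 'n::{finite,linorder} ext) \<Rightarrow> bool" where
  "smooth_ext_on U \<omega> \<longleftrightarrow> (\<forall>I. smooth_on U (\<lambda>x. ext_coeff (\<omega> x) I))"

definition partial :: "'n \<Rightarrow> ('n rvec \<Rightarrow> 'n::{finite,linorder} ext) \<Rightarrow> 'n rvec \<Rightarrow> 'n ext" where
  "partial j \<omega> x = Ext (\<lambda>I. frechet_derivative (\<lambda>y. ext_coeff (\<omega> y) I) (at x) (axis j 1))"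

lemma ext_coeff_partial [simp]:
  "ext_coeff (partial j \<omega> x) I = frechet_derivative (\<lambda>y. ext_coeff (\<omega> y) I) (at x) (axis j 1)"
  by (simp add: partial_def)

lemma ext_d_eq: "ext_d \<omega> x = (\<Sum>j\<in>UNIV. dx j * partial j \<omega> x)"
  by (simp add: ext_d_def partial_def)

lemma smooth_ext_onD: "smooth_ext_on U \<omega> \<Longrightarrow> x \<in> U \<Longrightarrow> (\<lambda>y. ext_coeff (\<omega> y) I) differentiable (at x)"
  unfolding smooth_ext_on_def by (blast intro: smooth_on_differentiable)

lemma smooth_ext_on_cong:
  "open U \<Longrightarrow> (\<And>y. y \<in> U \<Longrightarrow> \<omega> y = \<eta> y) \<Longrightarrow> smooth_ext_on U \<omega> \<longleftrightarrow> smooth_ext_on U \<eta>"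
  unfolding smooth_ext_on_def by (intro iff_allI smooth_on_cong) auto

lemma smooth_ext_on_subset: "smooth_ext_on U \<omega> \<Longrightarrow> V \<subseteq> U \<Longrightarrow> smooth_ext_on V \<omega>"
  unfolding smooth_ext_on_def using smooth_on_subset by blast

lemma smooth_ext_on_const: "smooth_ext_on U (\<lambda>x. a)"
  by (simp add: smooth_ext_on_def smooth_on_const)

lemma smooth_ext_on_add:
  "open U \<Longrightarrow> smooth_ext_on U \<omega> \<Longrightarrow> smooth_ext_on U \<eta> \<Longrightarrow> smooth_ext_on U (\<lambda>x. \<omega> x + \<eta> x)"
  by (simp add: smooth_ext_on_def smooth_on_add)

lemma smooth_ext_on_sum:
  "open U \<Longrightarrow> (\<And>i. i \<in> A \<Longrightarrow> smooth_ext_on U (f i)) \<Longrightarrow> smooth_ext_on U (\<lambda>x. \<Sum>i\<in>A. f i x)"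
  by (simp add: smooth_ext_on_def smooth_on_sum)

lemma smooth_ext_on_mult:
  "open U \<Longrightarrow> smooth_ext_on U \<omega> \<Longrightarrow> smooth_ext_on U \<eta> \<Longrightarrow> smooth_ext_on U (\<lambda>x. \<omega> x * \<eta> x)"
  unfolding smooth_ext_on_def ext_coeff_mult
  by (intro allI smooth_on_sum smooth_on_mult smooth_on_const) auto

lemma smooth_ext_on_prod_list:
  "open U \<Longrightarrow> (\<And>i. i \<in> set xs \<Longrightarrow> smooth_ext_on U (f i)) \<Longrightarrow>
    smooth_ext_on U (\<lambda>x. prod_list (map (\<lambda>i. f i x) xs))"
  by (induction xs) (auto intro: smooth_ext_on_const smooth_ext_on_mult)

lemma smooth_ext_on_ext_const:
  "open U \<Longrightarrow> smooth_on U f \<Longrightarrow> smooth_ext_on U (\<lambda>x. ext_const (f x))"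
  unfolding smooth_ext_on_def by (intro allI, case_tac "I = {}") (simp_all add: smooth_on_const)

lemma smooth_ext_on_partial: "smooth_ext_on U \<omega> \<Longrightarrow> smooth_ext_on U (partial j \<omega>)"
  by (simp add: smooth_ext_on_def smooth_on_frechet_derivative)

lemma smooth_ext_on_ext_d:
  "open U \<Longrightarrow> smooth_ext_on U \<omega> \<Longrightarrow> smooth_ext_on U (ext_d \<omega>)"
  unfolding ext_d_eq[abs_def]
  by (intro smooth_ext_on_sum smooth_ext_on_mult smooth_ext_on_const smooth_ext_on_partial)

subsection \<open>Partial derivatives\<close>

lemma partial_cong:
  assumes "open U" "x \<in> U" "\<And>y. y \<in> U \<Longrightarrow> \<omega> y = \<eta> y"
  shows "partial j \<omega> x = partial j \<eta> x"
  using assms frechet_derivative_eq_on_open[OF assms(1,2), of "\<lambda>y. ext_coeff (\<omega> y) I" "\<lambda>y. ext_coeff (\<eta> y) I" for I]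
  by (intro ext_eqI) simp

lemma partial_const: "partial j (\<lambda>y. a) x = 0"
  by (intro ext_eqI) simp

lemma partial_add:
  assumes "smooth_ext_on U \<omega>" "smooth_ext_on U \<eta>" "x \<in> U"
  shows "partial j (\<lambda>y. \<omega> y + \<eta> y) x = partial j \<omega> x + partial j \<eta> x"
  using frechet_derivative_eqI[OF has_derivative_add[OF has_derivative_frechet[OF smooth_ext_onD[OF assms(1,3)]]
     has_derivative_frechet[OF smooth_ext_onD[OF assms(2,3)]]]]
  by (intro ext_eqI) simp

lemma partial_sum:
  assumes "open U" "\<And>i. i \<in> A \<Longrightarrow> smooth_ext_on U (f i)" "x \<in> U"
  shows "partial j (\<lambda>y. \<Sum>i\<in>A. f i y) x = (\<Sum>i\<in>A. partial j (f i) x)"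
  using assms(2)
  by (induction A rule: infinite_finite_induct)
    (auto simp: partial_const partial_add[OF _ smooth_ext_on_sum[OF assms(1)] assms(3)])

lemma partial_mult:
  assumes U: "open U" "x \<in> U" and s: "smooth_ext_on U \<omega>" "smooth_ext_on U \<eta>"
  shows "partial j (\<lambda>y. \<omega> y * \<eta> y) x = partial j \<omega> x * \<eta> x + \<omega> x * partial j \<eta> x"
proof (rule ext_eqI)
  fix K
  let ?a = "\<lambda>I y. ext_coeff (\<omega> y) I" and ?b = "\<lambda>I y. ext_coeff (\<eta> y) I"
  have "((\<lambda>y. \<Sum>I\<in>Pow K. shuffle_sign I (K - I) * (?a I y * ?b (K - I) y)) has_derivative
     (\<lambda>v. \<Sum>I\<in>Pow K. shuffle_sign I (K - I) *
       (?a I x * frechet_derivative (?b (K - I)) (at x) v + frechet_derivative (?a I) (at x) v * ?b (K - I) x))) (at x)"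
    by (intro has_derivative_sum has_derivative_mult_right has_derivative_mult has_derivative_frechet
        smooth_ext_onD[OF s(1) U(2)] smooth_ext_onD[OF s(2) U(2)])
  from frechet_derivative_eqI[OF this]
  show "ext_coeff (partial j (\<lambda>y. \<omega> y * \<eta> y) x) K =
      ext_coeff (partial j \<omega> x * \<eta> x + \<omega> x * partial j \<eta> x) K"
    by (simp add: ext_coeff_mult mult.assoc distrib_left sum.distrib)
qed

lemma homog_partial:
  assumes "open U" "x \<in> U" "\<And>y. y \<in> U \<Longrightarrow> homog k (\<omega> y)"
  shows "homog k (partial j \<omega> x)"
  unfolding homog_def
proof (intro allI impI, rule ccontr)
  fix I assume I: "ext_coeff (partial j \<omega> x) I \<noteq> 0" "card I \<noteq> k"
  have "frechet_derivative (\<lambda>y. ext_coeff (\<omega> y) I) (at x) = frechet_derivative (\<lambda>y. 0) (at x)"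
    by (rule frechet_derivative_eq_on_open[OF assms(1,2)]) (use assms(3) I in \<open>auto simp: homog_def\<close>)
  then show False using I by simp
qed

lemma real_ext_partial:
  assumes "open U" "x \<in> U" "smooth_ext_on U \<omega>" "\<And>y. y \<in> U \<Longrightarrow> real_ext (\<omega> y)"
  shows "real_ext (partial j \<omega> x)"
  unfolding real_ext_def
proof
  fix I
  have "Im (frechet_derivative (\<lambda>y. ext_coeff (\<omega> y) I) (at x) (axis j 1)) =
      frechet_derivative (\<lambda>y. Im (ext_coeff (\<omega> y) I)) (at x) (axis j 1)"
    by (rule frechet_derivative_linear[OF bounded_linear_Im smooth_ext_onD[OF assms(3,2)], symmetric])
  also have "frechet_derivative (\<lambda>y. Im (ext_coeff (\<omega> y) I)) (at x) = frechet_derivative (\<lambda>y. 0) (at x)"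
    by (rule frechet_derivative_eq_on_open[OF assms(1,2)]) (use assms(4) in \<open>auto simp: real_ext_def complex_is_Real_iff\<close>)
  finally show "ext_coeff (partial j \<omega> x) I \<in> \<real>" by (simp add: complex_is_Real_iff)
qed

subsection \<open>The exterior derivative\<close>

lemma ext_d_cong:
  assumes "open U" "x \<in> U" "\<And>y. y \<in> U \<Longrightarrow> \<omega> y = \<eta> y"
  shows "ext_d \<omega> x = ext_d \<eta> x"
  unfolding ext_d_eq using partial_cong[OF assms] by simp

lemma ext_d_const: "ext_d (\<lambda>y. a) x = 0"
  by (simp add: ext_d_eq partial_const)

lemma ext_d_add:
  assumes "smooth_ext_on U \<omega>" "smooth_ext_on U \<eta>" "x \<in> U"
  shows "ext_d (\<lambda>y. \<omega> y + \<eta> y) x = ext_d \<omega> x + ext_d \<eta> x"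
  by (simp add: ext_d_eq partial_add[OF assms] distrib_left sum.distrib)

lemma ext_d_sum:
  assumes "open U" "\<And>i. i \<in> A \<Longrightarrow> smooth_ext_on U (f i)" "x \<in> U"
  shows "ext_d (\<lambda>y. \<Sum>i\<in>A. f i y) x = (\<Sum>i\<in>A. ext_d (f i) x)"
  by (simp add: ext_d_eq partial_sum[OF assms(1) _ assms(3)] assms(2) sum_distrib_left) (rule sum.swap)

lemma ext_d_mult_even:
  assumes U: "open U" "x \<in> U" and s: "smooth_ext_on U \<omega>" "smooth_ext_on U \<eta>" and e: "even_ext (\<omega> x)"
  shows "ext_d (\<lambda>y. \<omega> y * \<eta> y) x = ext_d \<omega> x * \<eta> x + \<omega> x * ext_d \<eta> x"
proof -
  have "dx j * (\<omega> x * partial j \<eta> x) = \<omega> x * (dx j * partial j \<eta> x)" for j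
    by (metis e even_ext_commute mult.assoc)
  then show ?thesis
    by (simp add: ext_d_eq partial_mult[OF U s] distrib_left sum.distrib sum_distrib_left sum_distrib_right mult.assoc)
qed

lemma ext_d_mult_one:
  assumes U: "open U" "x \<in> U" and s: "smooth_ext_on U \<omega>" "smooth_ext_on U \<eta>" and e: "homog 1 (\<omega> x)"
  shows "ext_d (\<lambda>y. \<omega> y * \<eta> y) x = ext_d \<omega> x * \<eta> x - \<omega> x * ext_d \<eta> x"
proof -
  have "dx j * (\<omega> x * partial j \<eta> x) = - (\<omega> x * (dx j * partial j \<eta> x))" for j
    using homog_one_anticommute[OF homog_simps(6)[of j] e] by (metis minus_mult_left mult.assoc)
  then show ?thesis
    by (simp add: ext_d_eq partial_mult[OF U s] distrib_left sum_subtractf sum_distrib_left sum_distrib_right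
        mult.assoc)
qed

lemma ext_d_const_mult:
  assumes U: "open U" "x \<in> U" and s: "smooth_ext_on U \<omega>"
  shows "ext_d (\<lambda>y. ext_const z * \<omega> y) x = ext_const z * ext_d \<omega> x"
  using ext_d_mult_even[OF U smooth_ext_on_const s even_ext_simps(3)[of z]] by (simp add: ext_d_const)

lemma homog_ext_d:
  assumes "open U" "x \<in> U" "\<And>y. y \<in> U \<Longrightarrow> homog k (\<omega> y)"
  shows "homog (Suc k) (ext_d \<omega> x)"
  unfolding ext_d_eq
  using homog_mult[OF homog_simps(6) homog_partial[OF assms]] by (intro homog_sum) simp

lemma real_ext_ext_d:
  assumes "open U" "x \<in> U" "smooth_ext_on U \<omega>" "\<And>y. y \<in> U \<Longrightarrow> real_ext (\<omega> y)"
  shows "real_ext (ext_d \<omega> x)"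
  unfolding ext_d_eq by (intro real_ext_sum real_ext_mult real_ext_simps real_ext_partial[OF assms])

lemma partial_commute:
  assumes "open U" "x \<in> U" "smooth_ext_on U \<omega>"
  shows "partial i (partial j \<omega>) x = partial j (partial i \<omega>) x"
  using assms second_derivative_symmetric[OF assms(1,2)]
  by (intro ext_eqI) (simp add: smooth_ext_on_def)

text \<open>Second derivatives are symmetric, while \<open>dx i * dx j\<close> is skew.\<close>

lemma ext_d_ext_d:
  assumes U: "open U" "x \<in> U" and s: "smooth_ext_on U \<omega>"
  shows "ext_d (ext_d \<omega>) x = 0"
proof -
  have p: "partial i (ext_d \<omega>) x = (\<Sum>j\<in>UNIV. dx j * partial i (partial j \<omega>) x)" for i
  proof -
    have "partial i (ext_d \<omega>) x = (\<Sum>j\<in>UNIV. partial i (\<lambda>y. dx j * partial j \<omega> y) x)"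
      unfolding ext_d_eq[abs_def]
      by (rule partial_sum[OF U(1) _ U(2)])
        (intro smooth_ext_on_mult U smooth_ext_on_const smooth_ext_on_partial s)
    also have "\<dots> = (\<Sum>j\<in>UNIV. dx j * partial i (partial j \<omega>) x)"
      by (simp add: partial_mult[OF U smooth_ext_on_const smooth_ext_on_partial[OF s]] partial_const)
    finally show ?thesis .
  qed
  have "ext_d (ext_d \<omega>) x = (\<Sum>i\<in>UNIV. \<Sum>j\<in>UNIV. dx i * dx j * partial i (partial j \<omega>) x)"
    by (simp add: ext_d_eq[of "ext_d \<omega>"] p sum_distrib_left mult.assoc)
  also have "\<dots> = (\<Sum>i\<in>UNIV. \<Sum>j\<in>UNIV. - (dx j * dx i * partial j (partial i \<omega>) x))"
  proof (intro sum.cong refl)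
    fix i j :: 'a
    show "dx i * dx j * partial i (partial j \<omega>) x = - (dx j * dx i * partial j (partial i \<omega>) x)"
      using homog_one_anticommute[OF homog_simps(6)[of i] homog_simps(6)[of j]] partial_commute[OF U s, of i j]
      by simp
  qed
  also have "\<dots> = - (\<Sum>i\<in>UNIV. \<Sum>j\<in>UNIV. dx i * dx j * partial i (partial j \<omega>) x)"
    by (simp add: sum_negf) (rule sum.swap)
  also have "(\<Sum>i\<in>UNIV. \<Sum>j\<in>UNIV. dx i * dx j * partial i (partial j \<omega>) x) = ext_d (ext_d \<omega>) x"
    by (simp add: ext_d_eq[of "ext_d \<omega>"] p sum_distrib_left mult.assoc)
  finally show ?thesis by (rule ext_eq_neg_imp_zero)
qed

subsection \<open>Substitution of one-forms\<close>

text \<open>The algebra homomorphism that replaces \<open>dx\<^sub>i\<close> by the one-form \<open>L i\<close>; a pullback is of this form.\<close>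

definition wedge_list :: "('n::{finite,linorder} \<Rightarrow> 'n ext) \<Rightarrow> 'n set \<Rightarrow> 'n ext" where
  "wedge_list L I = prod_list (map L (sorted_list_of_set I))"

definition substitute :: "('n::{finite,linorder} \<Rightarrow> 'n ext) \<Rightarrow> 'n ext \<Rightarrow> 'n ext" where
  "substitute L a = (\<Sum>I\<in>UNIV. ext_const (ext_coeff a I) * wedge_list L I)"

lemma wedge_list_empty [simp]: "wedge_list L {} = 1"
  by (simp add: wedge_list_def)

lemma wedge_list_insert_Min:
  assumes "\<And>k. k \<in> I \<Longrightarrow> i < k"
  shows "wedge_list L (insert i I) = L i * wedge_list L I"
proof -
  have "i \<notin> I" using assms by blast
  then have "sorted_list_of_set (insert i I) = insort i (sorted_list_of_set I)" by simp
  also have "\<dots> = i # sorted_list_of_set I"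
    using assms by (intro insort_is_Cons) (auto intro: less_imp_le)
  finally show ?thesis by (simp add: wedge_list_def)
qed

text \<open>Putting \<open>L i\<close> at its place in the increasing product costs one sign for each
  smaller index. The induction removes the smallest index of \<open>K\<close>.\<close>

lemma wedge_list_mult_left:
  fixes L :: "'n::{finite,linorder} \<Rightarrow> 'n ext"
  assumes L: "\<And>i. homog 1 (L i)"
  shows "L i * wedge_list L K = (if i \<in> K then 0 else shuffle_sign {i} K * wedge_list L (insert i K))"
proof (induction "card K" arbitrary: K)
  case 0
  then show ?case using wedge_list_insert_Min[of "{}" i L] by simp
next
  case (Suc n)
  define m where "m = Min K"
  define K' where "K' = K - {m}"
  have "K \<noteq> {}" using Suc.hyps(2) by auto
  then have mK: "m \<in> K" by (simp add: m_def)
  have K: "K = insert m K'" "m \<notin> K'" using mK by (auto simp: K'_def)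
  have less: "m < k" if "k \<in> K'" for k
    using that Min_le[of K k] by (auto simp: K'_def m_def order_le_less)
  have n: "n = card K'" using Suc.hyps(2) K by simp
  note IH = Suc.hyps(1)[OF n]
  have LL: "L a * L b = - (L b * L a)" for a b by (rule homog_one_anticommute[OF L L])
  have sq: "L a * L a = 0" for a
    using LL[of a a] by (rule ext_eq_neg_imp_zero)
  have wK: "wedge_list L K = L m * wedge_list L K'" unfolding K(1) by (rule wedge_list_insert_Min[OF less])
  consider "i = m" | "i < m" | "m < i" by (metis linorder_neqE)
  then show ?case
  proof cases
    case 1
    then show ?thesis using mK by (simp add: wK sq flip: mult.assoc)
  next
    case 2
    then have less': "i < k" if "k \<in> K" for k using that K less by force
    then have "{(a, b). a \<in> {i} \<and> b \<in> K \<and> b < a} = {}" by force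
    then have "(shuffle_sign {i} K :: 'n ext) = 1" by (simp only: shuffle_sign_def) simp
    then show ?thesis using less' wedge_list_insert_Min[of K i L] by force
  next
    case 3
    have s: "shuffle_sign {i} K = (- shuffle_sign {i} K' :: 'n ext)"
    proof -
      have "{(a, b). a \<in> {i} \<and> b \<in> K \<and> b < a} = insert (i, m) {(a, b). a \<in> {i} \<and> b \<in> K' \<and> b < a}"
        using 3 K(1) by auto
      then have "card {(a, b). a \<in> {i} \<and> b \<in> K \<and> b < a} = Suc (card {(a, b). a \<in> {i} \<and> b \<in> K' \<and> b < a})"
        using K(2) by (simp add: card_insert_if)
      then show ?thesis by (simp only: shuffle_sign_def power_Suc) simp
    qed
    have sc: "a * shuffle_sign {i} K' = shuffle_sign {i} K' * (a :: 'n ext)" for a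
      by (simp add: shuffle_sign_def uminus_power_if)
    have "L i * wedge_list L K = - (L m * (L i * wedge_list L K'))"
      unfolding wK by (simp only: mult.assoc[symmetric] LL[of i m] mult_minus_left)
    also have "\<dots> = (if i \<in> K then 0 else shuffle_sign {i} K * wedge_list L (insert i K))"
    proof (cases "i \<in> K'")
      case True
      then show ?thesis using IH K(1) by simp
    next
      case False
      have "insert i K = insert m (insert i K')" using K(1) by auto
      moreover have "wedge_list L (insert m (insert i K')) = L m * wedge_list L (insert i K')"
        using less 3 by (intro wedge_list_insert_Min) auto
      moreover have "i \<notin> K" using False 3 K(1) by auto
      moreover have "L m * (L i * wedge_list L K') = shuffle_sign {i} K' * (L m * wedge_list L (insert i K'))"
      proof -
        have IH': "L i * wedge_list L K' = shuffle_sign {i} K' * wedge_list L (insert i K')"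
          using IH False by simp
        show ?thesis unfolding IH' by (simp only: mult.assoc[symmetric] sc[of "L m"])
      qed
      ultimately show ?thesis by (simp add: s)
    qed
    finally show ?thesis .
  qed
qed

text \<open>The products obey the sign rule of the basis forms, and therefore substitution is
  multiplicative.\<close>

lemma wedge_list_mult:
  fixes L :: "'n::{finite,linorder} \<Rightarrow> 'n ext"
  assumes L: "\<And>i. homog 1 (L i)"
  shows "wedge_list L I * wedge_list L K =
    (if I \<inter> K = {} then shuffle_sign I K * wedge_list L (I \<union> K) else 0)"
proof (induction "card I" arbitrary: I)
  case 0
  then show ?case by simp
next
  case (Suc n)
  define m where "m = Min I"
  define I' where "I' = I - {m}"
  have "I \<noteq> {}" using Suc.hyps(2) by auto
  then have mI: "m \<in> I" by (simp add: m_def)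
  have I: "I = insert m I'" "m \<notin> I'" using mI by (auto simp: I'_def)
  have less: "m < k" if "k \<in> I'" for k
    using that Min_le[of I k] by (auto simp: I'_def m_def order_le_less)
  have n: "n = card I'" using Suc.hyps(2) I by simp
  note IH = Suc.hyps(1)[OF n]
  have wI: "wedge_list L I = L m * wedge_list L I'" unfolding I(1) by (rule wedge_list_insert_Min[OF less])
  have sc: "a * shuffle_sign J K = shuffle_sign J K * (a :: 'n ext)" for a J K
    by (simp add: shuffle_sign_def uminus_power_if)
  have "wedge_list L I * wedge_list L K = L m * (wedge_list L I' * wedge_list L K)"
    by (simp add: wI mult.assoc)
  also have "\<dots> = (if I' \<inter> K = {} then shuffle_sign I' K * (L m * wedge_list L (I' \<union> K)) else 0)"
    unfolding IH by (simp add: mult.assoc[symmetric] sc)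
  also have "\<dots> = (if I' \<inter> K = {} then shuffle_sign I' K *
     (if m \<in> I' \<union> K then 0 else shuffle_sign {m} (I' \<union> K) * wedge_list L (insert m (I' \<union> K))) else 0)"
    by (simp only: wedge_list_mult_left[of L, OF L])
  also have "\<dots> = (if I \<inter> K = {} then shuffle_sign I K * wedge_list L (I \<union> K) else 0)"
  proof (cases "I \<inter> K = {}")
    case True
    then have d: "I' \<inter> K = {}" "m \<notin> I' \<union> K" using I by auto
    have "{(a, b). a \<in> {m} \<and> b \<in> I' \<and> b < a} = {}" using less by force
    then have "(shuffle_sign {m} I' :: 'n ext) = 1" by (simp only: shuffle_sign_def) simp
    then have "shuffle_sign {m} (I' \<union> K) = (shuffle_sign {m} K :: 'n ext)"
      using shuffle_sign_Un_right[OF d(1), of "{m}", where 'a = "'n ext"] by simp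
    moreover have "shuffle_sign I K = (shuffle_sign {m} K * shuffle_sign I' K :: 'n ext)"
      using shuffle_sign_Un_left[of "{m}" I' K, where 'a = "'n ext"] I by simp
    moreover have "I \<union> K = insert m (I' \<union> K)" using I by auto
    moreover have "shuffle_sign I' K * (shuffle_sign {m} K * w) = shuffle_sign {m} K * shuffle_sign I' K * w"
      for w :: "'n ext" by (simp only: mult.assoc[symmetric] sc[of "shuffle_sign I' K" "{m}" K])
    ultimately show ?thesis using True d by simp
  next
    case False
    then show ?thesis using I by auto
  qed
  finally show ?case .
qed

lemma ext_const_shuffle_sign: "ext_const (shuffle_sign I K) = shuffle_sign I K"
  by (simp add: shuffle_sign_def ext_const_power ext_const_simps)

lemma substitute_mult:
  fixes L :: "'n::{finite,linorder} \<Rightarrow> 'n ext"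
  assumes L: "\<And>i. homog 1 (L i)"
  shows "substitute L (a * b) = substitute L a * substitute L b"
proof -
  let ?c = "\<lambda>I K. ext_const (shuffle_sign I K * ext_coeff a I * ext_coeff b K) * wedge_list L (I \<union> K)"
  have "substitute L a * substitute L b =
    (\<Sum>I\<in>UNIV. \<Sum>K\<in>UNIV. if I \<inter> K = {} then ?c I K else 0)"
    unfolding substitute_def sum_product
  proof (intro sum.cong refl)
    fix I K :: "'n set"
    show "ext_const (ext_coeff a I) * wedge_list L I * (ext_const (ext_coeff b K) * wedge_list L K) =
        (if I \<inter> K = {} then ?c I K else 0)"
      by (simp add: ext_const_mult_mult wedge_list_mult[of L, OF L])
        (simp add: ext_const_const_mult mult_ac flip: ext_const_shuffle_sign)
  qed
  also have "\<dots> = (\<Sum>(I, K)\<in>UNIV \<times> UNIV. if I \<inter> K = {} then ?c I K else 0)"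
    by (rule sum.cartesian_product)
  also have "\<dots> = (\<Sum>(I, K)\<in>{(I, K). I \<inter> K = {}}. ?c I K)"
    by (rule sum.mono_neutral_cong_right) (auto split: if_splits)
  also have "\<dots> = (\<Sum>(J, I)\<in>Sigma UNIV Pow. ?c I (J - I))"
  proof (rule sum.reindex_bij_witness[of _ "\<lambda>(J, I). (I, J - I)" "\<lambda>(I, K). (I \<union> K, I)"])
    have "I \<union> K - I = K" if "I \<inter> K = {}" for I K :: "'n set" using that by auto
    then show "(case (case p of (I, K) \<Rightarrow> (I \<union> K, I)) of (J, I) \<Rightarrow> ?c I (J - I)) = (case p of (I, K) \<Rightarrow> ?c I K)"
      if "p \<in> {(I, K). I \<inter> K = {}}" for p using that by auto
  qed auto
  also have "\<dots> = (\<Sum>J\<in>UNIV. \<Sum>I\<in>Pow J. ?c I (J - I))"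
    by (rule sum.Sigma[symmetric]) auto
  also have "\<dots> = substitute L (a * b)"
    unfolding substitute_def ext_coeff_mult ext_const_sum sum_distrib_right
    by (intro sum.cong refl) (auto simp: Un_absorb1)
  finally show ?thesis by simp
qed

lemma substitute_simps:
  "substitute L (a + b) = substitute L a + substitute L b"
  "substitute L (a - b) = substitute L a - substitute L b"
  "substitute L (ext_const z * a) = ext_const z * substitute L a"
  "substitute L 0 = 0"
  by (simp_all add: substitute_def ext_const_simps distrib_right sum.distrib left_diff_distrib sum_subtractf
      sum_distrib_left ext_const_mult mult.assoc)

lemma substitute_sum: "substitute L (sum f A) = (\<Sum>x\<in>A. substitute L (f x))"
  by (induction A rule: infinite_finite_induct) (auto simp: substitute_simps)

lemma substitute_ext_const: "substitute L (ext_const z) = ext_const z"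
proof -
  have "substitute L (ext_const z) = (\<Sum>I\<in>UNIV. if I = ({} :: 'a set) then ext_const z else 0)"
    unfolding substitute_def by (intro sum.cong) (auto simp: ext_const_simps)
  then show ?thesis by simp
qed

lemma substitute_one: "substitute L 1 = 1"
  using substitute_ext_const[of L 1] by (simp add: ext_const_simps)

lemma substitute_dx: "substitute L (dx i) = L i"
proof -
  have "substitute L (dx i) = (\<Sum>I\<in>UNIV. if I = {i} then L i else 0)"
    unfolding substitute_def
    by (intro sum.cong) (auto simp: ext_const_simps wedge_list_def)
  then show ?thesis by simp
qed

lemma pullback_eq_substitute:
  "pullback J = substitute (\<lambda>i. \<Sum>j\<in>UNIV. ext_const (of_real (J $ i $ j)) * dx j)"
  by (simp add: pullback_def substitute_def wedge_list_def fun_eq_iff)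

lemma homog_linear_form: "homog 1 (\<Sum>j\<in>UNIV. ext_const (c j) * dx j)"
  by (intro homog_sum homog_const_mult homog_simps)

lemma pullback_mult: "pullback J (a * b) = pullback J a * pullback J b"
  unfolding pullback_eq_substitute by (rule substitute_mult, rule homog_linear_form)

lemma pullback_simps:
  "pullback J (a + b) = pullback J a + pullback J b" "pullback J (a - b) = pullback J a - pullback J b"
  "pullback J (ext_const z * a) = ext_const z * pullback J a"
  "pullback J 0 = 0" "pullback J 1 = 1" "pullback J (ext_const z) = ext_const z"
  "pullback J (dx i) = (\<Sum>j\<in>UNIV. ext_const (of_real (J $ i $ j)) * dx j)"
  by (simp_all add: pullback_eq_substitute substitute_simps substitute_one substitute_ext_const substitute_dx)

lemma pullback_sum: "pullback J (sum f A) = (\<Sum>x\<in>A. pullback J (f x))"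
  unfolding pullback_eq_substitute by (rule substitute_sum)

subsection \<open>Pullbacks commute with the exterior derivative\<close>

lemma ext_d_prod_list_closed:
  assumes U: "open U" "x \<in> U" and s: "\<And>i. smooth_ext_on U (f i)" and h: "\<And>i y. y \<in> U \<Longrightarrow> homog 1 (f i y)"
    and c: "\<And>i. ext_d (f i) x = 0"
  shows "ext_d (\<lambda>y. prod_list (map (\<lambda>i. f i y) xs)) x = 0"
proof (induction xs)
  case (Cons i xs)
  have "smooth_ext_on U (\<lambda>y. prod_list (map (\<lambda>i. f i y) xs))"
    by (rule smooth_ext_on_prod_list[OF U(1) s])
  from ext_d_mult_one[OF U s this h[OF U(2)]] show ?case by (simp add: Cons.IH c)
qed (simp add: ext_d_const)

text \<open>The pullback of \<open>dx\<^sub>i\<close> is the differential of the \<open>i\<close>th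
  component of \<open>\<phi>\<close> and hence closed. So only the coefficients are differentiated, and for
  them the claim is the chain rule.\<close>

lemma ext_d_pullback:
  fixes \<phi> :: "'n::{finite,linorder} rvec \<Rightarrow> 'n rvec"
  assumes U: "open U" "x \<in> U" and V: "open V" "\<phi> ` U \<subseteq> V"
    and \<phi>: "smooth_on U \<phi>" and \<omega>: "smooth_ext_on V \<omega>"
  defines "J \<equiv> \<lambda>y. matrix (frechet_derivative \<phi> (at y))"
  shows "ext_d (\<lambda>y. pullback (J y) (\<omega> (\<phi> y))) x = pullback (J x) (ext_d \<omega> (\<phi> x))"
    "smooth_ext_on U (\<lambda>y. pullback (J y) (\<omega> (\<phi> y)))"
proof -
  define L where "L = (\<lambda>y i. \<Sum>j\<in>UNIV. ext_const (of_real (J y $ i $ j)) * dx j :: 'n ext)"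
  define \<phi>c where "\<phi>c = (\<lambda>i y. ext_const (of_real (\<phi> y $ i)) :: 'n ext)"
  have \<phi>i: "smooth_on U (\<lambda>y. complex_of_real (\<phi> y $ i))" for i
    by (intro smooth_on_linear[OF bounded_linear_of_real] smooth_on_linear[OF bounded_linear_vec_nth] U \<phi>)
  have \<phi>cs: "smooth_ext_on U (\<phi>c i)" for i
    unfolding \<phi>c_def by (rule smooth_ext_on_ext_const[OF U(1) \<phi>i])
  have Jij: "J y $ i $ j = frechet_derivative \<phi> (at y) (axis j 1) $ i" for y i j
    by (simp add: J_def matrix_def)
  have L_d: "L y i = ext_d (\<phi>c i) y" if "y \<in> U" for y i
  proof -
    have "partial j (\<phi>c i) y = ext_const (of_real (J y $ i $ j))" for j
    proof (rule ext_eqI)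
      fix I
      have "frechet_derivative (\<lambda>z. complex_of_real (\<phi> z $ i)) (at y) (axis j 1) =
          of_real (frechet_derivative \<phi> (at y) (axis j 1) $ i)"
        by (rule frechet_derivative_linear[OF _ smooth_on_differentiable[OF \<phi> that]])
          (intro bounded_linear_compose[OF bounded_linear_of_real] bounded_linear_vec_nth)
      then show "ext_coeff (partial j (\<phi>c i) y) I = ext_coeff (ext_const (of_real (J y $ i $ j))) I"
        by (cases "I = {}") (simp_all add: \<phi>c_def Jij)
    qed
    then show ?thesis by (simp add: L_def ext_d_eq ext_const_commute)
  qed
  have Ls: "smooth_ext_on U (\<lambda>y. L y i)" for i
    using smooth_ext_on_cong[OF U(1), of "\<lambda>y. L y i" "ext_d (\<phi>c i)"] L_d smooth_ext_on_ext_d[OF U(1) \<phi>cs] by simp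
  have Lh: "homog 1 (L y i)" for y i unfolding L_def by (rule homog_linear_form)
  have Lc: "ext_d (\<lambda>y. L y i) x = 0" for i
    using ext_d_cong[OF U, of "\<lambda>y. L y i" "ext_d (\<phi>c i)"] L_d ext_d_ext_d[OF U \<phi>cs] by simp
  have pb: "pullback (J y) a = substitute (L y) a" for y a
    by (simp add: pullback_eq_substitute L_def)
  have ws: "smooth_ext_on U (\<lambda>y. wedge_list (L y) I)" for I
    unfolding wedge_list_def by (rule smooth_ext_on_prod_list[OF U(1) Ls])
  have wc: "ext_d (\<lambda>y. wedge_list (L y) I) x = 0" for I
    unfolding wedge_list_def by (rule ext_d_prod_list_closed[of U x "\<lambda>i y. L y i", OF U Ls Lh Lc])
  let ?f = "\<lambda>I y. ext_const (ext_coeff (\<omega> (\<phi> y)) I) :: 'n ext"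
  have fs: "smooth_ext_on U (?f I)" for I
    using \<omega> by (intro smooth_ext_on_ext_const U smooth_on_compose[OF U(1) V(1,2) \<phi>]) (simp add: smooth_ext_on_def)
  have fd: "ext_d (?f I) x = (\<Sum>i\<in>UNIV. ext_const (ext_coeff (partial i \<omega> (\<phi> x)) I) * L x i)" for I
  proof -
    let ?g = "\<lambda>z. ext_coeff (\<omega> z) I" and ?D = "frechet_derivative \<phi> (at x)"
    have gd: "?g differentiable (at (\<phi> x))" using smooth_ext_onD[OF \<omega>] V U by blast
    have lin: "linear (frechet_derivative ?g (at (\<phi> x)))" using linear_frechet_derivative[OF gd] .
    have exp: "frechet_derivative ?g (at (\<phi> x)) w =
        (\<Sum>i\<in>UNIV. of_real (w $ i) * frechet_derivative ?g (at (\<phi> x)) (axis i 1))" for w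
    proof -
      have "w = (\<Sum>i\<in>UNIV. (w $ i) *\<^sub>R axis i 1)" by (simp add: basis_expansion flip: scalar_mult_eq_scaleR)
      then have "frechet_derivative ?g (at (\<phi> x)) w =
        frechet_derivative ?g (at (\<phi> x)) (\<Sum>i\<in>UNIV. (w $ i) *\<^sub>R axis i 1)" by simp
      then show ?thesis
        by (simp add: linear_sum[OF lin] linear_scale[OF lin]) (simp add: scaleR_conv_of_real)
    qed
    have "((\<lambda>y. ?g (\<phi> y)) has_derivative (\<lambda>v. frechet_derivative ?g (at (\<phi> x)) (?D v))) (at x)"
      by (rule has_derivative_compose[OF has_derivative_frechet[OF smooth_on_differentiable[OF \<phi> U(2)]]
            has_derivative_frechet[OF gd]])
    note comp = frechet_derivative_eqI[OF this]
    have "partial j (?f I) x = ext_const (\<Sum>i\<in>UNIV. of_real (J x $ i $ j) * ext_coeff (partial i \<omega> (\<phi> x)) I)" for j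
    proof (rule ext_eqI)
      fix K
      show "ext_coeff (partial j (?f I) x) K =
        ext_coeff (ext_const (\<Sum>i\<in>UNIV. of_real (J x $ i $ j) * ext_coeff (partial i \<omega> (\<phi> x)) I)) K"
        using exp[of "?D (axis j 1)"] by (cases "K = {}") (simp_all add: comp Jij)
    qed
    then have "ext_d (?f I) x = (\<Sum>j\<in>UNIV. \<Sum>i\<in>UNIV.
        ext_const (ext_coeff (partial i \<omega> (\<phi> x)) I) * (ext_const (of_real (J x $ i $ j)) * dx j))"
      by (simp add: ext_d_eq ext_const_sum sum_distrib_left ext_const_const_mult ext_const_commute[of "dx _"] mult.commute
          del: ext_coeff_partial)
    also have "\<dots> = (\<Sum>i\<in>UNIV. ext_const (ext_coeff (partial i \<omega> (\<phi> x)) I) * L x i)"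
      by (subst sum.swap) (simp add: L_def sum_distrib_left)
    finally show ?thesis .
  qed
  have eq: "pullback (J y) (\<omega> (\<phi> y)) = (\<Sum>I\<in>UNIV. ?f I y * wedge_list (L y) I)" for y
    by (simp add: pb substitute_def)
  show "smooth_ext_on U (\<lambda>y. pullback (J y) (\<omega> (\<phi> y)))"
    unfolding eq by (intro smooth_ext_on_sum smooth_ext_on_mult U fs ws)
  have "ext_d (\<lambda>y. pullback (J y) (\<omega> (\<phi> y))) x =
      (\<Sum>I\<in>UNIV. ext_d (\<lambda>y. ?f I y * wedge_list (L y) I) x)"
    unfolding eq by (intro ext_d_sum[OF U(1) _ U(2)] smooth_ext_on_mult U fs ws)
  also have "\<dots> = (\<Sum>I\<in>UNIV. ext_d (?f I) x * wedge_list (L x) I)"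
    by (simp add: ext_d_mult_even[OF U fs ws even_ext_simps(3)] wc)
  also have "\<dots> = (\<Sum>I\<in>UNIV. \<Sum>i\<in>UNIV. L x i * (ext_const (ext_coeff (partial i \<omega> (\<phi> x)) I) * wedge_list (L x) I))"
    by (simp add: fd sum_distrib_right ext_const_left_commute mult.assoc del: ext_coeff_partial)
  also have "\<dots> = (\<Sum>i\<in>UNIV. L x i * substitute (L x) (partial i \<omega> (\<phi> x)))"
    by (subst sum.swap) (simp add: substitute_def sum_distrib_left del: ext_coeff_partial)
  also have "\<dots> = pullback (J x) (ext_d \<omega> (\<phi> x))"
    by (simp add: pb ext_d_eq substitute_sum substitute_mult[of "L x", OF Lh] substitute_dx)
  finally show "ext_d (\<lambda>y. pullback (J y) (\<omega> (\<phi> y))) x = pullback (J x) (ext_d \<omega> (\<phi> x))" .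
qed

section \<open>Connections and their Chern characters\<close>

definition curv ::
  "nat set \<Rightarrow> ('n rvec \<Rightarrow> nat \<Rightarrow> nat \<Rightarrow> 'n ext) \<Rightarrow> 'n::{finite,linorder} rvec \<Rightarrow> nat \<Rightarrow> nat \<Rightarrow> 'n ext" where
  "curv I \<theta> x i j = ext_d (\<lambda>y. \<theta> y i j) x + (\<Sum>k\<in>I. \<theta> x i k * \<theta> x k j)"

lemma curvature_eq_curv: "curvature E c x = curv (fst (E c x)) (snd (E c x)) x"
  by (simp add: fun_eq_iff curvature_def curv_def split: prod.split)

definition connection_on ::
  "'n rvec set \<Rightarrow> nat set \<Rightarrow> ('n rvec \<Rightarrow> nat \<Rightarrow> nat \<Rightarrow> 'n::{finite,linorder} ext) \<Rightarrow> bool" where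
  "connection_on U I \<theta> \<longleftrightarrow> open U \<and> finite I \<and>
     (\<forall>i\<in>I. \<forall>j\<in>I. smooth_ext_on U (\<lambda>y. \<theta> y i j) \<and> (\<forall>y\<in>U. homog 1 (\<theta> y i j)))"

lemma connection_onD:
  assumes "connection_on U I \<theta>"
  shows "open U" "finite I" "\<And>i j. i \<in> I \<Longrightarrow> j \<in> I \<Longrightarrow> smooth_ext_on U (\<lambda>y. \<theta> y i j)"
    "\<And>i j y. i \<in> I \<Longrightarrow> j \<in> I \<Longrightarrow> y \<in> U \<Longrightarrow> homog 1 (\<theta> y i j)"
  using assms by (auto simp: connection_on_def)

lemma homog_curv:
  assumes "connection_on U I \<theta>" "x \<in> U" "i \<in> I" "j \<in> I"
  shows "homog 2 (curv I \<theta> x i j)"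
proof -
  note c = connection_onD[OF assms(1)]
  have "homog (Suc 1) (ext_d (\<lambda>y. \<theta> y i j) x)"
    using c(4)[OF assms(3,4)] by (intro homog_ext_d[OF c(1) assms(2)]) auto
  moreover have "homog (1 + 1) (\<theta> x i k * \<theta> x k j)" if "k \<in> I" for k
    by (intro homog_mult c(4) assms that)
  ultimately show ?thesis unfolding curv_def numeral_2_eq_2 by (intro homog_simps(3) homog_sum) auto
qed

lemma smooth_ext_on_curv:
  assumes "connection_on U I \<theta>" "i \<in> I" "j \<in> I"
  shows "smooth_ext_on U (\<lambda>x. curv I \<theta> x i j)"
proof -
  note c = connection_onD[OF assms(1)]
  show ?thesis unfolding curv_def
    by (intro smooth_ext_on_add smooth_ext_on_sum smooth_ext_on_mult smooth_ext_on_ext_d c(1,3) assms)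
qed

text \<open>For \<open>t = 1\<close> this is the Chern character, for \<open>t = 2\<close> that of the
  second Adams operation, which doubles the eigenvalues of the curvature.\<close>

definition exp_trace :: "complex \<Rightarrow> nat set \<Rightarrow> (nat \<Rightarrow> nat \<Rightarrow> 'n::{finite,linorder} ext) \<Rightarrow> 'n ext" where
  "exp_trace t I R = mtrace I (fps_mapp I (fps_exp t) (\<lambda>i j. ext_const (\<i> / (2 * of_real pi)) * R i j))"

lemma ch_form_eq: "ch_form E c x = exp_trace 1 (fst (E c x)) (curv (fst (E c x)) (snd (E c x)) x)"
  by (simp add: ch_form_def exp_trace_def index_set_def scaled_curvature_def[abs_def] curvature_eq_curv)

lemma exp_trace_cong:
  assumes "\<And>i j. i \<in> I \<Longrightarrow> j \<in> I \<Longrightarrow> R i j = R' i j"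
  shows "exp_trace t I R = exp_trace t I R'"
  unfolding exp_trace_def mtrace_def
  by (intro sum.cong refl fps_mapp_cong) (simp_all add: assms)

lemma mpower_reindex:
  assumes "inj_on f I" "\<And>i j. i \<in> I \<Longrightarrow> j \<in> I \<Longrightarrow> M' (f i) (f j) = M i j" "i \<in> I" "j \<in> I"
  shows "mpower (f ` I) M' n (f i) (f j) = mpower I M n i j"
  using assms(3)
proof (induction n arbitrary: i)
  case 0
  then show ?case using assms(1,4) by (auto simp: inj_on_eq_iff)
next
  case (Suc n)
  then show ?case using assms(1,2) by (simp add: sum.reindex)
qed

lemma exp_trace_reindex:
  assumes "inj_on f I" "\<And>i j. i \<in> I \<Longrightarrow> j \<in> I \<Longrightarrow> R' (f i) (f j) = R i j"
  shows "exp_trace t (f ` I) R' = exp_trace t I R"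
proof -
  let ?c = "\<lambda>a. ext_const (\<i> / (2 * of_real pi)) * a"
  have "mpower (f ` I) (\<lambda>i j. ?c (R' i j)) n (f i) (f j) = mpower I (\<lambda>i j. ?c (R i j)) n i j"
    if "i \<in> I" "j \<in> I" for n i j
    by (rule mpower_reindex[OF assms(1) _ that]) (simp add: assms(2))
  then show ?thesis
    using assms(1) by (simp add: exp_trace_def mtrace_def fps_mapp_def sum.reindex)
qed

lemma exp_trace_zero:
  assumes "finite I" "\<And>i j. i \<in> I \<Longrightarrow> j \<in> I \<Longrightarrow> R i j = 0"
  shows "exp_trace t I R = of_nat (card I)"
proof -
  have p: "mpower I (\<lambda>i j. 0) n i j = (if n = 0 \<and> i = j then 1 else (0 :: 'a ext))" for n i j
    by (cases n) auto
  have "exp_trace t I R = exp_trace t I (\<lambda>i j. 0)"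
    by (rule exp_trace_cong) (simp add: assms(2))
  also have "\<dots> = (\<Sum>i\<in>I. \<Sum>k\<le>CARD('a). if k = 0 then 1 else 0)"
    by (simp add: exp_trace_def mtrace_def fps_mapp_def p if_distrib[of "(*) _"] ext_const_simps cong: if_cong)
  finally show ?thesis by simp
qed

lemma even_scaled:
  assumes "homog 2 a" shows "homog 2 (ext_const z * a)" "even_ext (ext_const z * a)"
  using homog_const_mult[OF assms, of z] homog_imp_even[of 2] by auto

subsection \<open>Tensor products\<close>

lemma sum_prod_encode: "(\<Sum>c\<in>prod_encode ` (I \<times> K). f c) = (\<Sum>i\<in>I. \<Sum>k\<in>K. f (prod_encode (i, k)))"
  by (simp add: sum.reindex[OF inj_prod_encode] sum.cartesian_product case_prod_unfold)

text \<open>The matrix of \<open>M \<otimes> 1 + 1 \<otimes> N\<close>, with pairs of indices encoded as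
  numbers.\<close>

definition kronecker_sum ::
  "(nat \<Rightarrow> nat \<Rightarrow> 'a::ring_1) \<Rightarrow> (nat \<Rightarrow> nat \<Rightarrow> 'a) \<Rightarrow> nat \<Rightarrow> nat \<Rightarrow> 'a" where
  "kronecker_sum M N a b = (let (i, k) = prod_decode a; (j, l) = prod_decode b
     in (if k = l then M i j else 0) + (if i = j then N k l else 0))"

lemma kronecker_sum_encode [simp]:
  "kronecker_sum M N (prod_encode (i, k)) (prod_encode (j, l)) =
    (if k = l then M i j else 0) + (if i = j then N k l else 0)"
  by (simp add: kronecker_sum_def)

lemma tensor_bundle_eq:
  "tensor_bundle E F c x = (prod_encode ` (fst (E c x) \<times> fst (F c x)),
     \<lambda>y. kronecker_sum (snd (E c x) y) (snd (F c x) y))"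
  by (simp add: tensor_bundle_def kronecker_sum_def fun_eq_iff)

lemma kronecker_sum_mult_left:
  fixes X :: "nat \<Rightarrow> 'a::ring_1"
  assumes "finite I" "finite K" "i \<in> I" "k \<in> K"
  shows "(\<Sum>c\<in>prod_encode ` (I \<times> K). kronecker_sum M N (prod_encode (i, k)) c * X c) =
    (\<Sum>i'\<in>I. M i i' * X (prod_encode (i', k))) + (\<Sum>k'\<in>K. N k k' * X (prod_encode (i, k')))"
proof -
  have "(\<Sum>c\<in>prod_encode ` (I \<times> K). kronecker_sum M N (prod_encode (i, k)) c * X c) =
      (\<Sum>i'\<in>I. \<Sum>k'\<in>K. (if k = k' then M i i' * X (prod_encode (i', k)) else 0) +
        (if i = i' then N k k' * X (prod_encode (i, k')) else 0))"
    unfolding sum_prod_encode by (intro sum.cong refl) (auto simp: distrib_right)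
  also have "\<dots> = (\<Sum>i'\<in>I. M i i' * X (prod_encode (i', k))) +
      (\<Sum>i'\<in>I. \<Sum>k'\<in>K. if i = i' then N k k' * X (prod_encode (i, k')) else 0)"
    using assms by (simp add: sum.distrib)
  also have "(\<Sum>i'\<in>I. \<Sum>k'\<in>K. if i = i' then N k k' * X (prod_encode (i, k')) else 0) =
      (\<Sum>k'\<in>K. N k k' * X (prod_encode (i, k')))"
    using assms by (subst sum.swap) simp
  finally show ?thesis .
qed

lemma connection_on_kronecker_sum:
  assumes "connection_on U I \<theta>" "connection_on U K \<eta>"
  shows "connection_on U (prod_encode ` (I \<times> K)) (\<lambda>y. kronecker_sum (\<theta> y) (\<eta> y))"
proof -
  note c = connection_onD[OF assms(1)] and d = connection_onD[OF assms(2)]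
  have "smooth_ext_on U (\<lambda>y. (if k = l then \<theta> y i j else 0) + (if i = j then \<eta> y k l else 0))"
    if "i \<in> I" "j \<in> I" "k \<in> K" "l \<in> K" for i j k l
    using that by (cases "k = l"; cases "i = j") (auto intro!: smooth_ext_on_add smooth_ext_on_const c d)
  moreover have "homog 1 ((if k = l then \<theta> y i j else 0) + (if i = j then \<eta> y k l else 0))"
    if "i \<in> I" "j \<in> I" "k \<in> K" "l \<in> K" "y \<in> U" for i j k l y
    using that by (auto intro!: homog_simps c d simp del: One_nat_def)
  ultimately show ?thesis unfolding connection_on_def using c(1,2) d(2) by auto
qed

text \<open>In the square of the connection matrix the mixed terms cancel, since one-forms
  anticommute.\<close>

lemma curv_kronecker_sum:
  assumes "connection_on U I \<theta>" "connection_on U K \<eta>" "x \<in> U" "i \<in> I" "j \<in> I" "k \<in> K" "l \<in> K"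
  shows "curv (prod_encode ` (I \<times> K)) (\<lambda>y. kronecker_sum (\<theta> y) (\<eta> y)) x (prod_encode (i, k)) (prod_encode (j, l)) =
    kronecker_sum (curv I \<theta> x) (curv K \<eta> x) (prod_encode (i, k)) (prod_encode (j, l))"
proof -
  note c = connection_onD[OF assms(1)] and d = connection_onD[OF assms(2)]
  have "ext_d (\<lambda>y. (if k = l then \<theta> y i j else 0) + (if i = j then \<eta> y k l else 0)) x =
      (if k = l then ext_d (\<lambda>y. \<theta> y i j) x else 0) + (if i = j then ext_d (\<lambda>y. \<eta> y k l) x else 0)"
    using ext_d_add[OF c(3)[OF assms(4,5)] d(3)[OF assms(6,7)] assms(3)]
    by (cases "k = l"; cases "i = j") (simp_all add: ext_d_const)
  moreover have "(\<Sum>b\<in>prod_encode ` (I \<times> K). kronecker_sum (\<theta> x) (\<eta> x) (prod_encode (i, k)) b *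
       kronecker_sum (\<theta> x) (\<eta> x) b (prod_encode (j, l))) =
     (if k = l then \<Sum>m\<in>I. \<theta> x i m * \<theta> x m j else 0) + (if i = j then \<Sum>m\<in>K. \<eta> x k m * \<eta> x m l else 0)"
  proof -
    have 1: "(\<Sum>m\<in>I. \<theta> x i m * ((if k = l then \<theta> x m j else 0) + (if m = j then \<eta> x k l else 0))) =
        (if k = l then \<Sum>m\<in>I. \<theta> x i m * \<theta> x m j else 0) + \<theta> x i j * \<eta> x k l"
      using assms(5) c(2) by (simp add: distrib_left sum.distrib if_distrib[of "(*) _"] cong: if_cong)
    have 2: "(\<Sum>m\<in>K. \<eta> x k m * ((if m = l then \<theta> x i j else 0) + (if i = j then \<eta> x m l else 0))) =
        \<eta> x k l * \<theta> x i j + (if i = j then \<Sum>m\<in>K. \<eta> x k m * \<eta> x m l else 0)"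
      using assms(7) d(2) by (simp add: distrib_left sum.distrib if_distrib[of "(*) _"] cong: if_cong)
    have "\<theta> x i j * \<eta> x k l = - (\<eta> x k l * \<theta> x i j)"
      by (rule homog_one_anticommute) (use assms c(4) d(4) in auto)
    then show ?thesis
      unfolding kronecker_sum_mult_left[OF c(2) d(2) assms(4,6)] kronecker_sum_encode 1 2 by simp
  qed
  ultimately show ?thesis by (simp add: curv_def)
qed

text \<open>The binomial theorem: \<open>M \<otimes> 1\<close> and \<open>1 \<otimes> N\<close> commute
  because the entries of \<open>M\<close> are even.\<close>

lemma mpower_kronecker_sum:
  fixes M N :: "nat \<Rightarrow> nat \<Rightarrow> 'n::{finite,linorder} ext"
  assumes I: "finite I" "finite K"
    and M: "\<And>i j. i \<in> I \<Longrightarrow> j \<in> I \<Longrightarrow> even_ext (M i j)"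
    and ij: "i \<in> I" "j \<in> I" "k \<in> K" "l \<in> K"
  shows "mpower (prod_encode ` (I \<times> K)) (kronecker_sum M N) n (prod_encode (i, k)) (prod_encode (j, l)) =
    (\<Sum>m\<le>n. of_nat (n choose m) * (mpower I M m i j * mpower K N (n - m) k l))"
  using ij(1,3)
proof (induction n arbitrary: i k)
  case 0
  then show ?case by auto
next
  case (Suc n)
  let ?p = "mpower I M" and ?q = "mpower K N"
  have nc: "a * (of_nat m * b) = of_nat m * (a * b)" for a b :: "'n ext" and m
    by (metis ext_const_left_commute ext_const_of_nat)
  have "mpower (prod_encode ` (I \<times> K)) (kronecker_sum M N) (Suc n) (prod_encode (i, k)) (prod_encode (j, l)) =
      (\<Sum>i'\<in>I. M i i' * (\<Sum>m\<le>n. of_nat (n choose m) * (?p m i' j * ?q (n - m) k l))) +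
      (\<Sum>k'\<in>K. N k k' * (\<Sum>m\<le>n. of_nat (n choose m) * (?p m i j * ?q (n - m) k' l)))"
    unfolding mpower.simps kronecker_sum_mult_left[OF I Suc.prems]
    by (intro arg_cong2[where f = "(+)"] sum.cong refl arg_cong2[where f = "(*)"] Suc.IH Suc.prems)
  also have "(\<Sum>i'\<in>I. M i i' * (\<Sum>m\<le>n. of_nat (n choose m) * (?p m i' j * ?q (n - m) k l))) =
      (\<Sum>m\<le>n. of_nat (n choose m) * (?p (Suc m) i j * ?q (n - m) k l))"
    unfolding sum_distrib_left nc by (subst sum.swap) (simp add: sum_distrib_left sum_distrib_right mult.assoc)
  also have "(\<Sum>k'\<in>K. N k k' * (\<Sum>m\<le>n. of_nat (n choose m) * (?p m i j * ?q (n - m) k' l))) =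
      (\<Sum>m\<le>n. of_nat (n choose m) * (?p m i j * ?q (Suc n - m) k l))"
  proof -
    have "N k k' * (?p m i j * b) = ?p m i j * (N k k' * b)" for m k' b
      using even_ext_commute[OF even_mpower[of I M i j m, OF M Suc.prems(1) ij(2)]] by (metis mult.assoc)
    then show ?thesis
      unfolding sum_distrib_left nc
      by (subst sum.swap) (simp add: sum_distrib_left Suc_diff_le)
  qed
  also have "(\<Sum>m\<le>n. of_nat (n choose m) * (?p (Suc m) i j * ?q (n - m) k l)) +
      (\<Sum>m\<le>n. of_nat (n choose m) * (?p m i j * ?q (Suc n - m) k l)) =
      (\<Sum>m\<le>Suc n. of_nat (Suc n choose m) * (?p m i j * ?q (Suc n - m) k l))" (is "?A + ?B = ?C")
  proof -
    let ?f = "\<lambda>m. ?p m i j * ?q (Suc n - m) k l"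
    have "?C = ?f 0 + (\<Sum>m\<le>n. of_nat (Suc n choose Suc m) * ?f (Suc m))"
      by (subst sum.atMost_Suc_shift) simp
    also have "\<dots> = ?A + (?f 0 + (\<Sum>m\<le>n. of_nat (n choose Suc m) * ?f (Suc m)))"
      by (simp add: distrib_right sum.distrib add_ac del: mpower.simps)
    also have "?f 0 + (\<Sum>m\<le>n. of_nat (n choose Suc m) * ?f (Suc m)) = (\<Sum>m\<le>Suc n. of_nat (n choose m) * ?f m)"
      by (subst sum.atMost_Suc_shift) simp
    also have "\<dots> = ?B" by (simp add: binomial_eq_0)
    finally show ?thesis by simp
  qed
  finally show ?case .
qed

text \<open>The exponential of a sum of commuting matrices; products beyond the truncation vanish for degree
  reasons.\<close>

lemma fps_exp_kronecker_sum:
  fixes M N :: "nat \<Rightarrow> nat \<Rightarrow> 'n::{finite,linorder} ext"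
  assumes I: "finite I" "finite K"
    and M: "\<And>i j. i \<in> I \<Longrightarrow> j \<in> I \<Longrightarrow> homog 2 (M i j)" and N: "\<And>i j. i \<in> K \<Longrightarrow> j \<in> K \<Longrightarrow> homog 2 (N i j)"
    and ij: "i \<in> I" "j \<in> I" "k \<in> K" "l \<in> K"
  shows "fps_mapp (prod_encode ` (I \<times> K)) (fps_exp 1) (kronecker_sum M N) (prod_encode (i, k)) (prod_encode (j, l)) =
    fps_mapp I (fps_exp 1) M i j * fps_mapp K (fps_exp 1) N k l"
proof -
  let ?p = "\<lambda>m. mpower I M m i j" and ?q = "\<lambda>m. mpower K N m k l" and ?N = "CARD('n)"
  have M': "even_ext (M i j)" if "i \<in> I" "j \<in> I" for i j using homog_imp_even[OF M[OF that]] by simp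
  have z: "?p m * ?q m' = 0" if "m + m' > ?N" for m m'
    using homog_gt_card[OF homog_mult[OF homog_mpower[of I M i j m, OF M ij(1,2)]
      homog_mpower[of K N k l m', OF N ij(3,4)]]] that by simp
  have s: "mpower (prod_encode ` (I \<times> K)) (kronecker_sum M N) n (prod_encode (i, k)) (prod_encode (j, l)) =
      (\<Sum>m\<le>n. of_nat (n choose m) * (?p m * ?q (n - m)))" for n
    by (rule mpower_kronecker_sum) (use I M' ij in auto)
  have "fps_mapp (prod_encode ` (I \<times> K)) (fps_exp 1) (kronecker_sum M N) (prod_encode (i, k)) (prod_encode (j, l)) =
      (\<Sum>n\<le>?N. \<Sum>m\<le>n. ext_const (1 / fact m * (1 / fact (n - m))) * (?p m * ?q (n - m)))"
    unfolding fps_mapp_def s sum_distrib_left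
  proof (intro sum.cong refl)
    fix n m :: nat assume "m \<in> {..n}"
    then have "(1 / fact n) * of_nat (n choose m) = 1 / fact m * (1 / (fact (n - m) :: complex))"
      by (simp add: binomial_fact)
    then show "ext_const (fps_nth (fps_exp 1) n) * (of_nat (n choose m) * (?p m * ?q (n - m))) =
        ext_const (1 / fact m * (1 / fact (n - m))) * (?p m * ?q (n - m))"
      by (simp add: ext_const_const_mult flip: ext_const_of_nat)
  qed
  also have "\<dots> = (\<Sum>m\<le>?N. \<Sum>m'\<le>?N. ext_const (1 / fact m * (1 / fact m')) * (?p m * ?q m'))"
    by (rule square_sum_truncated[symmetric]) (simp add: z)
  also have "\<dots> = fps_mapp I (fps_exp 1) M i j * fps_mapp K (fps_exp 1) N k l"
    by (simp add: fps_mapp_def sum_product ext_const_mult_mult)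
  finally show ?thesis .
qed

lemma kronecker_sum_scale:
  "ext_const z * kronecker_sum M N a b = kronecker_sum (\<lambda>i j. ext_const z * M i j) (\<lambda>i j. ext_const z * N i j) a b"
  by (simp add: kronecker_sum_def case_prod_unfold Let_def distrib_left)

lemma exp_trace_kronecker_sum:
  assumes "finite I" "finite K"
    "\<And>i j. i \<in> I \<Longrightarrow> j \<in> I \<Longrightarrow> homog 2 (M i j)" "\<And>i j. i \<in> K \<Longrightarrow> j \<in> K \<Longrightarrow> homog 2 (N i j)"
  shows "exp_trace 1 (prod_encode ` (I \<times> K)) (kronecker_sum M N) = exp_trace 1 I M * exp_trace 1 K N"
  unfolding exp_trace_def kronecker_sum_scale mtrace_def sum_prod_encode sum_product
proof (intro sum.cong refl fps_exp_kronecker_sum assms(1,2))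
qed (auto intro: homog_const_mult assms)

lemma exp_trace_curv_kronecker_sum:
  assumes "connection_on U I \<theta>" "connection_on U K \<eta>" "x \<in> U"
  shows "exp_trace 1 (prod_encode ` (I \<times> K)) (curv (prod_encode ` (I \<times> K)) (\<lambda>y. kronecker_sum (\<theta> y) (\<eta> y)) x) =
    exp_trace 1 I (curv I \<theta> x) * exp_trace 1 K (curv K \<eta> x)"
proof -
  have "exp_trace 1 (prod_encode ` (I \<times> K)) (curv (prod_encode ` (I \<times> K)) (\<lambda>y. kronecker_sum (\<theta> y) (\<eta> y)) x) =
    exp_trace 1 (prod_encode ` (I \<times> K)) (kronecker_sum (curv I \<theta> x) (curv K \<eta> x))"
    by (rule exp_trace_cong) (auto simp: curv_kronecker_sum[OF assms] simp del: kronecker_sum_encode)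
  also have "\<dots> = exp_trace 1 I (curv I \<theta> x) * exp_trace 1 K (curv K \<eta> x)"
    by (rule exp_trace_kronecker_sum)
      (use connection_onD[OF assms(1)] connection_onD[OF assms(2)] homog_curv assms in auto)
  finally show ?thesis .
qed

subsection \<open>Exterior powers\<close>

text \<open>Codes of sets stay opaque; this rule would turn them into sums of powers of two.\<close>

declare set_encode_insert [simp del]

text \<open>The derivation induced by \<open>M\<close> on exterior powers, in the basis of increasing
  products. A basis element is given by its set of indices, encoded as a number.\<close>

definition wedge_matrix :: "(nat \<Rightarrow> nat \<Rightarrow> 'a::ring_1) \<Rightarrow> nat \<Rightarrow> nat \<Rightarrow> 'a" where
  "wedge_matrix M a b = (let R = set_decode a; S = set_decode b
     in \<Sum>j\<in>S. \<Sum>i\<in>R. if R - {i} = S - {j}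
          then (-1) ^ (card {m \<in> S - {j}. m < j} + card {m \<in> S - {j}. m < i}) * M i j
          else 0)"

definition subset_codes :: "nat \<Rightarrow> nat set \<Rightarrow> nat set" where
  "subset_codes k I = set_encode ` {S. S \<subseteq> I \<and> card S = k}"

lemma wedge_bundle_eq:
  "wedge_bundle k E c x = (subset_codes k (fst (E c x)), \<lambda>y. wedge_matrix (snd (E c x) y))"
  by (simp add: wedge_bundle_def wedge_matrix_def subset_codes_def fun_eq_iff)

lemma wedge_matrix_encode:
  "finite R \<Longrightarrow> finite S \<Longrightarrow> wedge_matrix M (set_encode R) (set_encode S) =
    (\<Sum>j\<in>S. \<Sum>i\<in>R. if R - {i} = S - {j}
      then (-1) ^ (card {m \<in> S - {j}. m < j} + card {m \<in> S - {j}. m < i}) * M i j else 0)"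
  by (simp add: wedge_matrix_def)

lemma inj_set_encode_subsets: "finite I \<Longrightarrow> inj_on set_encode {S. S \<subseteq> I \<and> P S}"
  by (rule inj_on_subset[OF inj_on_set_encode]) (auto intro: finite_subset)

lemma finite_subset_codes: "finite I \<Longrightarrow> finite (subset_codes k I)"
  by (simp add: subset_codes_def)

lemma card_subset_codes: "finite I \<Longrightarrow> card (subset_codes k I) = card I choose k"
  by (simp add: subset_codes_def card_image inj_set_encode_subsets n_subsets)

lemma connection_on_wedge_matrix:
  assumes "connection_on U I \<theta>"
  shows "connection_on U (subset_codes k I) (\<lambda>y. wedge_matrix (\<theta> y))"
proof -
  note c = connection_onD[OF assms]
  have e: "(-1) ^ m * a = ext_const ((-1) ^ m) * a" for m and a :: "'a ext"
    by (simp add: ext_const_power ext_const_simps)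
  have s: "smooth_ext_on U (\<lambda>y. if Q then (-1) ^ m * \<theta> y i j else 0)" if "i \<in> I" "j \<in> I" for Q m i j
    using that unfolding e by (cases Q) (auto intro!: smooth_ext_on_mult smooth_ext_on_const c)
  have h: "homog 1 (if Q then (-1) ^ m * \<theta> y i j else 0)" if "i \<in> I" "j \<in> I" "y \<in> U" for Q m i j y
    using that unfolding e by (auto intro!: homog_const_mult c homog_simps simp del: One_nat_def)
  have "smooth_ext_on U (\<lambda>y. wedge_matrix (\<theta> y) (set_encode R) (set_encode S)) \<and>
    (\<forall>y\<in>U. homog 1 (wedge_matrix (\<theta> y) (set_encode R) (set_encode S)))"
    if RS: "R \<subseteq> I" "S \<subseteq> I" for R S
    unfolding wedge_matrix_def Let_def set_encode_inverse[OF finite_subset[OF RS(1) c(2)]]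
      set_encode_inverse[OF finite_subset[OF RS(2) c(2)]]
    by (intro conjI ballI smooth_ext_on_sum homog_sum c(1) s h subsetD[OF RS(1)] subsetD[OF RS(2)])
  then show ?thesis
    unfolding connection_on_def using c(1,2) finite_subset_codes[of I k]
    by (auto simp: subset_codes_def simp del: One_nat_def)
qed

lemma exp_trace_flat:
  assumes "connection_on U I \<theta>" "x \<in> U" "\<And>y i j. i \<in> I \<Longrightarrow> j \<in> I \<Longrightarrow> \<theta> y i j = 0"
  shows "exp_trace t I (curv I \<theta> x) = of_nat (card I)"
proof (rule exp_trace_zero)
  show "finite I" using connection_onD[OF assms(1)] by simp
  show "curv I \<theta> x i j = 0" if "i \<in> I" "j \<in> I" for i j
    using that by (simp add: curv_def assms(3) ext_d_const)
qed

lemma exp_trace_wedge_flat: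
  assumes "connection_on U I \<theta>" "x \<in> U" "\<And>y i j. \<theta> y i j = 0"
  shows "exp_trace t (subset_codes k I) (curv (subset_codes k I) (\<lambda>y. wedge_matrix (\<theta> y)) x) = of_nat (card I choose k)"
proof -
  have "exp_trace t (subset_codes k I) (curv (subset_codes k I) (\<lambda>y. wedge_matrix (\<theta> y)) x) =
      of_nat (card (subset_codes k I))"
    by (rule exp_trace_flat[OF connection_on_wedge_matrix[OF assms(1)] assms(2)])
      (auto simp: wedge_matrix_def assms(3) Let_def intro!: sum.neutral)
  then show ?thesis using connection_onD(2)[OF assms(1)] by (simp add: card_subset_codes)
qed

lemma exp_trace_wedge_0:
  assumes "connection_on U I \<theta>" "x \<in> U"
  shows "exp_trace t (subset_codes 0 I) (curv (subset_codes 0 I) (\<lambda>y. wedge_matrix (\<theta> y)) x) = 1"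
proof -
  have fin: "finite I" using connection_onD[OF assms(1)] by simp
  have "{S. S \<subseteq> I \<and> card S = 0} = {{}}" using fin finite_subset by fastforce
  then have c: "subset_codes 0 I = {set_encode {}}" by (simp add: subset_codes_def)
  have "exp_trace t (subset_codes 0 I) (curv (subset_codes 0 I) (\<lambda>y. wedge_matrix (\<theta> y)) x) =
      of_nat (card (subset_codes 0 I))"
    by (rule exp_trace_flat[OF connection_on_wedge_matrix[OF assms(1)] assms(2)])
      (auto simp: wedge_matrix_def c Let_def)
  then show ?thesis by (simp add: c)
qed

lemma exp_trace_wedge_1:
  assumes "connection_on U I \<theta>" "x \<in> U"
  shows "exp_trace t (subset_codes 1 I) (curv (subset_codes 1 I) (\<lambda>y. wedge_matrix (\<theta> y)) x) = exp_trace t I (curv I \<theta> x)"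
proof -
  let ?f = "\<lambda>i. set_encode {i}"
  have c: "subset_codes 1 I = ?f ` I"
  proof -
    have "{S. S \<subseteq> I \<and> card S = 1} = (\<lambda>i. {i}) ` I" by (auto simp: card_1_singleton_iff)
    then show ?thesis by (simp add: subset_codes_def image_image)
  qed
  have inj: "inj_on ?f I"
    by (rule inj_onI) (simp only: set_encode_eq finite.intros singleton_inject)
  have w: "wedge_matrix M (?f i) (?f j) = M i j" for M :: "nat \<Rightarrow> nat \<Rightarrow> 'a ext" and i j
    by (simp add: wedge_matrix_encode)
  have "curv (?f ` I) (\<lambda>y. wedge_matrix (\<theta> y)) x (?f i) (?f j) = curv I \<theta> x i j" for i j
    unfolding curv_def by (simp add: sum.reindex[OF inj] w)
  then show ?thesis unfolding c by (intro exp_trace_reindex inj)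
qed

text \<open>\<open>\<Lambda>\<^sup>2\<close> embeds into the tensor square by \<open>e\<^sub>i \<and> e\<^sub>k \<mapsto> e\<^sub>i \<otimes> e\<^sub>k - e\<^sub>k \<otimes> e\<^sub>i\<close>; the embedding intertwines the
  connections, hence their curvatures and all power series in them.\<close>

definition pair_sign :: "nat \<Rightarrow> nat \<Rightarrow> nat set \<Rightarrow> 'a::ring_1" where
  "pair_sign i k S = (if i \<noteq> k \<and> S = {i, k} then (if i < k then 1 else -1) else 0)"

text \<open>The matrix of this embedding, with encoded pairs as rows and encoded sets as columns.\<close>

definition antisym :: "nat \<Rightarrow> nat \<Rightarrow> 'a::ring_1" where
  "antisym a b = (let (i, k) = prod_decode a in pair_sign i k (set_decode b))"

lemma antisym_encode [simp]: "finite S \<Longrightarrow> antisym (prod_encode (i, k)) (set_encode S) = pair_sign i k S"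
  by (simp add: antisym_def)

lemma two_subsets: "{S. S \<subseteq> I \<and> card S = 2} = {{p, q} | p q. p \<in> I \<and> q \<in> I \<and> p < (q::nat)}"
proof (intro set_eqI iffI)
  fix S assume "S \<in> {S. S \<subseteq> I \<and> card S = 2}"
  then obtain p q where "S = {p, q}" "p \<noteq> q" "p \<in> I" "q \<in> I" by (auto simp: card_2_iff)
  then show "S \<in> {{p, q} | p q. p \<in> I \<and> q \<in> I \<and> p < q}"
    by (cases "p < q") (auto, metis insert_commute linorder_neqE_nat)
qed auto

lemma wedge_matrix_two:
  assumes "p < q" "i < k"
  shows "wedge_matrix M (set_encode {i, k}) (set_encode {p, q}) =
    (if k = q then M i p else 0) - (if k = p then M i q else 0) +
    (if i = p then M k q else 0) - (if i = q then M k p else 0)"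
proof -
  have d: "{i, k} - {i} = {k}" "{i, k} - {k} = {i}" "{p, q} - {p} = {q}" "{p, q} - {q} = {p}"
    using assms by auto
  have c: "card {m. m = a \<and> m < b} = (if a < b then 1 else 0)" for a b :: nat
  proof -
    have "{m. m = a \<and> m < b} = (if a < b then {a} else {})" by auto
    then show ?thesis by simp
  qed
  show ?thesis
    using assms by (simp add: wedge_matrix_encode d c)
qed

lemma antisym_intertwines:
  fixes M :: "nat \<Rightarrow> nat \<Rightarrow> 'a::ring_1"
  assumes I: "finite I" and a: "a \<in> prod_encode ` (I \<times> I)" and b: "b \<in> subset_codes 2 I"
  shows "(\<Sum>c\<in>prod_encode ` (I \<times> I). kronecker_sum M M a c * antisym c b) =
    (\<Sum>c\<in>subset_codes 2 I. antisym a c * wedge_matrix M c b)"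
proof -
  obtain i k where ik: "a = prod_encode (i, k)" "i \<in> I" "k \<in> I" using a by auto
  obtain p q where pq: "b = set_encode {p, q}" "p \<in> I" "q \<in> I" "p < q"
    using b unfolding subset_codes_def two_subsets by auto
  have ps: "pair_sign i' k {p, q} = (if k = q then (if i' = p then 1 else 0)
      else if k = p then (if i' = q then -1 else 0) else (0 :: 'a))" for i' k
    using pq(4) by (auto simp: pair_sign_def doubleton_eq_iff)
  have ps': "pair_sign i k' {p, q} = (if i = p then (if k' = q then 1 else 0)
      else if i = q then (if k' = p then -1 else 0) else (0 :: 'a))" for k' i
    using pq(4) by (auto simp: pair_sign_def doubleton_eq_iff)
  have L: "(\<Sum>c\<in>prod_encode ` (I \<times> I). kronecker_sum M M a c * antisym c b) =
      (if k = q then M i p else if k = p then - M i q else 0) +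
      (if i = p then M k q else if i = q then - M k p else 0)"
  proof -
    have "(\<Sum>i'\<in>I. M i i' * pair_sign i' k {p, q}) = (if k = q then M i p else if k = p then - M i q else 0)"
      unfolding ps using I pq by (simp add: if_distrib[of "(*) _"] cong: if_cong)
    moreover have "(\<Sum>k'\<in>I. M k k' * pair_sign i k' {p, q}) = (if i = p then M k q else if i = q then - M k p else 0)"
      unfolding ps' using I pq by (simp add: if_distrib[of "(*) _"] cong: if_cong)
    ultimately show ?thesis
      unfolding ik(1) pq(1) kronecker_sum_mult_left[OF I I ik(2,3)] by simp
  qed
  have R: "(\<Sum>c\<in>subset_codes 2 I. antisym a c * wedge_matrix M c b) =
      (if i = k then 0 else (if i < k then 1 else -1) * wedge_matrix M (set_encode {i, k}) b)"
  proof -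
    have "(\<Sum>c\<in>subset_codes 2 I. antisym a c * wedge_matrix M c b) =
        (\<Sum>S\<in>{S. S \<subseteq> I \<and> card S = 2}. pair_sign i k S * wedge_matrix M (set_encode S) b)"
      unfolding subset_codes_def ik(1)
      by (subst sum.reindex[OF inj_set_encode_subsets[OF I]])
        (intro sum.cong refl, auto simp: antisym_encode dest: finite_subset[OF _ I])
    also have "\<dots> = (\<Sum>S\<in>{S. S \<subseteq> I \<and> card S = 2}. if S = {i, k} then
        (if i = k then 0 else (if i < k then 1 else -1) * wedge_matrix M (set_encode {i, k}) b) else 0)"
      by (intro sum.cong refl) (auto simp: pair_sign_def)
    also have "\<dots> = (if i = k then 0 else (if i < k then 1 else -1) * wedge_matrix M (set_encode {i, k}) b)"
      using I ik by (subst sum.delta) (auto simp: card_insert_if)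
    finally show ?thesis .
  qed
  consider "i < k" | "i = k" | "k < i" by linarith
  then show ?thesis
  proof cases
    case 1
    then show ?thesis unfolding L R using wedge_matrix_two[OF pq(4) 1, of M] pq(1,4) by auto
  next
    case 2
    then show ?thesis unfolding L R using pq(4) by auto
  next
    case 3
    then show ?thesis unfolding L R using wedge_matrix_two[OF pq(4) 3, of M] pq(1,4)
      by (auto simp: insert_commute)
  qed
qed

lemma mpower_intertwines:
  fixes J :: "nat \<Rightarrow> nat \<Rightarrow> 'a::ring_1"
  assumes "finite P" "finite Q"
    and T: "\<And>a b. a \<in> P \<Longrightarrow> b \<in> Q \<Longrightarrow> (\<Sum>c\<in>P. T a c * J c b) = (\<Sum>c\<in>Q. J a c * W c b)"
    and ab: "a \<in> P" "b \<in> Q"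
  shows "(\<Sum>c\<in>P. mpower P T n a c * J c b) = (\<Sum>c\<in>Q. J a c * mpower Q W n c b)"
  using ab(1)
proof (induction n arbitrary: a)
  case 0
  have "(\<Sum>c\<in>P. mpower P T 0 a c * J c b) = (\<Sum>c\<in>P. if a = c then J a b else 0)"
    by (intro sum.cong) auto
  moreover have "(\<Sum>c\<in>Q. J a c * mpower Q W 0 c b) = (\<Sum>c\<in>Q. if c = b then J a b else 0)"
    by (intro sum.cong) auto
  ultimately show ?case using 0 assms(1,2) ab(2) by simp
next
  case (Suc n)
  have "(\<Sum>c\<in>P. mpower P T (Suc n) a c * J c b) = (\<Sum>d\<in>P. T a d * (\<Sum>c\<in>P. mpower P T n d c * J c b))"
    by (simp add: sum_distrib_left sum_distrib_right mult.assoc) (rule sum.swap)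
  also have "\<dots> = (\<Sum>d\<in>P. T a d * (\<Sum>c\<in>Q. J d c * mpower Q W n c b))" using Suc.IH by simp
  also have "\<dots> = (\<Sum>c\<in>Q. (\<Sum>d\<in>P. T a d * J d c) * mpower Q W n c b)"
    by (simp add: sum_distrib_left sum_distrib_right mult.assoc) (rule sum.swap)
  also have "\<dots> = (\<Sum>c\<in>Q. (\<Sum>d\<in>Q. J a d * W d c) * mpower Q W n c b)" using T Suc.prems by simp
  also have "\<dots> = (\<Sum>d\<in>Q. J a d * mpower Q W (Suc n) d b)"
    by (simp add: sum_distrib_left sum_distrib_right mult.assoc) (rule sum.swap)
  finally show ?case .
qed

lemma fps_mapp_intertwines:
  fixes J :: "nat \<Rightarrow> nat \<Rightarrow> 'n::{finite,linorder} ext"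
  assumes "finite P" "finite Q"
    and T: "\<And>a b. a \<in> P \<Longrightarrow> b \<in> Q \<Longrightarrow> (\<Sum>c\<in>P. T a c * J c b) = (\<Sum>c\<in>Q. J a c * W c b)"
    and ab: "a \<in> P" "b \<in> Q"
  shows "(\<Sum>c\<in>P. fps_mapp P f T a c * J c b) = (\<Sum>c\<in>Q. J a c * fps_mapp Q f W c b)"
proof -
  have "(\<Sum>c\<in>P. fps_mapp P f T a c * J c b) =
      (\<Sum>k\<le>CARD('n). ext_const (fps_nth f k) * (\<Sum>c\<in>P. mpower P T k a c * J c b))"
    unfolding fps_mapp_def sum_distrib_right sum_distrib_left by (subst sum.swap) (simp add: mult.assoc)
  also have "\<dots> = (\<Sum>k\<le>CARD('n). ext_const (fps_nth f k) * (\<Sum>c\<in>Q. J a c * mpower Q W k c b))"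
    by (intro sum.cong refl arg_cong2[where f = "(*)"] mpower_intertwines assms)
  also have "\<dots> = (\<Sum>c\<in>Q. J a c * fps_mapp Q f W c b)"
    unfolding fps_mapp_def sum_distrib_left ext_const_left_commute by (rule sum.swap)
  finally show ?thesis .
qed

text \<open>The intertwining matrix is constant, so it passes through the exterior derivative as well as
  through products.\<close>

lemma curv_intertwines:
  fixes z :: "nat \<Rightarrow> nat \<Rightarrow> complex"
  assumes \<theta>: "connection_on U P \<theta>" and \<eta>: "connection_on U Q \<eta>" and x: "x \<in> U"
    and T: "\<And>y a b. y \<in> U \<Longrightarrow> a \<in> P \<Longrightarrow> b \<in> Q \<Longrightarrow>
      (\<Sum>c\<in>P. \<theta> y a c * ext_const (z c b)) = (\<Sum>c\<in>Q. ext_const (z a c) * \<eta> y c b)"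
    and ab: "a \<in> P" "b \<in> Q"
  shows "(\<Sum>c\<in>P. curv P \<theta> x a c * ext_const (z c b)) = (\<Sum>c\<in>Q. ext_const (z a c) * curv Q \<eta> x c b)"
proof -
  note c = connection_onD[OF \<theta>] and d = connection_onD[OF \<eta>]
  have "(\<Sum>e\<in>P. ext_d (\<lambda>y. \<theta> y a e) x * ext_const (z e b)) = (\<Sum>e\<in>P. ext_d (\<lambda>y. ext_const (z e b) * \<theta> y a e) x)"
    by (intro sum.cong refl) (simp add: ext_d_const_mult[OF c(1) x c(3)[OF ab(1)]] ext_const_commute)
  also have "\<dots> = ext_d (\<lambda>y. \<Sum>e\<in>P. ext_const (z e b) * \<theta> y a e) x"
    by (rule ext_d_sum[symmetric]) (auto intro!: c x ab smooth_ext_on_mult smooth_ext_on_const)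
  also have "\<dots> = ext_d (\<lambda>y. \<Sum>e\<in>Q. ext_const (z a e) * \<eta> y e b) x"
    using T[OF _ ab] by (intro ext_d_cong[OF c(1) x]) (simp add: ext_const_commute)
  also have "\<dots> = (\<Sum>e\<in>Q. ext_d (\<lambda>y. ext_const (z a e) * \<eta> y e b) x)"
    by (rule ext_d_sum) (auto intro!: d x ab smooth_ext_on_mult smooth_ext_on_const)
  also have "\<dots> = (\<Sum>e\<in>Q. ext_const (z a e) * ext_d (\<lambda>y. \<eta> y e b) x)"
    by (intro sum.cong refl) (simp add: ext_d_const_mult[OF c(1) x d(3)[OF _ ab(2)]])
  finally have 1: "(\<Sum>e\<in>P. ext_d (\<lambda>y. \<theta> y a e) x * ext_const (z e b)) =
      (\<Sum>e\<in>Q. ext_const (z a e) * ext_d (\<lambda>y. \<eta> y e b) x)" .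
  have "(\<Sum>e\<in>P. (\<Sum>k\<in>P. \<theta> x a k * \<theta> x k e) * ext_const (z e b)) =
      (\<Sum>e\<in>P. mpower P (\<theta> x) 2 a e * ext_const (z e b))"
    using c(2) ab(1) by (intro sum.cong refl) (simp add: numeral_2_eq_2 if_distrib[of "(*) _"] cong: if_cong)
  also have "\<dots> = (\<Sum>e\<in>Q. ext_const (z a e) * mpower Q (\<eta> x) 2 e b)"
    by (rule mpower_intertwines[OF c(2) d(2) T[OF x] ab])
  also have "\<dots> = (\<Sum>e\<in>Q. ext_const (z a e) * (\<Sum>k\<in>Q. \<eta> x e k * \<eta> x k b))"
    using d(2) ab(2) by (intro sum.cong refl) (simp add: numeral_2_eq_2 if_distrib[of "(*) _"] cong: if_cong)
  finally show ?thesis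
    using 1 by (simp add: curv_def distrib_left distrib_right sum.distrib)
qed

lemma antisym_eq_ext_const: "antisym a b = ext_const (antisym a b)"
  by (simp add: antisym_def pair_sign_def ext_const_simps split: prod.split)

lemma sum_symmetric_pairs:
  fixes g :: "nat \<Rightarrow> nat \<Rightarrow> 'a::ring_1"
  assumes "finite I" "\<And>i k. i \<in> I \<Longrightarrow> k \<in> I \<Longrightarrow> g i k = g k i" "\<And>i. i \<in> I \<Longrightarrow> g i i = 0"
  shows "(\<Sum>i\<in>I. \<Sum>k\<in>I. g i k) = 2 * (\<Sum>(i, k)\<in>{(i, k). i \<in> I \<and> k \<in> I \<and> i < k}. g i k)"
proof -
  let ?L = "{(i, k). i \<in> I \<and> k \<in> I \<and> i < k}" and ?G = "{(i, k). i \<in> I \<and> k \<in> I \<and> k < i}"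
  have fin: "finite ?L" "finite ?G"
    by (rule finite_subset[of _ "I \<times> I"]; use assms(1) in force)+
  have "(\<Sum>i\<in>I. \<Sum>k\<in>I. g i k) = (\<Sum>(i, k)\<in>I \<times> I. g i k)" by (simp add: sum.cartesian_product)
  also have "\<dots> = (\<Sum>(i, k)\<in>?L \<union> ?G. g i k)"
    by (rule sum.mono_neutral_right) (use assms in \<open>auto, metis linorder_neqE_nat\<close>)
  also have "\<dots> = (\<Sum>(i, k)\<in>?L. g i k) + (\<Sum>(i, k)\<in>?G. g i k)"
    by (rule sum.union_disjoint) (use fin in auto)
  also have "(\<Sum>(i, k)\<in>?G. g i k) = (\<Sum>(i, k)\<in>?L. g i k)"
    by (rule sum.reindex_bij_witness[of _ prod.swap prod.swap]) (use assms(2) in auto)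
  finally show ?thesis by (simp only: mult_2)
qed

text \<open>For the exponential \<open>e\<close> of the curvature this is \<open>2 tr \<Lambda>\<^sup>2e =
  (tr e)\<^sup>2 - tr e\<^sup>2\<close>. That the exponential of the curvature of
  \<open>\<Lambda>\<^sup>2\<close> is \<open>\<Lambda>\<^sup>2e\<close> is read off from the tensor square,
  where it is \<open>e \<otimes> e\<close>, through the intertwining embedding.\<close>

lemma exp_trace_wedge_2:
  fixes \<theta> :: "'n::{finite,linorder} rvec \<Rightarrow> nat \<Rightarrow> nat \<Rightarrow> 'n ext"
  assumes \<theta>: "connection_on U I \<theta>" and x: "x \<in> U"
  shows "2 * exp_trace 1 (subset_codes 2 I) (curv (subset_codes 2 I) (\<lambda>y. wedge_matrix (\<theta> y)) x) =
    exp_trace 1 I (curv I \<theta> x) ^ 2 - exp_trace 2 I (curv I \<theta> x)"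
proof -
  let ?P = "prod_encode ` (I \<times> I)" and ?Q = "subset_codes 2 I"
  let ?z = "\<i> / (2 * complex_of_real pi)"
  define R where "R = curv I \<theta> x"
  define M where "M = (\<lambda>i j. ext_const ?z * R i j)"
  define e where "e = fps_mapp I (fps_exp 1) M"
  define W where "W = (\<lambda>a b. ext_const ?z * curv ?Q (\<lambda>y. wedge_matrix (\<theta> y)) x a b)"
  have I: "finite I" by (rule connection_onD(2)[OF \<theta>])
  have finP: "finite ?P" and finQ: "finite ?Q" using I by (auto intro: finite_subset_codes)
  have M2: "homog 2 (M i j)" if "i \<in> I" "j \<in> I" for i j
    unfolding M_def R_def by (intro even_scaled homog_curv[OF \<theta> x that])
  have Mev: "even_ext (M i j)" if "i \<in> I" "j \<in> I" for i j using homog_imp_even[OF M2[OF that]] by simp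
  have eev: "even_ext (e i j)" if "i \<in> I" "j \<in> I" for i j
    unfolding e_def by (rule even_fps_mapp[of I M i j, OF Mev that])
  have curvJ: "(\<Sum>c\<in>?P. kronecker_sum R R a c * antisym c b) =
      (\<Sum>c\<in>?Q. antisym a c * curv ?Q (\<lambda>y. wedge_matrix (\<theta> y)) x c b)" if "a \<in> ?P" "b \<in> ?Q" for a b
  proof -
    have "(\<Sum>c\<in>?P. curv ?P (\<lambda>y. kronecker_sum (\<theta> y) (\<theta> y)) x a c * ext_const (antisym c b)) =
        (\<Sum>c\<in>?Q. ext_const (antisym a c) * curv ?Q (\<lambda>y. wedge_matrix (\<theta> y)) x c b)"
    proof (rule curv_intertwines[OF connection_on_kronecker_sum[OF \<theta> \<theta>] connection_on_wedge_matrix[OF \<theta>] x _ that])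
      fix y a b assume "a \<in> ?P" "b \<in> ?Q"
      from antisym_intertwines[OF I this, of "\<theta> y"]
      show "(\<Sum>c\<in>?P. kronecker_sum (\<theta> y) (\<theta> y) a c * ext_const (antisym c b)) =
          (\<Sum>c\<in>?Q. ext_const (antisym a c) * wedge_matrix (\<theta> y) c b)"
        by (simp only: antisym_eq_ext_const[symmetric])
    qed
    moreover have "curv ?P (\<lambda>y. kronecker_sum (\<theta> y) (\<theta> y)) x a c = kronecker_sum R R a c" if "c \<in> ?P" for c
      using \<open>a \<in> ?P\<close> that unfolding R_def
      by (auto simp: curv_kronecker_sum[OF \<theta> \<theta> x] simp del: kronecker_sum_encode)
    ultimately show ?thesis by (simp add: antisym_eq_ext_const[symmetric])
  qed
  have MJ: "(\<Sum>c\<in>?P. kronecker_sum M M a c * antisym c b) = (\<Sum>c\<in>?Q. antisym a c * W c b)"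
    if "a \<in> ?P" "b \<in> ?Q" for a b
  proof -
    have "(\<Sum>c\<in>?P. kronecker_sum M M a c * antisym c b) =
        ext_const ?z * (\<Sum>c\<in>?P. kronecker_sum R R a c * antisym c b)"
      by (simp add: M_def kronecker_sum_scale[symmetric] sum_distrib_left mult.assoc)
    also have "\<dots> = (\<Sum>c\<in>?Q. antisym a c * W c b)"
      unfolding curvJ[OF that] W_def sum_distrib_left by (simp only: ext_const_left_commute)
    finally show ?thesis .
  qed
  \<comment> \<open>A diagonal entry is a minor of \<open>e\<close>: row \<open>(i, k)\<close> of the embedding has its only entry, \<open>1\<close>, at \<open>{i, k}\<close>.\<close>
  have diag: "fps_mapp ?Q (fps_exp 1) W (set_encode {i, k}) (set_encode {i, k}) = e i i * e k k - e i k * e k i"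
    if ik: "i \<in> I" "k \<in> I" "i < k" for i k
  proof -
    let ?b = "set_encode {i, k}" and ?a = "prod_encode (i, k)"
    have b: "?b \<in> ?Q"
      unfolding subset_codes_def two_subsets
      by (intro imageI CollectI exI[of _ i] exI[of _ k] conjI refl ik)
    have a: "?a \<in> ?P" using ik by auto
    have "fps_mapp ?Q (fps_exp 1) W ?b ?b = (\<Sum>c\<in>?Q. if c = ?b then fps_mapp ?Q (fps_exp 1) W ?b ?b else 0)"
      using finQ b by simp
    also have "\<dots> = (\<Sum>c\<in>?Q. antisym ?a c * fps_mapp ?Q (fps_exp 1) W c ?b)"
    proof (intro sum.cong refl)
      fix c assume "c \<in> ?Q"
      then obtain S where S: "c = set_encode S" "S \<subseteq> I" by (auto simp: subset_codes_def)
      have "finite S" by (rule finite_subset[OF S(2) I])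
      then have "c = ?b \<longleftrightarrow> S = {i, k}" by (simp add: S(1) set_encode_eq)
      with \<open>finite S\<close> show "(if c = ?b then fps_mapp ?Q (fps_exp 1) W ?b ?b else 0) = antisym ?a c * fps_mapp ?Q (fps_exp 1) W c ?b"
        using ik(3) by (cases "S = {i, k}") (simp_all add: S(1) pair_sign_def)
    qed
    also have "\<dots> = (\<Sum>c\<in>?P. fps_mapp ?P (fps_exp 1) (kronecker_sum M M) ?a c * antisym c ?b)"
      by (rule fps_mapp_intertwines[symmetric, OF finP finQ MJ a b])
    also have "\<dots> = (\<Sum>j\<in>I. \<Sum>l\<in>I. e i j * e k l * pair_sign j l {i, k})"
      unfolding sum_prod_encode
      by (intro sum.cong refl) (simp add: fps_exp_kronecker_sum[of I I M M, OF I I M2 M2] ik e_def)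
    also have "\<dots> = (\<Sum>j\<in>I. \<Sum>l\<in>I. (if j = i then if l = k then e i i * e k k else 0 else 0) +
        (if j = k then if l = i then - (e i k * e k i) else 0 else 0))"
      using ik(3) by (intro sum.cong refl) (auto simp: pair_sign_def doubleton_eq_iff)
    also have "\<dots> = e i i * e k k - e i k * e k i"
    proof -
      have "(\<Sum>j\<in>I. \<Sum>l\<in>I. (if j = a then if l = b then v else 0 else 0)) = v"
        if "a \<in> I" "b \<in> I" for a b and v :: "'n ext"
      proof -
        have "(\<Sum>j\<in>I. \<Sum>l\<in>I. (if j = a then if l = b then v else 0 else 0)) = (\<Sum>j\<in>I. if j = a then v else 0)"
          using I that by (intro sum.cong) auto
        then show ?thesis using I that by simp
      qed
      then show ?thesis using ik by (simp add: sum.distrib)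
    qed
    finally show ?thesis .
  qed
  have "exp_trace 1 ?Q (curv ?Q (\<lambda>y. wedge_matrix (\<theta> y)) x) = (\<Sum>b\<in>?Q. fps_mapp ?Q (fps_exp 1) W b b)"
    by (simp add: exp_trace_def mtrace_def W_def)
  also have "\<dots> = (\<Sum>(i, k)\<in>{(i, k). i \<in> I \<and> k \<in> I \<and> i < k}. e i i * e k k - e i k * e k i)"
  proof -
    let ?D = "{(i, k). i \<in> I \<and> k \<in> I \<and> i < k}" and ?f = "\<lambda>(i, k). set_encode {i, k}"
    have Q: "?Q = ?f ` ?D" unfolding subset_codes_def two_subsets by (auto simp: image_iff)
    have "inj_on ?f ?D"
      by (auto simp: inj_on_def set_encode_eq doubleton_eq_iff)
    then have "(\<Sum>b\<in>?f ` ?D. fps_mapp ?Q (fps_exp 1) W b b) =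
        (\<Sum>p\<in>?D. fps_mapp ?Q (fps_exp 1) W (?f p) (?f p))"
      by (simp add: sum.reindex)
    also have "\<dots> = (\<Sum>(i, k)\<in>?D. e i i * e k k - e i k * e k i)"
      by (intro sum.cong refl) (auto simp: diag)
    finally show ?thesis using Q by simp
  qed
  finally have "2 * exp_trace 1 ?Q (curv ?Q (\<lambda>y. wedge_matrix (\<theta> y)) x) =
      2 * (\<Sum>(i, k)\<in>{(i, k). i \<in> I \<and> k \<in> I \<and> i < k}. e i i * e k k - e i k * e k i)" by simp
  also have "\<dots> = (\<Sum>i\<in>I. \<Sum>k\<in>I. e i i * e k k - e i k * e k i)"
  proof (rule sum_symmetric_pairs[symmetric, OF I])
    fix i k assume "i \<in> I" "k \<in> I"
    then show "e i i * e k k - e i k * e k i = e k k * e i i - e k i * e i k"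
      using even_ext_commute[OF eev, of i i "e k k"] even_ext_commute[OF eev, of i k "e k i"] by simp
  qed simp
  also have "\<dots> = (\<Sum>i\<in>I. e i i) * (\<Sum>k\<in>I. e k k) - (\<Sum>i\<in>I. \<Sum>k\<in>I. e i k * e k i)"
    by (simp add: sum_subtractf sum_product)
  also have "(\<Sum>i\<in>I. \<Sum>k\<in>I. e i k * e k i) = (\<Sum>i\<in>I. fps_mapp I (fps_exp 1 * fps_exp 1) M i i)"
  proof (intro sum.cong refl)
    fix i assume i: "i \<in> I"
    have "mpower I M m i i = 0" if "m > CARD('n)" for m
      using homog_gt_card[OF homog_mpower[of I M i i m, OF M2 i i]] that by simp
    then show "(\<Sum>k\<in>I. e i k * e k i) = fps_mapp I (fps_exp 1 * fps_exp 1) M i i"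
      unfolding e_def by (rule fps_mapp_mult[OF I i])
  qed
  also have "fps_exp 1 * fps_exp 1 = fps_exp (2 :: complex)"
    using fps_exp_add_mult[of "1 :: complex" 1] by simp
  finally show ?thesis
    by (simp add: exp_trace_def mtrace_def e_def M_def R_def power2_eq_square)
qed

section \<open>Bianchi identity, gauge changes and metric connections\<close>

definition mmul :: "nat set \<Rightarrow> (nat \<Rightarrow> nat \<Rightarrow> 'a::ring_1) \<Rightarrow> (nat \<Rightarrow> nat \<Rightarrow> 'a) \<Rightarrow> nat \<Rightarrow> nat \<Rightarrow> 'a" where
  "mmul I A B i j = (\<Sum>k\<in>I. A i k * B k j)"

lemma mmul_assoc: "mmul I (mmul I A B) C i j = mmul I A (mmul I B C) i j"
  unfolding mmul_def sum_distrib_left sum_distrib_right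
  by (subst sum.swap) (simp add: mult.assoc)

lemma mmul_simps:
  "mmul I (\<lambda>i j. A i j + B i j) C i j = mmul I A C i j + mmul I B C i j"
  "mmul I A (\<lambda>i j. B i j + C i j) i j = mmul I A B i j + mmul I A C i j"
  "mmul I (\<lambda>i j. A i j - B i j) C i j = mmul I A C i j - mmul I B C i j"
  "mmul I A (\<lambda>i j. B i j - C i j) i j = mmul I A B i j - mmul I A C i j"
  by (simp_all add: mmul_def distrib_left distrib_right sum.distrib left_diff_distrib right_diff_distrib sum_subtractf)

lemma mmul_cong:
  assumes "\<And>k. k \<in> I \<Longrightarrow> A i k = A' i k" "\<And>k. k \<in> I \<Longrightarrow> B k j = B' k j"
  shows "mmul I A B i j = mmul I A' B' i j"
  using assms by (simp add: mmul_def)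

definition ext_dm :: "('n rvec \<Rightarrow> nat \<Rightarrow> nat \<Rightarrow> 'n ext) \<Rightarrow> 'n::{finite,linorder} rvec \<Rightarrow> nat \<Rightarrow> nat \<Rightarrow> 'n ext" where
  "ext_dm a x i j = ext_d (\<lambda>y. a y i j) x"

lemma curv_eq: "curv I \<theta> x i j = ext_dm \<theta> x i j + mmul I (\<theta> x) (\<theta> x) i j"
  by (simp add: curv_def ext_dm_def mmul_def)

definition smooth_matrix_on :: "'n rvec set \<Rightarrow> nat set \<Rightarrow> ('n rvec \<Rightarrow> nat \<Rightarrow> nat \<Rightarrow> 'n::{finite,linorder} ext) \<Rightarrow> bool" where
  "smooth_matrix_on U I a \<longleftrightarrow> (\<forall>i\<in>I. \<forall>j\<in>I. smooth_ext_on U (\<lambda>y. a y i j))"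

lemma smooth_matrix_on_connection: "connection_on U I \<theta> \<Longrightarrow> smooth_matrix_on U I \<theta>"
  by (simp add: connection_on_def smooth_matrix_on_def)

lemma ext_dm_mmul_even:
  assumes U: "open U" "x \<in> U" and s: "smooth_matrix_on U I a" "smooth_matrix_on U I b"
    and e: "\<And>k. k \<in> I \<Longrightarrow> even_ext (a x i k)" and ij: "i \<in> I" "j \<in> I"
  shows "ext_d (\<lambda>y. mmul I (a y) (b y) i j) x = mmul I (ext_dm a x) (b x) i j + mmul I (a x) (ext_dm b x) i j"
proof -
  have "ext_d (\<lambda>y. mmul I (a y) (b y) i j) x = (\<Sum>k\<in>I. ext_d (\<lambda>y. a y i k * b y k j) x)"
    unfolding mmul_def using s ij
    by (intro ext_d_sum[OF U(1) _ U(2)] smooth_ext_on_mult U(1)) (auto simp: smooth_matrix_on_def)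
  also have "\<dots> = (\<Sum>k\<in>I. ext_dm a x i k * b x k j + a x i k * ext_dm b x k j)"
    unfolding ext_dm_def using s ij
    by (intro sum.cong refl ext_d_mult_even[OF U] e) (auto simp: smooth_matrix_on_def)
  finally show ?thesis by (simp add: mmul_def sum.distrib)
qed

lemma ext_dm_mmul_one:
  assumes U: "open U" "x \<in> U" and s: "smooth_matrix_on U I a" "smooth_matrix_on U I b"
    and e: "\<And>k. k \<in> I \<Longrightarrow> homog 1 (a x i k)" and ij: "i \<in> I" "j \<in> I"
  shows "ext_d (\<lambda>y. mmul I (a y) (b y) i j) x = mmul I (ext_dm a x) (b x) i j - mmul I (a x) (ext_dm b x) i j"
proof -
  have "ext_d (\<lambda>y. mmul I (a y) (b y) i j) x = (\<Sum>k\<in>I. ext_d (\<lambda>y. a y i k * b y k j) x)"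
    unfolding mmul_def using s ij
    by (intro ext_d_sum[OF U(1) _ U(2)] smooth_ext_on_mult U(1)) (auto simp: smooth_matrix_on_def)
  also have "\<dots> = (\<Sum>k\<in>I. ext_dm a x i k * b x k j - a x i k * ext_dm b x k j)"
    unfolding ext_dm_def using s ij
    by (intro sum.cong refl ext_d_mult_one[OF U] e) (auto simp: smooth_matrix_on_def)
  finally show ?thesis by (simp add: mmul_def sum_subtractf)
qed

lemma smooth_matrix_on_mmul:
  assumes "open U" "smooth_matrix_on U I a" "smooth_matrix_on U I b"
  shows "smooth_matrix_on U I (\<lambda>y. mmul I (a y) (b y))"
  using assms unfolding smooth_matrix_on_def mmul_def
  by (auto intro!: smooth_ext_on_sum smooth_ext_on_mult)

lemma smooth_matrix_on_ext_dm: "open U \<Longrightarrow> smooth_matrix_on U I a \<Longrightarrow> smooth_matrix_on U I (ext_dm a)"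
  unfolding smooth_matrix_on_def ext_dm_def by (auto intro!: smooth_ext_on_ext_d)

lemma smooth_matrix_on_curv: "connection_on U I \<theta> \<Longrightarrow> smooth_matrix_on U I (curv I \<theta>)"
  unfolding smooth_matrix_on_def by (auto intro!: smooth_ext_on_curv)

lemma smooth_matrix_on_mpower:
  assumes U: "open U" and a: "smooth_matrix_on U I a"
  shows "smooth_matrix_on U I (\<lambda>y. mpower I (a y) n)"
proof (induction n)
  case 0
  then show ?case by (simp add: smooth_matrix_on_def smooth_ext_on_const)
next
  case (Suc n)
  from smooth_matrix_on_mmul[OF U a this] show ?case
    by (simp add: smooth_matrix_on_def mmul_def)
qed

text \<open>Differentiate \<open>d\<theta> + \<theta> \<and> \<theta>\<close> and replace
  \<open>d\<theta>\<close> by the curvature minus \<open>\<theta> \<and> \<theta>\<close>; the cubic terms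
  cancel.\<close>

lemma bianchi_identity:
  assumes \<theta>: "connection_on U I \<theta>" and x: "x \<in> U" and ij: "i \<in> I" "j \<in> I"
  shows "ext_dm (curv I \<theta>) x i j = mmul I (curv I \<theta> x) (\<theta> x) i j - mmul I (\<theta> x) (curv I \<theta> x) i j"
proof -
  note c = connection_onD[OF \<theta>] and s = smooth_matrix_on_connection[OF \<theta>]
  have sd: "smooth_ext_on U (\<lambda>y. ext_dm \<theta> y i j)"
    unfolding ext_dm_def using ij c by (auto intro!: smooth_ext_on_ext_d)
  have sm: "smooth_ext_on U (\<lambda>y. mmul I (\<theta> y) (\<theta> y) i j)"
    using smooth_matrix_on_mmul[OF c(1) s s] ij by (simp add: smooth_matrix_on_def)
  have dd: "ext_d (\<lambda>y. ext_dm \<theta> y i j) x = 0"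
    unfolding ext_dm_def by (rule ext_d_ext_d[OF c(1) x c(3)[OF ij]])
  have "ext_dm (curv I \<theta>) x i j = ext_d (\<lambda>y. mmul I (\<theta> y) (\<theta> y) i j) x"
    unfolding ext_dm_def[of "curv I \<theta>"] curv_eq ext_d_add[OF sd sm x] dd by simp
  also have "\<dots> = mmul I (ext_dm \<theta> x) (\<theta> x) i j - mmul I (\<theta> x) (ext_dm \<theta> x) i j"
    by (rule ext_dm_mmul_one[OF c(1) x s s _ ij]) (use c(4) ij x in auto)
  also have "ext_dm \<theta> x = (\<lambda>i j. curv I \<theta> x i j - mmul I (\<theta> x) (\<theta> x) i j)"
    by (simp add: fun_eq_iff curv_eq)
  finally show ?thesis by (simp add: mmul_simps mmul_assoc)
qed

lemma mpower_Suc_mmul: "mpower I M (Suc n) = mmul I M (mpower I M n)"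
  by (simp add: fun_eq_iff mmul_def)

text \<open>Both sides are derivations in the power, so this follows from the Bianchi identity.\<close>

lemma ext_d_mpower_curv:
  assumes \<theta>: "connection_on U I \<theta>" and x: "x \<in> U" and ij: "i \<in> I" "j \<in> I"
  shows "ext_dm (\<lambda>y. mpower I (curv I \<theta> y) n) x i j =
    mmul I (mpower I (curv I \<theta> x) n) (\<theta> x) i j - mmul I (\<theta> x) (mpower I (curv I \<theta> x) n) i j"
  using ij(1)
proof (induction n arbitrary: i)
  case 0
  have "mmul I (mpower I (curv I \<theta> x) 0) (\<theta> x) i j = (\<Sum>k\<in>I. if i = k then \<theta> x i j else 0)"
    unfolding mmul_def by (intro sum.cong) auto
  moreover have "mmul I (\<theta> x) (mpower I (curv I \<theta> x) 0) i j = (\<Sum>k\<in>I. if k = j then \<theta> x i j else 0)"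
    unfolding mmul_def by (intro sum.cong) auto
  ultimately show ?case using 0 ij(2) connection_onD(2)[OF \<theta>]
    by (simp del: mpower.simps) (simp add: ext_dm_def ext_d_const)
next
  case (Suc n)
  note c = connection_onD[OF \<theta>]
  let ?R = "curv I \<theta> x" and ?P = "mpower I (curv I \<theta> x) n"
  have "ext_dm (\<lambda>y. mpower I (curv I \<theta> y) (Suc n)) x i j =
      ext_d (\<lambda>y. mmul I (curv I \<theta> y) (mpower I (curv I \<theta> y) n) i j) x"
    unfolding ext_dm_def mpower_Suc_mmul ..
  also have "\<dots> = mmul I (ext_dm (curv I \<theta>) x) ?P i j + mmul I ?R (ext_dm (\<lambda>y. mpower I (curv I \<theta> y) n) x) i j"
    by (rule ext_dm_mmul_even[OF c(1) x smooth_matrix_on_curv[OF \<theta>]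
          smooth_matrix_on_mpower[OF c(1) smooth_matrix_on_curv[OF \<theta>]] _ Suc.prems ij(2)])
      (use homog_imp_even[OF homog_curv[OF \<theta> x Suc.prems]] in auto)
  also have "mmul I (ext_dm (curv I \<theta>) x) ?P i j =
      mmul I (\<lambda>i j. mmul I ?R (\<theta> x) i j - mmul I (\<theta> x) ?R i j) ?P i j"
    by (intro mmul_cong refl bianchi_identity[OF \<theta> x Suc.prems])
  also have "mmul I ?R (ext_dm (\<lambda>y. mpower I (curv I \<theta> y) n) x) i j =
      mmul I ?R (\<lambda>i j. mmul I ?P (\<theta> x) i j - mmul I (\<theta> x) ?P i j) i j"
    by (intro mmul_cong refl Suc.IH)
  finally show ?case
    unfolding mpower_Suc_mmul by (simp add: mmul_simps mmul_assoc)
qed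

text \<open>The trace of a commutator with a matrix of even forms vanishes.\<close>

lemma ext_d_mtrace_mpower_curv:
  assumes \<theta>: "connection_on U I \<theta>" and x: "x \<in> U"
  shows "ext_d (\<lambda>y. mtrace I (mpower I (curv I \<theta> y) n)) x = 0"
proof -
  note c = connection_onD[OF \<theta>]
  let ?P = "mpower I (curv I \<theta> x) n"
  have P: "even_ext (?P i j)" if "i \<in> I" "j \<in> I" for i j
    by (rule even_mpower[of I]) (use homog_imp_even[OF homog_curv[OF \<theta> x]] that in auto)
  have "ext_d (\<lambda>y. mtrace I (mpower I (curv I \<theta> y) n)) x = (\<Sum>i\<in>I. ext_dm (\<lambda>y. mpower I (curv I \<theta> y) n) x i i)"
    unfolding mtrace_def ext_dm_def
    using smooth_matrix_on_mpower[OF c(1) smooth_matrix_on_curv[OF \<theta>], of n]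
    by (intro ext_d_sum[OF c(1) _ x]) (auto simp: smooth_matrix_on_def)
  also have "\<dots> = (\<Sum>i\<in>I. \<Sum>k\<in>I. ?P i k * \<theta> x k i) - (\<Sum>i\<in>I. \<Sum>k\<in>I. \<theta> x i k * ?P k i)"
    by (simp add: ext_d_mpower_curv[OF \<theta> x] sum_subtractf mmul_def)
  also have "(\<Sum>i\<in>I. \<Sum>k\<in>I. ?P i k * \<theta> x k i) = (\<Sum>i\<in>I. \<Sum>k\<in>I. \<theta> x i k * ?P k i)"
    by (subst sum.swap) (intro sum.cong refl even_ext_commute P)
  finally show ?thesis by simp
qed

text \<open>Differentiate the transformation law \<open>g \<eta> = dg + \<theta> g\<close> and eliminate \<open>dg\<close> with the same law. So a change of
  frame conjugates the curvature.\<close>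

lemma curv_gauge_change:
  assumes \<theta>: "connection_on U I \<theta>" and \<eta>: "connection_on U I \<eta>" and x: "x \<in> U"
    and g: "smooth_matrix_on U I g" and ge: "\<And>y i j. y \<in> U \<Longrightarrow> i \<in> I \<Longrightarrow> j \<in> I \<Longrightarrow> even_ext (g y i j)"
    and eq: "\<And>y i j. y \<in> U \<Longrightarrow> i \<in> I \<Longrightarrow> j \<in> I \<Longrightarrow>
      mmul I (g y) (\<eta> y) i j = ext_dm g y i j + mmul I (\<theta> y) (g y) i j"
    and ij: "i \<in> I" "j \<in> I"
  shows "mmul I (g x) (curv I \<eta> x) i j = mmul I (curv I \<theta> x) (g x) i j"
proof -
  note c = connection_onD[OF \<theta>] and s = smooth_matrix_on_connection[OF \<theta>] smooth_matrix_on_connection[OF \<eta>]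
  have dg: "ext_dm g x i j = mmul I (g x) (\<eta> x) i j - mmul I (\<theta> x) (g x) i j" if "i \<in> I" "j \<in> I" for i j
    using eq[OF x that] by simp
  have "mmul I (ext_dm g x) (\<eta> x) i j + mmul I (g x) (ext_dm \<eta> x) i j =
      ext_d (\<lambda>y. mmul I (g y) (\<eta> y) i j) x"
    by (rule ext_dm_mmul_even[symmetric, OF c(1) x g s(2) _ ij]) (use ge x ij in auto)
  also have "\<dots> = ext_d (\<lambda>y. ext_dm g y i j + mmul I (\<theta> y) (g y) i j) x"
    by (rule ext_d_cong[OF c(1) x]) (rule eq[OF _ ij])
  also have "\<dots> = ext_d (\<lambda>y. ext_dm g y i j) x + ext_d (\<lambda>y. mmul I (\<theta> y) (g y) i j) x"
    using smooth_matrix_on_ext_dm[OF c(1) g] smooth_matrix_on_mmul[OF c(1) s(1) g] ij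
    by (intro ext_d_add[OF _ _ x]) (auto simp: smooth_matrix_on_def)
  also have "ext_d (\<lambda>y. ext_dm g y i j) x = 0"
    unfolding ext_dm_def using g ij by (intro ext_d_ext_d[OF c(1) x]) (auto simp: smooth_matrix_on_def)
  also have "ext_d (\<lambda>y. mmul I (\<theta> y) (g y) i j) x = mmul I (ext_dm \<theta> x) (g x) i j - mmul I (\<theta> x) (ext_dm g x) i j"
    by (rule ext_dm_mmul_one[OF c(1) x s(1) g _ ij]) (use c(4) x ij in auto)
  also have "mmul I (\<theta> x) (ext_dm g x) i j =
      mmul I (\<theta> x) (\<lambda>i j. mmul I (g x) (\<eta> x) i j - mmul I (\<theta> x) (g x) i j) i j"
    by (intro mmul_cong refl dg ij)
  also have "mmul I (ext_dm g x) (\<eta> x) i j =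
      mmul I (\<lambda>i j. mmul I (g x) (\<eta> x) i j - mmul I (\<theta> x) (g x) i j) (\<eta> x) i j"
    by (intro mmul_cong refl dg ij)
  finally have *: "mmul I (g x) (ext_dm \<eta> x) i j + mmul I (g x) (mmul I (\<eta> x) (\<eta> x)) i j =
      mmul I (ext_dm \<theta> x) (g x) i j + mmul I (mmul I (\<theta> x) (\<theta> x)) (g x) i j"
    by (simp add: mmul_simps mmul_assoc algebra_simps)
  have "mmul I (g x) (curv I \<eta> x) i j = mmul I (g x) (\<lambda>i j. ext_dm \<eta> x i j + mmul I (\<eta> x) (\<eta> x) i j) i j"
    by (intro mmul_cong refl curv_eq)
  also have "\<dots> = mmul I (\<lambda>i j. ext_dm \<theta> x i j + mmul I (\<theta> x) (\<theta> x) i j) (g x) i j"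
    unfolding mmul_simps using * .
  also have "\<dots> = mmul I (curv I \<theta> x) (g x) i j"
    by (intro mmul_cong refl curv_eq[symmetric])
  finally show ?thesis .
qed

text \<open>Cyclic invariance of the trace holds because the entries of the inverse are even and hence
  central.\<close>

lemma mtrace_mpower_conjugate:
  assumes I: "finite I" and ev: "\<And>i j. i \<in> I \<Longrightarrow> j \<in> I \<Longrightarrow> even_ext (g' i j)"
    and eq: "\<And>i j. i \<in> I \<Longrightarrow> j \<in> I \<Longrightarrow> mmul I g R i j = mmul I S g i j"
    and inv: "\<And>i j. i \<in> I \<Longrightarrow> j \<in> I \<Longrightarrow> mmul I g g' i j = (if i = j then 1 else 0)"
      "\<And>i j. i \<in> I \<Longrightarrow> j \<in> I \<Longrightarrow> mmul I g' g i j = (if i = j then 1 else 0)"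
  shows "mtrace I (mpower I R n) = mtrace I (mpower I S n)"
proof -
  have pw: "mmul I (mpower I S n) g i j = mmul I g (mpower I R n) i j" if "i \<in> I" "j \<in> I" for i j
    unfolding mmul_def
    by (rule mpower_intertwines[OF I I _ that]) (use eq in \<open>simp add: mmul_def\<close>)
  have "mtrace I (mpower I R n) = (\<Sum>i\<in>I. mmul I (mmul I g' g) (mpower I R n) i i)"
    unfolding mtrace_def
  proof (intro sum.cong refl)
    fix i assume i: "i \<in> I"
    have "mmul I (mmul I g' g) (mpower I R n) i i = (\<Sum>k\<in>I. if i = k then mpower I R n i i else 0)"
      unfolding mmul_def[of I "mmul I g' g"] using inv(2)[OF i] by (intro sum.cong) auto
    then show "mpower I R n i i = mmul I (mmul I g' g) (mpower I R n) i i" using i I by simp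
  qed
  also have "\<dots> = (\<Sum>i\<in>I. mmul I g' (mmul I (mpower I S n) g) i i)"
    unfolding mmul_assoc mmul_def[of I g']
    by (intro sum.cong refl arg_cong2[where f = "(*)"] pw[symmetric])
  also have "\<dots> = (\<Sum>i\<in>I. \<Sum>k\<in>I. mmul I (mpower I S n) g k i * g' i k)"
    unfolding mmul_def[of I g'] by (intro sum.cong refl even_ext_commute ev)
  also have "\<dots> = (\<Sum>k\<in>I. mmul I (mmul I (mpower I S n) g) g' k k)"
    unfolding mmul_def[of I _ g'] by (rule sum.swap)
  also have "\<dots> = (\<Sum>k\<in>I. mmul I (mpower I S n) (mmul I g g') k k)"
    by (simp add: mmul_assoc)
  also have "\<dots> = (\<Sum>k\<in>I. mpower I S n k k)"
  proof (intro sum.cong refl)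
    fix k assume k: "k \<in> I"
    have "mmul I (mpower I S n) (mmul I g g') k k = (\<Sum>i\<in>I. if i = k then mpower I S n k k else 0)"
      unfolding mmul_def[of I "mpower I S n"] using inv(1)[OF _ k] by (intro sum.cong) auto
    then show "mmul I (mpower I S n) (mmul I g g') k k = mpower I S n k k" using k I by simp
  qed
  finally show ?thesis by (simp add: mtrace_def)
qed

lemma mpower_Suc_right:
  assumes "finite I" "i \<in> I" "j \<in> I"
  shows "mpower I M (Suc n) i j = (\<Sum>k\<in>I. mpower I M n i k * M k j)"
proof -
  have "mpower I M (Suc 0) k j = M k j" if "k \<in> I" for k
  proof -
    have "mpower I M (Suc 0) k j = (\<Sum>l\<in>I. if l = j then M k j else 0)"
      unfolding mpower.simps by (intro sum.cong) auto
    then show ?thesis using assms by simp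
  qed
  then show ?thesis using mpower_add[OF assms(1,2), of M n "Suc 0" j] by simp
qed

lemma mpower_neg_transpose:
  assumes I: "finite I" and ev: "\<And>i j. i \<in> I \<Longrightarrow> j \<in> I \<Longrightarrow> even_ext (R i j)" and ij: "i \<in> I" "j \<in> I"
  shows "mpower I (\<lambda>i j. - R j i) n i j = (-1) ^ n * mpower I R n j i"
  using ij(1)
proof (induction n arbitrary: i)
  case 0
  then show ?case by simp
next
  case (Suc n)
  have "mpower I (\<lambda>i j. - R j i) (Suc n) i j = (\<Sum>k\<in>I. (-1) ^ Suc n * (mpower I R n j k * R k i))"
    unfolding mpower.simps
  proof (intro sum.cong refl)
    fix k assume k: "k \<in> I"
    have "R k i * mpower I R n j k = mpower I R n j k * R k i"
      by (rule even_ext_commute[OF ev[OF k Suc.prems]])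
    then show "- R k i * mpower I (\<lambda>i j. - R j i) n k j = (-1) ^ Suc n * (mpower I R n j k * R k i)"
      using Suc.IH[OF k] by (simp add: uminus_power_if)
  qed
  also have "\<dots> = (-1) ^ Suc n * mpower I R (Suc n) j i"
    by (simp only: mpower_Suc_right[OF I ij(2) Suc.prems] sum_distrib_left)
  finally show ?case .
qed

text \<open>Differentiate \<open>dH = \<theta>\<^sup>T H + H \<theta>\<close> and eliminate \<open>dH\<close>. Since one-forms anticommute, the transpose of
  \<open>\<theta> \<and> \<theta>\<close> is \<open>- \<theta>\<^sup>T \<and> \<theta>\<^sup>T\<close>. So the curvature of a metric connection is skew with respect to the metric.\<close>

lemma curv_metric_skew:
  assumes \<theta>: "connection_on U I \<theta>" and x: "x \<in> U"
    and H: "smooth_matrix_on U I H" and He: "\<And>y i j. y \<in> U \<Longrightarrow> i \<in> I \<Longrightarrow> j \<in> I \<Longrightarrow> even_ext (H y i j)"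
    and eq: "\<And>y i j. y \<in> U \<Longrightarrow> i \<in> I \<Longrightarrow> j \<in> I \<Longrightarrow>
      ext_dm H y i j = mmul I (\<lambda>i j. \<theta> y j i) (H y) i j + mmul I (H y) (\<theta> y) i j"
    and ij: "i \<in> I" "j \<in> I"
  shows "mmul I (\<lambda>i j. curv I \<theta> x j i) (H x) i j + mmul I (H x) (curv I \<theta> x) i j = 0"
proof -
  note c = connection_onD[OF \<theta>] and s = smooth_matrix_on_connection[OF \<theta>]
  let ?t = "\<lambda>i j. \<theta> x j i"
  have st: "smooth_matrix_on U I (\<lambda>y i j. \<theta> y j i)" using s by (auto simp: smooth_matrix_on_def)
  have dH: "ext_dm H x i j = mmul I ?t (H x) i j + mmul I (H x) (\<theta> x) i j" if "i \<in> I" "j \<in> I" for i j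
    using eq[OF x that] .
  have "0 = ext_d (\<lambda>y. ext_dm H y i j) x"
    unfolding ext_dm_def using H ij by (intro ext_d_ext_d[symmetric, OF c(1) x]) (auto simp: smooth_matrix_on_def)
  also have "\<dots> = ext_d (\<lambda>y. mmul I (\<lambda>i j. \<theta> y j i) (H y) i j + mmul I (H y) (\<theta> y) i j) x"
    by (rule ext_d_cong[OF c(1) x]) (rule eq[OF _ ij])
  also have "\<dots> = ext_d (\<lambda>y. mmul I (\<lambda>i j. \<theta> y j i) (H y) i j) x + ext_d (\<lambda>y. mmul I (H y) (\<theta> y) i j) x"
    using smooth_matrix_on_mmul[OF c(1) st H] smooth_matrix_on_mmul[OF c(1) H s] ij
    by (intro ext_d_add[OF _ _ x]) (auto simp: smooth_matrix_on_def)
  also have "ext_d (\<lambda>y. mmul I (\<lambda>i j. \<theta> y j i) (H y) i j) x =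
      mmul I (ext_dm (\<lambda>y i j. \<theta> y j i) x) (H x) i j - mmul I ?t (ext_dm H x) i j"
    by (rule ext_dm_mmul_one[OF c(1) x st H _ ij]) (use c(4) x ij in auto)
  also have "ext_d (\<lambda>y. mmul I (H y) (\<theta> y) i j) x = mmul I (ext_dm H x) (\<theta> x) i j + mmul I (H x) (ext_dm \<theta> x) i j"
    by (rule ext_dm_mmul_even[OF c(1) x H s _ ij]) (use He x ij in auto)
  also have "mmul I ?t (ext_dm H x) i j = mmul I ?t (\<lambda>i j. mmul I ?t (H x) i j + mmul I (H x) (\<theta> x) i j) i j"
    by (intro mmul_cong refl dH ij)
  also have "mmul I (ext_dm H x) (\<theta> x) i j = mmul I (\<lambda>i j. mmul I ?t (H x) i j + mmul I (H x) (\<theta> x) i j) (\<theta> x) i j"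
    by (intro mmul_cong refl dH ij)
  finally have *: "0 = mmul I (ext_dm (\<lambda>y i j. \<theta> y j i) x) (H x) i j - mmul I (mmul I ?t ?t) (H x) i j +
      (mmul I (H x) (ext_dm \<theta> x) i j + mmul I (H x) (mmul I (\<theta> x) (\<theta> x)) i j)"
    by (simp add: mmul_simps mmul_assoc algebra_simps)
  have "mmul I (\<lambda>i j. curv I \<theta> x j i) (H x) i j =
      mmul I (\<lambda>i j. ext_dm (\<lambda>y i j. \<theta> y j i) x i j - mmul I ?t ?t i j) (H x) i j"
  proof (intro mmul_cong refl)
    fix k assume k: "k \<in> I"
    have "mmul I (\<theta> x) (\<theta> x) k i = - mmul I ?t ?t i k"
      unfolding mmul_def sum_negf[symmetric]
      by (intro sum.cong refl homog_one_anticommute c(4) x k ij)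
    then show "curv I \<theta> x k i = ext_dm (\<lambda>y i j. \<theta> y j i) x i k - mmul I ?t ?t i k"
      by (simp add: curv_eq ext_dm_def)
  qed
  moreover have "mmul I (H x) (curv I \<theta> x) i j = mmul I (H x) (\<lambda>i j. ext_dm \<theta> x i j + mmul I (\<theta> x) (\<theta> x) i j) i j"
    by (intro mmul_cong refl curv_eq)
  ultimately show ?thesis using * by (simp add: mmul_simps)
qed

text \<open>The metric conjugates \<open>R\<close> into \<open>- R\<^sup>T\<close>, and the trace of an odd
  power of the latter is minus that of \<open>R\<close>.\<close>

lemma mtrace_odd_power_zero:
  assumes I: "finite I" and ev: "\<And>i j. i \<in> I \<Longrightarrow> j \<in> I \<Longrightarrow> even_ext (R i j)" "\<And>i j. i \<in> I \<Longrightarrow> j \<in> I \<Longrightarrow> even_ext (K i j)"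
    and skew: "\<And>i j. i \<in> I \<Longrightarrow> j \<in> I \<Longrightarrow> mmul I (\<lambda>i j. R j i) H i j + mmul I H R i j = 0"
    and inv: "\<And>i j. i \<in> I \<Longrightarrow> j \<in> I \<Longrightarrow> mmul I H K i j = (if i = j then 1 else 0)"
      "\<And>i j. i \<in> I \<Longrightarrow> j \<in> I \<Longrightarrow> mmul I K H i j = (if i = j then 1 else 0)"
    and n: "odd n"
  shows "mtrace I (mpower I R n) = 0"
proof (rule ext_eq_neg_imp_zero)
  have "mtrace I (mpower I R n) = mtrace I (mpower I (\<lambda>i j. - R j i) n)"
  proof (rule mtrace_mpower_conjugate[OF I ev(2) _ inv])
    fix i j assume ij: "i \<in> I" "j \<in> I"
    have "mmul I (\<lambda>i j. - R j i) H i j = - mmul I (\<lambda>i j. R j i) H i j" by (simp add: mmul_def sum_negf)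
    then show "mmul I H R i j = mmul I (\<lambda>i j. - R j i) H i j"
      using add.inverse_unique[OF skew[OF ij]] by simp
  qed
  also have "\<dots> = - mtrace I (mpower I R n)"
    unfolding mtrace_def sum_negf[symmetric]
    by (intro sum.cong refl) (use mpower_neg_transpose[OF I ev(1)] n in simp)
  finally show "mtrace I (mpower I R n) = - mtrace I (mpower I R n)" .
qed

text \<open>Inverting a positive definite matrix by induction on the index set (block elimination).\<close>

lemma positive_definite_solvable:
  fixes H :: "nat \<Rightarrow> nat \<Rightarrow> real"
  assumes "finite I"
    and "\<And>v. (\<exists>i\<in>I. v i \<noteq> 0) \<Longrightarrow> (\<Sum>i\<in>I. \<Sum>j\<in>I. H i j * v i * v j) > 0"
  shows "\<exists>z. \<forall>i\<in>I. (\<Sum>j\<in>I. H i j * z j) = b i"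
  using assms
proof (induction I arbitrary: b rule: finite_induct)
  case empty
  then show ?case by simp
next
  case (insert k I)
  have pos: "(\<Sum>i\<in>I. \<Sum>j\<in>I. H i j * v i * v j) > 0" if v: "\<exists>i\<in>I. v i \<noteq> 0" for v
  proof -
    let ?v = "v(k := 0)"
    have "(\<Sum>i\<in>insert k I. \<Sum>j\<in>insert k I. H i j * ?v i * ?v j) = (\<Sum>i\<in>I. \<Sum>j\<in>I. H i j * v i * v j)"
      using insert.hyps by (auto intro!: sum.cong)
    moreover have "\<exists>i\<in>insert k I. ?v i \<noteq> 0" using v insert.hyps by auto
    ultimately show ?thesis using insert.prems[of ?v] by simp
  qed
  have IH: "\<exists>z. \<forall>i\<in>I. (\<Sum>j\<in>I. H i j * z j) = c i" for c
    by (rule insert.IH) (rule pos)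
  obtain z where z: "\<forall>i\<in>I. (\<Sum>j\<in>I. H i j * z j) = b i" using IH by blast
  obtain y where y: "\<forall>i\<in>I. (\<Sum>j\<in>I. H i j * y j) = - H i k" using IH[of "\<lambda>i. - H i k"] by blast
  \<comment> \<open>With respect to \<open>H\<close>, \<open>v\<close> is orthogonal to the span of \<open>I\<close> and has positive square length \<open>d\<close>.\<close>
  define v where "v = y(k := 1)"
  define d where "d = (\<Sum>j\<in>insert k I. H k j * v j)"
  have Hv: "(\<Sum>j\<in>insert k I. H i j * v j) = (if i = k then d else 0)" if "i \<in> insert k I" for i
  proof (cases "i = k")
    case False
    then have "(\<Sum>j\<in>I. H i j * v j) = (\<Sum>j\<in>I. H i j * y j)"
      using insert.hyps by (intro sum.cong) (auto simp: v_def)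
    then show ?thesis using False that y insert.hyps by (simp add: v_def)
  qed (simp add: d_def)
  have "(\<Sum>i\<in>insert k I. \<Sum>j\<in>insert k I. H i j * v i * v j) =
      (\<Sum>i\<in>insert k I. v i * (\<Sum>j\<in>insert k I. H i j * v j))"
    by (simp only: sum_distrib_left mult_ac)
  also have "\<dots> = (\<Sum>i\<in>insert k I. if i = k then d else 0)"
  proof (intro sum.cong refl)
    fix i assume "i \<in> insert k I"
    moreover have "v k = 1" by (simp add: v_def)
    ultimately show "v i * (\<Sum>j\<in>insert k I. H i j * v j) = (if i = k then d else 0)"
      by (simp only: Hv) simp
  qed
  also have "\<dots> = d" using insert.hyps by simp
  finally have "(\<Sum>i\<in>insert k I. \<Sum>j\<in>insert k I. H i j * v i * v j) = d" .
  moreover have "\<exists>i\<in>insert k I. v i \<noteq> 0" by (simp add: v_def)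
  ultimately have d: "d > 0" using insert.prems[of v] by simp
  define z' where "z' = z(k := 0)"
  define t where "t = (b k - (\<Sum>j\<in>insert k I. H k j * z' j)) / d"
  have "(\<Sum>j\<in>insert k I. H i j * (z' j + t * v j)) = b i" if i: "i \<in> insert k I" for i
  proof -
    have "(\<Sum>j\<in>insert k I. H i j * (z' j + t * v j)) =
        (\<Sum>j\<in>insert k I. H i j * z' j) + t * (\<Sum>j\<in>insert k I. H i j * v j)"
      by (simp only: distrib_left sum.distrib sum_distrib_left mult_ac)
    also have "\<dots> = b i"
    proof (cases "i = k")
      case True
      then show ?thesis using d unfolding Hv[OF i] by (simp add: t_def del: sum.insert)
    next
      case False
      then have "(\<Sum>j\<in>I. H i j * z' j) = (\<Sum>j\<in>I. H i j * z j)"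
        using insert.hyps by (intro sum.cong) (auto simp: z'_def)
      then show ?thesis using False i z insert.hyps unfolding Hv[OF i] by (simp add: z'_def)
    qed
    finally show ?thesis .
  qed
  then show ?case by (intro exI[of _ "\<lambda>j. z' j + t * v j"]) blast
qed

lemma positive_definite_inverse:
  fixes H :: "nat \<Rightarrow> nat \<Rightarrow> real"
  assumes I: "finite I" and sym: "\<And>i j. i \<in> I \<Longrightarrow> j \<in> I \<Longrightarrow> H i j = H j i"
    and pos: "\<And>v. (\<exists>i\<in>I. v i \<noteq> 0) \<Longrightarrow> (\<Sum>i\<in>I. \<Sum>j\<in>I. H i j * v i * v j) > 0"
  obtains K where "\<And>i j. i \<in> I \<Longrightarrow> j \<in> I \<Longrightarrow> mmul I H K i j = (if i = j then 1 else 0)"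
    "\<And>i j. i \<in> I \<Longrightarrow> j \<in> I \<Longrightarrow> mmul I K H i j = (if i = j then 1 else 0)"
proof -
  have "\<forall>j. \<exists>z. \<forall>i\<in>I. (\<Sum>k\<in>I. H i k * z k) = (if i = j then 1 else 0)"
    by (intro allI positive_definite_solvable I pos)
  from choice[OF this] obtain z where
    z: "\<forall>j. \<forall>i\<in>I. (\<Sum>k\<in>I. H i k * z j k) = (if i = j then 1 else 0)" by blast
  define K where "K = (\<lambda>k j. z j k)"
  have HK: "mmul I H K i j = (if i = j then 1 else 0)" if "i \<in> I" for i j
    using z that by (simp add: mmul_def K_def)
  have KH: "mmul I (\<lambda>i j. K j i) H i j = (if i = j then 1 else 0)" if "i \<in> I" "j \<in> I" for i j
    using HK[OF that(2), of i] sym that unfolding mmul_def by (auto simp: mult.commute intro!: sum.cong)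
  have sym: "K i j = K j i" if "i \<in> I" "j \<in> I" for i j
  proof -
    have "(\<Sum>k\<in>I. (if i = k then 1 else 0) * K k j) = mmul I (mmul I (\<lambda>i j. K j i) H) K i j"
      unfolding mmul_def[of I "mmul I (\<lambda>i j. K j i) H"] using KH[OF that(1)] by (intro sum.cong) auto
    also have "\<dots> = (\<Sum>k\<in>I. K k i * (if k = j then 1 else 0))"
      unfolding mmul_assoc mmul_def[of I "\<lambda>i j. K j i"] using HK by (intro sum.cong) auto
    finally show ?thesis using I that by (simp add: if_distrib[of "(*) _"] if_distrib[of "\<lambda>a. a * _"] cong: if_cong)
  qed
  have "mmul I K H i j = (if i = j then 1 else 0)" if "i \<in> I" "j \<in> I" for i j
    unfolding KH[OF that, symmetric] by (rule mmul_cong) (use sym that in auto)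
  then show ?thesis using HK that[of K] by blast
qed

section \<open>Closed Chern--Weil forms\<close>

definition power_trace :: "('x, 'n::{finite,linorder}) cbundle \<Rightarrow> nat \<Rightarrow> ('x, 'n) form" where
  "power_trace E n c x = mtrace (fst (E c x)) (mpower (fst (E c x)) (curvature E c x) n)"

lemma times_differentiable_on_local:
  assumes "\<And>x. x \<in> S \<Longrightarrow> \<exists>V. open V \<and> x \<in> V \<and> times_differentiable_on k V f"
  shows "times_differentiable_on k S f"
  using assms
proof (induction k arbitrary: f)
  case 0
  have "isCont f x" if "x \<in> S" for x
    using 0[OF that] by (auto simp: continuous_on_eq_continuous_at)
  then show ?case by (simp add: continuous_at_imp_continuous_on)
next
  case (Suc k)
  have "f differentiable (at x)" if "x \<in> S" for x using Suc.prems[OF that] by auto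
  moreover have "times_differentiable_on k S (\<lambda>x. frechet_derivative f (at x) v)" for v
    by (rule Suc.IH) (use Suc.prems in fastforce)
  ultimately show ?case by simp
qed

lemma smooth_ext_on_local:
  assumes "\<And>x. x \<in> S \<Longrightarrow> \<exists>V. open V \<and> x \<in> V \<and> smooth_ext_on V \<omega>"
  shows "smooth_ext_on S \<omega>"
  unfolding smooth_ext_on_def smooth_on_def
  by (intro allI times_differentiable_on_local) (use assms in \<open>fastforce simp: smooth_ext_on_def smooth_on_def\<close>)

lemma real_ext_mpower:
  assumes "\<And>i j. i \<in> I \<Longrightarrow> j \<in> I \<Longrightarrow> real_ext (M i j)" "i \<in> I" "j \<in> I"
  shows "real_ext (mpower I M n i j)"
  using assms(2)
proof (induction n arbitrary: i)
  case (Suc n)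
  then show ?case unfolding mpower.simps by (intro real_ext_sum real_ext_mult assms(1)) auto
qed (auto simp: real_ext_simps)

lemma real_ext_curv:
  assumes \<theta>: "connection_on U I \<theta>" and x: "x \<in> U"
    and r: "\<And>y i j. y \<in> U \<Longrightarrow> i \<in> I \<Longrightarrow> j \<in> I \<Longrightarrow> real_ext (\<theta> y i j)" and ij: "i \<in> I" "j \<in> I"
  shows "real_ext (curv I \<theta> x i j)"
  unfolding curv_def
  by (intro real_ext_simps real_ext_sum real_ext_mult real_ext_ext_d[OF connection_onD(1)[OF \<theta>] x]
      connection_onD(3)[OF \<theta>] r ij x)

lemma homog_mtrace_mpower_curv:
  assumes "connection_on U I \<theta>" "x \<in> U"
  shows "homog (2 * n) (mtrace I (mpower I (curv I \<theta> x) n))"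
  unfolding mtrace_def
proof (rule homog_sum)
  fix i assume i: "i \<in> I"
  show "homog (2 * n) (mpower I (curv I \<theta> x) n i i)"
  proof (rule homog_mpower[OF _ i i])
    show "homog 2 (curv I \<theta> x j k)" if "j \<in> I" "k \<in> I" for j k
      by (rule homog_curv[OF assms that])
  qed
qed

text \<open>Smoothness, reality, degree and closedness are local, so it suffices to describe the trace near each point by
  some connection matrix, which may differ from the frame that the bundle assigns to the nearby points.\<close>

lemma closed_form_power_traceI:
  assumes op: "\<And>c. c \<in> A \<Longrightarrow> open (snd c ` fst c)"
    and loc: "\<And>c x. c \<in> A \<Longrightarrow> x \<in> snd c ` fst c \<Longrightarrow> \<exists>U I \<theta>. x \<in> U \<and> connection_on U I \<theta> \<and>
      (\<forall>y\<in>U. \<forall>i\<in>I. \<forall>j\<in>I. real_ext (\<theta> y i j)) \<and>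
      (\<forall>y\<in>U. power_trace E n c y = mtrace I (mpower I (curv I \<theta> y) n))"
    and change: "\<And>c d x. c \<in> A \<Longrightarrow> d \<in> A \<Longrightarrow> x \<in> snd c ` (fst c \<inter> fst d) \<Longrightarrow>
      power_trace E n c x = pullback (jacobian c d x) (power_trace E n d (transition c d x))"
  shows "closed_form A (2 * n) (power_trace E n)"
proof -
  have sm: "smooth_ext_on (snd c ` fst c) (power_trace E n c)" if c: "c \<in> A" for c
  proof (rule smooth_ext_on_local)
    fix x assume x: "x \<in> snd c ` fst c"
    from loc[OF c x] obtain U I \<theta> where U: "x \<in> U" "connection_on U I \<theta>"
      "\<forall>y\<in>U. power_trace E n c y = mtrace I (mpower I (curv I \<theta> y) n)"
      by (elim exE conjE)
    note oU = connection_onD(1)[OF U(2)]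
    have "smooth_ext_on U (\<lambda>y. mtrace I (mpower I (curv I \<theta> y) n))"
      using smooth_matrix_on_mpower[OF oU smooth_matrix_on_curv[OF U(2)], of n] unfolding mtrace_def
      by (intro smooth_ext_on_sum oU) (auto simp: smooth_matrix_on_def)
    then have "smooth_ext_on U (power_trace E n c)"
      using smooth_ext_on_cong[OF oU, of "power_trace E n c" "\<lambda>y. mtrace I (mpower I (curv I \<theta> y) n)"] U(3)
      by simp
    then show "\<exists>V. open V \<and> x \<in> V \<and> smooth_ext_on V (power_trace E n c)" using U oU by blast
  qed
  have pt: "real_ext (power_trace E n c x) \<and> homog (2 * n) (power_trace E n c x) \<and> ext_d (power_trace E n c) x = 0"
    if cx: "c \<in> A" "x \<in> snd c ` fst c" for c x
  proof -
    from loc[OF cx(1) cx(2)] obtain U I \<theta> where U: "x \<in> U" "connection_on U I \<theta>"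
      "\<forall>y\<in>U. power_trace E n c y = mtrace I (mpower I (curv I \<theta> y) n)"
      and r: "\<forall>y\<in>U. \<forall>i\<in>I. \<forall>j\<in>I. real_ext (\<theta> y i j)"
      by (elim exE conjE)
    have "real_ext (mtrace I (mpower I (curv I \<theta> x) n))"
      unfolding mtrace_def
      by (intro real_ext_sum real_ext_mpower real_ext_curv[OF U(2,1)]) (use r in auto)
    moreover have "ext_d (power_trace E n c) x = ext_d (\<lambda>y. mtrace I (mpower I (curv I \<theta> y) n)) x"
      by (rule ext_d_cong[OF connection_onD(1)[OF U(2)] U(1)]) (use U(3) in blast)
    ultimately show ?thesis
      using U homog_mtrace_mpower_curv[OF U(2,1), of n] ext_d_mtrace_mpower_curv[OF U(2,1), of n] by simp
  qed
  show ?thesis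
    unfolding closed_form_def diff_form_def
  proof (intro conjI ballI allI)
    fix c I assume "c \<in> A"
    then show "smooth_on (snd c ` (fst c \<inter> UNIV)) (\<lambda>x. ext_coeff (power_trace E n c x) I)"
      using sm by (simp add: smooth_ext_on_def)
  next
    fix c x I assume "c \<in> A" "x \<in> snd c ` (fst c \<inter> UNIV)"
    then show "ext_coeff (power_trace E n c x) I \<in> \<real>"
      "card I \<noteq> 2 * n \<longrightarrow> ext_coeff (power_trace E n c x) I = 0"
      using pt[of c x] by (auto simp: real_ext_def homog_def)
  qed (use change pt in auto)
qed

subsection \<open>Charts\<close>

lemma smooth_atlasD:
  assumes "smooth_atlas A" "c \<in> A"
  shows "open (snd c ` fst c)" "open (fst c)"
    "\<And>p. p \<in> fst c \<Longrightarrow> chart_inv c (snd c p) = p"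
    "\<And>x. x \<in> snd c ` fst c \<Longrightarrow> snd c (chart_inv c x) = x"
    "\<And>x. x \<in> snd c ` fst c \<Longrightarrow> chart_inv c x \<in> fst c"
    "continuous_on (snd c ` fst c) (chart_inv c)"
proof -
  have h: "open (fst c)" "open (snd c ` fst c)"
    "homeomorphism (fst c) (snd c ` fst c) (snd c) (chart_inv c)"
    using assms by (auto simp: smooth_atlas_def)
  then show "open (snd c ` fst c)" "open (fst c)" "continuous_on (snd c ` fst c) (chart_inv c)"
    by (auto simp: homeomorphism_def)
  show i: "chart_inv c (snd c p) = p" if "p \<in> fst c" for p using h(3) that by (auto simp: homeomorphism_def)
  show "snd c (chart_inv c x) = x" "chart_inv c x \<in> fst c" if "x \<in> snd c ` fst c" for x
    using that i by auto
qed

lemma chart_image_open: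
  assumes A: "smooth_atlas A" "c \<in> A" and W: "open W"
  shows "open (snd c ` (fst c \<inter> W))"
proof -
  note a = smooth_atlasD[OF A]
  have "snd c ` (fst c \<inter> W) = chart_inv c -` W \<inter> snd c ` fst c" using a(3) by force
  then show ?thesis using a(6) W by (simp add: continuous_on_open_vimage[OF a(1)])
qed

lemma transition_facts:
  assumes A: "smooth_atlas A" "c \<in> A" "d \<in> A"
  defines "U \<equiv> snd c ` (fst c \<inter> fst d)"
  shows "open U" "smooth_on U (transition c d)" "transition c d ` U \<subseteq> snd d ` (fst c \<inter> fst d)"
    "\<And>x. x \<in> U \<Longrightarrow> chart_inv d (transition c d x) = chart_inv c x"
proof -
  note a = smooth_atlasD[OF A(1,2)] and b = smooth_atlasD[OF A(1,3)]
  show "open U" unfolding U_def by (rule chart_image_open[OF A(1,2) b(2)])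
  show "smooth_on U (transition c d)" using A by (auto simp: smooth_atlas_def U_def)
  show "transition c d ` U \<subseteq> snd d ` (fst c \<inter> fst d)" using a(3) by (force simp: U_def transition_def)
  show "chart_inv d (transition c d x) = chart_inv c x" if "x \<in> U" for x
    using that a(3) b(3) by (auto simp: U_def transition_def)
qed

subsection \<open>Real one-forms\<close>

definition one_form :: "('n::{finite,linorder} \<Rightarrow> real) \<Rightarrow> 'n ext" where
  "one_form f = (\<Sum>m\<in>UNIV. ext_const (of_real (f m)) * dx m)"

abbreviation rconst :: "real \<Rightarrow> 'n::{finite,linorder} ext" where
  "rconst r \<equiv> ext_const (of_real r)"

lemma one_form_add: "one_form f + one_form g = one_form (\<lambda>m. f m + g m)"
  by (simp add: one_form_def ext_const_simps distrib_right sum.distrib)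

lemma rconst_mult_one_form: "rconst r * one_form f = one_form (\<lambda>m. r * f m)"
  by (simp add: one_form_def sum_distrib_left ext_const_const_mult)

lemma one_form_mult_rconst: "one_form f * rconst r = one_form (\<lambda>m. f m * r)"
  by (simp add: ext_const_commute rconst_mult_one_form mult.commute)

lemma one_form_zero: "one_form (\<lambda>m. 0) = 0"
  by (simp add: one_form_def ext_const_simps)

lemma one_form_sum: "(\<Sum>k\<in>K. one_form (f k)) = one_form (\<lambda>m. \<Sum>k\<in>K. f k m)"
  by (induction K rule: infinite_finite_induct) (simp_all add: one_form_zero one_form_add)

lemma homog_one_form: "homog 1 (one_form f)"
  unfolding one_form_def by (rule homog_linear_form)

lemma real_ext_one_form: "real_ext (one_form f)"
  unfolding one_form_def by (intro real_ext_sum real_ext_mult real_ext_simps)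

lemma pullback_one_form: "pullback J (one_form f) = one_form (\<lambda>m. \<Sum>n\<in>UNIV. f n * J $ n $ m)"
proof -
  have "pullback J (one_form f) = (\<Sum>n\<in>UNIV. rconst (f n) * one_form (\<lambda>m. J $ n $ m))"
    unfolding one_form_def by (simp add: pullback_sum pullback_simps)
  then show ?thesis by (simp add: rconst_mult_one_form one_form_sum)
qed

lemma smooth_ext_on_rconst: "open U \<Longrightarrow> smooth_on U f \<Longrightarrow> smooth_ext_on U (\<lambda>y. rconst (f y))"
  by (intro smooth_ext_on_ext_const smooth_on_linear[OF bounded_linear_of_real])

lemma smooth_ext_on_one_form:
  assumes "open U" "\<And>m. smooth_on U (\<lambda>y. f y m)"
  shows "smooth_ext_on U (\<lambda>y. one_form (f y))"
  unfolding one_form_def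
  by (intro smooth_ext_on_sum smooth_ext_on_mult smooth_ext_on_rconst smooth_ext_on_const assms)

lemma ext_d_rconst:
  assumes "f differentiable (at x)"
  shows "ext_d (\<lambda>y. rconst (f y)) x = one_form (\<lambda>m. frechet_derivative f (at x) (axis m 1))"
proof -
  have "partial m (\<lambda>y. rconst (f y)) x = rconst (frechet_derivative f (at x) (axis m 1))" for m
  proof (rule ext_eqI)
    fix I show "ext_coeff (partial m (\<lambda>y. rconst (f y)) x) I = ext_coeff (rconst (frechet_derivative f (at x) (axis m 1))) I"
      by (cases "I = {}") (simp_all add: frechet_derivative_linear[OF bounded_linear_of_real assms])
  qed
  then show ?thesis by (simp add: ext_d_eq one_form_def ext_const_commute)
qed

subsection \<open>The Levi-Civita connection\<close>

definition dcomp :: "('n rvec \<Rightarrow> 'n rmat) \<Rightarrow> 'n::finite rvec \<Rightarrow> 'n \<Rightarrow> 'n \<Rightarrow> 'n \<Rightarrow> real" where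
  "dcomp g x m a b = frechet_derivative (\<lambda>y. g y $ a $ b) (at x) (axis m 1)"

lemma christoffel_eq:
  "christoffel g x k i j =
     (\<Sum>l\<in>UNIV. matrix_inv (g x) $ k $ l * (dcomp g x i j l + dcomp g x j i l - dcomp g x l i j)) / 2"
  by (simp add: christoffel_def dcomp_def Let_def)

lemma matrix_mult_matrix_inv:
  "invertible M \<Longrightarrow> M ** matrix_inv M = mat 1" "invertible M \<Longrightarrow> matrix_inv M ** M = mat 1"
  unfolding invertible_def matrix_inv_def by (rule someI2_ex; blast)+

locale metric_on =
  fixes U :: "'n::finite rvec set" and g :: "'n rvec \<Rightarrow> 'n rmat"
  assumes open_U: "open U" and smooth_g: "smooth_on U g"
    and sym_g: "\<And>y. y \<in> U \<Longrightarrow> transpose (g y) = g y"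
    and pos_g: "\<And>y v. y \<in> U \<Longrightarrow> v \<noteq> 0 \<Longrightarrow> v \<bullet> (g y *v v) > 0"
begin

lemma g_commute: "y \<in> U \<Longrightarrow> g y $ a $ b = g y $ b $ a"
  using sym_g[of y] by (metis transpose_def vec_lambda_beta)

lemma dcomp_commute:
  assumes "y \<in> U" shows "dcomp g y m a b = dcomp g y m b a"
  unfolding dcomp_def
  by (subst frechet_derivative_eq_on_open[OF open_U assms, of "\<lambda>y. g y $ a $ b" "\<lambda>y. g y $ b $ a"])
    (simp_all add: g_commute)

lemma invertible_g: assumes "y \<in> U" shows "invertible (g y)"
proof -
  have "v = 0" if "g y *v v = 0" for v using pos_g[OF assms, of v] that by force
  then have "\<exists>B. B ** g y = mat 1" by (simp add: matrix_left_invertible_ker)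
  then show ?thesis by (simp add: invertible_left_inverse)
qed

lemma smooth_g_comp: "smooth_on U (\<lambda>y. g y $ a $ b)"
  by (intro smooth_on_linear[OF bounded_linear_vec_nth] smooth_on_linear[OF bounded_linear_vec_nth open_U smooth_g] open_U)

lemma christoffel_commute: "y \<in> U \<Longrightarrow> christoffel g y k i j = christoffel g y k j i"
  unfolding christoffel_eq using dcomp_commute[of y] by (simp add: add.commute)

lemma christoffel_lowered:
  assumes y: "y \<in> U"
  shows "(\<Sum>k\<in>UNIV. christoffel g y k i j * g y $ k $ b) = (dcomp g y i j b + dcomp g y j i b - dcomp g y b i j) / 2"
proof -
  let ?D = "\<lambda>l. dcomp g y i j l + dcomp g y j i l - dcomp g y l i j"
  have "g y ** matrix_inv (g y) = mat 1" by (rule matrix_mult_matrix_inv(1)[OF invertible_g[OF y]])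
  then have inv: "(\<Sum>k\<in>UNIV. g y $ b $ k * matrix_inv (g y) $ k $ l) = (if b = l then 1 else 0)" for l
    by (simp add: matrix_matrix_mult_def mat_def vec_eq_iff)
  have "(\<Sum>k\<in>UNIV. christoffel g y k i j * g y $ k $ b) =
      (\<Sum>k\<in>UNIV. \<Sum>l\<in>UNIV. g y $ b $ k * matrix_inv (g y) $ k $ l * ?D l / 2)"
    unfolding christoffel_eq using g_commute[OF y]
    by (intro sum.cong refl) (simp add: sum_divide_distrib sum_distrib_left sum_distrib_right mult_ac)
  also have "\<dots> = (\<Sum>l\<in>UNIV. (\<Sum>k\<in>UNIV. g y $ b $ k * matrix_inv (g y) $ k $ l) * ?D l / 2)"
    by (subst sum.swap) (simp add: sum_divide_distrib sum_distrib_right)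
  also have "\<dots> = ?D b / 2" unfolding inv by (simp add: if_distrib[of "\<lambda>a. a * _ / 2"] cong: if_cong)
  finally show ?thesis .
qed

text \<open>In the sum of the two lowered symbols the derivatives in the directions \<open>a\<close> and
  \<open>b\<close> cancel.\<close>

lemma christoffel_metric:
  assumes y: "y \<in> U"
  shows "dcomp g y m a b = (\<Sum>k\<in>UNIV. christoffel g y k m a * g y $ k $ b) + (\<Sum>k\<in>UNIV. christoffel g y k m b * g y $ k $ a)"
  unfolding christoffel_lowered[OF y] using dcomp_commute[OF y] by (simp add: field_simps)

lemma smooth_on_det:
  fixes M :: "'n rvec \<Rightarrow> real^'n^'n"
  assumes "\<And>i j. smooth_on U (\<lambda>y. M y $ i $ j)" shows "smooth_on U (\<lambda>y. det (M y))"
  unfolding det_def by (intro smooth_on_sum smooth_on_mult smooth_on_const smooth_on_prod assms open_U)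

lemma smooth_matrix_inv: "smooth_on U (\<lambda>y. matrix_inv (g y) $ k $ l)"
proof -
  \<comment> \<open>The numerator in Cramer's rule.\<close>
  define N where "N = (\<lambda>y. (\<chi> i j. if j = k then axis l 1 $ i else g y $ i $ j) :: real^'n^'n)"
  have nz: "det (g y) \<noteq> 0" if "y \<in> U" for y using invertible_g[OF that] by (simp add: invertible_det_nz)
  have eq: "matrix_inv (g y) $ k $ l = det (N y) * inverse (det (g y))" if y: "y \<in> U" for y
  proof -
    have "g y ** matrix_inv (g y) = mat 1" by (rule matrix_mult_matrix_inv(1)[OF invertible_g[OF y]])
    then have "g y *v (matrix_inv (g y) *v axis l 1) = axis l 1"
      by (simp add: matrix_vector_mul_assoc)
    then have "matrix_inv (g y) *v axis l 1 = (\<chi> k. det (\<chi> i j. if j = k then axis l 1 $ i else g y $ i $ j) / det (g y))"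
      by (simp add: cramer[OF nz[OF y]])
    moreover have "(matrix_inv (g y) *v axis l 1) $ k = matrix_inv (g y) $ k $ l"
      by (simp add: matrix_vector_mult_basis column_def)
    ultimately show ?thesis by (simp add: N_def divide_inverse)
  qed
  have "smooth_on U (\<lambda>y. N y $ i $ j)" for i j
    by (cases "j = k") (simp_all add: N_def smooth_on_const smooth_g_comp)
  then have "smooth_on U (\<lambda>y. det (N y) * inverse (det (g y)))"
    by (intro smooth_on_mult smooth_on_inverse smooth_on_det smooth_g_comp open_U nz)
  then show ?thesis using smooth_on_cong[OF open_U eq] by simp
qed

lemma smooth_christoffel: "smooth_on U (\<lambda>y. christoffel g y k i j)"
proof -
  have "smooth_on U (\<lambda>y. dcomp g y m a b)" for m a b
    unfolding dcomp_def by (intro smooth_on_frechet_derivative smooth_g_comp)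
  then have "smooth_on U (\<lambda>y. (\<Sum>l\<in>UNIV. matrix_inv (g y) $ k $ l * (dcomp g y i j l + dcomp g y j i l - dcomp g y l i j)) * (1 / 2))"
    by (intro smooth_on_mult smooth_on_sum smooth_on_add smooth_on_minus smooth_on_const smooth_matrix_inv open_U)
  then show ?thesis by (simp add: christoffel_eq)
qed

end

text \<open>The Koszul formula: the lowered coefficients \<open>L\<close> of a symmetric connection are determined by the derivatives
  \<open>P\<close> of a metric with which it is compatible.\<close>

lemma koszul_unique:
  fixes L L' P :: "'n \<Rightarrow> 'n \<Rightarrow> 'n \<Rightarrow> real"
  assumes "\<And>b m a. L b m a = L b a m" "\<And>b m a. L' b m a = L' b a m"
    "\<And>m a b. P m a b = L b m a + L a m b" "\<And>m a b. P m a b = L' b m a + L' a m b"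
  shows "L b m a = L' b m a"
  using assms(1)[of b m a] assms(1)[of a m b] assms(1)[of m a b]
    assms(2)[of b m a] assms(2)[of a m b] assms(2)[of m a b]
    assms(3)[of m a b] assms(3)[of a b m] assms(3)[of b m a]
    assms(4)[of m a b] assms(4)[of a b m] assms(4)[of b m a]
  by linarith

subsection \<open>Naturality of the Levi-Civita connection\<close>

lemma sum_swap_14:
  fixes F :: "'a::finite \<Rightarrow> 'b::finite \<Rightarrow> 'c::finite \<Rightarrow> 'd::finite \<Rightarrow> 'e::comm_monoid_add"
  shows "(\<Sum>p\<in>UNIV. \<Sum>q\<in>UNIV. \<Sum>n\<in>UNIV. \<Sum>k\<in>UNIV. F p q n k) =
    (\<Sum>k\<in>UNIV. \<Sum>q\<in>UNIV. \<Sum>n\<in>UNIV. \<Sum>p\<in>UNIV. F p q n k)"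
proof -
  have "(\<Sum>p\<in>UNIV. \<Sum>q\<in>UNIV. \<Sum>n\<in>UNIV. \<Sum>k\<in>UNIV. F p q n k) =
      (\<Sum>p\<in>UNIV. \<Sum>k\<in>UNIV. \<Sum>q\<in>UNIV. \<Sum>n\<in>UNIV. F p q n k)"
    by (intro sum.cong refl) (simp add: sum.swap[of _ "UNIV :: 'd set"])
  also have "\<dots> = (\<Sum>k\<in>UNIV. \<Sum>p\<in>UNIV. \<Sum>q\<in>UNIV. \<Sum>n\<in>UNIV. F p q n k)" by (rule sum.swap)
  also have "\<dots> = (\<Sum>k\<in>UNIV. \<Sum>q\<in>UNIV. \<Sum>n\<in>UNIV. \<Sum>p\<in>UNIV. F p q n k)"
    by (intro sum.cong refl) (simp add: sum.swap[of _ _ "UNIV :: 'a set"])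
  finally show ?thesis .
qed

locale metric_change =
  c: metric_on U g + d: metric_on V h
  for U V :: "'n::finite rvec set" and g h +
  fixes \<phi> :: "'n rvec \<Rightarrow> 'n rvec" and J
  assumes smooth_\<phi>: "smooth_on U \<phi>" and \<phi>_V: "\<phi> ` U \<subseteq> V"
    and J_eq: "J = (\<lambda>y. matrix (frechet_derivative \<phi> (at y)))"
    and metric_eq: "\<And>y. y \<in> U \<Longrightarrow> g y = transpose (J y) ** h (\<phi> y) ** J y"
begin

lemma J_comp: "J y $ p $ a = frechet_derivative \<phi> (at y) (axis a 1) $ p"
  by (simp add: J_eq matrix_def)

lemma J_comp': "y \<in> U \<Longrightarrow> J y $ p $ a = frechet_derivative (\<lambda>z. \<phi> z $ p) (at y) (axis a 1)"
  unfolding J_comp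
  by (rule frechet_derivative_linear[OF bounded_linear_vec_nth smooth_on_differentiable[OF smooth_\<phi>], symmetric])

lemma smooth_\<phi>_comp: "smooth_on U (\<lambda>y. \<phi> y $ p)"
  by (rule smooth_on_linear[OF bounded_linear_vec_nth c.open_U smooth_\<phi>])

lemma smooth_J: "smooth_on U (\<lambda>y. J y $ p $ a)"
  using smooth_on_cong[OF c.open_U, of "\<lambda>y. J y $ p $ a" "\<lambda>y. frechet_derivative (\<lambda>z. \<phi> z $ p) (at y) (axis a 1)"]
    J_comp' smooth_on_frechet_derivative[OF smooth_\<phi>_comp] by simp

definition dJ where "dJ x m p a = frechet_derivative (\<lambda>y. J y $ p $ a) (at x) (axis m 1)"

lemma dJ_commute: assumes x: "x \<in> U" shows "dJ x m p a = dJ x a p m"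
proof -
  have "dJ x m p a = frechet_derivative (\<lambda>y. frechet_derivative (\<lambda>z. \<phi> z $ p) (at y) (axis a 1)) (at x) (axis m 1)" for m a
    unfolding dJ_def
    using frechet_derivative_eq_on_open[OF c.open_U x, of "\<lambda>y. J y $ p $ a"
        "\<lambda>y. frechet_derivative (\<lambda>z. \<phi> z $ p) (at y) (axis a 1)"] J_comp' by simp
  then show ?thesis using second_derivative_symmetric_real[OF c.open_U x smooth_\<phi>_comp] by metis
qed

lemma g_comp: "y \<in> U \<Longrightarrow> g y $ a $ b = (\<Sum>p\<in>UNIV. \<Sum>q\<in>UNIV. J y $ p $ a * h (\<phi> y) $ p $ q * J y $ q $ b)"
  by (simp add: metric_eq matrix_matrix_mult_def transpose_def sum_distrib_right) (rule sum.swap)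

lemma h_chain:
  assumes x: "x \<in> U"
  shows "((\<lambda>y. h (\<phi> y) $ p $ q) has_derivative
    (\<lambda>v. frechet_derivative (\<lambda>z. h z $ p $ q) (at (\<phi> x)) (frechet_derivative \<phi> (at x) v))) (at x)"
    "frechet_derivative (\<lambda>z. h z $ p $ q) (at (\<phi> x)) (frechet_derivative \<phi> (at x) (axis m 1)) =
      (\<Sum>n\<in>UNIV. J x $ n $ m * dcomp h (\<phi> x) n p q)"
proof -
  have hd: "(\<lambda>z. h z $ p $ q) differentiable (at (\<phi> x))"
    using smooth_on_differentiable[OF d.smooth_g_comp] \<phi>_V x by blast
  show "((\<lambda>y. h (\<phi> y) $ p $ q) has_derivative
    (\<lambda>v. frechet_derivative (\<lambda>z. h z $ p $ q) (at (\<phi> x)) (frechet_derivative \<phi> (at x) v))) (at x)"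
    by (rule has_derivative_compose[OF has_derivative_frechet[OF smooth_on_differentiable[OF smooth_\<phi> x]]
          has_derivative_frechet[OF hd]])
  let ?w = "frechet_derivative \<phi> (at x) (axis m 1)" and ?D = "frechet_derivative (\<lambda>z. h z $ p $ q) (at (\<phi> x))"
  have lin: "linear ?D" using linear_frechet_derivative[OF hd] .
  have "?w = (\<Sum>n\<in>UNIV. (?w $ n) *\<^sub>R axis n 1)" by (simp add: basis_expansion flip: scalar_mult_eq_scaleR)
  then have "?D ?w = ?D (\<Sum>n\<in>UNIV. (?w $ n) *\<^sub>R axis n 1)" by simp
  then show "?D ?w = (\<Sum>n\<in>UNIV. J x $ n $ m * dcomp h (\<phi> x) n p q)"
    by (simp add: linear_sum[OF lin] linear_scale[OF lin] J_comp dcomp_def)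
qed

lemma dcomp_g:
  assumes x: "x \<in> U"
  shows "dcomp g x m a b = (\<Sum>p\<in>UNIV. \<Sum>q\<in>UNIV.
     J x $ p $ a * h (\<phi> x) $ p $ q * dJ x m q b +
     (J x $ p $ a * (\<Sum>n\<in>UNIV. J x $ n $ m * dcomp h (\<phi> x) n p q) + dJ x m p a * h (\<phi> x) $ p $ q) * J x $ q $ b)"
proof -
  let ?d = "\<lambda>p a. frechet_derivative (\<lambda>y. J y $ p $ a) (at x)"
  have Jd: "((\<lambda>y. J y $ p $ a) has_derivative ?d p a) (at x)" for p a
    by (rule has_derivative_frechet[OF smooth_on_differentiable[OF smooth_J x]])
  have "dcomp g x m a b = frechet_derivative (\<lambda>y. \<Sum>p\<in>UNIV. \<Sum>q\<in>UNIV. J y $ p $ a * h (\<phi> y) $ p $ q * J y $ q $ b) (at x) (axis m 1)"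
    unfolding dcomp_def
    using frechet_derivative_eq_on_open[OF c.open_U x, of "\<lambda>y. g y $ a $ b"
        "\<lambda>y. \<Sum>p\<in>UNIV. \<Sum>q\<in>UNIV. J y $ p $ a * h (\<phi> y) $ p $ q * J y $ q $ b"] g_comp by simp
  also have "frechet_derivative (\<lambda>y. \<Sum>p\<in>UNIV. \<Sum>q\<in>UNIV. J y $ p $ a * h (\<phi> y) $ p $ q * J y $ q $ b) (at x) =
    (\<lambda>v. \<Sum>p\<in>UNIV. \<Sum>q\<in>UNIV. J x $ p $ a * h (\<phi> x) $ p $ q * ?d q b v +
      (J x $ p $ a * frechet_derivative (\<lambda>z. h z $ p $ q) (at (\<phi> x)) (frechet_derivative \<phi> (at x) v) +
        ?d p a v * h (\<phi> x) $ p $ q) * J x $ q $ b)"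
    by (intro frechet_derivative_eqI has_derivative_sum has_derivative_mult Jd h_chain(1)[OF x])
  finally show ?thesis by (simp add: h_chain(2)[OF x] dJ_def)
qed

text \<open>The connection of \<open>h\<close>, pulled back along \<open>\<phi>\<close>, in the frame moved by \<open>J\<close>.\<close>

definition X where
  "X x p m a = dJ x m p a + (\<Sum>n\<in>UNIV. \<Sum>k\<in>UNIV. J x $ n $ m * christoffel h (\<phi> x) p n k * J x $ k $ a)"

text \<open>These coefficients, lowered with \<open>h\<close> and \<open>J\<close>. If \<open>X\<close>
  comes from Christoffel symbols of \<open>g\<close>, moved by \<open>J\<close>, then these are the
  Christoffel symbols lowered with \<open>g = J\<^sup>T h J\<close>.\<close>

definition LX where
  "LX x b m a = (\<Sum>p\<in>UNIV. \<Sum>q\<in>UNIV. X x p m a * h (\<phi> x) $ p $ q * J x $ q $ b)"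

lemma X_commute: assumes x: "x \<in> U" shows "X x p m a = X x p a m"
proof -
  have "\<phi> x \<in> V" using \<phi>_V x by auto
  then have "(\<Sum>n\<in>UNIV. \<Sum>k\<in>UNIV. J x $ n $ m * christoffel h (\<phi> x) p n k * J x $ k $ a) =
      (\<Sum>n\<in>UNIV. \<Sum>k\<in>UNIV. J x $ k $ a * christoffel h (\<phi> x) p k n * J x $ n $ m)"
    using d.christoffel_commute by (intro sum.cong refl) (simp add: mult_ac)
  also have "\<dots> = (\<Sum>n\<in>UNIV. \<Sum>k\<in>UNIV. J x $ n $ a * christoffel h (\<phi> x) p n k * J x $ k $ m)"
    by (rule sum.swap)
  finally show ?thesis using dJ_commute[OF x, of m p a] by (simp add: X_def)
qed

lemma LX_metric:
  assumes x: "x \<in> U" shows "dcomp g x m a b = LX x b m a + LX x a m b"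
proof -
  have \<phi>x: "\<phi> x \<in> V" using \<phi>_V x by auto
  note hc = d.g_commute[OF \<phi>x]
  let ?J = "\<lambda>p a. J x $ p $ a" and ?h = "\<lambda>p q. h (\<phi> x) $ p $ q" and ?C = "christoffel h (\<phi> x)"
  let ?D = "\<lambda>b m a. \<Sum>p\<in>UNIV. \<Sum>q\<in>UNIV. dJ x m p a * ?h p q * ?J q b"
  let ?E = "\<lambda>b m a. \<Sum>p\<in>UNIV. \<Sum>q\<in>UNIV. \<Sum>n\<in>UNIV. \<Sum>k\<in>UNIV. ?J n m * ?C p n k * ?J k a * ?h p q * ?J q b"
  have LX: "LX x b m a = ?D b m a + ?E b m a" for b m a
    by (simp add: LX_def X_def distrib_right sum.distrib sum_distrib_right)
  have E1: "(\<Sum>p\<in>UNIV. \<Sum>q\<in>UNIV. \<Sum>n\<in>UNIV. \<Sum>k\<in>UNIV. ?J p a * ?J n m * (?C k n p * ?h k q) * ?J q b) = ?E b m a"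
    by (subst sum_swap_14) (simp add: mult_ac)
  have E2: "(\<Sum>p\<in>UNIV. \<Sum>q\<in>UNIV. \<Sum>n\<in>UNIV. \<Sum>k\<in>UNIV. ?J p a * ?J n m * (?C k n q * ?h k p) * ?J q b) = ?E a m b"
  proof -
    have "(\<Sum>p\<in>UNIV. \<Sum>q\<in>UNIV. \<Sum>n\<in>UNIV. \<Sum>k\<in>UNIV. ?J p a * ?J n m * (?C k n q * ?h k p) * ?J q b) =
      (\<Sum>q\<in>UNIV. \<Sum>p\<in>UNIV. \<Sum>n\<in>UNIV. \<Sum>k\<in>UNIV. ?J p a * ?J n m * (?C k n q * ?h k p) * ?J q b)"
      by (rule sum.swap)
    also have "\<dots> = ?E a m b" by (subst sum_swap_14) (simp add: mult_ac)
    finally show ?thesis .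
  qed
  have D2: "(\<Sum>p\<in>UNIV. \<Sum>q\<in>UNIV. ?J p a * ?h p q * dJ x m q b) = ?D a m b"
    by (subst sum.swap) (intro sum.cong refl, simp add: hc mult_ac)
  have "dcomp g x m a b = (\<Sum>p\<in>UNIV. \<Sum>q\<in>UNIV. ?J p a * ?h p q * dJ x m q b) + ?D b m a +
      (\<Sum>p\<in>UNIV. \<Sum>q\<in>UNIV. ?J p a * (\<Sum>n\<in>UNIV. ?J n m * dcomp h (\<phi> x) n p q) * ?J q b)"
    unfolding dcomp_g[OF x] by (simp add: sum.distrib distrib_right)
  also have "(\<Sum>p\<in>UNIV. \<Sum>q\<in>UNIV. ?J p a * (\<Sum>n\<in>UNIV. ?J n m * dcomp h (\<phi> x) n p q) * ?J q b) =
      (\<Sum>p\<in>UNIV. \<Sum>q\<in>UNIV. \<Sum>n\<in>UNIV. \<Sum>k\<in>UNIV. ?J p a * ?J n m * (?C k n p * ?h k q) * ?J q b) +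
      (\<Sum>p\<in>UNIV. \<Sum>q\<in>UNIV. \<Sum>n\<in>UNIV. \<Sum>k\<in>UNIV. ?J p a * ?J n m * (?C k n q * ?h k p) * ?J q b)"
    unfolding d.christoffel_metric[OF \<phi>x]
    by (simp add: sum_distrib_left sum_distrib_right distrib_left distrib_right sum.distrib mult.assoc)
  finally show ?thesis unfolding LX E1 E2 D2 by simp
qed

lemma invertible_J:
  assumes x: "x \<in> U" shows "invertible (J x)"
proof -
  have "w = 0" if "J x *v w = 0" for w
  proof -
    have "g x *v w = 0" unfolding metric_eq[OF x]
      by (simp add: matrix_vector_mul_assoc[symmetric] that)
    then show ?thesis using c.pos_g[OF x, of w] by force
  qed
  then show ?thesis by (simp add: invertible_left_inverse matrix_left_invertible_ker)
qed

text \<open>Both connections are symmetric and compatible with \<open>g\<close>, so their lowered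
  coefficients agree. The difference \<open>z\<close> of the two sides is thus \<open>h\<close>-orthogonal to
  the image of \<open>J\<close>, which is everything.\<close>

lemma christoffel_change:
  assumes x: "x \<in> U"
  shows "(\<Sum>k\<in>UNIV. J x $ p $ k * christoffel g x k m a) = X x p m a"
proof -
  let ?Y = "\<lambda>p. \<Sum>k\<in>UNIV. J x $ p $ k * christoffel g x k m a"
  define z where "z = (\<chi> p. ?Y p - X x p m a)"
  have \<phi>x: "\<phi> x \<in> V" using \<phi>_V x by auto
  have L: "(\<Sum>k\<in>UNIV. christoffel g x k m a * g x $ k $ b) = LX x b m a" for b
  proof (rule koszul_unique[where P = "dcomp g x"])
    show "LX x b m a = LX x b a m" for b m a unfolding LX_def using X_commute[OF x] by simp
  qed (use c.christoffel_commute[OF x] c.christoffel_metric[OF x] LX_metric[OF x] in auto)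
  have z0: "(\<Sum>p\<in>UNIV. \<Sum>q\<in>UNIV. z $ p * h (\<phi> x) $ p $ q * J x $ q $ b) = 0" for b
  proof -
    have "(\<Sum>k\<in>UNIV. christoffel g x k m a * g x $ k $ b) =
        (\<Sum>k\<in>UNIV. \<Sum>p\<in>UNIV. \<Sum>q\<in>UNIV. J x $ p $ k * christoffel g x k m a * h (\<phi> x) $ p $ q * J x $ q $ b)"
      by (simp add: g_comp[OF x] sum_distrib_left mult_ac)
    also have "\<dots> = (\<Sum>p\<in>UNIV. \<Sum>q\<in>UNIV. ?Y p * h (\<phi> x) $ p $ q * J x $ q $ b)"
      unfolding sum_distrib_right
      by (subst sum.swap, rule sum.cong[OF refl], rule sum.swap)
    finally show ?thesis
      using L[of b] by (simp add: z_def LX_def left_diff_distrib sum_subtractf)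
  qed
  have "J x *v (matrix_inv (J x) *v z) = z"
    by (simp add: matrix_vector_mul_assoc matrix_mult_matrix_inv[OF invertible_J[OF x]])
  then obtain u where u: "J x *v u = z" by blast
  have "z \<bullet> (h (\<phi> x) *v z) = (\<Sum>p\<in>UNIV. \<Sum>q\<in>UNIV. z $ p * h (\<phi> x) $ p $ q * (\<Sum>b\<in>UNIV. J x $ q $ b * u $ b))"
    unfolding u[symmetric] by (simp add: inner_vec_def matrix_vector_mult_def sum_distrib_left mult.assoc)
  also have "\<dots> = (\<Sum>p\<in>UNIV. \<Sum>q\<in>UNIV. \<Sum>b\<in>UNIV. z $ p * h (\<phi> x) $ p $ q * J x $ q $ b * u $ b)"
    by (simp add: sum_distrib_left mult.assoc)
  also have "\<dots> = (\<Sum>p\<in>UNIV. \<Sum>b\<in>UNIV. \<Sum>q\<in>UNIV. z $ p * h (\<phi> x) $ p $ q * J x $ q $ b * u $ b)"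
    by (rule sum.cong[OF refl]) (rule sum.swap)
  also have "\<dots> = (\<Sum>b\<in>UNIV. \<Sum>p\<in>UNIV. \<Sum>q\<in>UNIV. z $ p * h (\<phi> x) $ p $ q * J x $ q $ b * u $ b)"
    by (rule sum.swap)
  also have "\<dots> = 0" by (simp add: z0 flip: sum_distrib_right)
  finally have "z = 0" using d.pos_g[OF \<phi>x, of z] by force
  then have "z $ p = 0" by simp
  then show ?thesis by (simp add: z_def)
qed

end

subsection \<open>Pullback of connections\<close>

lemma homog_pullback:
  fixes a :: "'n::{finite,linorder} ext"
  assumes "homog k a" shows "homog k (pullback J a)"
proof -
  define L where "L = (\<lambda>i. \<Sum>j\<in>UNIV. ext_const (of_real (J $ i $ j)) * dx j :: 'n ext)"
  have L: "homog 1 (L i)" for i unfolding L_def by (rule homog_linear_form)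
  have pl: "homog (length xs) (prod_list (map L xs))" for xs
  proof (induction xs)
    case (Cons i xs)
    show ?case using homog_mult[OF L Cons.IH] by simp
  qed (simp add: homog_simps)
  have w: "homog (card I) (wedge_list L I)" for I
    using pl[of "sorted_list_of_set I"] by (simp add: wedge_list_def)
  have "homog k (ext_const (ext_coeff a I) * wedge_list L I)" for I
  proof (cases "ext_coeff a I = 0")
    case False
    then have "card I = k" using assms by (auto simp: homog_def)
    then show ?thesis using w[of I] homog_const_mult by blast
  qed (simp add: ext_const_simps homog_simps)
  then show ?thesis
    unfolding pullback_eq_substitute L_def[symmetric] substitute_def by (intro homog_sum)
qed

lemma pullback_mpower: "pullback J (mpower I M n i j) = mpower I (\<lambda>i j. pullback J (M i j)) n i j"
  by (induction n arbitrary: i) (auto simp: pullback_simps pullback_sum pullback_mult)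

lemma pullback_mtrace_mpower:
  "pullback J (mtrace I (mpower I M n)) = mtrace I (mpower I (\<lambda>i j. pullback J (M i j)) n)"
  by (simp add: mtrace_def pullback_sum pullback_mpower)

lemma mtrace_mpower_cong:
  assumes "\<And>i j. i \<in> I \<Longrightarrow> j \<in> I \<Longrightarrow> M i j = M' i j"
  shows "mtrace I (mpower I M n) = mtrace I (mpower I M' n)"
  unfolding mtrace_def using mpower_cong[of I M M'] assms by (intro sum.cong) auto

lemma pullback_connection:
  fixes \<phi> :: "'n::{finite,linorder} rvec \<Rightarrow> 'n rvec"
  assumes U: "open U" and \<phi>: "smooth_on U \<phi>" "\<phi> ` U \<subseteq> V" and \<theta>: "connection_on V I \<theta>"
  defines "J \<equiv> \<lambda>y. matrix (frechet_derivative \<phi> (at y))"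
  shows "connection_on U I (\<lambda>y i j. pullback (J y) (\<theta> (\<phi> y) i j))"
    and "x \<in> U \<Longrightarrow> i \<in> I \<Longrightarrow> j \<in> I \<Longrightarrow>
      curv I (\<lambda>y i j. pullback (J y) (\<theta> (\<phi> y) i j)) x i j = pullback (J x) (curv I \<theta> (\<phi> x) i j)"
proof -
  note c = connection_onD[OF \<theta>]
  show "connection_on U I (\<lambda>y i j. pullback (J y) (\<theta> (\<phi> y) i j))"
    unfolding connection_on_def
  proof (intro conjI ballI U c(2))
    fix i j assume ij: "i \<in> I" "j \<in> I"
    show "homog 1 (pullback (J y) (\<theta> (\<phi> y) i j))" if "y \<in> U" for y
      by (rule homog_pullback) (use c(4) ij \<phi>(2) that in blast)
    show "smooth_ext_on U (\<lambda>y. pullback (J y) (\<theta> (\<phi> y) i j))"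
    proof (cases "U = {}")
      case False
      then obtain x where "x \<in> U" by blast
      from ext_d_pullback(2)[OF U this c(1) \<phi>(2,1) c(3)[OF ij]] show ?thesis unfolding J_def .
    qed (auto intro!: smooth_ext_on_local)
  qed
  show "curv I (\<lambda>y i j. pullback (J y) (\<theta> (\<phi> y) i j)) x i j = pullback (J x) (curv I \<theta> (\<phi> x) i j)"
    if "x \<in> U" "i \<in> I" "j \<in> I"
    using ext_d_pullback(1)[OF U that(1) c(1) \<phi>(2,1) c(3)[OF that(2,3)]]
    by (simp add: curv_def J_def pullback_simps pullback_sum pullback_mult)
qed

lemma curv_cong:
  assumes "open U" "x \<in> U" "\<And>y i j. y \<in> U \<Longrightarrow> i \<in> I \<Longrightarrow> j \<in> I \<Longrightarrow> \<theta> y i j = \<eta> y i j" "i \<in> I" "j \<in> I"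
  shows "curv I \<theta> x i j = curv I \<eta> x i j"
proof -
  have "ext_d (\<lambda>y. \<theta> y i j) x = ext_d (\<lambda>y. \<eta> y i j) x"
    by (rule ext_d_cong[OF assms(1,2)]) (rule assms(3)[OF _ assms(4,5)])
  moreover have "(\<Sum>k\<in>I. \<theta> x i k * \<theta> x k j) = (\<Sum>k\<in>I. \<eta> x i k * \<eta> x k j)"
    using assms(2-5) by (intro sum.cong) auto
  ultimately show ?thesis by (simp add: curv_def)
qed

subsection \<open>The tangent bundle\<close>

definition levi_civita ::
  "('n rvec \<Rightarrow> 'n rmat) \<Rightarrow> 'n::{finite,linorder} rvec \<Rightarrow> nat \<Rightarrow> nat \<Rightarrow> 'n ext" where
  "levi_civita g y k j = one_form (\<lambda>i. christoffel g y (from_nat k) i (from_nat j))"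

lemma tangent_bundle_eq: "tangent_bundle G c x = (range (to_nat :: 'n \<Rightarrow> nat), levi_civita (G c))"
  for G :: "('x, 'n::{finite,linorder}) chart \<Rightarrow> 'n rvec \<Rightarrow> 'n rmat"
  by (simp add: tangent_bundle_def levi_civita_def one_form_def fun_eq_iff)

definition rmatrix :: "'n::{finite,linorder} rmat \<Rightarrow> nat \<Rightarrow> nat \<Rightarrow> 'n ext" where
  "rmatrix M i j = rconst (M $ from_nat i $ from_nat j)"

lemma even_rmatrix: "even_ext (rmatrix M i j)"
  by (simp add: rmatrix_def even_ext_simps)

lemma mmul_coord:
  "mmul (range (to_nat :: 'n::finite \<Rightarrow> nat)) M N i j = (\<Sum>k\<in>UNIV. M i (to_nat (k :: 'n)) * N (to_nat k) j)"
  by (simp add: mmul_def sum.reindex)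

lemma mmul_rmatrix:
  fixes M N :: "'n::{finite,linorder} rmat"
  shows "mmul (range (to_nat :: 'n \<Rightarrow> nat)) (rmatrix M) (rmatrix N) i j = rmatrix (M ** N) i j"
  by (simp add: mmul_coord rmatrix_def matrix_matrix_mult_def ext_const_sum ext_const_mult)

lemma rmatrix_one:
  assumes "i \<in> range (to_nat :: 'n::{finite,linorder} \<Rightarrow> nat)" "j \<in> range (to_nat :: 'n \<Rightarrow> nat)"
  shows "rmatrix (mat 1 :: 'n rmat) i j = (if i = j then 1 else 0)"
  using assms by (auto simp: rmatrix_def mat_def ext_const_simps)

lemma connection_on_levi_civita:
  fixes g :: "'n::{finite,linorder} rvec \<Rightarrow> 'n rmat"
  assumes "metric_on U g"
  shows "connection_on U (range (to_nat :: 'n \<Rightarrow> nat)) (levi_civita g)"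
proof -
  interpret metric_on U g by fact
  show ?thesis
    unfolding connection_on_def levi_civita_def
    by (intro conjI ballI open_U homog_one_form smooth_ext_on_one_form smooth_christoffel) simp
qed

lemma smooth_matrix_on_rmatrix:
  assumes "open U" "\<And>a b. smooth_on U (\<lambda>y. M y $ a $ b)"
  shows "smooth_matrix_on U I (\<lambda>y. rmatrix (M y))"
  unfolding smooth_matrix_on_def rmatrix_def by (intro ballI smooth_ext_on_rconst assms)

lemma levi_civita_odd_trace:
  fixes g :: "'n::{finite,linorder} rvec \<Rightarrow> 'n rmat"
  defines "I \<equiv> range (to_nat :: 'n \<Rightarrow> nat)"
  assumes g: "metric_on U g" and x: "x \<in> U" and n: "odd n"
  shows "mtrace I (mpower I (curv I (levi_civita g) x) n) = 0"
proof -
  interpret metric_on U g by fact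
  note con = connection_on_levi_civita[OF g, folded I_def]
  have fin: "finite I" by (simp add: I_def)
  have ev: "even_ext (curv I (levi_civita g) x i j)" if "i \<in> I" "j \<in> I" for i j
    using homog_imp_even[OF homog_curv[OF con x that]] by simp
  have skew: "mmul I (\<lambda>i j. curv I (levi_civita g) x j i) (rmatrix (g x)) i j +
      mmul I (rmatrix (g x)) (curv I (levi_civita g) x) i j = 0" if "i \<in> I" "j \<in> I" for i j
  proof (rule curv_metric_skew[OF con x, where H = "\<lambda>y. rmatrix (g y)"])
    show "smooth_matrix_on U I (\<lambda>y. rmatrix (g y))"
      by (rule smooth_matrix_on_rmatrix[OF open_U smooth_g_comp])
    show "ext_dm (\<lambda>y. rmatrix (g y)) y i j =
        mmul I (\<lambda>i j. levi_civita g y j i) (rmatrix (g y)) i j + mmul I (rmatrix (g y)) (levi_civita g y) i j"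
      if y: "y \<in> U" and ij: "i \<in> I" "j \<in> I" for y i j
    proof -
      obtain a b :: 'n where ab: "i = to_nat a" "j = to_nat b" using ij by (auto simp: I_def)
      have "ext_dm (\<lambda>y. rmatrix (g y)) y i j = one_form (\<lambda>m. dcomp g y m a b)"
        unfolding ext_dm_def rmatrix_def ab from_nat_to_nat dcomp_def
        by (rule ext_d_rconst[OF smooth_on_differentiable[OF smooth_g_comp y]])
      also have "\<dots> = one_form (\<lambda>m. (\<Sum>k\<in>UNIV. christoffel g y k m a * g y $ k $ b) +
          (\<Sum>k\<in>UNIV. g y $ a $ k * christoffel g y k m b))"
        unfolding christoffel_metric[OF y] using g_commute[OF y] by (simp add: mult.commute)
      also have "\<dots> = mmul I (\<lambda>i j. levi_civita g y j i) (rmatrix (g y)) i j + mmul I (rmatrix (g y)) (levi_civita g y) i j"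
        unfolding I_def mmul_coord ab levi_civita_def rmatrix_def from_nat_to_nat
          rconst_mult_one_form one_form_mult_rconst one_form_sum one_form_add ..
      finally show ?thesis .
    qed
  qed (use that in \<open>auto simp: even_rmatrix\<close>)
  note inv = matrix_mult_matrix_inv[OF invertible_g[OF x]]
  show ?thesis
    by (rule mtrace_odd_power_zero[OF fin ev _ skew _ _ n, where K = "rmatrix (matrix_inv (g x))"])
      (auto simp: even_rmatrix I_def mmul_rmatrix inv rmatrix_one)
qed

text \<open>The Jacobian is a change of frame from the Levi-Civita connection of \<open>g\<close> to the
  pullback of that of \<open>h\<close>.\<close>

lemma levi_civita_trace_change:
  fixes g h :: "'n::{finite,linorder} rvec \<Rightarrow> 'n rmat"
  defines "I \<equiv> range (to_nat :: 'n \<Rightarrow> nat)"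
  assumes ch: "metric_change U V g h \<phi> J" and x: "x \<in> U"
  shows "mtrace I (mpower I (curv I (levi_civita g) x) n) =
    pullback (J x) (mtrace I (mpower I (curv I (levi_civita h) (\<phi> x)) n))"
proof -
  interpret metric_change U V g h \<phi> J by fact
  have fin: "finite I" by (simp add: I_def)
  note cg = connection_on_levi_civita[OF c.metric_on_axioms, folded I_def]
    and cd = connection_on_levi_civita[OF d.metric_on_axioms, folded I_def]
  define \<theta> where "\<theta> = (\<lambda>y i j. pullback (J y) (levi_civita h (\<phi> y) i j))"
  have \<theta>: "connection_on U I \<theta>"
    unfolding \<theta>_def J_eq by (rule pullback_connection(1)[OF c.open_U smooth_\<phi> \<phi>_V cd])
  have \<theta>c: "curv I \<theta> x i j = pullback (J x) (curv I (levi_civita h) (\<phi> x) i j)" if "i \<in> I" "j \<in> I" for i j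
    unfolding \<theta>_def J_eq by (rule pullback_connection(2)[OF c.open_U smooth_\<phi> \<phi>_V cd x that])
  note inv = matrix_mult_matrix_inv[OF invertible_J[OF x]]
  have "mtrace I (mpower I (curv I (levi_civita g) x) n) = mtrace I (mpower I (curv I \<theta> x) n)"
  proof (rule mtrace_mpower_conjugate[OF fin, where g = "rmatrix (J x)" and g' = "rmatrix (matrix_inv (J x))"])
    fix i j assume ij: "i \<in> I" "j \<in> I"
    show "mmul I (rmatrix (J x)) (curv I (levi_civita g) x) i j = mmul I (curv I \<theta> x) (rmatrix (J x)) i j"
    proof (rule curv_gauge_change[OF \<theta> cg x, where g = "\<lambda>y. rmatrix (J y)"])
      show "smooth_matrix_on U I (\<lambda>y. rmatrix (J y))"
        by (rule smooth_matrix_on_rmatrix[OF c.open_U smooth_J])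
      show "mmul I (rmatrix (J y)) (levi_civita g y) i j = ext_dm (\<lambda>y. rmatrix (J y)) y i j + mmul I (\<theta> y) (rmatrix (J y)) i j"
        if y: "y \<in> U" and ij: "i \<in> I" "j \<in> I" for y i j
      proof -
        obtain p a :: 'n where pa: "i = to_nat p" "j = to_nat a" using ij by (auto simp: I_def)
        have "ext_dm (\<lambda>y. rmatrix (J y)) y i j = one_form (\<lambda>m. dJ y m p a)"
          unfolding ext_dm_def rmatrix_def pa from_nat_to_nat dJ_def
          by (rule ext_d_rconst[OF smooth_on_differentiable[OF smooth_J y]])
        moreover have "mmul I (\<theta> y) (rmatrix (J y)) i j =
            one_form (\<lambda>m. \<Sum>n\<in>UNIV. \<Sum>k\<in>UNIV. J y $ n $ m * christoffel h (\<phi> y) p n k * J y $ k $ a)"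
        proof -
          have "mmul I (\<theta> y) (rmatrix (J y)) i j =
              one_form (\<lambda>m. \<Sum>k\<in>UNIV. (\<Sum>n\<in>UNIV. christoffel h (\<phi> y) p n k * J y $ n $ m) * J y $ k $ a)"
            unfolding I_def mmul_coord pa \<theta>_def levi_civita_def rmatrix_def from_nat_to_nat
              pullback_one_form one_form_mult_rconst one_form_sum ..
          also have "\<dots> = one_form (\<lambda>m. \<Sum>n\<in>UNIV. \<Sum>k\<in>UNIV. J y $ n $ m * christoffel h (\<phi> y) p n k * J y $ k $ a)"
            unfolding sum_distrib_right by (subst sum.swap) (simp add: mult_ac)
          finally show ?thesis .
        qed
        moreover have "mmul I (rmatrix (J y)) (levi_civita g y) i j = one_form (\<lambda>m. X y p m a)"
          unfolding I_def mmul_coord pa levi_civita_def rmatrix_def from_nat_to_nat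
            rconst_mult_one_form one_form_sum christoffel_change[OF y] ..
        ultimately show ?thesis by (simp add: X_def one_form_add)
      qed
    qed (use ij in \<open>auto simp: even_rmatrix\<close>)
  qed (auto simp: even_rmatrix I_def mmul_rmatrix inv rmatrix_one)
  also have "\<dots> = mtrace I (mpower I (\<lambda>i j. pullback (J x) (curv I (levi_civita h) (\<phi> x) i j)) n)"
    by (rule mtrace_mpower_cong) (rule \<theta>c)
  finally show ?thesis by (simp add: pullback_mtrace_mpower)
qed

lemma metric_on_chart:
  assumes "smooth_atlas A" "riemannian_metric A G" "c \<in> A" "open W" "W \<subseteq> snd c ` fst c"
  shows "metric_on W (G c)"
  using assms smooth_on_subset[of "snd c ` fst c" "G c" W]
  by unfold_locales (auto simp: riemannian_metric_def)

lemma metric_change_charts: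
  assumes A: "smooth_atlas A" "riemannian_metric A G" and cd: "c \<in> A" "d \<in> A"
  shows "metric_change (snd c ` (fst c \<inter> fst d)) (snd d ` fst d) (G c) (G d) (transition c d) (jacobian c d)"
proof -
  note t = transition_facts[OF A(1) cd]
  interpret c: metric_on "snd c ` (fst c \<inter> fst d)" "G c"
    by (rule metric_on_chart[OF A cd(1) t(1)]) auto
  interpret d: metric_on "snd d ` fst d" "G d"
    by (rule metric_on_chart[OF A cd(2)]) (use smooth_atlasD(1)[OF A(1) cd(2)] in auto)
  show ?thesis
  proof unfold_locales
    show "transition c d ` snd c ` (fst c \<inter> fst d) \<subseteq> snd d ` fst d" using t(3) by blast
    show "jacobian c d = (\<lambda>y. matrix (frechet_derivative (transition c d) (at y)))"
      by (simp add: jacobian_def fun_eq_iff)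
    show "G c y = transpose (jacobian c d y) ** G d (transition c d y) ** jacobian c d y"
      if "y \<in> snd c ` (fst c \<inter> fst d)" for y
      using A(2) cd that unfolding riemannian_metric_def by blast
  qed (rule t(2))
qed

text \<open>What the cancellation formula requires of \<open>TX\<close> and \<open>V\<close>. The frames assigned to points may vary arbitrarily, so the
  second condition includes that the traces do not depend on the frames.\<close>

definition characteristic_bundle :: "('x, 'n::{finite,linorder}) chart set \<Rightarrow> ('x, 'n) cbundle \<Rightarrow> bool" where
  "characteristic_bundle A E \<longleftrightarrow>
     (\<forall>c\<in>A. \<forall>x\<in>snd c ` fst c. \<exists>U. x \<in> U \<and> connection_on U (fst (E c x)) (snd (E c x))) \<and>
     (\<forall>n. closed_form A (2 * n) (power_trace E n)) \<and>
     (\<forall>n. \<forall>c\<in>A. \<forall>x\<in>snd c ` fst c. odd n \<longrightarrow> power_trace E n c x = 0)"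

lemma characteristic_bundle_tangent:
  fixes G :: "('x::topological_space, 'n::{finite,linorder}) chart \<Rightarrow> 'n rvec \<Rightarrow> 'n rmat"
  assumes A: "smooth_atlas A" "riemannian_metric A G"
  shows "characteristic_bundle A (tangent_bundle G)"
proof -
  let ?I = "range (to_nat :: 'n \<Rightarrow> nat)"
  have pt: "power_trace (tangent_bundle G) n c x = mtrace ?I (mpower ?I (curv ?I (levi_civita (G c)) x) n)" for n c x
    by (simp add: power_trace_def curvature_eq_curv tangent_bundle_eq)
  have m: "metric_on (snd c ` fst c) (G c)" if "c \<in> A" for c
    by (rule metric_on_chart[OF A that smooth_atlasD(1)[OF A(1) that]]) simp
  have con: "connection_on (snd c ` fst c) ?I (levi_civita (G c))" if "c \<in> A" for c
    by (rule connection_on_levi_civita[OF m[OF that]])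
  have "closed_form A (2 * n) (power_trace (tangent_bundle G) n)" for n
  proof (rule closed_form_power_traceI)
    show "open (snd c ` fst c)" if "c \<in> A" for c by (rule smooth_atlasD(1)[OF A(1) that])
  next
    fix c x assume "c \<in> A" "x \<in> snd c ` fst c"
    then show "\<exists>U I \<theta>. x \<in> U \<and> connection_on U I \<theta> \<and> (\<forall>y\<in>U. \<forall>i\<in>I. \<forall>j\<in>I. real_ext (\<theta> y i j)) \<and>
        (\<forall>y\<in>U. power_trace (tangent_bundle G) n c y = mtrace I (mpower I (curv I \<theta> y) n))"
      using con[of c]
      by (intro exI[of _ "snd c ` fst c"] exI[of _ ?I] exI[of _ "levi_civita (G c)"])
        (simp add: pt levi_civita_def real_ext_one_form)
  next
    fix c d x assume cd: "c \<in> A" "d \<in> A" "x \<in> snd c ` (fst c \<inter> fst d)"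
    show "power_trace (tangent_bundle G) n c x =
        pullback (jacobian c d x) (power_trace (tangent_bundle G) n d (transition c d x))"
      unfolding pt by (rule levi_civita_trace_change[OF metric_change_charts[OF A cd(1,2)] cd(3)])
  qed
  moreover have "\<exists>U. x \<in> U \<and> connection_on U (fst (tangent_bundle G c x)) (snd (tangent_bundle G c x))"
    if "c \<in> A" "x \<in> snd c ` fst c" for c x
    unfolding tangent_bundle_eq fst_conv snd_conv using con[OF that(1)] that(2) by blast
  moreover have "power_trace (tangent_bundle G) n c x = 0" if "odd n" "c \<in> A" "x \<in> snd c ` fst c" for n c x
    unfolding pt by (rule levi_civita_odd_trace[OF m[OF that(2)] that(3,1)])
  ultimately show ?thesis unfolding characteristic_bundle_def by blast
qed

subsection \<open>Euclidean vector bundles\<close>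

lemma connection_on_subset:
  assumes "connection_on U I \<theta>" "open W" "W \<subseteq> U" shows "connection_on W I \<theta>"
  using connection_onD[OF assms(1)] assms(2,3) smooth_ext_on_subset[of U _ W]
  unfolding connection_on_def by (auto simp del: One_nat_def)

lemma vector_bundleD:
  assumes "vector_bundle A r \<pi> T"
  shows "(\<Union>t\<in>T. fst t) = UNIV"
    "\<And>t. t \<in> T \<Longrightarrow> open (fst t)"
    "\<And>t p. t \<in> T \<Longrightarrow> p \<in> fst t \<Longrightarrow> bij_betw (snd t) (\<pi> -` {p}) {w. \<forall>i\<ge>r. w i = 0}"
    "\<And>t s i j. t \<in> T \<Longrightarrow> s \<in> T \<Longrightarrow> i < r \<Longrightarrow> j < r \<Longrightarrow>
      smooth_fun A (fst t \<inter> fst s) (triv_change \<pi> t s i j)"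
    "\<And>t s v i. t \<in> T \<Longrightarrow> s \<in> T \<Longrightarrow> \<pi> v \<in> fst t \<inter> fst s \<Longrightarrow> i < r \<Longrightarrow>
      snd t v i = (\<Sum>j<r. triv_change \<pi> t s i j (\<pi> v) * snd s v j)"
proof -
  note v = assms[unfolded vector_bundle_def]
  show "(\<Union>t\<in>T. fst t) = UNIV" by (rule conjunct1[OF v])
  show "open (fst t)" if "t \<in> T" for t
    by (rule conjunct1[OF bspec[OF conjunct1[OF conjunct2[OF v]] that]])
  show "bij_betw (snd t) (\<pi> -` {p}) {w. \<forall>i\<ge>r. w i = 0}" if "t \<in> T" "p \<in> fst t" for t p
    by (rule bspec[OF conjunct2[OF bspec[OF conjunct1[OF conjunct2[OF v]] that(1)]] that(2)])
  show "smooth_fun A (fst t \<inter> fst s) (triv_change \<pi> t s i j)" if "t \<in> T" "s \<in> T" "i < r" "j < r" for t s i j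
    using conjunct1[OF bspec[OF bspec[OF conjunct2[OF conjunct2[OF v]] that(1)] that(2)]] that(3,4) by simp
  show "snd t w i = (\<Sum>j<r. triv_change \<pi> t s i j (\<pi> w) * snd s w j)"
    if "t \<in> T" "s \<in> T" "\<pi> w \<in> fst t \<inter> fst s" "i < r" for t s w i
    by (rule mp[OF spec[OF mp[OF spec[OF conjunct2[OF bspec[OF bspec[OF conjunct2[OF conjunct2[OF v]]
      that(1)] that(2)]]] that(3)]] that(4)])
qed

lemma basis_section_facts:
  assumes V: "vector_bundle A r \<pi> T" and t: "t \<in> T" "p \<in> fst t" and j: "j < r"
  shows "\<pi> (basis_section \<pi> t j p) = p" "snd t (basis_section \<pi> t j p) = (\<lambda>i. if i = j then 1 else 0)"
proof -
  have b: "bij_betw (snd t) (\<pi> -` {p}) {w. \<forall>i\<ge>r. w i = 0}"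
    by (rule vector_bundleD(3)[OF V t])
  have e: "(\<lambda>i. if i = j then 1 else 0) \<in> snd t ` (\<pi> -` {p})"
    unfolding bij_betw_imp_surj_on[OF b] using j by auto
  show "\<pi> (basis_section \<pi> t j p) = p"
    using inv_into_into[OF e] by (simp add: basis_section_def)
  show "snd t (basis_section \<pi> t j p) = (\<lambda>i. if i = j then 1 else 0)"
    using f_inv_into_f[OF e] by (simp add: basis_section_def)
qed

lemma triv_change_inverse:
  assumes V: "vector_bundle A r \<pi> T" and t: "t \<in> T" "s \<in> T" "p \<in> fst t" "p \<in> fst s" and ij: "i < r" "j < r"
  shows "(\<Sum>k<r. triv_change \<pi> t s i k p * triv_change \<pi> s t k j p) = (if i = j then 1 else 0)"
proof -
  let ?v = "basis_section \<pi> t j p"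
  note b = basis_section_facts[OF V t(1,3) ij(2)]
  have "snd t ?v i = (\<Sum>k<r. triv_change \<pi> t s i k (\<pi> ?v) * snd s ?v k)"
    by (rule vector_bundleD(5)[OF V t(1,2) _ ij(1)]) (use t b(1) in simp)
  then show ?thesis by (simp add: b triv_change_def)
qed

definition bundle_conn ::
  "(('x, 'e) trivialization \<Rightarrow> nat \<Rightarrow> nat \<Rightarrow> ('x, 'n) form) \<Rightarrow> ('x, 'e) trivialization \<Rightarrow> ('x, 'n) chart \<Rightarrow>
    'n::{finite,linorder} rvec \<Rightarrow> nat \<Rightarrow> nat \<Rightarrow> 'n ext" where
  "bundle_conn \<theta> t c y i j = \<theta> t i j c y"

definition coord_matrix ::
  "(nat \<Rightarrow> nat \<Rightarrow> 'x \<Rightarrow> real) \<Rightarrow> ('x, 'n) chart \<Rightarrow> 'n::{finite,linorder} rvec \<Rightarrow> nat \<Rightarrow> nat \<Rightarrow> 'n ext" where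
  "coord_matrix f c y i j = fun_form (f i j) c y"

lemma even_coord_matrix: "even_ext (coord_matrix f c y i j)"
  by (simp add: coord_matrix_def fun_form_def even_ext_simps)

lemma mmul_coord_matrix:
  "mmul {..<r} (coord_matrix f c y) (coord_matrix g c y) i j = rconst (\<Sum>k<r. f i k (chart_inv c y) * g k j (chart_inv c y))"
  by (simp add: mmul_def coord_matrix_def fun_form_def ext_const_sum ext_const_mult)

lemma smooth_coord_matrix:
  assumes A: "smooth_atlas A" "c \<in> A" and W: "open W"
    and f: "\<And>i j. i < r \<Longrightarrow> j < r \<Longrightarrow> smooth_fun A W (f i j)"
  shows "smooth_matrix_on (snd c ` (fst c \<inter> W)) {..<r} (coord_matrix f c)"
  unfolding smooth_matrix_on_def coord_matrix_def fun_form_def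
proof (intro ballI smooth_ext_on_rconst chart_image_open[OF A W])
  fix i j assume "i \<in> {..<r}" "j \<in> {..<r}"
  then show "smooth_on (snd c ` (fst c \<inter> W)) (\<lambda>y. f i j (chart_inv c y))"
    using f[of i j] A(2) by (simp add: smooth_fun_def comp_def)
qed

locale euclidean_bundle =
  fixes A :: "('x::topological_space, 'n::{finite,linorder}) chart set" and r \<pi> T h
    and \<theta> :: "('x, 'e) trivialization \<Rightarrow> nat \<Rightarrow> nat \<Rightarrow> ('x, 'n) form"
  assumes A: "smooth_atlas A" and V: "vector_bundle A r \<pi> T" and M: "bundle_metric A r \<pi> T h"
    and E: "euclidean_connection A r \<pi> T h \<theta>"
begin

lemma open_triv: "t \<in> T \<Longrightarrow> open (fst t)"
  by (rule vector_bundleD(2)[OF V])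

lemma connection_on_bundle:
  assumes "t \<in> T" "c \<in> A"
  shows "connection_on (snd c ` (fst c \<inter> fst t)) {..<r} (bundle_conn \<theta> t c)"
    "y \<in> snd c ` (fst c \<inter> fst t) \<Longrightarrow> i < r \<Longrightarrow> j < r \<Longrightarrow> real_ext (bundle_conn \<theta> t c y i j)"
proof -
  have d: "diff_form A (fst t) 1 (\<theta> t i j)" if "i < r" "j < r" for i j
    using E assms that by (auto simp: euclidean_connection_def)
  show "connection_on (snd c ` (fst c \<inter> fst t)) {..<r} (bundle_conn \<theta> t c)"
    unfolding connection_on_def bundle_conn_def
  proof (intro conjI ballI chart_image_open[OF A assms(2) open_triv[OF assms(1)]] finite_lessThan)
    fix i j assume ij: "i \<in> {..<r}" "j \<in> {..<r}"
    show "smooth_ext_on (snd c ` (fst c \<inter> fst t)) (\<lambda>y. \<theta> t i j c y)"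
      using d[of i j] ij assms(2) unfolding diff_form_def smooth_ext_on_def by blast
    show "homog 1 (\<theta> t i j c y)" if "y \<in> snd c ` (fst c \<inter> fst t)" for y
      using d[of i j] ij assms(2) that unfolding diff_form_def homog_def by blast
  qed
  show "real_ext (bundle_conn \<theta> t c y i j)" if "y \<in> snd c ` (fst c \<inter> fst t)" "i < r" "j < r"
    using d[OF that(2,3)] that(1) assms(2) unfolding diff_form_def real_ext_def bundle_conn_def by blast
qed

text \<open>The trace in a fixed trivialization. It does not depend on the trivialization, which makes the
  choice in \<open>bundle_of\<close> harmless.\<close>

definition local_trace where
  "local_trace t n c x = mtrace {..<r} (mpower {..<r} (curv {..<r} (bundle_conn \<theta> t c) x) n)"

lemma local_trace_gauge:
  assumes ts: "t \<in> T" "s \<in> T" and c: "c \<in> A" and x: "x \<in> snd c ` (fst c \<inter> fst t \<inter> fst s)"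
  shows "local_trace t n c x = local_trace s n c x"
proof -
  let ?U = "snd c ` (fst c \<inter> (fst t \<inter> fst s))"
  have x': "x \<in> ?U" using x by (simp add: Int_assoc)
  have oW: "open (fst t \<inter> fst s)" by (intro open_Int open_triv ts)
  have oU: "open ?U" by (rule chart_image_open[OF A c oW])
  have con: "connection_on ?U {..<r} (bundle_conn \<theta> u c)" if "u \<in> T" "?U \<subseteq> snd c ` (fst c \<inter> fst u)" for u
    by (rule connection_on_subset[OF connection_on_bundle(1)[OF that(1) c] oU that(2)])
  have ct: "connection_on ?U {..<r} (bundle_conn \<theta> t c)" and cs: "connection_on ?U {..<r} (bundle_conn \<theta> s c)"
    by (rule con[OF ts(1)], blast, rule con[OF ts(2)], blast)
  let ?g = "coord_matrix (triv_change \<pi> t s) c" and ?g' = "coord_matrix (triv_change \<pi> s t) c"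
  have p: "chart_inv c x \<in> fst t" "chart_inv c x \<in> fst s"
    using x smooth_atlasD(3)[OF A c] by auto
  have "mtrace {..<r} (mpower {..<r} (curv {..<r} (bundle_conn \<theta> s c) x) n) =
      mtrace {..<r} (mpower {..<r} (curv {..<r} (bundle_conn \<theta> t c) x) n)"
  proof (rule mtrace_mpower_conjugate[where g = "?g x" and g' = "?g' x"])
    fix i j assume ij: "i \<in> {..<r}" "j \<in> {..<r}"
    show "mmul {..<r} (?g x) (curv {..<r} (bundle_conn \<theta> s c) x) i j =
        mmul {..<r} (curv {..<r} (bundle_conn \<theta> t c) x) (?g x) i j"
    proof (rule curv_gauge_change[OF ct cs x'])
      show "smooth_matrix_on ?U {..<r} ?g"
        by (rule smooth_coord_matrix[OF A c oW vector_bundleD(4)[OF V ts]])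
      show "mmul {..<r} (?g y) (bundle_conn \<theta> s c y) i j = ext_dm ?g y i j + mmul {..<r} (bundle_conn \<theta> t c y) (?g y) i j"
        if "y \<in> ?U" "i \<in> {..<r}" "j \<in> {..<r}" for y i j
      proof -
        have "y \<in> snd c ` (fst c \<inter> fst t \<inter> fst s)" using that(1) by (simp add: Int_assoc)
        then have "(\<Sum>k<r. fun_form (triv_change \<pi> t s i k) c y * \<theta> s k j c y) =
            ext_d (fun_form (triv_change \<pi> t s i j) c) y +
            (\<Sum>k<r. \<theta> t i k c y * fun_form (triv_change \<pi> t s k j) c y)"
          using E ts c that(2,3) unfolding euclidean_connection_def by blast
        then show ?thesis
          by (simp add: mmul_def coord_matrix_def bundle_conn_def ext_dm_def)
      qed
    qed (use ij in \<open>auto simp: even_coord_matrix\<close>)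
    show "mmul {..<r} (?g x) (?g' x) i j = (if i = j then 1 else 0)"
      using triv_change_inverse[OF V ts p] ij by (simp add: mmul_coord_matrix ext_const_simps)
    show "mmul {..<r} (?g' x) (?g x) i j = (if i = j then 1 else 0)"
      using triv_change_inverse[OF V ts(2,1) p(2,1)] ij by (simp add: mmul_coord_matrix ext_const_simps)
  qed (auto simp: even_coord_matrix)
  then show ?thesis by (simp add: local_trace_def)
qed

lemma local_trace_chart:
  assumes t: "t \<in> T" and cd: "c \<in> A" "d \<in> A" and x: "x \<in> snd c ` (fst c \<inter> fst d \<inter> fst t)"
  shows "local_trace t n c x = pullback (jacobian c d x) (local_trace t n d (transition c d x))"
proof -
  let ?\<phi> = "transition c d" and ?U = "snd c ` (fst c \<inter> (fst d \<inter> fst t))" and ?V = "snd d ` (fst d \<inter> fst t)"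
  have x': "x \<in> ?U" using x by (simp add: Int_assoc)
  note tr = transition_facts[OF A cd]
  have oU: "open ?U"
    by (rule chart_image_open[OF A cd(1) open_Int[OF smooth_atlasD(2)[OF A cd(2)] open_triv[OF t]]])
  have sm: "smooth_on ?U ?\<phi>" by (rule smooth_on_subset[OF tr(2)]) auto
  have im: "?\<phi> ` ?U \<subseteq> ?V" using smooth_atlasD(3)[OF A cd(1)] by (force simp: transition_def)
  let ?\<theta> = "\<lambda>y i j. pullback (matrix (frechet_derivative ?\<phi> (at y))) (bundle_conn \<theta> t d (?\<phi> y) i j)"
  have eq: "bundle_conn \<theta> t c y i j = ?\<theta> y i j" if "y \<in> ?U" "i \<in> {..<r}" "j \<in> {..<r}" for y i j
  proof -
    have "diff_form A (fst t) 1 (\<theta> t i j)" using E t that by (auto simp: euclidean_connection_def)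
    moreover have "y \<in> snd c ` (fst c \<inter> fst d \<inter> fst t)" using that(1) by (simp add: Int_assoc)
    ultimately have "\<theta> t i j c y = pullback (jacobian c d y) (\<theta> t i j d (transition c d y))"
      using cd unfolding diff_form_def by blast
    then show ?thesis by (simp add: bundle_conn_def jacobian_def)
  qed
  have "curv {..<r} (bundle_conn \<theta> t c) x i j = pullback (jacobian c d x) (curv {..<r} (bundle_conn \<theta> t d) (?\<phi> x) i j)"
    if "i \<in> {..<r}" "j \<in> {..<r}" for i j
  proof -
    have "curv {..<r} (bundle_conn \<theta> t c) x i j = curv {..<r} ?\<theta> x i j"
      by (rule curv_cong[OF oU x' eq that])
    then show ?thesis
      using pullback_connection(2)[OF oU sm im connection_on_bundle(1)[OF t cd(2)] x' that]
      by (simp add: jacobian_def)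
  qed
  then have "local_trace t n c x =
      mtrace {..<r} (mpower {..<r} (\<lambda>i j. pullback (jacobian c d x) (curv {..<r} (bundle_conn \<theta> t d) (?\<phi> x) i j)) n)"
    unfolding local_trace_def by (rule mtrace_mpower_cong)
  then show ?thesis by (simp add: local_trace_def pullback_mtrace_mpower)
qed

lemma local_trace_odd:
  assumes t: "t \<in> T" and c: "c \<in> A" and x: "x \<in> snd c ` (fst c \<inter> fst t)" and n: "odd n"
  shows "local_trace t n c x = 0"
proof -
  let ?I = "{..<r}" and ?R = "curv {..<r} (bundle_conn \<theta> t c) x" and ?H = "coord_matrix (gram \<pi> h t) c"
  define p where "p = chart_inv c x"
  have p: "p \<in> fst t" using x smooth_atlasD(3)[OF A c] by (auto simp: p_def)
  note con = connection_on_bundle(1)[OF t c]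
  note mt = bspec[OF M[unfolded bundle_metric_def] t]
  have m: "h v w = (\<Sum>i<r. \<Sum>j<r. gram \<pi> h t i j (\<pi> v) * snd t v i * snd t w j)" "h v w = h w v"
    "snd t v \<noteq> (\<lambda>i. 0) \<Longrightarrow> h v v > 0" if vw: "\<pi> v = p" "\<pi> w = p" for v w
  proof -
    have "\<pi> v = \<pi> w \<and> \<pi> v \<in> fst t" using vw p by simp
    note m' = mp[OF spec[OF spec[OF conjunct2[OF mt]]] this]
    show "h v w = (\<Sum>i<r. \<Sum>j<r. gram \<pi> h t i j (\<pi> v) * snd t v i * snd t w j)" by (rule conjunct1[OF m'])
    show "h v w = h w v" by (rule conjunct1[OF conjunct2[OF m']])
    show "snd t v \<noteq> (\<lambda>i. 0) \<Longrightarrow> h v v > 0" by (rule mp[OF conjunct2[OF conjunct2[OF m']]])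
  qed
  have sym: "gram \<pi> h t i j p = gram \<pi> h t j i p" if "i \<in> ?I" "j \<in> ?I" for i j
    unfolding gram_def using basis_section_facts(1)[OF V t p] that by (intro m(2)) auto
  have pos: "(\<Sum>i\<in>?I. \<Sum>j\<in>?I. gram \<pi> h t i j p * w i * w j) > 0" if w: "\<exists>i\<in>?I. w i \<noteq> 0" for w
  proof -
    define w' where "w' = (\<lambda>i. if i < r then w i else 0)"
    have "bij_betw (snd t) (\<pi> -` {p}) {w. \<forall>i\<ge>r. w i = 0}"
      by (rule vector_bundleD(3)[OF V t p])
    then have "w' \<in> snd t ` (\<pi> -` {p})" by (simp add: bij_betw_imp_surj_on w'_def)
    then obtain v where "v \<in> \<pi> -` {p}" and v2: "w' = snd t v" by (elim imageE)
    then have v: "\<pi> v = p" "snd t v = w'" by simp_all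
    obtain i where "i < r" "w i \<noteq> 0" using w by auto
    then have "w' i \<noteq> 0" by (simp add: w'_def)
    then have "snd t v \<noteq> (\<lambda>i. 0)" using v(2) by auto
    then have "h v v > 0" by (rule m(3)[OF v(1) v(1)])
    moreover have "h v v = (\<Sum>i\<in>?I. \<Sum>j\<in>?I. gram \<pi> h t i j p * w i * w j)"
      unfolding m(1)[OF v(1) v(1)] v(1) v(2) by (intro sum.cong) (auto simp: w'_def)
    ultimately show ?thesis by simp
  qed
  obtain K where K: "\<And>i j. i \<in> ?I \<Longrightarrow> j \<in> ?I \<Longrightarrow> mmul ?I (\<lambda>i j. gram \<pi> h t i j p) K i j = (if i = j then 1 else 0)"
    "\<And>i j. i \<in> ?I \<Longrightarrow> j \<in> ?I \<Longrightarrow> mmul ?I K (\<lambda>i j. gram \<pi> h t i j p) i j = (if i = j then 1 else 0)"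
    using positive_definite_inverse[of ?I "\<lambda>i j. gram \<pi> h t i j p", OF _ sym pos] by auto
  let ?K = "coord_matrix (\<lambda>i j q. K i j) c x"
  have "mtrace ?I (mpower ?I ?R n) = 0"
  proof (rule mtrace_odd_power_zero[where H = "?H x" and K = ?K])
    fix i j assume ij: "i \<in> ?I" "j \<in> ?I"
    show "even_ext (?R i j)" using homog_imp_even[OF homog_curv[OF con x ij]] by simp
    show "mmul ?I (?H x) ?K i j = (if i = j then 1 else 0)"
      using K(1)[OF ij, unfolded mmul_def p_def] by (simp add: mmul_coord_matrix ext_const_simps)
    show "mmul ?I ?K (?H x) i j = (if i = j then 1 else 0)"
      using K(2)[OF ij, unfolded mmul_def p_def] by (simp add: mmul_coord_matrix ext_const_simps)
    show "mmul ?I (\<lambda>i j. ?R j i) (?H x) i j + mmul ?I (?H x) ?R i j = 0"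
    proof (rule curv_metric_skew[OF con x])
      show "smooth_matrix_on (snd c ` (fst c \<inter> fst t)) ?I ?H"
        by (rule smooth_coord_matrix[OF A c open_triv[OF t]]) (use conjunct1[OF mt] in simp)
      show "ext_dm ?H y i j = mmul ?I (\<lambda>i j. bundle_conn \<theta> t c y j i) (?H y) i j + mmul ?I (?H y) (bundle_conn \<theta> t c y) i j"
        if "y \<in> snd c ` (fst c \<inter> fst t)" "i \<in> ?I" "j \<in> ?I" for y i j
      proof -
        have "ext_d (fun_form (gram \<pi> h t i j) c) y = (\<Sum>k<r. \<theta> t k i c y * fun_form (gram \<pi> h t k j) c y +
            fun_form (gram \<pi> h t i k) c y * \<theta> t k j c y)"
          using E t c that unfolding euclidean_connection_def by blast
        then show ?thesis
          by (simp add: mmul_def coord_matrix_def bundle_conn_def ext_dm_def sum.distrib)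
      qed
    qed (use ij in \<open>auto simp: even_coord_matrix\<close>)
  qed (use n in \<open>auto simp: even_coord_matrix\<close>)
  then show ?thesis by (simp add: local_trace_def)
qed

definition triv_at where "triv_at c x = (SOME t. t \<in> T \<and> chart_inv c x \<in> fst t)"

lemma triv_at: "triv_at c x \<in> T" "chart_inv c x \<in> fst (triv_at c x)"
proof -
  have "chart_inv c x \<in> (\<Union>t\<in>T. fst t)" using vector_bundleD(1)[OF V] by simp
  then have "\<exists>t. t \<in> T \<and> chart_inv c x \<in> fst t" by blast
  from someI_ex[OF this] show "triv_at c x \<in> T" "chart_inv c x \<in> fst (triv_at c x)"
    by (auto simp: triv_at_def)
qed

lemma triv_at_image:
  assumes "c \<in> A" "x \<in> snd c ` fst c" shows "x \<in> snd c ` (fst c \<inter> fst (triv_at c x))"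
  using smooth_atlasD(4,5)[OF A assms(1,2)] triv_at(2)[of c x] by (metis IntI image_eqI)

lemma bundle_of_eq: "bundle_of r T \<theta> c x = ({..<r}, bundle_conn \<theta> (triv_at c x) c)"
  by (simp add: bundle_of_def triv_at_def bundle_conn_def Let_def fun_eq_iff)

lemma power_trace_eq: "power_trace (bundle_of r T \<theta>) n c x = local_trace (triv_at c x) n c x"
  by (simp add: power_trace_def curvature_eq_curv bundle_of_eq local_trace_def)

lemma power_trace_eq_local:
  assumes "c \<in> A" "t \<in> T" "x \<in> snd c ` (fst c \<inter> fst t)"
  shows "power_trace (bundle_of r T \<theta>) n c x = local_trace t n c x"
  unfolding power_trace_eq
proof (rule local_trace_gauge[OF triv_at(1) assms(2,1)])
  obtain p where p: "x = snd c p" "p \<in> fst c" "p \<in> fst t" using assms(3) by auto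
  then have "p \<in> fst (triv_at c x)" using triv_at(2)[of c x] smooth_atlasD(3)[OF A assms(1) p(2)] by simp
  then show "x \<in> snd c ` (fst c \<inter> fst (triv_at c x) \<inter> fst t)" using p by blast
qed

lemma characteristic_bundle_euclidean: "characteristic_bundle A (bundle_of r T \<theta>)"
proof -
  have "closed_form A (2 * n) (power_trace (bundle_of r T \<theta>) n)" for n
  proof (rule closed_form_power_traceI)
    show "open (snd c ` fst c)" if "c \<in> A" for c by (rule smooth_atlasD(1)[OF A that])
  next
    fix c x assume cx: "c \<in> A" "x \<in> snd c ` fst c"
    let ?t = "triv_at c x" and ?U = "snd c ` (fst c \<inter> fst (triv_at c x))"
    show "\<exists>U I \<theta>'. x \<in> U \<and> connection_on U I \<theta>' \<and> (\<forall>y\<in>U. \<forall>i\<in>I. \<forall>j\<in>I. real_ext (\<theta>' y i j)) \<and>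
        (\<forall>y\<in>U. power_trace (bundle_of r T \<theta>) n c y = mtrace I (mpower I (curv I \<theta>' y) n))"
    proof (intro exI conjI ballI)
      show "x \<in> ?U" by (rule triv_at_image[OF cx])
      show "connection_on ?U {..<r} (bundle_conn \<theta> ?t c)" by (rule connection_on_bundle(1)[OF triv_at(1) cx(1)])
      show "real_ext (bundle_conn \<theta> ?t c y i j)" if "y \<in> ?U" "i \<in> {..<r}" "j \<in> {..<r}" for y i j
        using connection_on_bundle(2)[OF triv_at(1) cx(1) that(1)] that by simp
      show "power_trace (bundle_of r T \<theta>) n c y = mtrace {..<r} (mpower {..<r} (curv {..<r} (bundle_conn \<theta> ?t c) y) n)"
        if "y \<in> ?U" for y
        using power_trace_eq_local[OF cx(1) triv_at(1) that] by (simp add: local_trace_def)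
    qed
  next
    fix c d x assume cd: "c \<in> A" "d \<in> A" and x: "x \<in> snd c ` (fst c \<inter> fst d)"
    let ?t = "triv_at c x"
    obtain p where p: "x = snd c p" "p \<in> fst c" "p \<in> fst d" using x by auto
    then have pt: "p \<in> fst ?t" using triv_at(2)[of c x] smooth_atlasD(3)[OF A cd(1) p(2)] by simp
    have "transition c d x = snd d p" using p smooth_atlasD(3)[OF A cd(1) p(2)] by (simp add: transition_def)
    then have "power_trace (bundle_of r T \<theta>) n d (transition c d x) = local_trace ?t n d (transition c d x)"
      using p pt by (intro power_trace_eq_local[OF cd(2) triv_at(1)]) auto
    moreover have "local_trace ?t n c x = pullback (jacobian c d x) (local_trace ?t n d (transition c d x))"
      by (rule local_trace_chart[OF triv_at(1) cd]) (use p pt in auto)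
    ultimately show "power_trace (bundle_of r T \<theta>) n c x =
        pullback (jacobian c d x) (power_trace (bundle_of r T \<theta>) n d (transition c d x))"
      by (simp add: power_trace_eq)
  qed
  moreover have "\<exists>U. x \<in> U \<and> connection_on U (fst (bundle_of r T \<theta> c x)) (snd (bundle_of r T \<theta> c x))"
    if "c \<in> A" "x \<in> snd c ` fst c" for c x
    unfolding bundle_of_eq fst_conv snd_conv
    by (intro exI conjI) (rule triv_at_image[OF that], rule connection_on_bundle(1)[OF triv_at(1) that(1)])
  moreover have "power_trace (bundle_of r T \<theta>) n c x = 0" if "odd n" "c \<in> A" "x \<in> snd c ` fst c" for n c x
    unfolding power_trace_eq by (rule local_trace_odd[OF triv_at(1) that(2) triv_at_image[OF that(2,3)] that(1)])
  ultimately show ?thesis unfolding characteristic_bundle_def by blast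
qed

end

section \<open>The Chern character of the virtual bundle\<close>

lemma vch_form_simps:
  "vch_form [] c x = 0" "vch_form ((m, E) # W) c x = of_int m * ch_form E c x + vch_form W c x"
  "vch_form (W @ W') c x = vch_form W c x + vch_form W' c x"
  by (simp_all add: vch_form_def)

lemma vch_form_vscale: "vch_form (vscale m W) c x = of_int m * vch_form W c x"
  by (induction W) (auto simp: vscale_def vch_form_simps distrib_left mult.assoc)

definition has_connection :: "'n rvec set \<Rightarrow> ('x, 'n) chart \<Rightarrow> 'n::{finite,linorder} rvec \<Rightarrow> ('x, 'n) cbundle \<Rightarrow> bool" where
  "has_connection U c x E \<longleftrightarrow> connection_on U (fst (E c x)) (snd (E c x))"

lemma has_connection_trivial: "open U \<Longrightarrow> has_connection U c x (trivial_bundle r)"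
  by (auto simp: has_connection_def connection_on_def trivial_bundle_def smooth_ext_on_const homog_simps)

lemma has_connection_tensor:
  "has_connection U c x E \<Longrightarrow> has_connection U c x F \<Longrightarrow> has_connection U c x (tensor_bundle E F)"
  by (simp add: has_connection_def tensor_bundle_eq connection_on_kronecker_sum)

lemma has_connection_wedge: "has_connection U c x E \<Longrightarrow> has_connection U c x (wedge_bundle k E)"
  by (simp add: has_connection_def wedge_bundle_eq connection_on_wedge_matrix)

lemma ch_form_tensor:
  "has_connection U c x E \<Longrightarrow> has_connection U c x F \<Longrightarrow> x \<in> U \<Longrightarrow>
    ch_form (tensor_bundle E F) c x = ch_form E c x * ch_form F c x"
  by (simp add: ch_form_eq has_connection_def tensor_bundle_eq exp_trace_curv_kronecker_sum)

lemma ch_form_trivial: "ch_form (trivial_bundle r) c x = of_nat r"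
proof -
  have "connection_on UNIV {..<r} (\<lambda>y i j. 0 :: 'a ext)"
    by (auto simp: connection_on_def smooth_ext_on_const homog_simps)
  from exp_trace_flat[OF this, of x] show ?thesis by (simp add: ch_form_eq trivial_bundle_def)
qed

lemma ch_form_wedge_trivial: "ch_form (wedge_bundle k (trivial_bundle r)) c x = of_nat (r choose k)"
proof -
  have "connection_on UNIV {..<r} (\<lambda>y i j. 0 :: 'a ext)"
    by (auto simp: connection_on_def smooth_ext_on_const homog_simps)
  from exp_trace_wedge_flat[OF this, of x] show ?thesis
    by (simp add: ch_form_eq wedge_bundle_eq trivial_bundle_def)
qed

lemma ch_form_wedge:
  assumes "has_connection U c x E" "x \<in> U"
  shows "ch_form (wedge_bundle 0 E) c x = 1" "ch_form (wedge_bundle (Suc 0) E) c x = ch_form E c x"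
    "2 * ch_form (wedge_bundle 2 E) c x = ch_form E c x ^ 2 - exp_trace 2 (fst (E c x)) (curvature E c x)"
proof -
  note con = assms(1)[unfolded has_connection_def]
  show "ch_form (wedge_bundle 0 E) c x = 1" "ch_form (wedge_bundle (Suc 0) E) c x = ch_form E c x"
    "2 * ch_form (wedge_bundle 2 E) c x = ch_form E c x ^ 2 - exp_trace 2 (fst (E c x)) (curvature E c x)"
    unfolding ch_form_eq wedge_bundle_eq fst_conv snd_conv curvature_eq_curv
    using exp_trace_wedge_0[OF con assms(2)] exp_trace_wedge_1[OF con assms(2)] exp_trace_wedge_2[OF con assms(2)]
    by simp_all
qed

lemma vwedge_two:
  "vwedge 2 E F = [(1, wedge_bundle 2 E), (-1, tensor_bundle (wedge_bundle 2 F) (wedge_bundle 0 E)),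
     (-1, tensor_bundle (wedge_bundle (Suc 0) F) (wedge_bundle (Suc 0) E)),
     (1, tensor_bundle (wedge_bundle (Suc 0) F) (tensor_bundle (wedge_bundle (Suc 0) F) (wedge_bundle 0 E)))]"
proof -
  have 0: "vwedge 0 E F = [(1, wedge_bundle 0 E)]" by (subst vwedge.simps) simp
  have 1: "vwedge (Suc 0) E F = [(1, wedge_bundle (Suc 0) E),
      (-1, tensor_bundle (wedge_bundle (Suc 0) F) (wedge_bundle 0 E))]"
    by (subst vwedge.simps) (simp add: 0 vscale_def vtensor_def)
  have "[0..<2] = [0, Suc 0]" by (simp add: upt_rec)
  then show ?thesis by (subst vwedge.simps) (simp add: 0 1 vscale_def vtensor_def numeral_2_eq_2)
qed

text \<open>Twice the Chern character of \<open>\<Lambda>\<^sup>2\<close> is the square of the Chern character minus that of the second Adams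
  operation. The square cancels against the tensor square, and the ranks cancel among themselves, so that the
  result is linear in the traces of powers of the curvatures.\<close>

lemma vch_form_W:
  fixes V TX :: "('x, 'n::{finite,linorder}) cbundle" and m r :: nat
  assumes V: "has_connection U c x V" and x: "x \<in> U"
  defines "W \<equiv> vminus TX (trivial_bundle m) @ vscale 2 (vwedge 2 V (trivial_bundle r)) @
    vscale (-1) (vtensor (vminus V (trivial_bundle r)) (vminus V (trivial_bundle r))) @ vminus V (trivial_bundle r)"
  shows "vch_form W c x = ch_form TX c x - of_nat m + (ch_form V c x - exp_trace 2 (fst (V c x)) (curvature V c x))"
proof -
  have U: "open U" using V connection_onD(1) by (auto simp: has_connection_def)
  let ?F = "trivial_bundle r :: ('x, 'n) cbundle"
  note F = has_connection_trivial[OF U, of c x r]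
  note con = V F has_connection_wedge has_connection_tensor
  have ten: "ch_form (tensor_bundle E F) c x = ch_form E c x * ch_form F c x"
    if "has_connection U c x E" "has_connection U c x F" for E F
    by (rule ch_form_tensor[OF that x])
  define v where "v = ch_form V c x"
  define R where "R = (of_nat r :: 'n ext)"
  define b where "b = (of_nat (r choose 2) :: 'n ext)"
  define l where "l = ch_form (wedge_bundle 2 V) c x"
  define e where "e = exp_trace 2 (fst (V c x)) (curvature V c x)"
  have l: "2 * l = v ^ 2 - e" using ch_form_wedge(3)[OF V x] by (simp add: l_def v_def e_def)
  have b: "2 * b = R * R - R"
  proof -
    have "2 * (r choose 2) + r = r * r"
      by (cases r) (simp_all add: choose_two)
    then have "of_nat (2 * (r choose 2) + r) = (of_nat (r * r) :: 'n ext)" by simp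
    then show ?thesis by (simp add: b_def R_def eq_diff_eq)
  qed
  have Rv: "v * R = R * v" unfolding R_def by (rule mult_of_nat_commute[symmetric])
  have a: "vch_form (vwedge 2 V ?F) c x = l - b - R * v + R * R"
    by (simp add: vwedge_two vch_form_simps ten con ch_form_wedge[OF V x] ch_form_wedge_trivial l_def b_def R_def v_def)
  have d: "vch_form (vtensor (vminus V ?F) (vminus V ?F)) c x = v * v - v * R - R * v + R * R"
    by (simp add: vtensor_def vminus_def vch_form_simps ten con ch_form_trivial R_def v_def)
  have m: "vch_form (vminus E (trivial_bundle k)) c x = ch_form E c x - of_nat k" for E k
    by (simp add: vminus_def vch_form_simps ch_form_trivial)
  have "vch_form W c x = ch_form TX c x - of_nat m + (2 * l - 2 * b - 2 * (R * v) + 2 * (R * R) -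
      (v * v - v * R - R * v + R * R) + (v - R))"
    unfolding W_def vch_form_simps vch_form_vscale a d m
    by (simp add: v_def[symmetric] R_def[symmetric] distrib_left right_diff_distrib)
  also have "\<dots> = ch_form TX c x - of_nat m + (v - e)"
    unfolding l b Rv by (simp add: power2_eq_square mult_2)
  finally show ?thesis by (simp add: v_def e_def)
qed

section \<open>Products of closed forms\<close>

lemma diff_form_iff:
  "diff_form A UNIV k \<omega> \<longleftrightarrow> (\<forall>c\<in>A. smooth_ext_on (snd c ` fst c) (\<omega> c) \<and>
     (\<forall>x\<in>snd c ` fst c. real_ext (\<omega> c x) \<and> homog k (\<omega> c x))) \<and>
     (\<forall>c\<in>A. \<forall>d\<in>A. \<forall>x\<in>snd c ` (fst c \<inter> fst d). \<omega> c x = pullback (jacobian c d x) (\<omega> d (transition c d x)))"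
  unfolding diff_form_def smooth_ext_on_def real_ext_def homog_def Int_UNIV_right by blast

lemma diff_formD:
  assumes "diff_form A UNIV k \<omega>" "c \<in> A"
  shows "smooth_ext_on (snd c ` fst c) (\<omega> c)"
    "x \<in> snd c ` fst c \<Longrightarrow> real_ext (\<omega> c x)" "x \<in> snd c ` fst c \<Longrightarrow> homog k (\<omega> c x)"
    "d \<in> A \<Longrightarrow> x \<in> snd c ` (fst c \<inter> fst d) \<Longrightarrow>
      \<omega> c x = pullback (jacobian c d x) (\<omega> d (transition c d x))"
  using assms unfolding diff_form_iff by blast+

lemma diff_form_cong:
  assumes A: "smooth_atlas A" and d: "diff_form A UNIV k \<omega>"
    and eq: "\<And>c x. c \<in> A \<Longrightarrow> x \<in> snd c ` fst c \<Longrightarrow> \<eta> c x = \<omega> c x"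
  shows "diff_form A UNIV k \<eta>"
  unfolding diff_form_iff
proof (intro conjI ballI)
  fix c assume c: "c \<in> A"
  show "smooth_ext_on (snd c ` fst c) (\<eta> c)"
    using smooth_ext_on_cong[OF smooth_atlasD(1)[OF A c], of "\<eta> c" "\<omega> c"] eq[OF c] diff_formD(1)[OF d c]
    by simp
  show "real_ext (\<eta> c x)" "homog k (\<eta> c x)" if "x \<in> snd c ` fst c" for x
    unfolding eq[OF c that] using diff_formD(2,3)[OF d c that] by blast+
next
  fix c d' x assume cd: "c \<in> A" "d' \<in> A" and x: "x \<in> snd c ` (fst c \<inter> fst d')"
  have "x \<in> snd c ` fst c" "transition c d' x \<in> snd d' ` fst d'"
    using x transition_facts(3)[OF A cd] by auto
  then show "\<eta> c x = pullback (jacobian c d' x) (\<eta> d' (transition c d' x))"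
    using diff_formD(4)[OF d cd x] eq cd by simp
qed

lemma closed_formD: "closed_form A k \<omega> \<Longrightarrow> c \<in> A \<Longrightarrow> x \<in> snd c ` fst c \<Longrightarrow> ext_d (\<omega> c) x = 0"
  unfolding closed_form_def by blast

lemma closed_form_cong:
  assumes A: "smooth_atlas A" and d: "closed_form A k \<omega>"
    and eq: "\<And>c x. c \<in> A \<Longrightarrow> x \<in> snd c ` fst c \<Longrightarrow> \<eta> c x = \<omega> c x"
  shows "closed_form A k \<eta>"
  unfolding closed_form_def
proof (intro conjI ballI)
  show "diff_form A UNIV k \<eta>" using diff_form_cong[OF A _ eq] d by (simp add: closed_form_def)
  fix c x assume cx: "c \<in> A" "x \<in> snd c ` fst c"
  have "ext_d (\<eta> c) x = ext_d (\<omega> c) x"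
    by (rule ext_d_cong[OF smooth_atlasD(1)[OF A cx(1)] cx(2)]) (rule eq[OF cx(1)])
  then show "ext_d (\<eta> c) x = 0" using closed_formD[OF d cx] by simp
qed

lemma diff_formI:
  assumes "\<And>c. c \<in> A \<Longrightarrow> smooth_ext_on (snd c ` fst c) (\<omega> c)"
    "\<And>c x. c \<in> A \<Longrightarrow> x \<in> snd c ` fst c \<Longrightarrow> real_ext (\<omega> c x)"
    "\<And>c x. c \<in> A \<Longrightarrow> x \<in> snd c ` fst c \<Longrightarrow> homog k (\<omega> c x)"
    "\<And>c d x. c \<in> A \<Longrightarrow> d \<in> A \<Longrightarrow> x \<in> snd c ` (fst c \<inter> fst d) \<Longrightarrow>
      \<omega> c x = pullback (jacobian c d x) (\<omega> d (transition c d x))"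
  shows "diff_form A UNIV k \<omega>"
  using assms unfolding diff_form_iff by blast

lemma diff_form_mult:
  assumes A: "smooth_atlas A" and d: "diff_form A UNIV k \<omega>" "diff_form A UNIV l \<eta>"
  shows "diff_form A UNIV (k + l) (\<lambda>c x. \<omega> c x * \<eta> c x)"
proof (rule diff_formI)
  note a = diff_formD[OF d(1)] and b = diff_formD[OF d(2)]
  show "smooth_ext_on (snd c ` fst c) (\<lambda>x. \<omega> c x * \<eta> c x)" if "c \<in> A" for c
    by (rule smooth_ext_on_mult[OF smooth_atlasD(1)[OF A that] a(1)[OF that] b(1)[OF that]])
  show "real_ext (\<omega> c x * \<eta> c x)" "homog (k + l) (\<omega> c x * \<eta> c x)" if "c \<in> A" "x \<in> snd c ` fst c" for c x
    by (rule real_ext_mult[OF a(2)[OF that] b(2)[OF that]], rule homog_mult[OF a(3)[OF that] b(3)[OF that]])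
  show "\<omega> c x * \<eta> c x = pullback (jacobian c d x) (\<omega> d (transition c d x) * \<eta> d (transition c d x))"
    if "c \<in> A" "d \<in> A" "x \<in> snd c ` (fst c \<inter> fst d)" for c d x
    unfolding pullback_mult a(4)[OF that, symmetric] b(4)[OF that, symmetric] ..
qed

lemma diff_form_scale:
  assumes A: "smooth_atlas A" and d: "diff_form A UNIV k \<omega>"
  shows "diff_form A UNIV k (\<lambda>c x. rconst r * \<omega> c x)"
proof (rule diff_formI)
  note a = diff_formD[OF d]
  show "smooth_ext_on (snd c ` fst c) (\<lambda>x. rconst r * \<omega> c x)" if "c \<in> A" for c
    by (rule smooth_ext_on_mult[OF smooth_atlasD(1)[OF A that] smooth_ext_on_const a(1)[OF that]])
  show "real_ext (rconst r * \<omega> c x)" "homog k (rconst r * \<omega> c x)" if "c \<in> A" "x \<in> snd c ` fst c" for c x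
    by (rule real_ext_mult[OF real_ext_simps(7) a(2)[OF that]], rule homog_const_mult[OF a(3)[OF that]])
  show "rconst r * \<omega> c x = pullback (jacobian c d x) (rconst r * \<omega> d (transition c d x))"
    if "c \<in> A" "d \<in> A" "x \<in> snd c ` (fst c \<inter> fst d)" for c d x
    unfolding pullback_simps a(4)[OF that, symmetric] ..
qed

lemma diff_form_add:
  assumes A: "smooth_atlas A" and d: "diff_form A UNIV k \<omega>" "diff_form A UNIV k \<eta>"
  shows "diff_form A UNIV k (\<lambda>c x. \<omega> c x + \<eta> c x)"
proof (rule diff_formI)
  note a = diff_formD[OF d(1)] and b = diff_formD[OF d(2)]
  show "smooth_ext_on (snd c ` fst c) (\<lambda>x. \<omega> c x + \<eta> c x)" if "c \<in> A" for c
    by (rule smooth_ext_on_add[OF smooth_atlasD(1)[OF A that] a(1)[OF that] b(1)[OF that]])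
  show "real_ext (\<omega> c x + \<eta> c x)" "homog k (\<omega> c x + \<eta> c x)" if "c \<in> A" "x \<in> snd c ` fst c" for c x
    by (rule real_ext_simps(5)[OF a(2)[OF that] b(2)[OF that]], rule homog_simps(3)[OF a(3)[OF that] b(3)[OF that]])
  show "\<omega> c x + \<eta> c x = pullback (jacobian c d x) (\<omega> d (transition c d x) + \<eta> d (transition c d x))"
    if "c \<in> A" "d \<in> A" "x \<in> snd c ` (fst c \<inter> fst d)" for c d x
    unfolding pullback_simps a(4)[OF that, symmetric] b(4)[OF that, symmetric] ..
qed

lemma diff_form_smooth: "diff_form A UNIV k \<omega> \<Longrightarrow> c \<in> A \<Longrightarrow> smooth_ext_on (snd c ` fst c) (\<omega> c)"
  by (simp add: diff_form_iff)

lemma closed_form_mult: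
  assumes A: "smooth_atlas A" and d: "closed_form A k \<omega>" "closed_form A l \<eta>" and k: "even k"
  shows "closed_form A (k + l) (\<lambda>c x. \<omega> c x * \<eta> c x)"
  unfolding closed_form_def
proof (intro conjI ballI)
  show "diff_form A UNIV (k + l) (\<lambda>c x. \<omega> c x * \<eta> c x)"
    using d by (intro diff_form_mult A) (auto simp: closed_form_def)
  fix c x assume cx: "c \<in> A" "x \<in> snd c ` fst c"
  have "even_ext (\<omega> c x)"
    using d(1) diff_formD(3)[OF _ cx, of k \<omega>] k by (auto simp: closed_form_def intro: homog_imp_even)
  then have "ext_d (\<lambda>y. \<omega> c y * \<eta> c y) x = ext_d (\<omega> c) x * \<eta> c x + \<omega> c x * ext_d (\<eta> c) x"
    using d cx by (intro ext_d_mult_even[OF smooth_atlasD(1)[OF A cx(1)] cx(2)])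
      (auto simp: closed_form_def diff_form_smooth)
  then show "ext_d (\<lambda>y. \<omega> c y * \<eta> c y) x = 0"
    using closed_formD[OF d(1) cx] closed_formD[OF d(2) cx] by simp
qed

lemma closed_form_scale:
  assumes A: "smooth_atlas A" and d: "closed_form A k \<omega>"
  shows "closed_form A k (\<lambda>c x. rconst r * \<omega> c x)"
  unfolding closed_form_def
proof (intro conjI ballI)
  show "diff_form A UNIV k (\<lambda>c x. rconst r * \<omega> c x)"
    using d by (intro diff_form_scale A) (auto simp: closed_form_def)
  fix c x assume cx: "c \<in> A" "x \<in> snd c ` fst c"
  have "ext_d (\<lambda>y. rconst r * \<omega> c y) x = rconst r * ext_d (\<omega> c) x"
    using d cx by (intro ext_d_const_mult[OF smooth_atlasD(1)[OF A cx(1)] cx(2)])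
      (auto simp: closed_form_def diff_form_smooth)
  then show "ext_d (\<lambda>y. rconst r * \<omega> c y) x = 0" using closed_formD[OF d cx] by simp
qed

lemma closed_form_add:
  assumes A: "smooth_atlas A" and d: "closed_form A k \<omega>" "closed_form A k \<eta>"
  shows "closed_form A k (\<lambda>c x. \<omega> c x + \<eta> c x)"
  unfolding closed_form_def
proof (intro conjI ballI)
  show "diff_form A UNIV k (\<lambda>c x. \<omega> c x + \<eta> c x)"
    using d by (intro diff_form_add A) (auto simp: closed_form_def)
  fix c x assume cx: "c \<in> A" "x \<in> snd c ` fst c"
  have "ext_d (\<lambda>y. \<omega> c y + \<eta> c y) x = ext_d (\<omega> c) x + ext_d (\<eta> c) x"
    using d cx by (intro ext_d_add[OF _ _ cx(2)]) (auto simp: closed_form_def diff_form_smooth)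
  then show "ext_d (\<lambda>y. \<omega> c y + \<eta> c y) x = 0"
    using closed_formD[OF d(1) cx] closed_formD[OF d(2) cx] by simp
qed

section \<open>Characteristic forms in terms of power traces\<close>

lemma mpower_scale: "mpower I (\<lambda>i j. ext_const z * M i j) k i j = ext_const (z ^ k) * mpower I M k i j"
proof (induction k arbitrary: i)
  case (Suc k)
  then show ?case by (simp add: ext_const_mult_mult sum_distrib_left ext_const_const_mult)
qed (simp add: ext_const_simps)

lemma mtrace_fps_mapp:
  fixes R :: "nat \<Rightarrow> nat \<Rightarrow> 'n::{finite,linorder} ext"
  shows "mtrace I (fps_mapp I f (\<lambda>i j. ext_const z * R i j)) =
    (\<Sum>k\<le>CARD('n). ext_const (fps_nth f k * z ^ k) * mtrace I (mpower I R k))"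
  unfolding mtrace_def fps_mapp_def mpower_scale ext_const_const_mult sum_distrib_left
  by (rule sum.swap)

text \<open>In dimension \<open>20\<close>, and if the traces of odd powers vanish, only five traces matter.\<close>

lemma mtrace_fps_mapp_20:
  fixes R :: "nat \<Rightarrow> nat \<Rightarrow> 20 ext"
  assumes R: "\<And>i j. i \<in> I \<Longrightarrow> j \<in> I \<Longrightarrow> homog 2 (R i j)"
    and odd: "\<And>n. odd n \<Longrightarrow> mtrace I (mpower I R n) = 0"
  shows "mtrace I (fps_mapp I f (\<lambda>i j. ext_const z * R i j)) =
    ext_const (fps_nth f 0 * of_nat (card I)) +
    (\<Sum>k\<in>{1..5}. ext_const (fps_nth f (2 * k) * z ^ (2 * k)) * mtrace I (mpower I R (2 * k)))"
proof -
  let ?t = "\<lambda>k. ext_const (fps_nth f k * z ^ k) * mtrace I (mpower I R k)"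
  have h: "homog (2 * k) (mtrace I (mpower I R k))" for k
    unfolding mtrace_def
  proof (rule homog_sum)
    show "homog (2 * k) (mpower I R k i i)" if "i \<in> I" for i
      by (rule homog_mpower[OF _ that that]) (rule R)
  qed
  have z: "?t k = 0" if "k \<notin> (\<lambda>k. 2 * k) ` {0..5}" for k
  proof (cases "odd k")
    case False
    then obtain m where "k = 2 * m" by blast
    then have "k > 10" using that by (cases "m \<le> 5") auto
    then show ?thesis using homog_gt_card[OF h[of k]] by simp
  qed (simp add: odd)
  have "mtrace I (fps_mapp I f (\<lambda>i j. ext_const z * R i j)) = (\<Sum>k\<le>20. ?t k)"
    by (simp add: mtrace_fps_mapp)
  also have "\<dots> = (\<Sum>k\<in>(\<lambda>k. 2 * k) ` {0..5}. ?t k)"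
    by (rule sum.mono_neutral_right) (use z in auto)
  also have "\<dots> = (\<Sum>k\<in>{0..5}. ?t (2 * k))"
    by (rule sum.reindex_cong[of "\<lambda>k. 2 * k"]) (auto simp: inj_on_def)
  also have "\<dots> = ?t 0 + (\<Sum>k\<in>{1..5}. ?t (2 * k))"
    by (simp add: sum.atLeast_Suc_atMost)
  also have "?t 0 = ext_const (fps_nth f 0 * of_nat (card I))"
    by (simp add: mtrace_def ext_const_mult ext_const_of_nat)
  finally show ?thesis .
qed

lemma degree_part_mult_homog:
  assumes "homog m a"
  shows "degree_part n (a * b) = (if m \<le> n then a * degree_part (n - m) b else 0)"
proof -
  have "degree_part n (a * b) = (\<Sum>k\<le>n. if k = m then a * degree_part (n - m) b else 0)"
    unfolding degree_part_mult using homog_eq_degree_part[OF assms] by (intro sum.cong) auto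
  then show ?thesis by simp
qed

section \<open>The cancellation formula\<close>

text \<open>The scalar factors of the curvature in the Chern character and in the two multiplicative
  genera.\<close>

abbreviation chern_const :: complex where "chern_const \<equiv> \<i> / (2 * of_real pi)"
abbreviation genus_const :: complex where "genus_const \<equiv> \<i> / (4 * of_real pi)"

text \<open>The characteristic forms of the theorem depend on the two curvatures only through these
  combinations.\<close>

definition S_form :: "('x, 20) cbundle \<Rightarrow> ('x, 20) cbundle \<Rightarrow> nat \<Rightarrow> ('x, 20) form" where
  "S_form E V k c x = ext_const (chern_const ^ (2 * k)) *
     (power_trace E (2 * k) c x - ext_const (4 ^ k - 1) * power_trace V (2 * k) c x)"

lemma chern_const_even_power: "chern_const ^ (2 * k) = of_real ((- 1 / (4 * pi ^ 2)) ^ k)"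
proof -
  have "chern_const ^ 2 = of_real (- 1 / (4 * pi ^ 2))" by (simp add: power_divide power_mult_distrib)
  then show ?thesis by (simp add: power_mult)
qed

lemma genus_const_even_power: "genus_const ^ (2 * k) = chern_const ^ (2 * k) / 4 ^ k"
proof -
  have "genus_const = chern_const / 2" by simp
  then have "genus_const ^ (2 * k) = chern_const ^ (2 * k) / 2 ^ (2 * k)" by (simp only: power_divide)
  then show ?thesis by (simp add: power_mult)
qed

lemma characteristic_bundleD:
  assumes "characteristic_bundle A E"
  shows "closed_form A (2 * n) (power_trace E n)"
    and "c \<in> A \<Longrightarrow> x \<in> snd c ` fst c \<Longrightarrow> odd n \<Longrightarrow> power_trace E n c x = 0"
    and "c \<in> A \<Longrightarrow> x \<in> snd c ` fst c \<Longrightarrow> \<exists>U. x \<in> U \<and> connection_on U (fst (E c x)) (snd (E c x))"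
proof -
  note a = assms[unfolded characteristic_bundle_def]
  show "closed_form A (2 * n) (power_trace E n)"
    by (rule spec[OF conjunct1[OF conjunct2[OF a]]])
  show "c \<in> A \<Longrightarrow> x \<in> snd c ` fst c \<Longrightarrow> odd n \<Longrightarrow> power_trace E n c x = 0"
    by (rule spec[OF conjunct2[OF conjunct2[OF a]], THEN bspec, THEN bspec, THEN mp])
  show "c \<in> A \<Longrightarrow> x \<in> snd c ` fst c \<Longrightarrow> \<exists>U. x \<in> U \<and> connection_on U (fst (E c x)) (snd (E c x))"
    by (rule conjunct1[OF a, THEN bspec, THEN bspec])
qed

locale two_bundles =
  fixes A :: "('x::topological_space, 20) chart set" and TX V :: "('x, 20) cbundle" and r :: nat
  assumes A: "smooth_atlas A" and TX: "characteristic_bundle A TX" and V: "characteristic_bundle A V"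
    and rank_TX: "\<And>c x. card (fst (TX c x)) = 20" and rank_V: "\<And>c x. card (fst (V c x)) = r"
begin

abbreviation "S \<equiv> S_form TX V"

lemma closed_S: "closed_form A (4 * k) (S k)"
proof -
  have t: "closed_form A (4 * k) (power_trace E (2 * k))" if "characteristic_bundle A E" for E
    using characteristic_bundleD(1)[OF that, of "2 * k"] by simp
  have "closed_form A (4 * k) (\<lambda>c x. rconst ((- 1 / (4 * pi ^ 2)) ^ k) *
      (power_trace TX (2 * k) c x + rconst (- (4 ^ k - 1)) * power_trace V (2 * k) c x))"
    by (intro closed_form_scale closed_form_add A t TX V)
  moreover have "S k = (\<lambda>c x. rconst ((- 1 / (4 * pi ^ 2)) ^ k) *
      (power_trace TX (2 * k) c x + rconst (- (4 ^ k - 1)) * power_trace V (2 * k) c x))"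
    unfolding S_form_def chern_const_even_power
    by (intro ext, rule ext_eqI) (simp add: algebra_simps)
  ultimately show ?thesis by simp
qed

context
  fixes c x assumes c: "c \<in> A" and x: "x \<in> snd c ` fst c"
begin

lemma homog_curvature:
  assumes "characteristic_bundle A E" "i \<in> fst (E c x)" "j \<in> fst (E c x)"
  shows "homog 2 (curvature E c x i j)"
proof -
  obtain U where "x \<in> U" "connection_on U (fst (E c x)) (snd (E c x))"
    using characteristic_bundleD(3)[OF assms(1) c x] by blast
  then show ?thesis unfolding curvature_eq_curv by (intro homog_curv assms)
qed

lemma series_trace:
  assumes "characteristic_bundle A E"
  shows "mtrace (fst (E c x)) (fps_mapp (fst (E c x)) f (\<lambda>i j. ext_const z * curvature E c x i j)) =
    ext_const (fps_nth f 0 * of_nat (card (fst (E c x)))) +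
    (\<Sum>k\<in>{1..5}. ext_const (fps_nth f (2 * k) * z ^ (2 * k)) * power_trace E (2 * k) c x)"
  unfolding power_trace_def
proof (rule mtrace_fps_mapp_20)
  show "mtrace (fst (E c x)) (mpower (fst (E c x)) (curvature E c x) n) = 0" if "odd n" for n
    using characteristic_bundleD(2)[OF assms c x that] by (simp add: power_trace_def)
qed (rule homog_curvature[OF assms])

lemma homog_S: "homog (4 * k) (S k c x)"
  using closed_S[of k] diff_formD(3)[OF _ c x] by (auto simp: closed_form_def)

lemma even_S: "even_ext (S k c x)"
  using homog_imp_even[OF homog_S] by simp

text \<open>The Adams operation multiplies the part of degree \<open>4 * k\<close> by \<open>4 ^ k\<close>,
  so that the bundle \<open>V\<close> contributes with the factor \<open>1 - 4 ^ k\<close>.\<close>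

lemma ch_eq_S:
  "ch_form TX c x - of_nat 20 + (ch_form V c x - exp_trace 2 (fst (V c x)) (curvature V c x)) =
    (\<Sum>k\<in>{1..5}. ext_const (1 / fact (2 * k)) * S k c x)"
proof -
  have "ch_form TX c x = ext_const 20 + (\<Sum>k\<in>{1..5}. ext_const (1 / fact (2 * k) * chern_const ^ (2 * k)) * power_trace TX (2 * k) c x)"
    unfolding ch_form_eq exp_trace_def curvature_eq_curv[symmetric] series_trace[OF TX] rank_TX by simp
  moreover have "ch_form V c x = ext_const (of_nat r) + (\<Sum>k\<in>{1..5}. ext_const (1 / fact (2 * k) * chern_const ^ (2 * k)) * power_trace V (2 * k) c x)"
    unfolding ch_form_eq exp_trace_def curvature_eq_curv[symmetric] series_trace[OF V] rank_V by simp
  moreover have "exp_trace 2 (fst (V c x)) (curvature V c x) =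
      ext_const (of_nat r) + (\<Sum>k\<in>{1..5}. ext_const (4 ^ k / fact (2 * k) * chern_const ^ (2 * k)) * power_trace V (2 * k) c x)"
    unfolding exp_trace_def series_trace[OF V] rank_V by (simp add: power_mult)
  ultimately have "ch_form TX c x - of_nat 20 + (ch_form V c x - exp_trace 2 (fst (V c x)) (curvature V c x)) =
      (\<Sum>k\<in>{1..5}. ext_const (1 / fact (2 * k) * chern_const ^ (2 * k)) * power_trace TX (2 * k) c x +
        (ext_const (1 / fact (2 * k) * chern_const ^ (2 * k)) * power_trace V (2 * k) c x -
         ext_const (4 ^ k / fact (2 * k) * chern_const ^ (2 * k)) * power_trace V (2 * k) c x))"
    by (simp add: sum.distrib sum_subtractf ext_const_numeral)
  also have "\<dots> = (\<Sum>k\<in>{1..5}. ext_const (1 / fact (2 * k)) * S k c x)"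
    by (intro sum.cong refl ext_eqI) (simp add: S_form_def algebra_simps)
  finally show ?thesis .
qed

definition "P = A_hat_form TX c x * det_cosh_form V c x"

text \<open>The logarithmic derivatives of the two factors of \<open>P\<close> add up. By the ratios of
  their coefficients, and as \<open>genus_const\<close> is half of \<open>chern_const\<close>, the same
  combinations of traces arise as in the Chern character.\<close>

lemma P_facts:
  shows "even_ext P" "degree_part 0 P = 1"
    "2 * euler P = (\<Sum>k\<in>{1..5}. ext_const (fps_nth A_hat_log (2 * k) / 4 ^ k) * S k c x) * P"
proof -
  let ?IX = "fst (TX c x)" and ?IV = "fst (V c x)"
  let ?RX = "scaled_curvature genus_const TX c x" and ?RV = "scaled_curvature genus_const V c x"
  let ?a = "A_hat_form TX c x" and ?d = "det_cosh_form V c x"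
  have fin: "finite ?IX" "finite ?IV"
    using characteristic_bundleD(3)[OF TX c x] characteristic_bundleD(3)[OF V c x] connection_onD(2) by blast+
  have hX: "homog 2 (?RX i j)" if "i \<in> ?IX" "j \<in> ?IX" for i j
    unfolding scaled_curvature_def by (intro homog_const_mult homog_curvature[OF TX that])
  have hV: "homog 2 (?RV i j)" if "i \<in> ?IV" "j \<in> ?IV" for i j
    unfolding scaled_curvature_def by (intro homog_const_mult homog_curvature[OF V that])
  have a: "even_ext ?a" "ext_coeff ?a {} = 1" "2 * euler ?a = mtrace ?IX (fps_mapp ?IX A_hat_log ?RX) * ?a"
    unfolding A_hat_form_def index_set_def
    using euler_form_sqrt_mdet[of ?IX ?RX A_hat_series A_hat_log, OF fin(1) hX A_hat_series_0 A_hat_log_mult]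
    by simp_all
  have d: "even_ext ?d" "ext_coeff ?d {} = 1" "2 * euler ?d = mtrace ?IV (fps_mapp ?IV cosh_log ?RV) * ?d"
    unfolding det_cosh_form_def index_set_def
    using euler_form_sqrt_mdet[of ?IV ?RV fps_cosh cosh_log, OF fin(2) hV _ cosh_log_mult]
    by (simp_all add: fps_nth_cosh)
  show "even_ext P" unfolding P_def by (rule even_ext_mult[OF a(1) d(1)])
  have "degree_part 0 P = ext_const (ext_coeff P {})" by (intro ext_eqI) auto
  then show "degree_part 0 P = 1" by (simp add: P_def a d ext_const_simps)
  let ?hX = "mtrace ?IX (fps_mapp ?IX A_hat_log ?RX)" and ?hV = "mtrace ?IV (fps_mapp ?IV cosh_log ?RV)"
  have "2 * euler P = (2 * euler ?a) * ?d + ?a * (2 * euler ?d)"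
    by (simp add: P_def euler_mult mult_2 distrib_left distrib_right)
  also have "\<dots> = ?hX * P + ?a * (?hV * ?d)" unfolding a(3) d(3) by (simp add: P_def mult.assoc)
  also have "?a * (?hV * ?d) = (?a * ?hV) * ?d" by (rule mult.assoc[symmetric])
  also have "?a * ?hV = ?hV * ?a" by (rule even_ext_commute[OF a(1)])
  also have "(?hV * ?a) * ?d = ?hV * P" unfolding P_def by (rule mult.assoc)
  finally have e: "2 * euler P = (?hX + ?hV) * P" by (simp add: distrib_right)
  have cosh: "fps_nth cosh_log (2 * k) = - (4 ^ k - 1) * fps_nth A_hat_log (2 * k)" if "k \<in> {1..5}" for k :: nat
  proof -
    have "f (2 * k) = - (4 ^ k - 1) * g (2 * k)"
      if "f 2 = - 3 * g 2" "f 4 = - 15 * g 4" "f 6 = - 63 * g 6" "f 8 = - 255 * g 8" "f 10 = - 1023 * g 10"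
      for f g :: "nat \<Rightarrow> complex"
    proof -
      have "k = 1 \<or> k = 2 \<or> k = 3 \<or> k = 4 \<or> k = 5" using \<open>k \<in> {1..5}\<close> by auto
      then show ?thesis using that by (elim disjE) simp_all
    qed
    from this[of "fps_nth cosh_log" "fps_nth A_hat_log"] show ?thesis using cosh_log_nth(2-) by blast
  qed
  have "?hX + ?hV = (\<Sum>k\<in>{1..5}. ext_const (fps_nth A_hat_log (2 * k) * genus_const ^ (2 * k)) * power_trace TX (2 * k) c x +
      ext_const (fps_nth cosh_log (2 * k) * genus_const ^ (2 * k)) * power_trace V (2 * k) c x)"
    unfolding scaled_curvature_def[abs_def] series_trace[OF TX] series_trace[OF V] A_hat_log_nth(1) cosh_log_nth(1)
    by (simp only: sum.distrib ext_const_simps mult_zero_left add_0_left)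
  also have "\<dots> = (\<Sum>k\<in>{1..5}. ext_const (fps_nth A_hat_log (2 * k) / 4 ^ k) * S k c x)"
  proof (intro sum.cong refl ext_eqI)
    fix k I assume k: "k \<in> {1..5::nat}"
    define g where "g = fps_nth A_hat_log (2 * k)"
    show "ext_coeff (ext_const (fps_nth A_hat_log (2 * k) * genus_const ^ (2 * k)) * power_trace TX (2 * k) c x +
      ext_const (fps_nth cosh_log (2 * k) * genus_const ^ (2 * k)) * power_trace V (2 * k) c x) I =
      ext_coeff (ext_const (fps_nth A_hat_log (2 * k) / 4 ^ k) * S k c x) I"
      unfolding cosh[OF k] genus_const_even_power S_form_def g_def[symmetric]
      by (simp add: field_simps)
  qed
  finally show "2 * euler P = (\<Sum>k\<in>{1..5}. ext_const (fps_nth A_hat_log (2 * k) / 4 ^ k) * S k c x) * P"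
    using e by simp
qed

abbreviation "Pk k \<equiv> degree_part (4 * k) P"

lemma degree_part_S_mult: "degree_part (4 * k) (ext_const z * S j c x * b) = (if j \<le> k then ext_const z * (S j c x * degree_part (4 * (k - j)) b) else 0)"
  using degree_part_mult_homog[OF homog_S[of j], of "4 * k" b]
  by (simp add: mult.assoc degree_part_simps right_diff_distrib')

text \<open>The part of degree \<open>4 * k\<close> of the differential equation for \<open>P\<close>; it
  expresses \<open>Pk k\<close> by lower parts.\<close>

lemma P_recursion:
  "ext_const (of_nat (8 * k)) * Pk k =
    (\<Sum>j\<in>{1..5}. if j \<le> k then ext_const (fps_nth A_hat_log (2 * j) / 4 ^ j) * (S j c x * Pk (k - j)) else 0)"
proof -
  have "degree_part (4 * k) (2 * euler P) = degree_part (4 * k) (ext_const 2 * euler P)"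
    by (simp add: ext_const_numeral)
  also have "\<dots> = ext_const (of_nat (8 * k)) * Pk k"
    unfolding degree_part_simps degree_part_euler ext_const_const_mult by simp
  finally have "ext_const (of_nat (8 * k)) * Pk k = degree_part (4 * k) (2 * euler P)" ..
  also have "\<dots> = (\<Sum>j\<in>{1..5}. if j \<le> k then ext_const (fps_nth A_hat_log (2 * j) / 4 ^ j) * (S j c x * Pk (k - j)) else 0)"
    unfolding P_facts(3) sum_distrib_right degree_part_sum degree_part_S_mult ..
  finally show ?thesis .
qed

lemma P_values:
  shows "Pk 0 = 1" and "Pk 1 = rconst (- 1 / 48) * S 1 c x"
    and "Pk 2 = rconst (- 1 / 96) * (S 1 c x * Pk 1) + rconst (1 / 5760) * S 2 c x"
    and "Pk 3 = rconst (- 1 / 144) * (S 1 c x * Pk 2) + (rconst (1 / 8640) * (S 2 c x * Pk 1) +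
      rconst (- 1 / 362880) * S 3 c x)"
    and "Pk 4 = rconst (- 1 / 192) * (S 1 c x * Pk 3) + (rconst (1 / 11520) * (S 2 c x * Pk 2) +
      (rconst (- 1 / 483840) * (S 3 c x * Pk 1) + rconst (1 / 19353600) * S 4 c x))"
    and "Pk 5 = rconst (- 1 / 240) * (S 1 c x * Pk 4) + (rconst (1 / 14400) * (S 2 c x * Pk 3) +
      (rconst (- 1 / 604800) * (S 3 c x * Pk 2) + (rconst (1 / 24192000) * (S 4 c x * Pk 1) +
      rconst (- 1 / 958003200) * S 5 c x)))"
proof -
  have r: "{1..5::nat} = {1, 2, 3, 4, 5}" by auto
  show P0: "Pk 0 = 1" using P_facts(2) by simp
  define lam where "lam j = fps_nth A_hat_log (2 * j)" for j
  have num: "2 * 1 = (2::nat)" "2 * 2 = (4::nat)" "2 * 3 = (6::nat)" "2 * 4 = (8::nat)" "2 * 5 = (10::nat)" by simp_all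
  have lam: "lam 1 = - 2 / 3" "lam 2 = 2 / 45" "lam 3 = - 4 / 945" "lam 4 = 2 / 4725" "lam 5 = - 4 / 93555"
    by (simp_all only: lam_def num A_hat_log_nth)
  have rec: "ext_coeff (Pk k) I = 1 / of_nat (8 * k) *
      (\<Sum>j\<in>{1, 2, 3, 4, 5}. if j \<le> k then lam j / 4 ^ j * ext_coeff (S j c x * Pk (k - j)) I else 0)"
    if "k > 0" for k I
    using arg_cong[OF P_recursion[of k], of "\<lambda>a. ext_coeff a I"] that unfolding r
    by (simp add: lam_def if_distrib[of "\<lambda>a. ext_coeff a I"] nonzero_eq_divide_eq mult.commute
        del: ext_coeff_simps(8) mult_eq_if cong: if_cong)
  note simps = lam lam[simplified] P0[simplified] field_simps
  note del = ext_coeff_simps(8)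
  show "Pk 1 = rconst (- 1 / 48) * S 1 c x"
    by (rule ext_eqI, rule trans[OF rec[of 1]]) (simp_all add: simps del: del)
  show "Pk 2 = rconst (- 1 / 96) * (S 1 c x * Pk 1) + rconst (1 / 5760) * S 2 c x"
    by (rule ext_eqI, rule trans[OF rec[of 2]]) (simp_all add: simps del: del)
  show "Pk 3 = rconst (- 1 / 144) * (S 1 c x * Pk 2) + (rconst (1 / 8640) * (S 2 c x * Pk 1) +
      rconst (- 1 / 362880) * S 3 c x)"
    by (rule ext_eqI, rule trans[OF rec[of 3]]) (simp_all add: simps del: del)
  show "Pk 4 = rconst (- 1 / 192) * (S 1 c x * Pk 3) + (rconst (1 / 11520) * (S 2 c x * Pk 2) +
      (rconst (- 1 / 483840) * (S 3 c x * Pk 1) + rconst (1 / 19353600) * S 4 c x))"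
    by (rule ext_eqI, rule trans[OF rec[of 4]]) (simp_all add: simps del: del)
  show "Pk 5 = rconst (- 1 / 240) * (S 1 c x * Pk 4) + (rconst (1 / 14400) * (S 2 c x * Pk 3) +
      (rconst (- 1 / 604800) * (S 3 c x * Pk 2) + (rconst (1 / 24192000) * (S 4 c x * Pk 1) +
      rconst (- 1 / 958003200) * S 5 c x)))"
    by (rule ext_eqI, rule trans[OF rec[of 5]]) (simp_all add: simps del: del)
qed

end

end

text \<open>Here \<open>sk\<close> and \<open>pk\<close> have weight \<open>k\<close>. The monomials of
  weight five without \<open>s1\<close> are \<open>s5\<close> and \<open>s2 * s3\<close>. The factor \<open>-
  264\<close> is the one for which \<open>s5\<close> drops out, by \<open>264 / 958003200 = 1 /
  3628800\<close>; then so does \<open>s2 * s3\<close>, whose coefficient is \<open>3 / 50 / 362880 - 1 / 1050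
  / 5760 = 0\<close>.\<close>

lemma weight_five_cancellation:
  fixes s1 :: "'n::{finite,linorder} ext"
  assumes even: "even_ext s1" "even_ext s2" "even_ext s3"
    and p: "p1 = rconst (- 1 / 48) * s1"
      "p2 = rconst (- 1 / 96) * (s1 * p1) + rconst (1 / 5760) * s2"
      "p3 = rconst (- 1 / 144) * (s1 * p2) + (rconst (1 / 8640) * (s2 * p1) + rconst (- 1 / 362880) * s3)"
      "p5 = rconst (- 1 / 240) * (s1 * p4) + (rconst (1 / 14400) * (s2 * p3) +
        (rconst (- 1 / 604800) * (s3 * p2) + (rconst (1 / 24192000) * (s4 * p1) + rconst (- 1 / 958003200) * s5)))"
    and even4: "even_ext s4"
  shows "rconst (- 264) * p5 - (rconst (1 / 2) * (s1 * p4) + (rconst (1 / 24) * (s2 * p3) +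
      (rconst (1 / 720) * (s3 * p2) + (rconst (1 / 40320) * (s4 * p1) + rconst (1 / 3628800) * s5)))) =
    s1 * (rconst (3 / 5) * p4 + (rconst (1 / 2400) * (s2 * p2) + (rconst (1 / 6912000) * (s2 * s2) +
      (rconst (1 / 100800) * (s3 * p1) + rconst (1 / 1344000) * s4))))"
proof -
  note com = even_ext_commute[OF even(1)]
  have swap: "b * (s1 * d) = s1 * (b * d)" for b d
    using com[of b] by (simp add: mult.assoc[symmetric])
  have e4: "s4 * p1 = rconst (- 1 / 48) * (s1 * s4)"
    unfolding p(1) ext_const_left_commute[of s4] com[of s4] ..
  have e2: "s2 * p1 = rconst (- 1 / 48) * (s1 * s2)"
    unfolding p(1) ext_const_left_commute[of s2] com[of s2] ..
  have e3: "s3 * p2 = rconst (- 1 / 96) * (s1 * (s3 * p1)) + rconst (1 / 5760) * (s2 * s3)"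
    unfolding p(2) distrib_left ext_const_left_commute[of s3] swap even_ext_commute[OF even(2), of s3] ..
  have e5: "s2 * p3 = rconst (- 1 / 144) * (s1 * (s2 * p2)) +
      (rconst (1 / 8640 * (- 1 / 48)) * (s1 * (s2 * s2)) + rconst (- 1 / 362880) * (s2 * s3))"
    unfolding p(3) distrib_left ext_const_left_commute[of s2] e2 swap
    by (simp add: ext_const_const_mult)
  show ?thesis
    unfolding p(4) e3 e5 e4 distrib_left ext_const_left_commute[of s1]
    by (rule ext_eqI) (simp add: field_simps)
qed

context two_bundles
begin

abbreviation "P_part k c x \<equiv> degree_part (4 * k) (P c x)"

lemma closed_S_mult: "closed_form A l \<omega> \<Longrightarrow> n = 4 * k + l \<Longrightarrow> closed_form A n (\<lambda>c x. S k c x * \<omega> c x)"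
  using closed_form_mult[OF A closed_S[of k]] by simp

lemma closed_P_part:
  "closed_form A (4 * 1) (P_part 1)" "closed_form A (4 * 2) (P_part 2)" "closed_form A (4 * 3) (P_part 3)"
  "closed_form A (4 * 4) (P_part 4)" "closed_form A (4 * 5) (P_part 5)"
proof -
  note i = closed_form_add[OF A] closed_form_scale[OF A] closed_S
  show 1: "closed_form A (4 * 1) (P_part 1)"
    by (rule closed_form_cong[OF A _ P_values(2)]) (intro i)
  show 2: "closed_form A (4 * 2) (P_part 2)"
    by (rule closed_form_cong[OF A _ P_values(3)]) (intro i closed_S_mult[OF 1], simp_all)
  show 3: "closed_form A (4 * 3) (P_part 3)"
    by (rule closed_form_cong[OF A _ P_values(4)]) (intro i closed_S_mult[OF 1] closed_S_mult[OF 2], simp_all)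
  show 4: "closed_form A (4 * 4) (P_part 4)"
    by (rule closed_form_cong[OF A _ P_values(5)])
      (intro i closed_S_mult[OF 1] closed_S_mult[OF 2] closed_S_mult[OF 3], simp_all)
  show "closed_form A (4 * 5) (P_part 5)"
    by (rule closed_form_cong[OF A _ P_values(6)])
      (intro i closed_S_mult[OF 1] closed_S_mult[OF 2] closed_S_mult[OF 3] closed_S_mult[OF 4], simp_all)
qed

lemma degree_part_P_ch:
  assumes "c \<in> A" "x \<in> snd c ` fst c"
  shows "degree_part 20 (P c x * (\<Sum>k\<in>{1..5}. ext_const (1 / fact (2 * k)) * S k c x)) =
    rconst (1 / 2) * (S 1 c x * P_part 4 c x) + (rconst (1 / 24) * (S 2 c x * P_part 3 c x) +
      (rconst (1 / 720) * (S 3 c x * P_part 2 c x) + (rconst (1 / 40320) * (S 4 c x * P_part 1 c x) +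
      rconst (1 / 3628800) * S 5 c x)))"
proof -
  let ?C = "\<Sum>k\<in>{1..5}. ext_const (1 / fact (2 * k)) * S k c x"
  have r: "{1..5::nat} = {1, 2, 3, 4, 5}" by auto
  have "degree_part 20 (P c x * ?C) = degree_part (4 * 5) (?C * P c x)"
    using even_ext_commute[OF P_facts(1)[OF assms], of ?C] by simp
  also have "\<dots> = (\<Sum>k\<in>{1..5}. if k \<le> 5 then ext_const (1 / fact (2 * k)) * (S k c x * P_part (5 - k) c x) else 0)"
    unfolding sum_distrib_right degree_part_sum degree_part_S_mult[OF assms] ..
  also have "\<dots> = (\<Sum>k\<in>{1..5}. ext_const (1 / fact (2 * k)) * (S k c x * P_part (5 - k) c x))"
    by (intro sum.cong) auto
  also have "\<dots> = rconst (1 / 2) * (S 1 c x * P_part 4 c x) + (rconst (1 / 24) * (S 2 c x * P_part 3 c x) +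
      (rconst (1 / 720) * (S 3 c x * P_part 2 c x) + (rconst (1 / 40320) * (S 4 c x * P_part 1 c x) +
      rconst (1 / 3628800) * (S 5 c x * P_part 0 c x))))"
    unfolding r by (simp add: fact_numeral del: One_nat_def mult_0_right)
  finally show ?thesis using P_values(1)[OF assms] by simp
qed

definition "cofactor c x = rconst (3 / 5) * P_part 4 c x + (rconst (1 / 2400) * (S 2 c x * P_part 2 c x) +
    (rconst (1 / 6912000) * (S 2 c x * S 2 c x) + (rconst (1 / 100800) * (S 3 c x * P_part 1 c x) +
    rconst (1 / 1344000) * S 4 c x)))"

lemma closed_cofactor: "closed_form A 16 cofactor"
proof -
  have "closed_form A (4 * 4) (\<lambda>c x. cofactor c x)"
    unfolding cofactor_def
    by (intro closed_form_add[OF A] closed_form_scale[OF A] closed_S closed_P_part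
        closed_S_mult[OF closed_P_part(1)] closed_S_mult[OF closed_P_part(2)] closed_S_mult[OF closed_S[of 2]], simp_all)
  then show ?thesis by simp
qed

lemma difference_eq_cofactor_mult:
  assumes "c \<in> A" "x \<in> snd c ` fst c"
  shows "rconst (- 264) * P_part 5 c x -
      degree_part 20 (P c x * (\<Sum>k\<in>{1..5}. ext_const (1 / fact (2 * k)) * S k c x)) = cofactor c x * S 1 c x"
  unfolding degree_part_P_ch[OF assms]
  by (rule trans[OF _ even_ext_commute[OF even_S[OF assms, of 1], of "cofactor c x"]], unfold cofactor_def,
      rule weight_five_cancellation[OF even_S[OF assms] even_S[OF assms] even_S[OF assms] P_values(2)[OF assms]
      P_values(3)[OF assms] P_values(4)[OF assms] P_values(6)[OF assms] even_S[OF assms]])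

lemma closed_P_ch:
  "closed_form A 20 (\<lambda>c x. degree_part 20 (P c x * (\<Sum>k\<in>{1..5}. ext_const (1 / fact (2 * k)) * S k c x)))"
proof -
  have "closed_form A (4 * 5) (\<lambda>c x. degree_part 20 (P c x * (\<Sum>k\<in>{1..5}. ext_const (1 / fact (2 * k)) * S k c x)))"
    by (rule closed_form_cong[OF A _ degree_part_P_ch])
      (intro closed_form_add[OF A] closed_form_scale[OF A] closed_S closed_S_mult[OF closed_P_part(1)]
        closed_S_mult[OF closed_P_part(2)] closed_S_mult[OF closed_P_part(3)] closed_S_mult[OF closed_P_part(4)],
        simp_all)
  then show ?thesis by simp
qed

text \<open>As \<open>cofactor\<close> is closed and of even degree, its product with a primitive of
  \<open>S 1\<close> is a primitive of the difference.\<close>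

lemma cohomologous_P_ch:
  assumes \<eta>: "diff_form A UNIV 3 \<eta>" and S1: "\<And>c x. c \<in> A \<Longrightarrow> x \<in> snd c ` fst c \<Longrightarrow> S 1 c x = rconst s * ext_d (\<eta> c) x"
  shows "cohomologous A 20 (\<lambda>c x. rconst (- 264) * P_part 5 c x)
    (\<lambda>c x. degree_part 20 (P c x * (\<Sum>k\<in>{1..5}. ext_const (1 / fact (2 * k)) * S k c x)))"
  unfolding cohomologous_def
proof (intro conjI exI ballI)
  show "closed_form A 20 (\<lambda>c x. rconst (- 264) * P_part 5 c x)"
    using closed_form_scale[OF A closed_P_part(5), of "- 264"] by simp
  have d: "diff_form A UNIV 16 cofactor" using closed_cofactor by (simp add: closed_form_def)
  show "diff_form A UNIV (20 - 1) (\<lambda>c x. rconst s * (cofactor c x * \<eta> c x))"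
    using diff_form_scale[OF A diff_form_mult[OF A d \<eta>]] by simp
  fix c x assume cx: "c \<in> A" "x \<in> snd c ` fst c"
  note U = smooth_atlasD(1)[OF A cx(1)]
  have "ext_d (\<lambda>y. rconst s * (cofactor c y * \<eta> c y)) x = rconst s * ext_d (\<lambda>y. cofactor c y * \<eta> c y) x"
    by (rule ext_d_const_mult[OF U cx(2) smooth_ext_on_mult[OF U diff_formD(1)[OF d cx(1)] diff_formD(1)[OF \<eta> cx(1)]]])
  also have "ext_d (\<lambda>y. cofactor c y * \<eta> c y) x = ext_d (cofactor c) x * \<eta> c x + cofactor c x * ext_d (\<eta> c) x"
    by (rule ext_d_mult_even[OF U cx(2) diff_formD(1)[OF d cx(1)] diff_formD(1)[OF \<eta> cx(1)]])
      (rule homog_imp_even[OF diff_formD(3)[OF d cx]], simp)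
  also have "\<dots> = cofactor c x * ext_d (\<eta> c) x" using closed_formD[OF closed_cofactor cx] by simp
  finally have "ext_d (\<lambda>y. rconst s * (cofactor c y * \<eta> c y)) x = cofactor c x * S 1 c x"
    unfolding S1[OF cx] ext_const_left_commute[of "cofactor c x"] .
  then show "rconst (- 264) * P_part 5 c x - degree_part 20 (P c x * (\<Sum>k\<in>{1..5}. ext_const (1 / fact (2 * k)) * S k c x)) =
      ext_d (\<lambda>y. rconst s * (cofactor c y * \<eta> c y)) x"
    using difference_eq_cofactor_mult[OF cx] by simp
qed (rule closed_P_ch)

lemma S_1_eq: "S 1 c x = rconst (- 2) * (3 * p1_form V c x - p1_form TX c x)"
proof (rule ext_eqI)
  fix I
  show "ext_coeff (S 1 c x) I = ext_coeff (rconst (- 2) * (3 * p1_form V c x - p1_form TX c x)) I"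
    unfolding S_form_def chern_const_even_power p1_form_def index_set_def ext_const_numeral[symmetric]
    by (simp add: power_trace_def field_simps numeral_2_eq_2)
qed

lemma cohomologous_of_p1:
  assumes "cohomologous A 4 (\<lambda>c x. 3 * p1_form V c x) (p1_form TX)"
  shows "cohomologous A 20 (\<lambda>c x. rconst (- 264) * P_part 5 c x)
    (\<lambda>c x. degree_part 20 (P c x * (\<Sum>k\<in>{1..5}. ext_const (1 / fact (2 * k)) * S k c x)))"
proof -
  obtain \<eta> where \<eta>: "diff_form A UNIV 3 \<eta>"
    "\<And>c x. c \<in> A \<Longrightarrow> x \<in> snd c ` fst c \<Longrightarrow> 3 * p1_form V c x - p1_form TX c x = ext_d (\<eta> c) x"
    using assms unfolding cohomologous_def by auto
  show ?thesis by (rule cohomologous_P_ch[OF \<eta>(1), of "- 2"]) (simp only: S_1_eq \<eta>(2))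
qed

end

lemma cohomologous_cong:
  assumes A: "smooth_atlas A" and co: "cohomologous A k \<alpha> \<beta>"
    and eq: "\<And>c x. c \<in> A \<Longrightarrow> x \<in> snd c ` fst c \<Longrightarrow> \<alpha>' c x = \<alpha> c x"
      "\<And>c x. c \<in> A \<Longrightarrow> x \<in> snd c ` fst c \<Longrightarrow> \<beta>' c x = \<beta> c x"
  shows "cohomologous A k \<alpha>' \<beta>'"
  unfolding cohomologous_def
proof (intro conjI)
  note a = co[unfolded cohomologous_def]
  show "closed_form A k \<alpha>'"
    by (rule closed_form_cong[OF A conjunct1[OF a]]) (rule eq(1))
  show "closed_form A k \<beta>'"
    by (rule closed_form_cong[OF A conjunct1[OF conjunct2[OF a]]]) (rule eq(2))
  show "\<exists>\<eta>. diff_form A UNIV (k - 1) \<eta> \<and> (\<forall>c\<in>A. \<forall>x\<in>snd c ` fst c. \<alpha>' c x - \<beta>' c x = ext_d (\<eta> c) x)"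
    using conjunct2[OF conjunct2[OF a]] by (simp only: eq cong: ball_cong ex_cong)
qed

theorem theorem1p18:
  fixes A :: "('x::{t2_space,second_countable_topology}, 20) chart set"
    and G :: "('x, 20) chart \<Rightarrow> real ^ 20 \<Rightarrow> real ^ 20 ^ 20"
    and m\<^sub>0 :: nat
    and \<pi> :: "'e \<Rightarrow> 'x"
    and T :: "('x, 'e) trivialization set"
    and h :: "'e \<Rightarrow> 'e \<Rightarrow> real"
    and \<theta> :: "('x, 'e) trivialization \<Rightarrow> nat \<Rightarrow> nat \<Rightarrow> ('x, 20) form"
  defines "TX \<equiv> tangent_bundle G"
    and "V \<equiv> bundle_of (2 * m\<^sub>0) T \<theta>"
  defines "TX' \<equiv> vminus TX (trivial_bundle 20)"
    and "V' \<equiv> vminus V (trivial_bundle (2 * m\<^sub>0))"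
  defines "W \<equiv> TX' @ vscale 2 (vwedge 2 V (trivial_bundle (2 * m\<^sub>0)))
                  @ vscale (-1) (vtensor V' V') @ V'"
  assumes "smooth_atlas A"
    and "riemannian_metric A G"
    and "spin A G"
    and "vector_bundle A (2 * m\<^sub>0) \<pi> T"
    and "bundle_metric A (2 * m\<^sub>0) \<pi> T h"
    and "euclidean_connection A (2 * m\<^sub>0) \<pi> T h \<theta>"
    and "cohomologous A 4 (\<lambda>c x. 3 * p1_form V c x) (p1_form TX)"
  shows "cohomologous A 20
     (\<lambda>c x. -264 * degree_part 20 (A_hat_form TX c x * det_cosh_form V c x))
     (\<lambda>c x. degree_part 20 (A_hat_form TX c x * det_cosh_form V c x * vch_form W c x))"
proof -
  note A = \<open>smooth_atlas A\<close>
  interpret euclidean_bundle A "2 * m\<^sub>0" \<pi> T h \<theta>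
    by (rule euclidean_bundle.intro) fact+
  have V: "characteristic_bundle A V" unfolding V_def by (rule characteristic_bundle_euclidean)
  interpret two_bundles A TX V "2 * m\<^sub>0"
  proof
    show "smooth_atlas A" by (rule A)
    show "characteristic_bundle A TX"
      unfolding TX_def by (rule characteristic_bundle_tangent[OF A \<open>riemannian_metric A G\<close>])
    show "characteristic_bundle A V" by (rule V)
    show "card (fst (TX c x)) = 20" for c x
      by (simp add: TX_def tangent_bundle_eq card_image)
    show "card (fst (V c x)) = 2 * m\<^sub>0" for c x by (simp add: V_def bundle_of_eq)
  qed
  show ?thesis
  proof (rule cohomologous_cong[OF A cohomologous_of_p1])
    show "cohomologous A 4 (\<lambda>c x. 3 * p1_form V c x) (p1_form TX)" by fact
    fix c x assume cx: "c \<in> A" "x \<in> snd c ` fst c"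
    have n: "(- 264 :: 20 ext) = rconst (- 264)"
      by (simp add: ext_const_simps ext_const_numeral)
    show "-264 * degree_part 20 (A_hat_form TX c x * det_cosh_form V c x) = rconst (- 264) * P_part 5 c x"
      unfolding n P_def[OF cx] by simp
    obtain U where "x \<in> U" "has_connection U c x V"
      using characteristic_bundleD(3)[OF V cx] unfolding has_connection_def by blast
    then have "vch_form W c x = (\<Sum>k\<in>{1..5}. ext_const (1 / fact (2 * k)) * S k c x)"
      unfolding W_def TX'_def V'_def ch_eq_S[OF cx, symmetric] by (rule vch_form_W[rotated])
    then show "degree_part 20 (A_hat_form TX c x * det_cosh_form V c x * vch_form W c x) =
        degree_part 20 (P c x * (\<Sum>k\<in>{1..5}. ext_const (1 / fact (2 * k)) * S k c x))"
      by (simp add: P_def[OF cx])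
  qed
qed

end
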